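(* Let $\phi:\mathbb Z\curvearrowright X$ and $\psi:\mathbb Z\curvearrowright Y$ be minimal actions on Cantor sets, and let $\pi:X\to Y$ be an equivariant two-to-one covering map. Write $\mathcal G:=X\rtimes_\phi\mathbb Z$, $\mathcal H:=Y\rtimes_\psi\mathbb Z$ and denote the induced factor map also by $\pi:\mathcal G\to\mathcal H$. Choose a clopen trivialization $X\cong Y\times\mathbb Z/2$ of $\pi$ and write $\phi(y,a)=(\psi(y),a+c(y))$ for a continuous function $c:Y\to\mathbb Z/2$. Then the following hold. (1) The pullback map $H_0^*(\pi):H_0(\mathcal H,\mathbb Z/2)\to H_0(\mathcal G,\mathbb Z/2)$ satisfies \[\operatorname{Ker}H_0^*(\pi)=\langle[c]\rangle\cong\mathbb Z/2,\qquad\operatorname{Coker}H_0^*(\pi)\cong H_0(\mathcal H,\mathbb Z/2)\neq0.\] Consequently, $\pi^*(\mathsf F(\mathcal H))$ is not maximal in $\mathsf F(\mathcal G)$ and $\pi^*(\mathsf D(\mathcal H))$ is not maximal in $\mathsf D(\mathcal G)$. (2) The subgroup \[M:=\pi^*\bigl(\operatorname{sgn}_{\mathcal H}^{-1}(\langle[c]\rangle)\bigr)=\mathrm N(\mathsf D(\mathcal G),\pi^*(\mathsf D(\mathcal H)))\] is the unique maximal subgroup of $\mathsf D(\mathcal G)$ containing $\pi^*(\mathsf D(\mathcal H))$. Moreover, the exact sequence \[1\to\pi^*(\mathsf D(\mathcal H))\to M\to\mathbb Z/2\to1\] splits.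
   Context: For a minimal $\mathbb Z$-action generated by a homeomorphism $\phi$ of a Cantor set $X$ (all orbits dense), the transformation groupoid $\mathcal G=X\rtimes_\phi\mathbb Z$ is $X\times\mathbb Z$ with the product topology, $r(x,n)=x$, $s(x,n)=\phi^{-n}(x)$, $(x,n)(\phi^{-n}(x),m)=(x,n+m)$, and unit space $X$. A bisection is a subset on which $r$ and $s$ are injective. A full bisection is a compact open bisection $U$ with $r(U)=s(U)=X$; $\theta_U:=r\circ(s|_U)^{-1}\in\mathrm{Homeo}(X)$. The topological full group $\mathsf F(\mathcal G)$ is the group of all such $\theta_U$ (each element comes from a unique $U$); $\mathsf D(\mathcal G)$ is its commutator subgroup. $\mathrm N(\Gamma,S)=\{\alpha\in\Gamma\mid\alpha S\alpha^{-1}=S\}$. The equivariant map $\pi$ induces the groupoid homomorphism $(x,n)\mapsto(\pi(x),n)$, and an injective homomorphism $\pi^*:\mathsf F(\mathcal H)\to\mathsf F(\mathcal G)$, $\pi^*(\theta_V):=\theta_{\pi^{-1}(V)}$. $H_0(\mathcal G,\mathbb Z/2)=C(X,\mathbb Z/2)/\{f\circ\phi-f\}$, and $H_0^*(\pi)([f])=[f\circ\pi]$; $[c]$ is the class of $c$ in $H_0(\mathcal H,\mathbb Z/2)$. For a transformation groupoid $\mathcal K$ of a minimal $\mathbb Z$-action on a Cantor set: the index map $I_{\mathcal K}:\mathsf F(\mathcal K)\to H_1(\mathcal K)\cong\mathbb Z$ is the homomorphism $\theta_U\mapsto[1_U]$, where $H_1(\mathcal K)$ is the first homology of the complex $C_c(\mathcal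 K^{(n)},\mathbb Z)$ of compactly supported continuous functions on composable $n$-strings, with boundary $\sum_i(-1)^id_{i*}$ given by pushforward along the face maps ($d_0=s$, $d_1=r$ on $\mathcal K^{(1)}=\mathcal K$). Put $\mathsf F_0(\mathcal K):=\operatorname{Ker}I_{\mathcal K}$. For a compact open bisection $U$ with $r(U)\cap s(U)=\emptyset$, $\tau_U:=\theta_W$ with $W=U\sqcup U^{-1}\sqcup(\mathcal K^{(0)}\setminus(r(U)\cup s(U)))$. The signature homomorphism $\operatorname{sgn}_{\mathcal K}:\mathsf F_0(\mathcal K)\to H_0(\mathcal K,\mathbb Z/2)$ is the (known) surjective homomorphism with kernel $\mathsf D(\mathcal K)$ that sends each $\tau_U$ to $[1_{r(U)}]$. *)

theory Defs
  imports
    "HOL-Analysis.Analysis"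
    "HOL-Library.Z2"
    "HOL-Algebra.Elementary_Groups"
    "HOL-Algebra.Generated_Groups"
    "HOL-Algebra.Group_Action"
begin

section \<open>Minimal actions of the integers on Cantor sets\<close>

text \<open>A space is the universe of a topological type.  It is a Cantor set if it is homeomorphic to
  the product of countably many copies of the two-point discrete space.\<close>

definition cantor_set :: "'x::topological_space itself \<Rightarrow> bool" where
  "cantor_set _ \<longleftrightarrow> (euclidean :: 'x topology) homeomorphic_space
     product_topology (\<lambda>n::nat. discrete_topology (UNIV :: bool set)) UNIV"

text \<open>The inverse function is written \<open>inv_into UNIV\<close>, since HOL-Algebra overloads \<open>inv\<close>.\<close>

definition homeo_pow :: "('x \<Rightarrow> 'x) \<Rightarrow> int \<Rightarrow> 'x \<Rightarrow> 'x" where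
  "homeo_pow \<phi> n = (if 0 \<le> n then \<phi> ^^ nat n else inv_into UNIV \<phi> ^^ nat (- n))"

definition minimal_action :: "('x::topological_space \<Rightarrow> 'x) \<Rightarrow> bool" where
  "minimal_action \<phi> \<longleftrightarrow> homeomorphic_map euclidean euclidean \<phi> \<and>
     (\<forall>x. closure (range (\<lambda>n. homeo_pow \<phi> n x)) = UNIV)"

definition cantor_minimal :: "('x::topological_space \<Rightarrow> 'x) \<Rightarrow> bool" where
  "cantor_minimal \<phi> \<longleftrightarrow> cantor_set TYPE('x) \<and> minimal_action \<phi>"

definition equivariant_double_cover ::
  "('x::topological_space \<Rightarrow> 'x) \<Rightarrow> ('y::topological_space \<Rightarrow> 'y) \<Rightarrow> ('x \<Rightarrow> 'y) \<Rightarrow> bool" where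
  "equivariant_double_cover \<phi> \<psi> \<pi> \<longleftrightarrow>
     covering_space UNIV \<pi> UNIV \<and> (\<forall>y. card (\<pi> -` {y}) = 2) \<and> (\<forall>x. \<pi> (\<phi> x) = \<psi> (\<pi> x))"

text \<open>The type \<open>bit\<close> is the field with two elements.  It carries no topology in the library, so its
  discrete topology is always written out.\<close>

definition clopen_trivialization ::
  "('x::topological_space \<Rightarrow> 'x) \<Rightarrow> ('y::topological_space \<Rightarrow> 'y) \<Rightarrow> ('x \<Rightarrow> 'y) \<Rightarrow>
     ('x \<Rightarrow> 'y \<times> bit) \<Rightarrow> ('y \<Rightarrow> bit) \<Rightarrow> bool" where
  "clopen_trivialization \<phi> \<psi> \<pi> T c \<longleftrightarrow>
     homeomorphic_map euclidean (prod_topology euclidean (discrete_topology UNIV)) T \<and>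
     (\<forall>x. fst (T x) = \<pi> x) \<and>
     continuous_map euclidean (discrete_topology UNIV) c \<and>
     (\<forall>x y a. T x = (y, a) \<longrightarrow> T (\<phi> x) = (\<psi> y, a + c y))"


section \<open>The transformation groupoid and its topological full group\<close>

text \<open>The groupoid of \<open>\<phi>\<close> is the type \<open>'x \<times> int\<close> with its product topology; its unit space
  is \<open>UNIV \<times> {0}\<close>, and \<open>(x, 0)\<close> is identified with \<open>x\<close>.  The product \<open>tg_mult g h\<close> is
  meaningful only if \<open>(g, h) \<in> tg_composable \<phi>\<close>.\<close>

definition tg_range :: "'x \<times> int \<Rightarrow> 'x" where
  "tg_range g = fst g"

definition tg_source :: "('x \<Rightarrow> 'x) \<Rightarrow> 'x \<times> int \<Rightarrow> 'x" where
  "tg_source \<phi> g = homeo_pow \<phi> (- snd g) (fst g)"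

definition tg_composable :: "('x \<Rightarrow> 'x) \<Rightarrow> (('x \<times> int) \<times> ('x \<times> int)) set" where
  "tg_composable \<phi> = {(g, h). tg_source \<phi> g = tg_range h}"

definition tg_mult :: "'x \<times> int \<Rightarrow> 'x \<times> int \<Rightarrow> 'x \<times> int" where
  "tg_mult g h = (fst g, snd g + snd h)"

definition tg_inverse :: "('x \<Rightarrow> 'x) \<Rightarrow> 'x \<times> int \<Rightarrow> 'x \<times> int" where
  "tg_inverse \<phi> g = (tg_source \<phi> g, - snd g)"

definition compact_open_bisection :: "('x::topological_space \<Rightarrow> 'x) \<Rightarrow> ('x \<times> int) set \<Rightarrow> bool" where
  "compact_open_bisection \<phi> U \<longleftrightarrow>
     compact U \<and> open U \<and> inj_on tg_range U \<and> inj_on (tg_source \<phi>) U"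

definition full_bisection :: "('x::topological_space \<Rightarrow> 'x) \<Rightarrow> ('x \<times> int) set \<Rightarrow> bool" where
  "full_bisection \<phi> U \<longleftrightarrow> compact_open_bisection \<phi> U \<and>
     tg_range ` U = UNIV \<and> tg_source \<phi> ` U = UNIV"

definition theta :: "('x \<Rightarrow> 'x) \<Rightarrow> ('x \<times> int) set \<Rightarrow> 'x \<Rightarrow> 'x" where
  "theta \<phi> U = tg_range \<circ> inv_into U (tg_source \<phi>)"

definition full_group :: "('x::topological_space \<Rightarrow> 'x) \<Rightarrow> ('x \<Rightarrow> 'x) monoid" where
  "full_group \<phi> =
     \<lparr>carrier = {theta \<phi> U | U. full_bisection \<phi> U}, monoid.mult = (\<circ>), one = id\<rparr>"

definition bisection_of :: "('x::topological_space \<Rightarrow> 'x) \<Rightarrow> ('x \<Rightarrow> 'x) \<Rightarrow> ('x \<times> int) set" where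
  "bisection_of \<phi> \<alpha> = (THE U. full_bisection \<phi> U \<and> theta \<phi> U = \<alpha>)"

abbreviation subgroup_of :: "('a, 'b) monoid_scheme \<Rightarrow> 'a set \<Rightarrow> ('a, 'b) monoid_scheme" where
  "subgroup_of G H \<equiv> G\<lparr>carrier := H\<rparr>"

definition commutator_full_group :: "('x::topological_space \<Rightarrow> 'x) \<Rightarrow> ('x \<Rightarrow> 'x) monoid" where
  "commutator_full_group \<phi> =
     subgroup_of (full_group \<phi>) (derived (full_group \<phi>) (carrier (full_group \<phi>)))"

definition pi_star ::
  "('x::topological_space \<Rightarrow> 'x) \<Rightarrow> ('y::topological_space \<Rightarrow> 'y) \<Rightarrow> ('x \<Rightarrow> 'y) \<Rightarrow>
     ('y \<Rightarrow> 'y) \<Rightarrow> ('x \<Rightarrow> 'x)" where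
  "pi_star \<phi> \<psi> \<pi> \<alpha> = theta \<phi> ((\<lambda>(x, n). (\<pi> x, n)) -` bisection_of \<psi> \<alpha>)"


section \<open>Homology\<close>

definition fun_group :: "('a \<Rightarrow> 'b::ab_group_add) set \<Rightarrow> ('a \<Rightarrow> 'b) monoid" where
  "fun_group S = \<lparr>carrier = S, monoid.mult = (\<lambda>f g z. f z + g z), one = (\<lambda>_. 0)\<rparr>"

definition coboundaries :: "('x::topological_space \<Rightarrow> 'x) \<Rightarrow> ('x \<Rightarrow> bit) set" where
  "coboundaries \<phi> = {(\<lambda>x. f (\<phi> x) - f x) | f. continuous_map euclidean (discrete_topology UNIV) f}"

definition cochain_group :: "('x::topological_space \<Rightarrow> bit) monoid" where
  "cochain_group = fun_group {f. continuous_map euclidean (discrete_topology UNIV) f}"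

definition H0 :: "('x::topological_space \<Rightarrow> 'x) \<Rightarrow> ('x \<Rightarrow> bit) set monoid" where
  "H0 \<phi> = cochain_group Mod coboundaries \<phi>"

definition H0_class :: "('x::topological_space \<Rightarrow> 'x) \<Rightarrow> ('x \<Rightarrow> bit) \<Rightarrow> ('x \<Rightarrow> bit) set" where
  "H0_class \<phi> f = coboundaries \<phi> #>\<^bsub>cochain_group\<^esub> f"

text \<open>For a class \<open>C\<close> the sets in the following union all coincide: this is the usual definition
  \<open>[f] \<mapsto> [f \<circ> \<pi>]\<close> through arbitrary representatives.\<close>

definition H0_pullback ::
  "('x::topological_space \<Rightarrow> 'x) \<Rightarrow> ('x \<Rightarrow> 'y) \<Rightarrow> ('y \<Rightarrow> bit) set \<Rightarrow> ('x \<Rightarrow> bit) set" where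
  "H0_pullback \<phi> \<pi> C = (\<Union>f\<in>C. H0_class \<phi> (f \<circ> \<pi>))"

text \<open>Compactly supported continuous integer-valued functions on the subspace \<open>S\<close>, extended by
  zero.  As the integers are discrete, the set where such a function is nonzero is already closed
  in \<open>S\<close>, so it is the support.\<close>

definition compactly_supported :: "'a::topological_space set \<Rightarrow> ('a \<Rightarrow> int) set" where
  "compactly_supported S =
     {f. continuous_map (top_of_set S) (discrete_topology UNIV) f \<and>
         compact {z. f z \<noteq> 0} \<and> (\<forall>z. z \<notin> S \<longrightarrow> f z = 0)}"

definition pushforward :: "('a \<Rightarrow> 'b) \<Rightarrow> ('a \<Rightarrow> int) \<Rightarrow> 'b \<Rightarrow> int" where
  "pushforward d f y = (\<Sum>z | d z = y \<and> f z \<noteq> 0. f z)"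

definition boundary1 :: "('x \<Rightarrow> 'x) \<Rightarrow> ('x \<times> int \<Rightarrow> int) \<Rightarrow> 'x \<Rightarrow> int" where
  "boundary1 \<phi> f = (\<lambda>x. pushforward (tg_source \<phi>) f x - pushforward tg_range f x)"

definition boundary2 :: "(('x \<times> int) \<times> ('x \<times> int) \<Rightarrow> int) \<Rightarrow> 'x \<times> int \<Rightarrow> int" where
  "boundary2 f = (\<lambda>g. pushforward snd f g - pushforward (\<lambda>(g, h). tg_mult g h) f g
                       + pushforward fst f g)"

definition cycle1_group :: "('x::topological_space \<Rightarrow> 'x) \<Rightarrow> ('x \<times> int \<Rightarrow> int) monoid" where
  "cycle1_group \<phi> = fun_group {f \<in> compactly_supported UNIV. boundary1 \<phi> f = (\<lambda>_. 0)}"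

definition boundaries1 :: "('x::topological_space \<Rightarrow> 'x) \<Rightarrow> ('x \<times> int \<Rightarrow> int) set" where
  "boundaries1 \<phi> = boundary2 ` compactly_supported (tg_composable \<phi>)"

definition H1 :: "('x::topological_space \<Rightarrow> 'x) \<Rightarrow> ('x \<times> int \<Rightarrow> int) set monoid" where
  "H1 \<phi> = cycle1_group \<phi> Mod boundaries1 \<phi>"


section \<open>Index map and signature\<close>

definition index_map ::
  "('x::topological_space \<Rightarrow> 'x) \<Rightarrow> ('x \<Rightarrow> 'x) \<Rightarrow> ('x \<times> int \<Rightarrow> int) set" where
  "index_map \<phi> \<alpha> = boundaries1 \<phi> #>\<^bsub>cycle1_group \<phi>\<^esub> indicator (bisection_of \<phi> \<alpha>)"

definition index_kernel_group :: "('x::topological_space \<Rightarrow> 'x) \<Rightarrow> ('x \<Rightarrow> 'x) monoid" where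
  "index_kernel_group \<phi> =
     subgroup_of (full_group \<phi>) (kernel (full_group \<phi>) (H1 \<phi>) (index_map \<phi>))"

definition tau :: "('x \<Rightarrow> 'x) \<Rightarrow> ('x \<times> int) set \<Rightarrow> 'x \<Rightarrow> 'x" where
  "tau \<phi> U = theta \<phi> (U \<union> tg_inverse \<phi> ` U \<union> (UNIV - (tg_range ` U \<union> tg_source \<phi> ` U)) \<times> {0})"

definition is_signature ::
  "('x::topological_space \<Rightarrow> 'x) \<Rightarrow> (('x \<Rightarrow> 'x) \<Rightarrow> ('x \<Rightarrow> bit) set) \<Rightarrow> bool" where
  "is_signature \<phi> s \<longleftrightarrow>
     s \<in> epi (index_kernel_group \<phi>) (H0 \<phi>) \<and>
     kernel (index_kernel_group \<phi>) (H0 \<phi>) s = carrier (commutator_full_group \<phi>) \<and>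
     (\<forall>U. compact_open_bisection \<phi> U \<and> tg_range ` U \<inter> tg_source \<phi> ` U = {} \<longrightarrow>
        s (tau \<phi> U) = H0_class \<phi> (indicator (tg_range ` U))) \<and>
     s \<in> extensional (carrier (index_kernel_group \<phi>))"

text \<open>For a minimal action on a Cantor set there is exactly one function satisfying
  \<open>is_signature\<close>; extensionality only fixes the irrelevant values outside the domain.\<close>

definition sgn_map :: "('x::topological_space \<Rightarrow> 'x) \<Rightarrow> ('x \<Rightarrow> 'x) \<Rightarrow> ('x \<Rightarrow> bit) set" where
  "sgn_map \<phi> = (THE s. is_signature \<phi> s)"


section \<open>Group theory\<close>

definition maximal_subgroup :: "'a set \<Rightarrow> ('a, 'b) monoid_scheme \<Rightarrow> bool" where
  "maximal_subgroup M G \<longleftrightarrow> subgroup M G \<and> M \<noteq> carrier G \<and>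
     (\<forall>L. subgroup L G \<and> M \<subseteq> L \<longrightarrow> L = M \<or> L = carrier G)"

text \<open>The sequence \<open>1 \<rightarrow> A \<rightarrow> B \<rightarrow> C \<rightarrow> 1\<close> with maps \<open>i\<close> and \<open>q\<close> is exact, respectively exact and
  split.  (The library's \<open>short_exact_sequence\<close> forces all groups to have one element type.)\<close>

definition short_exact ::
  "('a, 'r) monoid_scheme \<Rightarrow> ('a \<Rightarrow> 'b) \<Rightarrow> ('b, 's) monoid_scheme \<Rightarrow> ('b \<Rightarrow> 'c) \<Rightarrow>
     ('c, 't) monoid_scheme \<Rightarrow> bool" where
  "short_exact A i B q C \<longleftrightarrow> group A \<and> group B \<and> group C \<and>
     i \<in> mon A B \<and> q \<in> epi B C \<and> kernel B C q = i ` carrier A"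

definition split_short_exact ::
  "('a, 'r) monoid_scheme \<Rightarrow> ('a \<Rightarrow> 'b) \<Rightarrow> ('b, 's) monoid_scheme \<Rightarrow> ('b \<Rightarrow> 'c) \<Rightarrow>
     ('c, 't) monoid_scheme \<Rightarrow> bool" where
  "split_short_exact A i B q C \<longleftrightarrow> short_exact A i B q C \<and>
     (\<exists>s \<in> hom C B. \<forall>z \<in> carrier C. q (s z) = z)"

end

theory Submission
  imports Defs "HOL-Combinatorics.Permutations"
begin

text \<open>The full group of \<open>\<phi>\<close> consists of the bijections that are locally powers of \<open>\<phi>\<close>, so an element
  induces a permutation of \<open>\<int>\<close> with bounded displacement on every orbit.  Its index is the net
  flow of this permutation across a cut of the orbit, and its signature is the class of the function
  counting, modulo 2, the inversions of the base point with later points of its orbit.  An element of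
  index zero preserves, up to involutions, a partition into towers, hence is a product of involutions
  swapping \<open>A\<close> and
  \<open>\<alpha> A\<close>; modulo 3-cycles such an involution depends only on the class of \<open>A\<close>.  Thus the
  commutator subgroup is generated by 3-cycles and is the kernel of the signature.

  Let \<open>\<sigma>\<close> be the deck transformation of \<open>\<pi>\<close>.  The second coordinate of the trivialization has
  coboundary \<open>c \<circ> \<pi>\<close>, which gives the kernel of the pullback; summing over fibres gives its
  cokernel.  The image of \<open>\<pi>\<^sup>*\<close> is the centralizer of \<open>\<sigma>\<close>, so \<open>M\<close> is the centralizer of
  \<open>\<sigma>\<close> in the commutator subgroup.  If a subgroup of the commutator subgroup contains the lifted
  3-cycles and an element \<open>\<alpha>\<close> that does not commute with \<open>\<sigma>\<close>, then the commutator of a lifted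
  3-cycle with an \<open>\<alpha>\<close>-conjugate of another one is a 3-cycle on a single sheet, and its conjugates
  by lifted elements generate everything.\<close>

text \<open>The signature is given by a definite description, so a homomorphism with the prescribed
  kernel must be constructed and shown to be the only one. The inversion cochain yields a
  homomorphism on the whole full group with values in an abelian group; hence the commutator
  subgroup lies in its kernel at once, and the work goes into the converse.

  Most statements are proved for small clopen sets around a point and then glued along disjoint
  unions. Freeness of the action makes this work: near a point finitely many positions of its orbit
  can be kept apart, and a further position is always available.

  The class of \<open>c\<close> is nonzero because \<phi> itself is minimal upstairs. This gives the
  index 2, the nontriviality of the homology group and, through an involution of that signature, the
  splitting.

  For maximality, failure to commute with the deck transformation is known only near one point.
  Containing all small 3-cycles is therefore treated as a local property at given orbit positions.
  Lifted elements move one position and fix two others, a shift changes the base point along the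
  orbit, and minimality carries the property to every point.\<close>

abbreviation finv :: "('a \<Rightarrow> 'b) \<Rightarrow> 'b \<Rightarrow> 'a" where
  "finv f \<equiv> inv_into UNIV f"

abbreviation clopen :: "'a::topological_space set \<Rightarrow> bool" where
  "clopen A \<equiv> open A \<and> closed A"

section \<open>Locally constant functions on Cantor sets\<close>

text \<open>The codomain is a bare type, so that functions with values in \<open>bit\<close>,
  \<open>int\<close> and \<open>bool\<close> are treated alike.
  \<open>loc_const_continuous_map\<close> is the bridge to the continuous maps in the
  definitions.\<close>

definition loc_const :: "('a::topological_space \<Rightarrow> 'b) \<Rightarrow> bool" where
  "loc_const f \<longleftrightarrow> (\<forall>x. \<exists>V. open V \<and> x \<in> V \<and> (\<forall>z\<in>V. f z = f x))"

lemma loc_constE: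
  assumes "loc_const f"
  obtains V where "open V" "(x :: 'a::topological_space) \<in> V" "\<And>z. z \<in> V \<Longrightarrow> f z = f x"
  using assms unfolding loc_const_def by metis

lemma loc_constI:
  assumes "\<And>x. \<exists>V. open V \<and> x \<in> V \<and> (\<forall>z\<in>V. f z = f x)"
  shows "loc_const f"
  using assms unfolding loc_const_def by metis

lemma loc_const_open_vimage: "loc_const f \<Longrightarrow> open {x. f x \<in> S}"
  unfolding loc_const_def by (subst open_subopen) (metis mem_Collect_eq subsetI)

lemma loc_const_clopen: "loc_const f \<Longrightarrow> clopen {x. Q (f x)}"
  using loc_const_open_vimage[of f "Collect Q"] loc_const_open_vimage[of f "- Collect Q"]
  by (auto simp: closed_def Collect_neg_eq[symmetric])

lemma loc_const_continuous_map:
  "continuous_map euclidean (discrete_topology UNIV) f \<longleftrightarrow> loc_const f"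
proof
  assume f: "continuous_map euclidean (discrete_topology UNIV) f"
  show "loc_const f" unfolding loc_const_def
  proof
    fix x
    have "openin euclidean {y \<in> topspace euclidean. f y \<in> {f x}}"
      using f by (rule openin_continuous_map_preimage) simp
    then show "\<exists>V. open V \<and> x \<in> V \<and> (\<forall>z\<in>V. f z = f x)"
      by (intro exI[of _ "{y. f y \<in> {f x}}"]) auto
  qed
next
  assume "loc_const f"
  then show "continuous_map euclidean (discrete_topology UNIV) f"
    by (auto simp: continuous_map_def loc_const_open_vimage)
qed

lemma loc_const_const [simp]: "loc_const (\<lambda>_. c)"
  by (auto simp: loc_const_def)

lemma loc_const_comp: "loc_const f \<Longrightarrow> loc_const (\<lambda>x. g (f x))"
  unfolding loc_const_def by metis

lemma loc_const_comp2:
  assumes "loc_const f" "loc_const g"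
  shows "loc_const (\<lambda>x. h (f x) (g x))"
  unfolding loc_const_def
proof
  fix x
  obtain V W where "open V" "x \<in> V" "\<forall>z\<in>V. f z = f x" "open W" "x \<in> W" "\<forall>z\<in>W. g z = g x"
    using assms unfolding loc_const_def by meson
  then show "\<exists>V. open V \<and> x \<in> V \<and> (\<forall>z\<in>V. h (f z) (g z) = h (f x) (g x))"
    by (metis IntE IntI open_Int)
qed

lemma loc_const_finite_family:
  assumes "finite I" "\<And>i. i \<in> I \<Longrightarrow> loc_const (f i)"
  shows "\<exists>V. open V \<and> x \<in> V \<and> (\<forall>i\<in>I. \<forall>z\<in>V. f i z = f i x)"
  using assms
proof (induction I)
  case empty
  then show ?case by (intro exI[of _ UNIV]) auto
next
  case (insert i I)
  obtain V where V: "open V" "x \<in> V" "\<forall>i\<in>I. \<forall>z\<in>V. f i z = f i x"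
    using insert.IH insert.prems by (metis insertCI)
  obtain W where W: "open W" "x \<in> W" "\<forall>z\<in>W. f i z = f i x"
    using insert.prems[of i] unfolding loc_const_def by (metis insertI1)
  show ?case
    by (rule exI[of _ "V \<inter> W"]) (use V W in \<open>metis IntD1 IntD2 IntI insertE open_Int\<close>)
qed

lemma loc_const_sum:
  assumes "finite I" "\<And>i. i \<in> I \<Longrightarrow> loc_const (f i)"
  shows "loc_const (\<lambda>x. \<Sum>i\<in>I. f i x)"
  unfolding loc_const_def
proof
  fix x
  obtain V where "open V" "x \<in> V" "\<forall>i\<in>I. \<forall>z\<in>V. f i z = f i x"
    using loc_const_finite_family[of I f, OF assms] by metis
  then show "\<exists>V. open V \<and> x \<in> V \<and> (\<forall>z\<in>V. (\<Sum>i\<in>I. f i z) = (\<Sum>i\<in>I. f i x))"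
    by (metis (mono_tags, lifting) sum.cong)
qed

lemma loc_const_vimage_comp:
  assumes "loc_const f" "continuous_on UNIV h"
  shows "loc_const (\<lambda>x. f (h x))"
  unfolding loc_const_def
proof
  fix x
  obtain V where V: "open V" "h x \<in> V" "\<forall>z\<in>V. f z = f (h x)"
    using assms(1) unfolding loc_const_def by meson
  show "\<exists>V. open V \<and> x \<in> V \<and> (\<forall>z\<in>V. f (h z) = f (h x))"
    using V open_vimage[OF V(1) assms(2)] by (metis vimage_eq)
qed

lemma loc_const_indicator: "clopen A \<Longrightarrow> loc_const (\<lambda>x. x \<in> A)"
  unfolding loc_const_def by (metis ComplI open_Compl Compl_iff)

lemma loc_const_of_clopen:
  assumes "clopen A" shows "loc_const (indicator A :: 'a::topological_space \<Rightarrow> 'b::zero_neq_one)"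
  using loc_const_comp[OF loc_const_indicator[OF assms], of "\<lambda>b. if b then 1 else 0"]
  by (simp add: indicator_def[abs_def] of_bool_def)

text \<open>The level sets form an open cover; a finite subcover leaves finitely many
  values.\<close>

lemma loc_const_bounded:
  fixes f :: "'a::topological_space \<Rightarrow> int"
  assumes "compact (UNIV :: 'a set)" "loc_const f"
  shows "\<exists>N\<ge>0. \<forall>x. \<bar>f x\<bar> \<le> N"
proof -
  have "open {x. f x = k}" for k using loc_const_open_vimage[OF assms(2), of "{k}"] by simp
  then have "\<exists>D\<subseteq>(\<lambda>k. {x. f x = k}) ` UNIV. finite D \<and> UNIV \<subseteq> \<Union>D"
    by (intro assms(1)[unfolded compact_eq_Heine_Borel, rule_format]) auto
  then obtain D where D: "D \<subseteq> (\<lambda>k. {x. f x = k}) ` UNIV" "finite D" "UNIV \<subseteq> \<Union>D"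
    by blast
  then obtain K where K: "finite K" "D = (\<lambda>k. {x. f x = k}) ` K"
    by (meson finite_subset_image)
  have "f x \<in> K" for x using D(3) K(2) by auto
  then have "\<bar>f x\<bar> \<le> Max (insert 0 (abs ` K))" for x
    using K(1) by (intro Max_ge) auto
  moreover have "Max (insert 0 (abs ` K)) \<ge> 0" using K(1) by (intro Max_ge) auto
  ultimately show ?thesis by blast
qed

text \<open>A basic box of the product restricts finitely many coordinates only, and boxes over
  discrete factors are closed as well as open. The preimage of such a box under the homeomorphism is
  the required neighbourhood.\<close>

lemma cantor_set_basis:
  assumes "cantor_set TYPE('x::topological_space)" "open U" "(x::'x) \<in> U"
  shows "\<exists>V. clopen V \<and> x \<in> V \<and> V \<subseteq> U"
proof -
  let ?C = "product_topology (\<lambda>n::nat. discrete_topology (UNIV :: bool set)) UNIV"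
  obtain f g where fg: "homeomorphic_maps (euclidean :: 'x topology) ?C f g"
    using assms(1) unfolding cantor_set_def homeomorphic_space_def by blast
  have cf: "continuous_map (euclidean :: 'x topology) ?C f" and cg: "continuous_map ?C euclidean g"
    and gf: "\<And>x. g (f x) = x" and fgC: "\<And>y. y \<in> topspace ?C \<Longrightarrow> f (g y) = y"
    using fg by (auto simp: homeomorphic_maps_def)
  have oU: "openin ?C {y \<in> topspace ?C. g y \<in> U}"
    using cg assms(2) by (intro openin_continuous_map_preimage) auto
  have "f x \<in> {y \<in> topspace ?C. g y \<in> U}" using gf assms(3) by auto
  from oU[unfolded openin_product_topology_alt, THEN bspec, OF this]
  have "\<exists>B. finite {i \<in> UNIV. B i \<noteq> topspace (discrete_topology (UNIV::bool set))} \<and>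
     f x \<in> Pi\<^sub>E UNIV B \<and> Pi\<^sub>E UNIV B \<subseteq> {y \<in> topspace ?C. g y \<in> U}"
    by (elim exE conjE) (rule exI, intro conjI)
  then obtain B where B: "finite {i \<in> UNIV. B i \<noteq> topspace (discrete_topology (UNIV::bool set))}"
     "f x \<in> Pi\<^sub>E UNIV B" "Pi\<^sub>E UNIV B \<subseteq> {y \<in> topspace ?C. g y \<in> U}"
    by blast
  have "openin ?C (Pi\<^sub>E UNIV B)"
    using B(1) by (subst openin_PiE_gen) auto
  moreover have "closedin ?C (Pi\<^sub>E UNIV B)" by (subst closedin_product_topology) auto
  ultimately have "openin euclidean {y \<in> topspace (euclidean :: 'x topology). f y \<in> Pi\<^sub>E UNIV B}"
    "closedin euclidean {y \<in> topspace (euclidean :: 'x topology). f y \<in> Pi\<^sub>E UNIV B}"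
    using openin_continuous_map_preimage[OF cf] closedin_continuous_map_preimage[OF cf] by blast+
  then have "clopen {y. f y \<in> Pi\<^sub>E UNIV B}" by simp
  moreover have "{y. f y \<in> Pi\<^sub>E UNIV B} \<subseteq> U"
  proof
    fix y assume "y \<in> {y. f y \<in> Pi\<^sub>E UNIV B}"
    then have "f y \<in> {y \<in> topspace ?C. g y \<in> U}" using B(3) by blast
    then show "y \<in> U" using gf by simp
  qed
  ultimately show ?thesis using B(2) by blast
qed

lemma cantor_set_compact:
  assumes "cantor_set TYPE('x::topological_space)" shows "compact (UNIV :: 'x set)"
proof -
  have "compact_space (euclidean :: 'x topology)"
    using homeomorphic_compact_space[OF assms[unfolded cantor_set_def]]
    by (simp add: compact_space_product_topology compact_space_discrete_topology)
  then show ?thesis by (simp add: compact_space_def)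
qed

lemma cantor_set_infinite:
  assumes "cantor_set TYPE('x::topological_space)" shows "infinite (UNIV :: 'x set)"
proof -
  let ?C = "product_topology (\<lambda>n::nat. discrete_topology (UNIV :: bool set)) UNIV"
  obtain f g where fg: "homeomorphic_maps (euclidean :: 'x topology) ?C f g"
    using assms(1) unfolding cantor_set_def homeomorphic_space_def by blast
  then have "y = f (g y)" for y by (auto simp: homeomorphic_maps_def)
  then have "surj f" by (metis surjI)
  moreover have "infinite (UNIV :: (nat \<Rightarrow> bool) set)"
    using finite_fun_UNIVD1[where 'a=nat and 'b=bool] by (auto simp: card_UNIV_bool)
  ultimately show ?thesis by (metis finite_imageI)
qed

section \<open>Minimal homeomorphisms and their full groups\<close>

locale cantor_system =
  fixes \<phi> :: "'x::t2_space \<Rightarrow> 'x"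
  assumes cantor_minimal: "cantor_minimal \<phi>"
begin

abbreviation P :: "int \<Rightarrow> 'x \<Rightarrow> 'x" where "P \<equiv> homeo_pow \<phi>"

lemma cantor: "cantor_set TYPE('x)" using cantor_minimal by (simp add: cantor_minimal_def)

lemma compact_space: "compact (UNIV :: 'x set)" by (rule cantor_set_compact[OF cantor])

lemma clopen_basis: "open U \<Longrightarrow> (x::'x) \<in> U \<Longrightarrow> \<exists>V. clopen V \<and> x \<in> V \<and> V \<subseteq> U"
  by (rule cantor_set_basis[OF cantor])

lemma clopen_compact: "closed (A :: 'x set) \<Longrightarrow> compact A"
  using compact_space by (metis compact_Int_closed inf_top_left)

lemma homeo: "homeomorphic_map euclidean euclidean \<phi>"
  using cantor_minimal by (simp add: cantor_minimal_def minimal_action_def)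

lemma bij_phi: "bij \<phi>"
  using homeo by (simp add: bij_def homeomorphic_eq_everything_map)

lemma continuous_phi: "continuous_on UNIV \<phi>"
  using homeomorphic_imp_continuous_map[OF homeo] by simp

lemma continuous_phi_inv: "continuous_on UNIV (finv \<phi>)"
proof -
  obtain g where g: "homeomorphic_maps euclidean euclidean \<phi> g"
    using homeo homeomorphic_map_maps by blast
  then have "finv \<phi> = g"
    by (intro inv_equality) (auto simp: homeomorphic_maps_def)
  then show ?thesis using g by (simp add: homeomorphic_maps_def)
qed

lemma P_0 [simp]: "P 0 x = x" by (simp add: homeo_pow_def)

lemma phi_finv [simp]: "\<phi> (finv \<phi> x) = x" "finv \<phi> (\<phi> x) = x"
  using bij_phi by (auto simp: bij_is_surj surj_f_inv_f bij_is_inj)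

lemma P_Suc: "P (n + 1) x = \<phi> (P n x)"
proof -
  consider "n \<ge> 0" | "n = -1" | "n < -1" by linarith
  then show ?thesis
  proof cases
    case 1 then show ?thesis by (simp add: homeo_pow_def nat_add_distrib)
  next
    case 2 then show ?thesis by (simp add: homeo_pow_def)
  next
    case 3
    then have "nat (-n) = Suc (nat (- (n+1)))" by simp
    with 3 show ?thesis unfolding homeo_pow_def by simp
  qed
qed

lemma P_1 [simp]: "P 1 = \<phi>" using P_Suc[of 0] by auto

lemma P_add: "P (m + n) x = P m (P n x)"
proof (induction m rule: int_induct[where k=0])
  case base then show ?case by simp
next
  case (step1 i)
  then show ?case using P_Suc[of "i+n" x] P_Suc[of i "P n x"] by (simp add: ac_simps)
next
  case (step2 i)
  then show ?case using P_Suc[of "i - 1 + n" x] P_Suc[of "i - 1" "P n x"]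
    by (simp add: ac_simps) (metis bij_phi bij_def injD)
qed

lemma P_P: "P m (P n x) = P (m + n) x" by (simp add: P_add)

lemma P_minus [simp]: "P (- n) (P n x) = x" "P n (P (- n) x) = x"
  by (simp_all add: P_P)

lemma P_inj_iff [simp]: "P n x = P n y \<longleftrightarrow> x = y" by (metis P_minus(1))

lemma bij_P: "bij (P n)"
  by (rule o_bij[of "P (- n)"]) (auto simp: fun_eq_iff)

lemma continuous_P: "continuous_on UNIV (P n)"
proof -
  have *: "continuous_on UNIV (f ^^ k)" if "continuous_on UNIV f" for k and f :: "'x \<Rightarrow> 'x"
    by (induction k) (auto intro!: continuous_on_compose2[OF that] simp: o_def)
  show ?thesis unfolding homeo_pow_def
    using *[OF continuous_phi] *[OF continuous_phi_inv] by simp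
qed

lemma image_P: "P n ` A = P (- n) -` A"
  by (auto simp: image_iff) (metis P_minus(2))

lemma open_image_P: "open A \<Longrightarrow> open (P n ` A)"
  unfolding image_P by (rule open_vimage[OF _ continuous_P])

lemma clopen_image_P: "clopen A \<Longrightarrow> clopen (P n ` A)"
  unfolding image_P by (auto intro: open_vimage closed_vimage continuous_P)

lemma orbit_dense: "closure (range (\<lambda>n. P n x)) = UNIV"
  using cantor_minimal by (simp add: cantor_minimal_def minimal_action_def)

text \<open>A nonzero period makes the orbit of \<open>x\<close> finite. Finite sets are closed in a
  Hausdorff space, so density of the orbit would make the whole Cantor set finite.\<close>

lemma free: assumes "P n x = x" shows "n = 0"
proof (rule ccontr)
  assume n: "n \<noteq> 0"
  have *: "P (n * int k) x = x" for k
    by (induction k) (auto simp: P_add assms distrib_left)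
  have per: "P (n * j) x = x" for j
  proof (cases "j \<ge> 0")
    case True then show ?thesis using *[of "nat j"] by simp
  next
    case False
    then show ?thesis using *[of "nat (-j)"] P_minus(1)[of "n * (-j)" x] by simp
  qed
  \<comment> \<open>For negative \<open>n\<close> the residue \<open>k mod n\<close> is nonpositive,
    hence the symmetric window.\<close>
  have "P k x \<in> (\<lambda>k. P k x) ` {-\<bar>n\<bar>..\<bar>n\<bar>}" for k
  proof -
    have "P k x = P (k mod n) x" using P_add[of "k mod n" "n * (k div n)" x] per[of "k div n"] by simp
    moreover have "k mod n \<in> {-\<bar>n\<bar>..\<bar>n\<bar>}"
      using n by (cases "n > 0") (auto simp: less_imp_le pos_mod_bound neg_mod_bound neg_mod_sign abs_if
         intro: order_trans[OF _ pos_mod_sign] order_trans[OF neg_mod_sign])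
    ultimately show ?thesis by blast
  qed
  then have "finite (range (\<lambda>n. P n x))" by (metis finite_atLeastAtMost_int finite_imageI finite_subset image_subsetI)
  then have "finite (UNIV :: 'x set)" using orbit_dense[of x] by (simp add: finite_imp_closed)
  then show False using cantor_set_infinite[OF cantor] by simp
qed

lemma P_eq_P_iff [simp]: "P m x = P n x \<longleftrightarrow> m = n"
proof
  assume "P m x = P n x"
  then have "P (m - n) x = x" by (metis P_add P_minus(1) add.commute uminus_add_conv_diff)
  then show "m = n" using free by force
qed simp

lemma recurrence_ex: assumes "open U" "U \<noteq> {}" shows "\<exists>n. P n x \<in> U"
proof (rule ccontr)
  assume "\<nexists>n. P n x \<in> U"
  then have "range (\<lambda>n. P n x) \<inter> U = {}" by auto
  then have "closure (range (\<lambda>n. P n x)) \<inter> U = {}"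
    using open_Int_closure_eq_empty[OF assms(1)] by blast
  then show False using assms(2) orbit_dense by simp
qed

lemma minimal_closed:
  assumes "closed S" "S \<noteq> {}" "\<And>x n. x \<in> S \<Longrightarrow> P n x \<in> S" shows "S = UNIV"
proof -
  obtain x where "x \<in> S" using assms by auto
  then have "range (\<lambda>n. P n x) \<subseteq> S" using assms by auto
  then have "closure (range (\<lambda>n. P n x)) \<subseteq> S" using assms(1) by (simp add: closure_minimal)
  then show ?thesis using orbit_dense by auto
qed

text \<open>By compactness finitely many preimages of \<open>U\<close> under powers of \<phi> cover
  the space, with exponents bounded by \<open>M\<close>. Applied at \<open>P M x\<close> instead of
  \<open>x\<close>, the cover gives visiting times between 0 and \<open>2 * M\<close>; this is
  uniform recurrence in forward time.\<close>

lemma recurrence: assumes "open U" "U \<noteq> {}"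
  shows "\<exists>K\<ge>0. \<forall>x. \<exists>k. 0 \<le> k \<and> k \<le> K \<and> P k x \<in> U"
proof -
  have cov: "UNIV \<subseteq> \<Union>((\<lambda>n. P n -` U) ` UNIV)"
    using recurrence_ex[OF assms] by auto
  obtain D where "D \<subseteq> (\<lambda>n. P n -` U) ` UNIV" "finite D" "UNIV \<subseteq> \<Union>D"
    using compactE[OF compact_space cov] open_vimage[OF assms(1) continuous_P] by auto
  then obtain I where I: "finite I" "UNIV \<subseteq> (\<Union>n\<in>I. P n -` U)"
    by (metis finite_subset_image)
  define M where "M = Max (insert 0 (abs ` I))"
  have M: "\<bar>n\<bar> \<le> M" if "n \<in> I" for n unfolding M_def using I(1) that by (intro Max_ge) auto
  have M0: "M \<ge> 0" unfolding M_def using I(1) by (intro Max_ge) auto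
  have "\<exists>k. 0 \<le> k \<and> k \<le> 2 * M \<and> P k x \<in> U" for x
  proof -
    obtain n where n: "n \<in> I" "P n (P M x) \<in> U" using I(2) by blast
    then show ?thesis using M[OF n(1)] by (intro exI[of _ "n + M"]) (auto simp: P_P)
  qed
  then show ?thesis using M0 by (intro exI[of _ "2 * M"]) auto
qed

text \<open>Gluing principle for clopen sets: compactness gives a finite cover by good
  neighbourhoods, and splitting off one of them at a time makes the pieces disjoint. The local
  premise concerns every clopen subset of \<open>N\<close>, since the pieces left after splitting
  are smaller than the neighbourhoods chosen.\<close>

lemma clopen_induct [consumes 1, case_names empty local union]:
  assumes "clopen (A :: 'x set)"
    and "Q {}"
    and local: "\<And>x. x \<in> A \<Longrightarrow> \<exists>N. open N \<and> x \<in> N \<and> (\<forall>V. clopen V \<longrightarrow> V \<subseteq> N \<longrightarrow> V \<subseteq> A \<longrightarrow> Q V)"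
    and union: "\<And>V W. clopen V \<Longrightarrow> clopen W \<Longrightarrow> V \<inter> W = {} \<Longrightarrow> V \<subseteq> A \<Longrightarrow> W \<subseteq> A \<Longrightarrow> Q V \<Longrightarrow> Q W \<Longrightarrow> Q (V \<union> W)"
  shows "Q A"
proof -
  let ?G = "{N. clopen N \<and> (\<forall>V. clopen V \<longrightarrow> V \<subseteq> N \<longrightarrow> V \<subseteq> A \<longrightarrow> Q V)}"
  have "A \<subseteq> \<Union>?G"
  proof
    fix x assume "x \<in> A"
    obtain N where N: "open N" "x \<in> N" "\<forall>V. clopen V \<longrightarrow> V \<subseteq> N \<longrightarrow> V \<subseteq> A \<longrightarrow> Q V"
      using local[OF \<open>x \<in> A\<close>] by metis
    obtain N' where "clopen N'" "x \<in> N'" "N' \<subseteq> N" using clopen_basis[OF N(1,2)] by blast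
    then show "x \<in> \<Union>?G" using N(3) by (intro UnionI[of N']) auto
  qed
  then obtain D where D: "D \<subseteq> ?G" "finite D" "A \<subseteq> \<Union>D"
    using compactE[OF clopen_compact[OF conjunct2[OF assms(1)]], of ?G] by (metis (no_types, lifting) mem_Collect_eq)
  have "\<forall>V. clopen V \<longrightarrow> V \<subseteq> A \<longrightarrow> V \<subseteq> \<Union>D \<longrightarrow> Q V"
    using D(2,1)
  proof (induction D rule: finite_induct)
    case empty then show ?case using assms(2) by auto
  next
    case (insert N D)
    show ?case
    proof (intro allI impI)
      fix V assume V: "clopen V" "V \<subseteq> A" "V \<subseteq> \<Union>(insert N D)"
      have N: "clopen N" "\<forall>V. clopen V \<longrightarrow> V \<subseteq> N \<longrightarrow> V \<subseteq> A \<longrightarrow> Q V" using insert by auto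
      have "Q (V \<inter> N)" using V N by auto
      moreover have "Q (V - N)" using insert V N by (auto simp: open_Diff closed_Diff)
      ultimately have "Q ((V \<inter> N) \<union> (V - N))"
        using V N by (intro union) (auto simp: open_Diff closed_Diff)
      then show "Q V" by (simp add: Int_Diff_Un)
    qed
  qed
  then show ?thesis using D(3) assms(1) by auto
qed

section \<open>The full group as a group of local powers\<close>

definition F :: "('x \<Rightarrow> 'x) set" where
  "F = {\<alpha>. bij \<alpha> \<and> (\<forall>x. \<exists>k V. open V \<and> x \<in> V \<and> (\<forall>z\<in>V. \<alpha> z = P k z))}"

text \<open>The exponent is unique because the action is free. It is the degree of the arrow with
  source \<open>x\<close> in the bisection of \<alpha>.\<close>

definition disp :: "('x \<Rightarrow> 'x) \<Rightarrow> 'x \<Rightarrow> int" where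
  "disp \<alpha> x = (THE k. \<alpha> x = P k x)"

lemma disp_eqI: "\<alpha> x = P k x \<Longrightarrow> disp \<alpha> x = k"
  unfolding disp_def by (rule the_equality) auto

lemma F_bij: "\<alpha> \<in> F \<Longrightarrow> bij \<alpha>" by (simp add: F_def)

lemma F_inj_iff: "\<alpha> \<in> F \<Longrightarrow> \<alpha> x = \<alpha> y \<longleftrightarrow> x = y" by (meson F_bij bij_def inj_eq)

lemma F_local: "\<alpha> \<in> F \<Longrightarrow> \<exists>V. open V \<and> x \<in> V \<and> (\<forall>z\<in>V. \<alpha> z = P (disp \<alpha> x) z)"
  unfolding F_def mem_Collect_eq using disp_eqI by metis

lemma F_disp: "\<alpha> \<in> F \<Longrightarrow> \<alpha> x = P (disp \<alpha> x) x"
  using F_local by blast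

lemma loc_const_disp: assumes "\<alpha> \<in> F" shows "loc_const (disp \<alpha>)"
  unfolding loc_const_def using F_local[OF assms] disp_eqI by metis

lemma disp_bounded: "\<alpha> \<in> F \<Longrightarrow> \<exists>N\<ge>0. \<forall>x. \<bar>disp \<alpha> x\<bar> \<le> N"
  using loc_const_bounded[OF compact_space loc_const_disp] .

lemma F_I:
  assumes "bij \<alpha>" "\<And>x. \<alpha> x = P (n x) x" "loc_const n"
  shows "\<alpha> \<in> F"
  unfolding F_def
proof (intro CollectI conjI allI assms(1))
  fix x
  obtain V where "open V" "x \<in> V" "\<forall>z\<in>V. n z = n x" using assms(3) unfolding loc_const_def by meson
  then show "\<exists>k V. open V \<and> x \<in> V \<and> (\<forall>z\<in>V. \<alpha> z = P k z)"
    using assms(2) by metis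
qed

lemma F_continuous: assumes "\<alpha> \<in> F" shows "continuous_on UNIV \<alpha>"
  unfolding continuous_on_open_vimage[OF open_UNIV]
proof (intro allI impI)
  fix B :: "'x set" assume B: "open B"
  show "open (\<alpha> -` B \<inter> UNIV)"
  proof (subst open_subopen, intro ballI)
    fix x assume x: "x \<in> \<alpha> -` B \<inter> UNIV"
    obtain V where V: "open V" "x \<in> V" "\<forall>z\<in>V. \<alpha> z = P (disp \<alpha> x) z" using F_local[OF assms] by blast
    show "\<exists>T. open T \<and> x \<in> T \<and> T \<subseteq> \<alpha> -` B \<inter> UNIV"
      using V x open_vimage[OF B continuous_P[of "disp \<alpha> x"]]
      by (intro exI[of _ "V \<inter> P (disp \<alpha> x) -` B"]) auto
  qed
qed

lemma F_id [simp]: "id \<in> F"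
  by (rule F_I[of _ "\<lambda>_. 0"]) auto

lemma P_in_F [simp]: "P n \<in> F"
  by (rule F_I[of _ "\<lambda>_. n"]) (auto simp: bij_P)

lemma phi_in_F [simp]: "\<phi> \<in> F" using P_in_F[of 1] by simp

lemma disp_id [simp]: "disp id x = 0" by (rule disp_eqI) simp

lemma disp_comp: "\<alpha> \<in> F \<Longrightarrow> \<beta> \<in> F \<Longrightarrow> disp (\<alpha> \<circ> \<beta>) x = disp \<beta> x + disp \<alpha> (\<beta> x)"
  by (rule disp_eqI) (simp add: P_add add.commute[of "disp \<beta> x"] flip: F_disp)

lemma F_comp [intro, simp]: assumes "\<alpha> \<in> F" "\<beta> \<in> F" shows "\<alpha> \<circ> \<beta> \<in> F"
proof (rule F_I)
  show "bij (\<alpha> \<circ> \<beta>)" using assms by (simp add: F_bij bij_comp)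
  show "(\<alpha> \<circ> \<beta>) x = P (disp \<beta> x + disp \<alpha> (\<beta> x)) x" for x
    using assms by (simp add: P_add add.commute[of "disp \<beta> x"] flip: F_disp)
  show "loc_const (\<lambda>x. disp \<beta> x + disp \<alpha> (\<beta> x))"
    by (intro loc_const_comp2[where h="(+)"] loc_const_disp assms loc_const_vimage_comp[OF loc_const_disp] F_continuous)
qed

lemma F_finv [simp]: "\<alpha> \<in> F \<Longrightarrow> \<alpha> (finv \<alpha> x) = x" "\<alpha> \<in> F \<Longrightarrow> finv \<alpha> (\<alpha> x) = x"
  by (auto simp: F_bij bij_is_surj surj_f_inv_f bij_is_inj)

lemma F_inv [intro, simp]: assumes "\<alpha> \<in> F" shows "finv \<alpha> \<in> F"
  unfolding F_def
proof (intro CollectI conjI allI)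
  show "bij (finv \<alpha>)" using assms F_bij bij_imp_bij_inv by blast
  fix x
  let ?k = "disp \<alpha> (finv \<alpha> x)"
  obtain V where V: "open V" "finv \<alpha> x \<in> V" "\<forall>z\<in>V. \<alpha> z = P ?k z" using F_local[OF assms] by blast
  have "finv \<alpha> z = P (- ?k) z" if "z \<in> P ?k ` V" for z
    using that V(3) assms by auto (metis F_finv(2))
  moreover have "x \<in> P ?k ` V" using V assms by (metis F_finv(1) image_eqI)
  ultimately show "\<exists>k V. open V \<and> x \<in> V \<and> (\<forall>z\<in>V. finv \<alpha> z = P k z)"
    using open_image_P[OF V(1)] by blast
qed

lemma finv_comp: "\<alpha> \<in> F \<Longrightarrow> \<alpha> \<circ> finv \<alpha> = id" "\<alpha> \<in> F \<Longrightarrow> finv \<alpha> \<circ> \<alpha> = id"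
  by (auto simp: fun_eq_iff)

lemma finv_eqI: "\<alpha> \<circ> \<beta> = id \<Longrightarrow> \<alpha> \<in> F \<Longrightarrow> finv \<alpha> = \<beta>"
  by (metis F_finv(2) comp_apply ext id_apply)

lemma image_F: "\<alpha> \<in> F \<Longrightarrow> \<alpha> ` A = finv \<alpha> -` A"
  by (auto simp: image_iff) (metis F_finv(1))

lemma clopen_image_F: "\<alpha> \<in> F \<Longrightarrow> clopen A \<Longrightarrow> clopen (\<alpha> ` A)"
  by (auto simp: image_F intro!: open_vimage closed_vimage F_continuous)

lemma open_image_F: "\<alpha> \<in> F \<Longrightarrow> open A \<Longrightarrow> open (\<alpha> ` A)"
  by (auto simp: image_F intro!: open_vimage F_continuous)

end

section \<open>Full bisections\<close>

lemma loc_const_continuous_on: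
  fixes f :: "'a::topological_space \<Rightarrow> 'b::topological_space"
  assumes "loc_const f" shows "continuous_on UNIV f"
proof -
  have "f -` B \<inter> UNIV = {x. f x \<in> B}" for B by auto
  then show ?thesis
    using loc_const_open_vimage[OF assms] by (simp add: continuous_on_open_vimage[OF open_UNIV])
qed

lemma continuous_on_prod_int:
  fixes f :: "'a::topological_space \<times> int \<Rightarrow> 'b::topological_space"
  assumes "\<And>n. continuous_on UNIV (\<lambda>x. f (x, n))"
  shows "continuous_on UNIV f"
  unfolding continuous_on_open_vimage[OF open_UNIV]
proof (intro allI impI)
  fix B :: "'b set" assume B: "open B"
  have "f -` B \<inter> UNIV = (\<Union>n. ((\<lambda>x. f (x, n)) -` B) \<times> {n})" by auto
  also have "open \<dots>"
    using open_vimage[OF B assms] by (intro open_UN ballI open_Times) (auto simp: open_discrete)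
  finally show "open (f -` B \<inter> UNIV)" .
qed

context cantor_system
begin

text \<open>The parameter \<open>z\<close> is the source of the arrow that it indexes; see
  \<open>source_bis\<close>.\<close>

definition bis :: "('x \<Rightarrow> 'x) \<Rightarrow> ('x \<times> int) set" where
  "bis \<alpha> = range (\<lambda>z. (\<alpha> z, disp \<alpha> z))"

lemma source_bis: "\<alpha> \<in> F \<Longrightarrow> tg_source \<phi> (\<alpha> z, disp \<alpha> z) = z"
  by (simp add: tg_source_def F_disp[of \<alpha>])

lemma inj_on_source_bis: "\<alpha> \<in> F \<Longrightarrow> inj_on (tg_source \<phi>) (bis \<alpha>)"
  by (auto simp: bis_def inj_on_def source_bis)

lemma full_bisection_bis: assumes "\<alpha> \<in> F" shows "full_bisection \<phi> (bis \<alpha>)"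
  unfolding full_bisection_def compact_open_bisection_def
proof (intro conjI)
  show "compact (bis \<alpha>)" unfolding bis_def
    by (intro compact_continuous_image compact_space continuous_on_Pair F_continuous
        loc_const_continuous_on loc_const_disp assms)
  show "open (bis \<alpha>)"
  proof (subst open_subopen, intro ballI)
    fix g assume "g \<in> bis \<alpha>"
    then obtain z where g: "g = (\<alpha> z, disp \<alpha> z)" by (auto simp: bis_def)
    obtain V where V: "open V" "z \<in> V" "\<And>y. y \<in> V \<Longrightarrow> disp \<alpha> y = disp \<alpha> z"
      using loc_constE[OF loc_const_disp[OF assms], of z] by metis
    have "open (\<alpha> ` V \<times> {disp \<alpha> z})" by (intro open_Times open_image_F assms V) (simp add: open_discrete)
    moreover have "\<alpha> ` V \<times> {disp \<alpha> z} \<subseteq> bis \<alpha>"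
    proof
      fix h assume "h \<in> \<alpha> ` V \<times> {disp \<alpha> z}"
      then obtain y where "y \<in> V" "h = (\<alpha> y, disp \<alpha> z)" by auto
      then show "h \<in> bis \<alpha>" using V(3)[of y] by (simp add: bis_def image_iff) (metis)
    qed
    moreover have "g \<in> \<alpha> ` V \<times> {disp \<alpha> z}" using g V(2) by simp
    ultimately show "\<exists>T. open T \<and> g \<in> T \<and> T \<subseteq> bis \<alpha>" by blast
  qed
  show "inj_on tg_range (bis \<alpha>)"
    by (auto simp: bis_def inj_on_def tg_range_def F_inj_iff assms)
  show "inj_on (tg_source \<phi>) (bis \<alpha>)" by (rule inj_on_source_bis[OF assms])
  show "tg_range ` bis \<alpha> = UNIV"
    using assms by (auto simp: bis_def tg_range_def image_iff) (metis F_finv(1))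
  show "tg_source \<phi> ` bis \<alpha> = UNIV"
    using assms by (auto simp: bis_def image_image source_bis)
qed

lemma theta_bis: assumes "\<alpha> \<in> F" shows "theta \<phi> (bis \<alpha>) = \<alpha>"
proof
  fix z
  have "inv_into (bis \<alpha>) (tg_source \<phi>) z = (\<alpha> z, disp \<alpha> z)"
    by (rule inv_into_f_eq[OF inj_on_source_bis]) (auto simp: assms source_bis bis_def)
  then show "theta \<phi> (bis \<alpha>) z = \<alpha> z" by (simp add: theta_def tg_range_def)
qed

text \<open>The open set \<open>U\<close> contains a box around each of its arrows, and keeping the
  degree fixed there makes \<open>theta\<close> locally a power of \<phi>. Together with
  \<open>theta_bis\<close> this identifies full bisections with \<open>F\<close>, so each element
  comes from only one bisection.\<close>

lemma full_bisection_theta: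
  assumes "full_bisection \<phi> U"
  shows "theta \<phi> U \<in> F" "bis (theta \<phi> U) = U"
proof -
  let ?a = "theta \<phi> U"
  have U: "open U" "inj_on tg_range U" "inj_on (tg_source \<phi>) U" "tg_range ` U = UNIV" "tg_source \<phi> ` U = UNIV"
    using assms by (auto simp: full_bisection_def compact_open_bisection_def)
  have th: "?a (P (-n) x) = x" if "(x, n) \<in> U" for x n
  proof -
    have "inv_into U (tg_source \<phi>) (P (-n) x) = (x, n)"
      by (rule inv_into_f_eq[OF U(3) that]) (simp add: tg_source_def)
    then show ?thesis by (simp add: theta_def tg_range_def)
  qed
  have ex: "\<exists>n. (P n z, n) \<in> U" for z
  proof -
    have "z \<in> tg_source \<phi> ` U" using U(5) by simp
    then obtain x n where "(x, n) \<in> U" "z = P (-n) x" by (auto simp: tg_source_def)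
    then show ?thesis by (intro exI[of _ n]) simp
  qed
  have a: "?a z = P n z" if "(P n z, n) \<in> U" for z n using th[OF that] by simp
  have "bij ?a"
  proof (rule bijI)
    show "inj ?a"
    proof (rule injI)
      fix y z assume e: "?a y = ?a z"
      obtain m n where mn: "(P m y, m) \<in> U" "(P n z, n) \<in> U" using ex by meson
      then have "P m y = P n z" using a e by metis
      then have "(P m y, m) = (P n z, n)" by (intro inj_onD[OF U(2)] mn) (simp add: tg_range_def)
      then show "y = z" by (metis P_inj_iff prod.inject)
    qed
    show "surj ?a"
    proof (rule surjI[of _ "\<lambda>x. P (- (SOME n. (x, n) \<in> U)) x"])
      fix x
      have "x \<in> tg_range ` U" using U(4) by simp
      then have "\<exists>n. (x, n) \<in> U" by (auto simp: tg_range_def)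
      then have "(x, SOME n. (x, n) \<in> U) \<in> U" by (rule someI_ex)
      then show "?a (P (- (SOME n. (x, n) \<in> U)) x) = x" by (rule th)
    qed
  qed
  moreover have "\<exists>k V. open V \<and> x \<in> V \<and> (\<forall>z\<in>V. ?a z = P k z)" for x
  proof -
    obtain n where n: "(P n x, n) \<in> U" using ex by meson
    then obtain A B where AB: "open A" "open B" "(P n x, n) \<in> A \<times> B" "A \<times> B \<subseteq> U"
      using U(1) by (elim open_prod_elim)
    have "?a z = P n z" if "z \<in> P n -` A" for z
      using that AB by (intro a) auto
    moreover have "open (P n -` A)" "x \<in> P n -` A" using open_vimage[OF AB(1) continuous_P] AB(3) by auto
    ultimately show ?thesis by (intro exI[of _ n] exI[of _ "P n -` A"]) blast
  qed
  ultimately show F: "?a \<in> F" by (simp add: F_def)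
  have d: "disp ?a z = n" if "(P n z, n) \<in> U" for z n using a[OF that] by (rule disp_eqI)
  show "bis ?a = U"
  proof
    show "bis ?a \<subseteq> U"
    proof
      fix g assume "g \<in> bis ?a"
      then obtain z where g: "g = (?a z, disp ?a z)" by (auto simp: bis_def)
      obtain n where "(P n z, n) \<in> U" using ex by meson
      then show "g \<in> U" using a[of n z] d[of n z] g by simp
    qed
    show "U \<subseteq> bis ?a"
    proof
      fix g assume "g \<in> U"
      then obtain x n where g: "g = (x, n)" "(x, n) \<in> U" by (metis surj_pair)
      then have "(P n (P (-n) x), n) \<in> U" by simp
      from a[OF this] d[OF this] have "g = (?a (P (-n) x), disp ?a (P (-n) x))" using g by simp
      then show "g \<in> bis ?a" unfolding bis_def by (rule range_eqI)
    qed
  qed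
qed

lemma carrier_full_group [simp]: "carrier (full_group \<phi>) = F"
proof
  show "carrier (full_group \<phi>) \<subseteq> F" by (auto simp: full_group_def full_bisection_theta)
  show "F \<subseteq> carrier (full_group \<phi>)"
    using full_bisection_bis theta_bis by (force simp: full_group_def)
qed

lemma mult_full_group [simp]: "monoid.mult (full_group \<phi>) = (\<circ>)"
  and one_full_group [simp]: "one (full_group \<phi>) = id"
  by (simp_all add: full_group_def)

lemma bisection_of_eq: assumes "\<alpha> \<in> F" shows "bisection_of \<phi> \<alpha> = bis \<alpha>"
  unfolding bisection_of_def
  by (rule the_equality) (use assms full_bisection_bis theta_bis full_bisection_theta in auto)

lemma group_full_group: "group (full_group \<phi>)"
  by (rule groupI) (auto simp: o_assoc, metis F_inv finv_comp(2))

lemma inv_full_group [simp]: "\<alpha> \<in> F \<Longrightarrow> m_inv (full_group \<phi>) \<alpha> = finv \<alpha>"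
  by (rule group.inv_equality[OF group_full_group]) (auto simp: finv_comp)

lemma subgroup_full_groupI:
  assumes "S \<subseteq> F" "id \<in> S" "\<And>\<alpha> \<beta>. \<alpha> \<in> S \<Longrightarrow> \<beta> \<in> S \<Longrightarrow> \<alpha> \<circ> \<beta> \<in> S" "\<And>\<alpha>. \<alpha> \<in> S \<Longrightarrow> finv \<alpha> \<in> S"
  shows "subgroup S (full_group \<phi>)"
  using assms by (intro group.subgroupI[OF group_full_group]) auto

section \<open>The commutator subgroup\<close>

definition D :: "('x \<Rightarrow> 'x) set" where "D = derived (full_group \<phi>) F"

lemma D_subgroup: "subgroup D (full_group \<phi>)"
  unfolding D_def using group.derived_is_subgroup[OF group_full_group, of F] by simp

lemma carrier_commutator_full_group [simp]: "carrier (commutator_full_group \<phi>) = D"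
  by (simp add: commutator_full_group_def D_def)

lemma D_subset_F: "D \<subseteq> F" using subgroup.subset[OF D_subgroup] by simp

lemma D_commutator: assumes "\<alpha> \<in> F" "\<beta> \<in> F" shows "\<alpha> \<circ> \<beta> \<circ> finv \<alpha> \<circ> finv \<beta> \<in> D"
  unfolding D_def derived_def by (rule generate.incl) (use assms in force)

lemma D_least:
  assumes "subgroup S (full_group \<phi>)" "\<And>\<alpha> \<beta>. \<alpha> \<in> F \<Longrightarrow> \<beta> \<in> F \<Longrightarrow> \<alpha> \<circ> \<beta> \<circ> finv \<alpha> \<circ> finv \<beta> \<in> S"
  shows "D \<subseteq> S"
  unfolding D_def derived_def
  by (rule group.generate_subgroup_incl[OF group_full_group _ assms(1)]) (use assms(2) in auto)

text \<open>Intended for \<open>A\<close> disjoint from its image under \<alpha>, when it is the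
  involution exchanging the two sets. Only the values of \<alpha> on \<open>A\<close> matter, see
  \<open>swap_cong\<close>.\<close>

definition swap :: "('x \<Rightarrow> 'x) \<Rightarrow> 'x set \<Rightarrow> 'x \<Rightarrow> 'x" where
  "swap \<alpha> A x = (if x \<in> A then \<alpha> x else if x \<in> \<alpha> ` A then finv \<alpha> x else x)"

lemma swap_in: "x \<in> A \<Longrightarrow> swap \<alpha> A x = \<alpha> x"
  and swap_out: "x \<notin> A \<Longrightarrow> x \<notin> \<alpha> ` A \<Longrightarrow> swap \<alpha> A x = x"
  by (auto simp: swap_def)

lemma swap_img: "\<alpha> \<in> F \<Longrightarrow> A \<inter> \<alpha> ` A = {} \<Longrightarrow> x \<in> A \<Longrightarrow> swap \<alpha> A (\<alpha> x) = x"
  by (auto simp: swap_def)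

lemma swap_swap: assumes "\<alpha> \<in> F" "A \<inter> \<alpha> ` A = {}" shows "swap \<alpha> A (swap \<alpha> A x) = x"
  using assms by (auto simp: swap_def)

lemma swap_bij: "\<alpha> \<in> F \<Longrightarrow> A \<inter> \<alpha> ` A = {} \<Longrightarrow> bij (swap \<alpha> A)"
  by (rule o_bij[of "swap \<alpha> A"]) (auto simp: fun_eq_iff swap_swap)

lemma swap_in_F: assumes "\<alpha> \<in> F" "clopen A" "A \<inter> \<alpha> ` A = {}" shows "swap \<alpha> A \<in> F"
proof (rule F_I[OF swap_bij[OF assms(1,3)]])
  let ?n = "\<lambda>x. if x \<in> A then disp \<alpha> x else if x \<in> \<alpha> ` A then disp (finv \<alpha>) x else 0"
  show "swap \<alpha> A x = P (?n x) x" for x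
    unfolding swap_def using F_disp[OF assms(1), of x] F_disp[OF F_inv[OF assms(1)], of x] by (simp split: if_splits)
  have 1: "loc_const (\<lambda>x. (x \<in> A, disp \<alpha> x))"
    by (intro loc_const_comp2[where h=Pair] loc_const_indicator loc_const_disp assms)
  have 2: "loc_const (\<lambda>x. (x \<in> \<alpha> ` A, disp (finv \<alpha>) x))"
    by (intro loc_const_comp2[where h=Pair] loc_const_indicator loc_const_disp assms clopen_image_F F_inv)
  show "loc_const ?n"
    using loc_const_comp2[OF 1 2, of "\<lambda>(p, a) (q, b). if p then a else if q then b else 0"] by simp
qed

lemma finv_swap: "\<alpha> \<in> F \<Longrightarrow> clopen A \<Longrightarrow> A \<inter> \<alpha> ` A = {} \<Longrightarrow> finv (swap \<alpha> A) = swap \<alpha> A"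
  by (rule finv_eqI) (auto simp: fun_eq_iff swap_swap swap_in_F)

section \<open>The involutions \<open>tau\<close> as swaps\<close>

lemma continuous_tg_inverse: "continuous_on UNIV (tg_inverse \<phi>)"
proof (rule continuous_on_prod_int)
  fix n show "continuous_on UNIV (\<lambda>x. tg_inverse \<phi> (x, n))"
    unfolding tg_inverse_def tg_source_def fst_conv snd_conv
    by (intro continuous_on_Pair continuous_P continuous_on_const)
qed

lemma tg_inverse_inverse [simp]: "tg_inverse \<phi> (tg_inverse \<phi> g) = g"
  by (cases g) (simp add: tg_inverse_def tg_source_def)

lemma tg_range_inverse [simp]: "tg_range (tg_inverse \<phi> g) = tg_source \<phi> g"
  and tg_source_inverse [simp]: "tg_source \<phi> (tg_inverse \<phi> g) = tg_range g"
  by (simp_all add: tg_inverse_def tg_source_def tg_range_def)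

lemma image_tg_inverse: "tg_inverse \<phi> ` U = tg_inverse \<phi> -` U"
  by (auto simp: image_iff) (metis tg_inverse_inverse)

lemma clopen_range:
  assumes "compact U" "open U" shows "clopen (tg_range ` (U :: ('x \<times> int) set))"
proof -
  have "tg_range ` U = fst ` U" by (simp add: tg_range_def image_def)
  moreover have "open (fst ` U)" by (rule open_image_fst[OF assms(2)])
  moreover have "compact (fst ` U)" by (rule compact_continuous_image[OF continuous_on_fst[OF continuous_on_id] assms(1)])
  ultimately show ?thesis by (simp add: compact_imp_closed)
qed

text \<open>The set \<open>?W\<close> is invariant under \<open>tg_inverse\<close>, which reduces
  the claims about sources to those about ranges. Writing \<open>tau\<close> as a swap whose moving
  map is \<open>tau\<close> itself makes the results about swaps applicable to it.\<close>

lemma tau_swap: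
  assumes "compact_open_bisection \<phi> U" "tg_range ` U \<inter> tg_source \<phi> ` U = {}"
  shows "tau \<phi> U \<in> F" "clopen (tg_range ` U)" "tau \<phi> U ` tg_range ` U = tg_source \<phi> ` U"
    "tau \<phi> U = swap (tau \<phi> U) (tg_range ` U)"
proof -
  let ?A = "tg_range ` U" and ?B = "tg_source \<phi> ` U"
  let ?V = "tg_inverse \<phi> ` U" and ?Z = "(UNIV - (?A \<union> ?B)) \<times> {0::int}"
  have U: "compact U" "open U" "inj_on tg_range U" "inj_on (tg_source \<phi>) U"
    using assms by (auto simp: compact_open_bisection_def)
  have V: "compact ?V" "open ?V"
    using compact_continuous_image[OF continuous_on_subset[OF continuous_tg_inverse] U(1)]
      open_vimage[OF U(2) continuous_tg_inverse] by (auto simp: image_tg_inverse)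
  show A: "clopen ?A" by (rule clopen_range[OF U(1,2)])
  have "?B = tg_range ` ?V" by (simp add: image_image)
  then have B: "clopen ?B" using clopen_range[OF V] by simp
  have Z: "compact ?Z" "open ?Z"
    using A B by (auto intro!: compact_Times clopen_compact open_Times closed_Diff open_Diff simp: open_discrete)
  let ?W = "U \<union> ?V \<union> ?Z"
  have rZ: "tg_range g \<notin> ?A" "tg_range g \<notin> ?B" if "g \<in> ?Z" for g
  proof -
    have "tg_range g \<in> UNIV - (?A \<union> ?B)" using that by (auto simp only: tg_range_def mem_Times_iff)
    then show "tg_range g \<notin> ?A" "tg_range g \<notin> ?B" by auto
  qed
  have dis: "tg_range g \<noteq> tg_source \<phi> h" if "g \<in> U" "h \<in> U" for g h using assms(2) that by blast
  have injr: "inj_on tg_range ?W"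
    unfolding inj_on_def
  proof (intro ballI impI)
    fix g h assume gh: "g \<in> ?W" "h \<in> ?W" "tg_range g = tg_range h"
    have A: "tg_range k \<in> ?A" if "k \<in> U" for k using that by blast
    have B: "tg_range k \<in> ?B" if k: "k \<in> ?V" for k using k by auto
    consider "g \<in> U" "h \<in> U" | "g \<in> ?V" "h \<in> ?V" | "g \<in> ?Z" "h \<in> ?Z"
      using gh A[of g] A[of h] B[of g] B[of h] rZ(1,2)[of g] rZ(1,2)[of h] assms(2)
      by (metis Un_iff disjoint_iff)
    then show "g = h"
    proof cases
      case 1 then show ?thesis using U(3) gh(3) by (auto simp: inj_on_def)
    next
      case 2
      then obtain g' h' where "g' \<in> U" "h' \<in> U" "g = tg_inverse \<phi> g'" "h = tg_inverse \<phi> h'" by auto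
      then show ?thesis using U(4) gh(3) by (auto simp: inj_on_def)
    next
      case 3 then show ?thesis using gh(3) by (auto simp: tg_range_def)
    qed
  qed
  have inv: "tg_inverse \<phi> g \<in> ?W" if "g \<in> ?W" for g
  proof (cases "g \<in> ?Z")
    case True
    then have "tg_inverse \<phi> g = g" by (cases g) (simp add: tg_inverse_def tg_source_def)
    then show ?thesis using that by simp
  next
    case False
    then have "g \<in> U \<or> (\<exists>h\<in>U. g = tg_inverse \<phi> h)" using that by blast
    then show ?thesis by auto
  qed
  have injs: "inj_on (tg_source \<phi>) ?W"
  proof (rule inj_onI)
    fix g h assume gh: "g \<in> ?W" "h \<in> ?W" "tg_source \<phi> g = tg_source \<phi> h"
    then have "tg_inverse \<phi> g = tg_inverse \<phi> h"
      using inj_onD[OF injr _ inv[OF gh(1)] inv[OF gh(2)]] by simp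
    then show "g = h" by (metis tg_inverse_inverse)
  qed
  have r: "x \<in> tg_range ` ?W" for x
  proof -
    consider "x \<in> ?A" | "x \<in> ?B" | "(x, 0) \<in> ?Z" by auto
    then show ?thesis
    proof cases
      case 2
      then have "x \<in> tg_range ` ?V" by (simp add: image_image)
      then show ?thesis by blast
    next
      case 3 then show ?thesis by (metis UnI2 fst_conv image_eqI tg_range_def)
    qed blast
  qed
  then have rW: "tg_range ` ?W = UNIV" by blast
  have sW: "tg_source \<phi> ` ?W = UNIV"
  proof -
    have "x \<in> tg_source \<phi> ` ?W" for x
    proof -
      obtain g where "g \<in> ?W" "x = tg_range g" using r by blast
      then show ?thesis using inv by (intro image_eqI[of _ _ "tg_inverse \<phi> g"]) auto
    qed
    then show ?thesis by blast
  qed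
  have W: "full_bisection \<phi> ?W"
    unfolding full_bisection_def compact_open_bisection_def
    using U(1,2) V Z injr injs rW sW by (intro conjI compact_Un open_Un) auto
  let ?t = "tau \<phi> U"
  show F: "?t \<in> F" unfolding tau_def by (rule full_bisection_theta(1)[OF W])
  have b: "bis ?t = ?W" unfolding tau_def by (rule full_bisection_theta(2)[OF W])
  have t: "?t (tg_source \<phi> g) = tg_range g" if "g \<in> ?W" for g
  proof -
    from that b obtain z where z: "g = (?t z, disp ?t z)" unfolding bis_def by blast
    then show ?thesis using source_bis[OF F, of z] by (simp add: tg_range_def)
  qed
  have t1: "?t (tg_source \<phi> g) = tg_range g" "?t (tg_range g) = tg_source \<phi> g" if "g \<in> U" for g
    using t[of g] t[of "tg_inverse \<phi> g"] that by auto
  show img: "?t ` ?A = ?B" using t1(2) by (auto simp: image_image)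
  show "?t = swap ?t ?A"
  proof
    fix x
    consider "x \<in> ?A" | "x \<in> ?B" | "(x, 0) \<in> ?Z" by auto
    then show "?t x = swap ?t ?A x"
    proof cases
      case 1 then show ?thesis by (simp add: swap_in)
    next
      case 2
      then obtain g where g: "g \<in> U" "x = tg_source \<phi> g" by blast
      then have "swap ?t ?A (?t (tg_range g)) = tg_range g"
        using swap_img[OF F, of ?A "tg_range g"] img assms(2) by simp
      then show ?thesis using t1[OF g(1)] g by simp
    next
      case 3
      then have "x \<notin> ?A" "x \<notin> ?t ` ?A" using img by auto
      moreover have "?t x = x" using t[of "(x,0)"] 3 by (simp add: tg_source_def tg_range_def)
      ultimately show ?thesis by (simp add: swap_out)
    qed
  qed
qed

text \<open>The degree is \<open>-1\<close> because \<open>(x, n)\<close> has source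
  \<open>P (- n) x\<close>; with this sign the source set becomes the image of \<open>A\<close>
  under \<phi>.\<close>

lemma tau_shift:
  assumes "clopen A" "A \<inter> \<phi> ` A = {}"
  shows "compact_open_bisection \<phi> (A \<times> {-1})" "tg_range ` (A \<times> {-1}) = A" "tg_source \<phi> ` (A \<times> {-1}) = \<phi> ` A"
proof -
  show r: "tg_range ` (A \<times> {-1}) = A" by (auto simp: tg_range_def image_iff)
  show "tg_source \<phi> ` (A \<times> {-1}) = \<phi> ` A" by (force simp: tg_source_def image_iff)
  show "compact_open_bisection \<phi> (A \<times> {-1})"
    unfolding compact_open_bisection_def
  proof (intro conjI)
    show "compact (A \<times> {-1::int})" using assms by (intro compact_Times clopen_compact) auto
    show "open (A \<times> {-1::int})" using assms by (intro open_Times) (auto simp: open_discrete)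
    show "inj_on tg_range (A \<times> {-1})" by (auto simp: inj_on_def tg_range_def)
    show "inj_on (tg_source \<phi>) (A \<times> {-1})" by (auto simp: inj_on_def tg_source_def) (metis P_1 P_inj_iff)
  qed
qed

end

section \<open>The index\<close>

text \<open>Stands for the difference of the cardinalities of two sets that may be infinite but
  differ in finitely many elements.\<close>

definition rel_card :: "'a set \<Rightarrow> 'a set \<Rightarrow> int" where
  "rel_card S T = int (card (S - T)) - int (card (T - S))"

lemma rel_card_window:
  assumes "finite W" "S - T \<subseteq> W" "T - S \<subseteq> W"
  shows "rel_card S T = int (card (S \<inter> W)) - int (card (T \<inter> W))"
proof -
  have "S \<inter> W = (S - T) \<union> (S \<inter> T \<inter> W)" "T \<inter> W = (T - S) \<union> (S \<inter> T \<inter> W)" using assms by auto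
  moreover have "card ((S - T) \<union> (S \<inter> T \<inter> W)) = card (S - T) + card (S \<inter> T \<inter> W)"
    by (rule card_Un_disjoint) (use assms finite_subset in auto)
  moreover have "card ((T - S) \<union> (S \<inter> T \<inter> W)) = card (T - S) + card (S \<inter> T \<inter> W)"
    by (rule card_Un_disjoint) (use assms finite_subset in auto)
  ultimately show ?thesis by (simp add: rel_card_def)
qed

lemma rel_card_trans:
  assumes "finite (S - T)" "finite (T - S)" "finite (T - U)" "finite (U - T)"
  shows "rel_card S U = rel_card S T + rel_card T U"
proof -
  let ?W = "(S - T) \<union> (T - S) \<union> (T - U) \<union> (U - T)"
  have "finite ?W" using assms by simp
  then have "rel_card S T = int (card (S \<inter> ?W)) - int (card (T \<inter> ?W))"
    "rel_card T U = int (card (T \<inter> ?W)) - int (card (U \<inter> ?W))"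
    "rel_card S U = int (card (S \<inter> ?W)) - int (card (U \<inter> ?W))"
    by (intro rel_card_window; blast)+
  then show ?thesis by simp
qed

lemma rel_card_image: "inj f \<Longrightarrow> rel_card (f ` S) (f ` T) = rel_card S T"
  by (simp add: rel_card_def image_set_diff[symmetric] card_image inj_on_subset)

section \<open>Bounded permutations of the integers\<close>

definition bounded_perm :: "(int \<Rightarrow> int) \<Rightarrow> bool" where
  "bounded_perm a \<longleftrightarrow> bij a \<and> (\<exists>N. \<forall>k. \<bar>a k - k\<bar> \<le> N)"

text \<open>Positive when points move on balance from negative to nonnegative positions. For bounded
  displacement only a finite window contributes (\<open>perm_window\<close>).\<close>

definition perm_index :: "(int \<Rightarrow> int) \<Rightarrow> int" where
  "perm_index a = rel_card (a ` {..<0}) {..<0}"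

lemma perm_window:
  fixes a :: "int \<Rightarrow> int"
  assumes "\<And>k. \<bar>a k - k\<bar> \<le> N" "bij a"
  shows "a ` {..<0} - {..<0} \<subseteq> {-N..N}" "{..<0} - a ` {..<0} \<subseteq> {-N..N}"
proof -
  show "a ` {..<0} - {..<0} \<subseteq> {-N..N}"
  proof
    fix x assume "x \<in> a ` {..<0} - {..<0}"
    then obtain k where "k < 0" "x = a k" "\<not> x < 0" by blast
    then show "x \<in> {-N..N}" using assms(1)[of k] by auto
  qed
  show "{..<0} - a ` {..<0} \<subseteq> {-N..N}"
  proof
    fix x assume x: "x \<in> {..<0} - a ` {..<0}"
    obtain k where "x = a k" using assms(2) by (metis bij_pointE)
    then show "x \<in> {-N..N}" using x assms(1)[of k] by auto
  qed
qed

lemma perm_finite: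
  assumes "bounded_perm a"
  shows "finite (a ` {..<0} - {..<0})" "finite ({..<0} - a ` {..<0})"
  using assms perm_window[of a] finite_subset[OF _ finite_atLeastAtMost_int] unfolding bounded_perm_def by metis+

text \<open>The half-line is compared with its image under \<open>a \<circ> b\<close> by way of its
  image under \<open>a\<close>. The first comparison is the \<open>a\<close>-image of the one that
  defines the index of \<open>b\<close>, and injective images preserve relative cardinality.\<close>

lemma perm_index_comp:
  assumes "bounded_perm a" "bounded_perm b"
  shows "perm_index (a \<circ> b) = perm_index a + perm_index b"
proof -
  have inj: "inj a" using assms(1) by (simp add: bounded_perm_def bij_def)
  have 1: "a ` b ` {..<0} - a ` {..<0} = a ` (b ` {..<0} - {..<0})"
    "a ` {..<0} - a ` b ` {..<0} = a ` ({..<0} - b ` {..<0})"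
    by (simp_all add: image_set_diff[OF inj])
  have "rel_card (a ` b ` {..<0}) {..<0} = rel_card (a ` b ` {..<0}) (a ` {..<0}) + rel_card (a ` {..<0}) {..<0}"
    by (rule rel_card_trans) (simp_all add: 1 perm_finite assms)
  then show ?thesis using rel_card_image[OF inj, of "b ` {..<0}" "{..<0}"]
    by (simp add: perm_index_def image_comp)
qed

lemma perm_index_id [simp]: "perm_index id = 0"
  by (simp add: perm_index_def rel_card_def)

text \<open>Brings index zero into the form of equal numbers of crossings in the two directions,
  from which a bijection between the crossing positions is obtained later.\<close>

lemma perm_index_eq_0:
  assumes "bounded_perm a" "perm_index a = 0"
  shows "card {k. k < 0 \<and> 0 \<le> a k} = card {k. 0 \<le> k \<and> a k < 0}"
proof -
  have inj: "inj a" and surj: "surj a" using assms(1) by (auto simp: bounded_perm_def bij_def)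
  have "a ` {..<0} - {..<0} = a ` {k. k < 0 \<and> 0 \<le> a k}" by auto
  moreover have "{..<0} - a ` {..<0} = a ` {k. 0 \<le> k \<and> a k < (0::int)}"
  proof (intro equalityI subsetI)
    fix x assume x: "x \<in> {..<0} - a ` {..<0}"
    obtain k where k: "x = a k" using surj by (metis surjD)
    then have "\<not> k < 0" using x by blast
    then show "x \<in> a ` {k. 0 \<le> k \<and> a k < 0}" using x k by simp
  next
    fix x assume "x \<in> a ` {k. 0 \<le> k \<and> a k < 0}"
    then obtain k where "x = a k" "0 \<le> k" "a k < 0" by blast
    then show "x \<in> {..<0} - a ` {..<0}" using injD[OF inj] by force
  qed
  ultimately show ?thesis
    using assms(2) by (simp add: perm_index_def rel_card_def card_image inj_on_subset[OF inj])
qed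

section \<open>Chains with compact support\<close>

lemma compact_int_finite: assumes "compact (S :: int set)" shows "finite S"
proof -
  have "\<exists>D\<subseteq>range (\<lambda>k::int. {k}). finite D \<and> S \<subseteq> \<Union>D"
    by (intro assms[unfolded compact_eq_Heine_Borel, rule_format]) (auto simp: open_discrete)
  then obtain D where "D \<subseteq> range (\<lambda>k::int. {k})" "finite D" "S \<subseteq> \<Union>D" by blast
  moreover from this have "finite (\<Union>D)" by auto
  ultimately show ?thesis by (rule_tac finite_subset)
qed

lemma compact_int_bounded: assumes "compact (S :: int set)" shows "\<exists>N\<ge>0. \<forall>k\<in>S. \<bar>k\<bar> \<le> N"
proof -
  let ?N = "Max (insert 0 (abs ` S))"
  have "finite S" by (rule compact_int_finite[OF assms])
  then have "\<forall>k\<in>S. \<bar>k\<bar> \<le> ?N" "?N \<ge> 0" by (auto intro!: Max_ge)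
  then show ?thesis by blast
qed

text \<open>Because \<open>h 0 0 = 0\<close>, the new support is a relatively closed subset of the
  union \<open>?K\<close> of the two compact supports.\<close>

lemma compactly_supported_combine:
  assumes "f \<in> compactly_supported S" "g \<in> compactly_supported S" "h 0 0 = 0"
  shows "(\<lambda>z. h (f z) (g z)) \<in> compactly_supported S"
proof -
  have o: "openin (top_of_set S) {z \<in> S. f z \<in> A}" "openin (top_of_set S) {z \<in> S. g z \<in> A}" for A
    using assms openin_continuous_map_preimage[of "top_of_set S" "discrete_topology UNIV" _ A]
    by (auto simp: compactly_supported_def)
  have oh: "openin (top_of_set S) {z \<in> S. h (f z) (g z) \<in> A}" for A
  proof -
    have "{z \<in> S. h (f z) (g z) \<in> A} = (\<Union>(a, b)\<in>{(a, b). h a b \<in> A}. {z \<in> S. f z \<in> {a}} \<inter> {z \<in> S. g z \<in> {b}})"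
      by auto
    also have "openin (top_of_set S) \<dots>" by (intro openin_Union) (use o[of "{_}"] in \<open>auto intro!: openin_Int\<close>)
    finally show ?thesis .
  qed
  have c: "continuous_map (top_of_set S) (discrete_topology UNIV) (\<lambda>z. h (f z) (g z))"
    using oh by (auto simp: continuous_map_def)
  let ?K = "{z. f z \<noteq> 0} \<union> {z. g z \<noteq> 0}"
  have K: "compact ?K" "?K \<subseteq> S" using assms by (auto simp: compactly_supported_def)
  have "closedin (top_of_set S) {z \<in> S. h (f z) (g z) \<noteq> 0}"
  proof -
    have "S - {z \<in> S. h (f z) (g z) \<noteq> 0} = {z \<in> S. h (f z) (g z) \<in> {0}}" by auto
    then show ?thesis using oh[of "{0}"] by (auto simp: closedin_def)
  qed
  moreover have "{z \<in> S. h (f z) (g z) \<noteq> 0} = {z. h (f z) (g z) \<noteq> 0}" "{z. h (f z) (g z) \<noteq> 0} \<subseteq> ?K"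
    using assms by (auto simp: compactly_supported_def) (metis assms(3))+
  ultimately have "compact {z. h (f z) (g z) \<noteq> 0}"
    by (metis (no_types, lifting) closedin_compact closedin_subset_trans K)
  then show ?thesis using c assms by (auto simp: compactly_supported_def)
qed

lemma pushforward_combine:
  assumes "finite {z. d z = y \<and> f z \<noteq> 0}" "finite {z. d z = y \<and> g z \<noteq> 0}"
  shows "pushforward d (\<lambda>z. f z + c * g z) y = pushforward d f y + c * pushforward d g y"
proof -
  let ?S = "{z. d z = y \<and> f z \<noteq> 0} \<union> {z. d z = y \<and> g z \<noteq> 0}"
  have fin: "finite ?S" using assms by simp
  have "pushforward d (\<lambda>z. f z + c * g z) y = (\<Sum>z\<in>?S. f z + c * g z)"
    unfolding pushforward_def by (rule sum.mono_neutral_left[OF fin]) auto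
  moreover have "pushforward d f y = (\<Sum>z\<in>?S. f z)"
    unfolding pushforward_def by (rule sum.mono_neutral_left[OF fin]) auto
  moreover have "pushforward d g y = (\<Sum>z\<in>?S. g z)"
    unfolding pushforward_def by (rule sum.mono_neutral_left[OF fin]) auto
  ultimately show ?thesis by (simp add: sum.distrib sum_distrib_left)
qed

lemma pushforward_reindex:
  assumes "finite J" "inj_on e J" "\<And>j. j \<in> J \<Longrightarrow> d (e j) = y"
    "\<And>z. d z = y \<Longrightarrow> f z \<noteq> 0 \<Longrightarrow> z \<in> e ` J"
  shows "finite {z. d z = y \<and> f z \<noteq> 0}" "pushforward d f y = (\<Sum>j\<in>J. f (e j))"
proof -
  have sub: "{z. d z = y \<and> f z \<noteq> 0} \<subseteq> e ` J" using assms(4) by auto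
  then show "finite {z. d z = y \<and> f z \<noteq> 0}" using assms(1) finite_subset by blast
  have "pushforward d f y = (\<Sum>z\<in>e ` J. f z)"
    unfolding pushforward_def by (rule sum.mono_neutral_left) (use assms sub in auto)
  then show "pushforward d f y = (\<Sum>j\<in>J. f (e j))" by (simp add: sum.reindex[OF assms(2)])
qed

text \<open>The index sets are windows around the support of \<open>u\<close> and around its shift,
  so a change of variable can be combined with a change of the summation window.\<close>

lemma sum_int_shift:
  fixes u :: "int \<Rightarrow> 'b::comm_monoid_add"
  assumes "\<And>i. u i \<noteq> 0 \<Longrightarrow> i \<in> A \<and> i + n \<in> B" "finite A" "finite B"
  shows "(\<Sum>i\<in>A. u i) = (\<Sum>j\<in>B. u (j - n))"
proof -
  have "(\<Sum>i\<in>A. u i) = (\<Sum>i\<in>{i. u i \<noteq> 0}. u i)"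
    by (rule sum.mono_neutral_right) (use assms in auto)
  also have "\<dots> = (\<Sum>j\<in>{j. u (j - n) \<noteq> 0}. u (j - n))"
    by (rule sum.reindex_bij_witness[where i="\<lambda>j. j - n" and j="\<lambda>i. i + n"]) auto
  also have "\<dots> = (\<Sum>j\<in>B. u (j - n))"
    by (rule sum.mono_neutral_left) (use assms(1)[of "_ - n"] assms(3) in auto)
  finally show ?thesis .
qed

context cantor_system
begin

section \<open>Orbit permutations and elements of index zero\<close>

definition orb :: "('x \<Rightarrow> 'x) \<Rightarrow> 'x \<Rightarrow> int \<Rightarrow> int" where
  "orb \<alpha> y k = k + disp \<alpha> (P k y)"

lemma P_orb: "\<alpha> \<in> F \<Longrightarrow> P (orb \<alpha> y k) y = \<alpha> (P k y)"
  by (simp add: orb_def F_disp[of \<alpha> "P k y"] P_P add.commute)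

lemma orb_comp: "\<alpha> \<in> F \<Longrightarrow> \<beta> \<in> F \<Longrightarrow> orb (\<alpha> \<circ> \<beta>) y = orb \<alpha> y \<circ> orb \<beta> y"
  by (rule ext, rule P_eq_P_iff[THEN iffD1, of _ y]) (simp add: P_orb)

lemma orb_id [simp]: "orb id y = id" by (auto simp: orb_def)

lemma orb_shift: "orb \<alpha> (P m y) k = orb \<alpha> y (k + m) - m" by (simp add: orb_def P_P)

lemma orb_bij: assumes "\<alpha> \<in> F" shows "bij (orb \<alpha> y)"
  by (rule o_bij[of "orb (finv \<alpha>) y"]) (simp_all add: orb_comp[symmetric] assms finv_comp)

lemma orb_inj_iff: "\<alpha> \<in> F \<Longrightarrow> orb \<alpha> y j = orb \<alpha> y k \<longleftrightarrow> j = k"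
  by (meson orb_bij bij_def inj_eq)

lemma orb_bounded: assumes "\<alpha> \<in> F" shows "bounded_perm (orb \<alpha> y)"
  using disp_bounded[OF assms] orb_bij[OF assms] by (auto simp: bounded_perm_def orb_def)

text \<open>Vanishing of the index at every base point is the concrete form of a trivial class in
  \<open>H1\<close>; see \<open>indicator_boundary_iff\<close>.\<close>

definition F0 :: "('x \<Rightarrow> 'x) set" where
  "F0 = {\<alpha> \<in> F. \<forall>y. perm_index (orb \<alpha> y) = 0}"

lemma F0_subset_F: "F0 \<subseteq> F" by (auto simp: F0_def)

lemma index_comp: "\<alpha> \<in> F \<Longrightarrow> \<beta> \<in> F \<Longrightarrow>
    perm_index (orb (\<alpha> \<circ> \<beta>) y) = perm_index (orb \<alpha> y) + perm_index (orb \<beta> y)"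
  by (simp add: orb_comp perm_index_comp orb_bounded)

lemma index_finv: assumes "\<alpha> \<in> F" shows "perm_index (orb (finv \<alpha>) y) = - perm_index (orb \<alpha> y)"
  using index_comp[OF assms F_inv[OF assms], of y] by (simp add: finv_comp assms)

lemma F0_comp [intro]: "\<alpha> \<in> F0 \<Longrightarrow> \<beta> \<in> F0 \<Longrightarrow> \<alpha> \<circ> \<beta> \<in> F0"
  by (auto simp: F0_def index_comp)

lemma F0_finv [intro]: "\<alpha> \<in> F0 \<Longrightarrow> finv \<alpha> \<in> F0" by (auto simp: F0_def index_finv)

lemma F0_subgroup: "subgroup F0 (full_group \<phi>)"
  by (rule subgroup_full_groupI) (auto simp: F0_def index_comp index_finv)

lemma F0_commutator: "\<alpha> \<in> F \<Longrightarrow> \<beta> \<in> F \<Longrightarrow> \<alpha> \<circ> \<beta> \<circ> finv \<alpha> \<circ> finv \<beta> \<in> F0"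
  by (auto simp: F0_def index_comp index_finv)

lemma D_subset_F0: "D \<subseteq> F0" by (rule D_least[OF F0_subgroup F0_commutator])

text \<open>The index of an involution is a solution of \<open>2 * n = 0\<close> in the
  integers.\<close>

lemma involution_F0: assumes "\<alpha> \<in> F" "\<alpha> \<circ> \<alpha> = id" shows "\<alpha> \<in> F0"
proof -
  have "perm_index (orb \<alpha> y) = 0" for y using index_comp[OF assms(1,1), of y] assms(2) by simp
  then show ?thesis using assms by (auto simp: F0_def)
qed

lemma swap_F0: "\<alpha> \<in> F \<Longrightarrow> clopen A \<Longrightarrow> A \<inter> \<alpha> ` A = {} \<Longrightarrow> swap \<alpha> A \<in> F0"
  by (intro involution_F0 swap_in_F) (auto simp: fun_eq_iff swap_swap)

text \<open>The net flow of a chain across the cut of the orbit of \<open>y\<close> between the positions \<open>-1\<close> and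
  \<open>0\<close>; for large \<open>N\<close> it realizes the isomorphism of \<open>H1\<close> with the integers.\<close>

definition edge_weight :: "int \<Rightarrow> int \<Rightarrow> int" where
  "edge_weight j n = of_bool (0 \<le> j) - of_bool (0 \<le> j - n)"

definition crossing :: "int \<Rightarrow> ('x \<times> int \<Rightarrow> int) \<Rightarrow> 'x \<Rightarrow> int" where
  "crossing N f y = (\<Sum>n\<in>{-N..N}. \<Sum>j\<in>{-N..N}. edge_weight j n * f (P j y, n))"

lemma edge_weight_neq_0: "edge_weight j n \<noteq> 0 \<Longrightarrow> \<bar>j\<bar> \<le> \<bar>n\<bar>"
  by (auto simp: edge_weight_def of_bool_def split: if_splits)

text \<open>For each \<open>j\<close> exactly one degree \<open>n\<close> occurs, namely
  \<open>j\<close> minus the preimage of \<open>j\<close> under the orbit permutation. The double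
  sum thus collapses to a difference of two counts in a window that contains all crossings.\<close>

lemma crossing_indicator_bis:
  assumes "\<alpha> \<in> F" "\<And>x. \<bar>disp \<alpha> x\<bar> \<le> N"
  shows "crossing N (indicator (bis \<alpha>)) y = perm_index (orb \<alpha> y)"
proof -
  let ?a = "orb \<alpha> y" and ?W = "{-N..N}"
  have b: "\<bar>?a k - k\<bar> \<le> N" for k using assms(2) by (simp add: orb_def)
  have mem: "(P j y, n) \<in> bis \<alpha> \<longleftrightarrow> j = ?a (j - n)" for j n
  proof
    assume "(P j y, n) \<in> bis \<alpha>"
    then obtain z where z: "P j y = \<alpha> z" "n = disp \<alpha> z" by (auto simp: bis_def)
    then have "P j y = P n z" using F_disp[OF assms(1), of z] by simp
    then have zz: "z = P (j - n) y" by (metis P_P P_minus(1) add.commute uminus_add_conv_diff)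
    then have "P (?a (j - n)) y = P j y" using P_orb[OF assms(1), of y "j - n"] z by simp
    then show "j = ?a (j - n)" by simp
  next
    assume a: "j = ?a (j - n)"
    then have "P j y = \<alpha> (P (j - n) y)" using P_orb[OF assms(1), of y "j - n"] by simp
    moreover have "n = disp \<alpha> (P (j - n) y)" using a by (simp add: orb_def)
    ultimately show "(P j y, n) \<in> bis \<alpha>" unfolding bis_def by blast
  qed
  define b' where "b' = finv ?a"
  have b'1: "?a (b' j) = j" for j
    unfolding b'_def using orb_bij[OF assms(1)] by (simp add: bij_is_surj surj_f_inv_f)
  have b'2: "j = ?a k \<longleftrightarrow> k = b' j" for j k
    using b'1 orb_inj_iff[OF assms(1)] by metis
  have "crossing N (indicator (bis \<alpha>)) y
      = (\<Sum>j\<in>?W. \<Sum>n\<in>?W. edge_weight j n * of_bool (n = j - b' j))"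
    unfolding crossing_def
    by (subst sum.swap) (intro sum.cong refl, auto simp: indicator_def mem b'2)
  also have "\<dots> = (\<Sum>j\<in>?W. edge_weight j (j - b' j))"
  proof (rule sum.cong[OF refl])
    fix j
    have "\<bar>j - b' j\<bar> \<le> N" using b[of "b' j"] b'1 by simp
    then show "(\<Sum>n\<in>?W. edge_weight j n * of_bool (n = j - b' j)) = edge_weight j (j - b' j)"
      by (subst sum.remove[of _ "j - b' j"]) (auto intro!: sum.neutral)
  qed
  also have "\<dots> = (\<Sum>j\<in>?W. of_bool (j \<in> ?a ` {..<0}) - of_bool (j \<in> {..<0}))"
  proof (rule sum.cong[OF refl])
    fix j
    have "j \<in> ?a ` {..<0} \<longleftrightarrow> b' j < 0" using b'2 by (auto simp: image_iff)
    then show "edge_weight j (j - b' j) = of_bool (j \<in> ?a ` {..<0}) - of_bool (j \<in> {..<0})"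
      by (auto simp: edge_weight_def)
  qed
  also have "\<dots> = int (card (?a ` {..<0} \<inter> ?W)) - int (card ({..<0} \<inter> ?W))"
    by (simp add: sum_subtractf sum.If_cases of_bool_def Int_commute Int_def conj_commute)
  also have "\<dots> = perm_index ?a"
    unfolding perm_index_def
    by (rule rel_card_window[symmetric]) (use perm_window[OF b orb_bij[OF assms(1)]] in auto)
  finally show ?thesis .
qed

lemma composable_bounded:
  assumes "h \<in> compactly_supported (tg_composable \<phi>)"
  obtains N where "N \<ge> 0" "\<And>x n x' m. h ((x, n), (x', m)) \<noteq> 0 \<Longrightarrow> \<bar>n\<bar> \<le> N \<and> \<bar>m\<bar> \<le> N \<and> x' = P (- n) x"
proof -
  have K: "compact {z. h z \<noteq> 0}" using assms by (simp add: compactly_supported_def)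
  have "compact ((\<lambda>z. snd (fst z)) ` {z. h z \<noteq> 0})" "compact ((\<lambda>z. snd (snd z)) ` {z. h z \<noteq> 0})"
    by (intro compact_continuous_image K continuous_intros)+
  from this[THEN compact_int_bounded] obtain N1 N2 where
    N: "N1 \<ge> 0" "N2 \<ge> 0" "\<forall>k\<in>(\<lambda>z. snd (fst z)) ` {z. h z \<noteq> 0}. \<bar>k\<bar> \<le> N1"
      "\<forall>k\<in>(\<lambda>z. snd (snd z)) ` {z. h z \<noteq> 0}. \<bar>k\<bar> \<le> N2" by blast
  show ?thesis
  proof (rule that[of "max N1 N2"])
    fix x n x' m assume nz: "h ((x, n), (x', m)) \<noteq> 0"
    then have "((x, n), (x', m)) \<in> tg_composable \<phi>" using assms by (auto simp: compactly_supported_def)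
    then have "x' = P (- n) x" by (simp add: tg_composable_def tg_source_def tg_range_def)
    moreover have "\<bar>n\<bar> \<le> N1" "\<bar>m\<bar> \<le> N2" using N(3,4) nz by force+
    ultimately show "\<bar>n\<bar> \<le> max N1 N2 \<and> \<bar>m\<bar> \<le> max N1 N2 \<and> x' = P (- n) x" by auto
  qed (use N in auto)
qed

lemma pushforward_composable:
  assumes "N \<ge> 0" and h: "\<And>x n x' m. h ((x, n), (x', m)) \<noteq> 0 \<Longrightarrow> \<bar>n\<bar> \<le> N \<and> \<bar>m\<bar> \<le> N \<and> x' = P (- n) x"
  shows "pushforward snd h (x, k) = (\<Sum>n\<in>{-N..N}. h ((P n x, n), (x, k)))"
    "pushforward (\<lambda>(g, h). tg_mult g h) h (x, k) = (\<Sum>n\<in>{-N..N}. h ((x, n), (P (- n) x, k - n)))"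
    "pushforward fst h (x, k) = (\<Sum>m\<in>{-N..N}. h ((x, k), (P (- k) x, m)))"
    "finite {z. snd z = (x, k) \<and> h z \<noteq> 0}"
    "finite {z. (\<lambda>(g, h). tg_mult g h) z = (x, k) \<and> h z \<noteq> 0}"
    "finite {z. fst z = (x, k) \<and> h z \<noteq> 0}"
proof -
  have 1: "z \<in> (\<lambda>n. ((P n x, n), (x, k))) ` {-N..N}" if "snd z = (x, k)" "h z \<noteq> 0" for z
  proof -
    obtain x1 n x2 m where z: "z = ((x1, n), (x2, m))" by (metis surj_pair)
    then have "\<bar>n\<bar> \<le> N" "x = P (- n) x1" "x2 = x" "m = k" using h[of x1 n x2 m] that by auto
    then show ?thesis using z by (intro image_eqI[of _ _ n]) auto
  qed
  have 2: "z \<in> (\<lambda>n. ((x, n), (P (- n) x, k - n))) ` {-N..N}"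
    if "(\<lambda>(g, h). tg_mult g h) z = (x, k)" "h z \<noteq> 0" for z
  proof -
    obtain x1 n x2 m where z: "z = ((x1, n), (x2, m))" by (metis surj_pair)
    then have "\<bar>n\<bar> \<le> N" "x2 = P (- n) x" "x1 = x" "m = k - n"
      using h[of x1 n x2 m] that by (auto simp: tg_mult_def)
    then show ?thesis using z by (intro image_eqI[of _ _ n]) auto
  qed
  have 3: "z \<in> (\<lambda>m. ((x, k), (P (- k) x, m))) ` {-N..N}" if "fst z = (x, k)" "h z \<noteq> 0" for z
  proof -
    obtain x1 n x2 m where z: "z = ((x1, n), (x2, m))" by (metis surj_pair)
    then have "\<bar>m\<bar> \<le> N" "x2 = P (- k) x" "x1 = x" "n = k" using h[of x1 n x2 m] that by auto
    then show ?thesis using z by (intro image_eqI[of _ _ m]) auto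
  qed
  show "pushforward snd h (x, k) = (\<Sum>n\<in>{-N..N}. h ((P n x, n), (x, k)))" "finite {z. snd z = (x, k) \<and> h z \<noteq> 0}"
    using pushforward_reindex[of "{-N..N}" "\<lambda>n. ((P n x, n), (x, k))" snd "(x, k)" h] 1
    by (auto simp: inj_on_def)
  show "pushforward (\<lambda>(g, h). tg_mult g h) h (x, k) = (\<Sum>n\<in>{-N..N}. h ((x, n), (P (- n) x, k - n)))"
    "finite {z. (\<lambda>(g, h). tg_mult g h) z = (x, k) \<and> h z \<noteq> 0}"
    using pushforward_reindex[of "{-N..N}" "\<lambda>n. ((x, n), (P (- n) x, k - n))" "\<lambda>(g, h). tg_mult g h" "(x, k)" h] 2
    by (auto simp: inj_on_def tg_mult_def)
  show "pushforward fst h (x, k) = (\<Sum>m\<in>{-N..N}. h ((x, k), (P (- k) x, m)))" "finite {z. fst z = (x, k) \<and> h z \<noteq> 0}"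
    using pushforward_reindex[of "{-N..N}" "\<lambda>m. ((x, k), (P (- k) x, m))" fst "(x, k)" h] 3
    by (auto simp: inj_on_def)
qed

text \<open>\<open>edge_weight\<close> is additive under composition of arrows: the weight of a
  product is the sum of the weights of its factors, so every composable pair contributes zero.
  Degrees of products reach \<open>2 * N\<close>, hence the bound on \<open>M\<close>.\<close>

lemma crossing_boundary2:
  assumes "N \<ge> 0" and h: "\<And>x n x' m. h ((x, n), (x', m)) \<noteq> 0 \<Longrightarrow> \<bar>n\<bar> \<le> N \<and> \<bar>m\<bar> \<le> N \<and> x' = P (- n) x"
    and M: "M \<ge> 2 * N"
  shows "crossing M (boundary2 h) y = 0"
proof -
  let ?I = "{-N..N}" and ?R = "{-M..M}"
  define H where "H j n m = h ((P j y, n), (P (j - n) y, m))" for j n m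
  have H0: "\<bar>n\<bar> \<le> N" "\<bar>m\<bar> \<le> N" if "H j n m \<noteq> 0" for j n m
    using that h unfolding H_def by blast+
  have H1: "H j n m = 0" if "\<not> (m \<le> N \<and> - N \<le> m) \<or> \<not> (n \<le> N \<and> - N \<le> n)" for j n m
    using that H0[of j n m] by fastforce
  have sub: "?I \<subseteq> ?R" using assms by auto
  have b: "boundary2 h (P i y, k) = (\<Sum>n\<in>?I. H (i + n) n k) - (\<Sum>n\<in>?I. H i n (k - n)) + (\<Sum>m\<in>?I. H i k m)" for i k
  proof -
    have 1: "pushforward snd h (P i y, k) = (\<Sum>n\<in>?I. h ((P n (P i y), n), (P i y, k)))"
      by (rule pushforward_composable(1)[OF assms(1)]) (rule h)
    have 2: "pushforward (\<lambda>(g, h). tg_mult g h) h (P i y, k) = (\<Sum>n\<in>?I. h ((P i y, n), (P (- n) (P i y), k - n)))"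
      by (rule pushforward_composable(2)[OF assms(1)]) (rule h)
    have 3: "pushforward fst h (P i y, k) = (\<Sum>m\<in>?I. h ((P i y, k), (P (- k) (P i y), m)))"
      by (rule pushforward_composable(3)[OF assms(1)]) (rule h)
    show ?thesis unfolding boundary2_def 1 2 3 H_def by (simp add: P_P add.commute)
  qed
  have 1: "(\<Sum>k\<in>?R. \<Sum>i\<in>?R. edge_weight i k * (\<Sum>n\<in>?I. H (i + n) n k))
    = (\<Sum>n\<in>?I. \<Sum>m\<in>?I. \<Sum>j\<in>?R. edge_weight (j - n) m * H j n m)"
  proof -
    have "(\<Sum>k\<in>?R. \<Sum>i\<in>?R. edge_weight i k * (\<Sum>n\<in>?I. H (i + n) n k))
       = (\<Sum>k\<in>?I. \<Sum>i\<in>?R. edge_weight i k * (\<Sum>n\<in>?I. H (i + n) n k))"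
      by (rule sum.mono_neutral_right) (use sub H1 in \<open>auto intro!: sum.neutral\<close>)
    also have "\<dots> = (\<Sum>k\<in>?I. \<Sum>i\<in>?R. \<Sum>n\<in>?I. edge_weight i k * H (i + n) n k)"
      by (simp add: sum_distrib_left)
    also have "\<dots> = (\<Sum>m\<in>?I. \<Sum>n\<in>?I. \<Sum>i\<in>?R. edge_weight i m * H (i + n) n m)"
      by (intro sum.cong refl sum.swap)
    also have "\<dots> = (\<Sum>n\<in>?I. \<Sum>m\<in>?I. \<Sum>i\<in>?R. edge_weight i m * H (i + n) n m)"
      by (rule sum.swap)
    also have "\<dots> = (\<Sum>n\<in>?I. \<Sum>m\<in>?I. \<Sum>j\<in>?R. edge_weight (j - n) m * H j n m)"
    proof (rule sum.cong[OF refl], rule sum.cong[OF refl])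
      fix n m assume nm: "n \<in> ?I" "m \<in> ?I"
      show "(\<Sum>i\<in>?R. edge_weight i m * H (i + n) n m) = (\<Sum>j\<in>?R. edge_weight (j - n) m * H j n m)"
        using sum_int_shift[of "\<lambda>i. edge_weight i m * H (i + n) n m" ?R n ?R] nm assms(1) M
          edge_weight_neq_0[of _ m] by force
    qed
    finally show ?thesis .
  qed
  have 2: "(\<Sum>k\<in>?R. \<Sum>i\<in>?R. edge_weight i k * (\<Sum>n\<in>?I. H i n (k - n)))
    = (\<Sum>n\<in>?I. \<Sum>m\<in>?I. \<Sum>j\<in>?R. edge_weight j (n + m) * H j n m)"
  proof -
    have "(\<Sum>k\<in>?R. \<Sum>i\<in>?R. edge_weight i k * (\<Sum>n\<in>?I. H i n (k - n)))
      = (\<Sum>i\<in>?R. \<Sum>k\<in>?R. \<Sum>n\<in>?I. edge_weight i k * H i n (k - n))"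
      by (subst sum.swap) (simp add: sum_distrib_left)
    also have "\<dots> = (\<Sum>i\<in>?R. \<Sum>n\<in>?I. \<Sum>k\<in>?R. edge_weight i k * H i n (k - n))"
      by (intro sum.cong refl sum.swap)
    also have "\<dots> = (\<Sum>i\<in>?R. \<Sum>n\<in>?I. \<Sum>m\<in>?I. edge_weight i (n + m) * H i n m)"
    proof (rule sum.cong[OF refl], rule sum.cong[OF refl])
      fix i n assume n: "n \<in> ?I"
      have "(\<Sum>m\<in>?I. edge_weight i (n + m) * H i n m) = (\<Sum>k\<in>?R. edge_weight i (n + (k - n)) * H i n (k - n))"
        by (rule sum_int_shift) (use n assms(1) M H0[of i n] in force)+
      then show "(\<Sum>k\<in>?R. edge_weight i k * H i n (k - n)) = (\<Sum>m\<in>?I. edge_weight i (n + m) * H i n m)"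
        by simp
    qed
    also have "\<dots> = (\<Sum>n\<in>?I. \<Sum>m\<in>?I. \<Sum>i\<in>?R. edge_weight i (n + m) * H i n m)"
      by (subst sum.swap) (intro sum.cong refl sum.swap)
    finally show ?thesis .
  qed
  have 3: "(\<Sum>k\<in>?R. \<Sum>i\<in>?R. edge_weight i k * (\<Sum>m\<in>?I. H i k m))
    = (\<Sum>n\<in>?I. \<Sum>m\<in>?I. \<Sum>j\<in>?R. edge_weight j n * H j n m)"
  proof -
    have "(\<Sum>k\<in>?R. \<Sum>i\<in>?R. edge_weight i k * (\<Sum>m\<in>?I. H i k m))
       = (\<Sum>k\<in>?I. \<Sum>i\<in>?R. edge_weight i k * (\<Sum>m\<in>?I. H i k m))"
      by (rule sum.mono_neutral_right) (use sub H1 in \<open>auto intro!: sum.neutral\<close>)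
    also have "\<dots> = (\<Sum>n\<in>?I. \<Sum>i\<in>?R. \<Sum>m\<in>?I. edge_weight i n * H i n m)"
      by (simp add: sum_distrib_left)
    also have "\<dots> = (\<Sum>n\<in>?I. \<Sum>m\<in>?I. \<Sum>j\<in>?R. edge_weight j n * H j n m)"
      by (intro sum.cong refl sum.swap)
    finally show ?thesis .
  qed
  have "crossing M (boundary2 h) y =
      (\<Sum>k\<in>?R. \<Sum>i\<in>?R. edge_weight i k * (\<Sum>n\<in>?I. H (i + n) n k))
    - (\<Sum>k\<in>?R. \<Sum>i\<in>?R. edge_weight i k * (\<Sum>n\<in>?I. H i n (k - n)))
    + (\<Sum>k\<in>?R. \<Sum>i\<in>?R. edge_weight i k * (\<Sum>m\<in>?I. H i k m))"
    unfolding crossing_def b by (simp only: ring_distribs sum.distrib sum_subtractf)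
  also have "\<dots> = (\<Sum>n\<in>?I. \<Sum>m\<in>?I. \<Sum>j\<in>?R. (edge_weight (j - n) m - edge_weight j (n + m) + edge_weight j n) * H j n m)"
    unfolding 1 2 3 by (simp only: ring_distribs sum.distrib sum_subtractf)
  also have "\<dots> = 0"
    by (intro sum.neutral ballI) (simp add: edge_weight_def)
  finally show ?thesis .
qed

end

section \<open>The kernel of the index map\<close>

lemma loc_const_snd_int: "loc_const (snd :: 'a::topological_space \<times> int \<Rightarrow> int)"
proof (rule loc_constI)
  fix x :: "'a \<times> int"
  have "open (UNIV \<times> {snd x} :: ('a \<times> int) set)" by (intro open_Times) (auto simp: open_discrete)
  then show "\<exists>V. open V \<and> x \<in> V \<and> (\<forall>z\<in>V. snd z = snd x)"
    by (intro exI[of _ "UNIV \<times> {snd x}"]) (auto simp: mem_Times_iff)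
qed

context cantor_system
begin

lemma P_phi: "P m (\<phi> x) = P (m + 1) x" by (simp add: P_add)

lemma boundaries1_combine:
  assumes "f \<in> boundaries1 \<phi>" "g \<in> boundaries1 \<phi>"
  shows "(\<lambda>z. f z + c * g z) \<in> boundaries1 \<phi>"
proof -
  obtain a b where ab: "a \<in> compactly_supported (tg_composable \<phi>)" "b \<in> compactly_supported (tg_composable \<phi>)"
    and fg: "f = boundary2 a" "g = boundary2 b" using assms by (auto simp: boundaries1_def)
  obtain N1 where N1: "N1 \<ge> 0" "\<And>x n x' m. a ((x, n), (x', m)) \<noteq> 0 \<Longrightarrow> \<bar>n\<bar> \<le> N1 \<and> \<bar>m\<bar> \<le> N1 \<and> x' = P (- n) x"
    using composable_bounded[OF ab(1)] by metis
  obtain N2 where N2: "N2 \<ge> 0" "\<And>x n x' m. b ((x, n), (x', m)) \<noteq> 0 \<Longrightarrow> \<bar>n\<bar> \<le> N2 \<and> \<bar>m\<bar> \<le> N2 \<and> x' = P (- n) x"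
    using composable_bounded[OF ab(2)] by metis
  have fin1: "finite {z. snd z = g \<and> a z \<noteq> 0}" "finite {z. (\<lambda>(g, h). tg_mult g h) z = g \<and> a z \<noteq> 0}"
    "finite {z. fst z = g \<and> a z \<noteq> 0}" for g
    using pushforward_composable(4-6)[OF N1(1), of a "fst g" "snd g"] N1(2) by auto
  have fin2: "finite {z. snd z = g \<and> b z \<noteq> 0}" "finite {z. (\<lambda>(g, h). tg_mult g h) z = g \<and> b z \<noteq> 0}"
    "finite {z. fst z = g \<and> b z \<noteq> 0}" for g
    using pushforward_composable(4-6)[OF N2(1), of b "fst g" "snd g"] N2(2) by auto
  have "(\<lambda>z. f z + c * g z) = boundary2 (\<lambda>z. a z + c * b z)"
  proof
    fix z
    have "pushforward snd (\<lambda>z. a z + c * b z) z = pushforward snd a z + c * pushforward snd b z"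
      "pushforward (\<lambda>(g, h). tg_mult g h) (\<lambda>z. a z + c * b z) z = pushforward (\<lambda>(g, h). tg_mult g h) a z + c * pushforward (\<lambda>(g, h). tg_mult g h) b z"
      "pushforward fst (\<lambda>z. a z + c * b z) z = pushforward fst a z + c * pushforward fst b z"
      by (intro pushforward_combine fin1 fin2)+
    then show "f z + c * g z = boundary2 (\<lambda>z. a z + c * b z) z"
      by (simp add: fg boundary2_def algebra_simps)
  qed
  moreover have "(\<lambda>z. a z + c * b z) \<in> compactly_supported (tg_composable \<phi>)"
    using compactly_supported_combine[OF ab, of "\<lambda>x y. x + c * y"] by simp
  ultimately show ?thesis by (auto simp: boundaries1_def)
qed

section \<open>Primitives of chains without net crossing\<close>

context
  fixes f :: "'x \<times> int \<Rightarrow> int" and N :: int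
  assumes N: "N \<ge> 0" and f_loc: "loc_const f" and f_supp: "\<And>x n. f (x, n) \<noteq> 0 \<Longrightarrow> \<bar>n\<bar> \<le> N"
begin

text \<open>If all crossing numbers of \<open>f\<close> vanish, \<open>f\<close> is a boundary: write an arrow of degree \<open>n\<close> as the
  product of one of degree \<open>1\<close> and one of degree \<open>n - 1\<close>, and solve for the coefficients.\<close>

definition primitive_weight :: "int \<Rightarrow> int \<Rightarrow> int" where
  "primitive_weight j n = of_bool (j < 0) - of_bool (2 \<le> n)"

definition primitive :: "'x \<times> int \<Rightarrow> int" where
  "primitive g = (\<Sum>j\<in>{-(N+2)..N+2}. primitive_weight j (snd g) * f (P j (fst g), snd g + j))"

text \<open>The value is attached to the product of the two arrows: degrees 1 and \<open>m\<close>
  multiply to degree \<open>m + 1\<close>. The condition on \<open>fst (snd z)\<close> is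
  composability, so the function vanishes off the composable pairs.\<close>

definition primitive2 :: "('x \<times> int) \<times> ('x \<times> int) \<Rightarrow> int" where
  "primitive2 z = (if snd (fst z) = 1 \<and> fst (snd z) = P (- 1) (fst (fst z))
      then primitive (fst (fst z), snd (snd z) + 1) else 0)"

text \<open>The weight is nonzero only for \<open>j < 0\<close>, \<open>n \<le> 1\<close> or for
  \<open>j \<ge> 0\<close>, \<open>n \<ge> 2\<close>. In both cases a bound on \<open>n + j\<close>
  bounds \<open>n\<close> and \<open>j\<close> separately; the window \<open>N + 2\<close> then
  contains all nonzero terms, also after a shift by one.\<close>

lemma primitive_term_neq_0:
  "primitive_weight j n * f (x, n + j) \<noteq> 0 \<Longrightarrow> \<bar>n\<bar> \<le> N + 1 \<and> \<bar>j\<bar> \<le> N + 2 \<and> \<bar>j + 1\<bar> \<le> N + 2 \<and> \<bar>n + j\<bar> \<le> N"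
  using f_supp[of x "n + j"] N by (auto simp: primitive_weight_def of_bool_def split: if_splits)

lemma primitive_neq_0: assumes "primitive g \<noteq> 0" shows "\<bar>snd g\<bar> \<le> N + 1"
proof (rule ccontr)
  assume "\<not> \<bar>snd g\<bar> \<le> N + 1"
  then have "primitive g = 0" unfolding primitive_def
    using primitive_term_neq_0 by (intro sum.neutral ballI) blast
  then show False using assms by simp
qed

lemma loc_const_primitive: "loc_const primitive"
  unfolding primitive_def
proof (rule loc_const_sum)
  fix j
  have "continuous_on UNIV (\<lambda>g::'x \<times> int. (P j (fst g), snd g + j))"
    by (rule continuous_on_prod_int) (auto intro!: continuous_on_Pair continuous_P)
  then have "loc_const (\<lambda>g. f (P j (fst g), snd g + j))" by (rule loc_const_vimage_comp[OF f_loc])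
  then show "loc_const (\<lambda>g. primitive_weight j (snd g) * f (P j (fst g), snd g + j))"
    by (rule loc_const_comp2[OF loc_const_comp[OF loc_const_snd_int, where g="primitive_weight j"], where h="(*)"])
qed simp

lemma primitive2_compactly_supported: "primitive2 \<in> compactly_supported (tg_composable \<phi>)"
proof -
  let ?S = "tg_composable \<phi>"
  let ?h = "\<lambda>z :: ('x \<times> int) \<times> ('x \<times> int). if snd (fst z) = 1 then primitive (fst (fst z), snd (snd z) + 1) else 0"
  have c: "continuous_on UNIV (\<lambda>g::'x \<times> int. (fst g, snd g + 1))"
    by (rule continuous_on_prod_int) (auto intro!: continuous_on_Pair continuous_on_id)
  have "continuous_on UNIV (\<lambda>z :: ('x \<times> int) \<times> ('x \<times> int). (fst (fst z), snd (snd z)))"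
    by (intro continuous_intros)
  from loc_const_vimage_comp[OF loc_const_vimage_comp[OF loc_const_primitive c] this]
  have 1: "loc_const (\<lambda>z :: ('x \<times> int) \<times> ('x \<times> int). primitive (fst (fst z), snd (snd z) + 1))" by simp
  have 2: "loc_const (\<lambda>z :: ('x \<times> int) \<times> ('x \<times> int). snd (fst z))"
    by (rule loc_const_vimage_comp[OF loc_const_snd_int]) (intro continuous_intros)
  have "loc_const ?h" by (rule loc_const_comp2[OF 2 1, where h="\<lambda>k u. if k = 1 then u else 0"])
  then have "continuous_map euclidean (discrete_topology UNIV) ?h" by (simp add: loc_const_continuous_map)
  then have "continuous_map (top_of_set ?S) (discrete_topology UNIV) ?h" by (rule continuous_map_from_subtopology)
  then have a: "continuous_map (top_of_set ?S) (discrete_topology UNIV) primitive2"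
    by (rule continuous_map_eq) (auto simp: primitive2_def tg_composable_def tg_source_def tg_range_def)
  let ?e = "\<lambda>g::'x \<times> int. ((fst g, 1::int), (P (- 1) (fst g), snd g - 1))"
  have "{z. primitive2 z \<noteq> 0} = ?e ` {g. primitive g \<noteq> 0}"
  proof (intro equalityI subsetI)
    fix z assume "z \<in> {z. primitive2 z \<noteq> 0}"
    then show "z \<in> ?e ` {g. primitive g \<noteq> 0}"
      by (intro image_eqI[of _ _ "(fst (fst z), snd (snd z) + 1)"]) (auto simp: primitive2_def prod_eq_iff split: if_splits)
  qed (auto simp: primitive2_def)
  moreover have "compact {g. primitive g \<noteq> 0}"
  proof -
    have "compact ((UNIV :: 'x set) \<times> {-(N+1)..N+1})"
      by (intro compact_Times compact_space finite_imp_compact) simp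
    moreover have "closed {g. primitive g \<noteq> 0}"
      using loc_const_clopen[OF loc_const_primitive, of "\<lambda>k. k \<noteq> 0"] by simp
    ultimately have "compact (((UNIV :: 'x set) \<times> {-(N+1)..N+1}) \<inter> {g. primitive g \<noteq> 0})"
      by (rule compact_Int_closed)
    moreover have "((UNIV :: 'x set) \<times> {-(N+1)..N+1}) \<inter> {g. primitive g \<noteq> 0} = {g. primitive g \<noteq> 0}"
    proof -
      have "snd g \<in> {-(N+1)..N+1}" if "primitive g \<noteq> 0" for g
        using primitive_neq_0[OF that] by (simp add: abs_le_iff)
      then have "{g. primitive g \<noteq> 0} \<subseteq> UNIV \<times> {-(N+1)..N+1}"
        by (intro subsetI) (simp only: mem_Times_iff mem_Collect_eq UNIV_I simp_thms)
      then show ?thesis by blast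
    qed
    ultimately show ?thesis by simp
  qed
  moreover have "continuous_on UNIV ?e"
    by (rule continuous_on_prod_int) (auto intro!: continuous_on_Pair continuous_P continuous_on_id)
  ultimately have b: "compact {z. primitive2 z \<noteq> 0}"
    using compact_continuous_image[OF continuous_on_subset[OF _ subset_UNIV], of ?e "{g. primitive g \<noteq> 0}"]
    by (simp only: simp_thms)
  have "primitive2 z = 0" if "z \<notin> ?S" for z
    using that by (auto simp: primitive2_def tg_composable_def tg_source_def tg_range_def)
  then show ?thesis using a b by (auto simp: compactly_supported_def)
qed

text \<open>A telescoping argument: passing from \<open>(x, n)\<close> to
  \<open>(\<phi> x, n + 1)\<close> shifts the summation index by one, and the weights then differ by
  1 at \<open>j = 0\<close> and, if \<open>n = 1\<close>, by a further \<open>-1\<close> at every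
  \<open>j\<close>. The second difference is the correction term in degree 1.\<close>

lemma primitive_difference:
  "primitive (\<phi> x, n + 1) - primitive (x, n) = f (x, n) - (if n = 1 then \<Sum>j\<in>{-(N+2)..N+2}. f (P j x, 1 + j) else 0)"
proof -
  let ?R = "{-(N+2)..N+2}"
  have "primitive (\<phi> x, n + 1) = (\<Sum>j\<in>?R. primitive_weight j (n + 1) * f (P j (\<phi> x), n + 1 + j))"
    by (simp add: primitive_def)
  also have "\<dots> = (\<Sum>j\<in>?R. primitive_weight (j - 1) (n + 1) * f (P (j - 1) (\<phi> x), n + 1 + (j - 1)))"
  proof (rule sum_int_shift)
    fix i assume "primitive_weight i (n + 1) * f (P i (\<phi> x), n + 1 + i) \<noteq> 0"
    from primitive_term_neq_0[OF this] show "i \<in> ?R \<and> i + 1 \<in> ?R" by auto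
  qed auto
  also have "\<dots> = (\<Sum>j\<in>?R. primitive_weight (j - 1) (n + 1) * f (P j x, n + j))"
    by (intro sum.cong refl) (simp add: P_phi)
  finally have e: "primitive (\<phi> x, n + 1) = (\<Sum>j\<in>?R. primitive_weight (j - 1) (n + 1) * f (P j x, n + j))" .
  have w: "primitive_weight (j - 1) (n + 1) - primitive_weight j n = of_bool (j = 0) - of_bool (n = 1)" for j
    by (auto simp: primitive_weight_def)
  have "primitive (\<phi> x, n + 1) - primitive (x, n) =
     (\<Sum>j\<in>?R. (of_bool (j = 0) - of_bool (n = 1)) * f (P j x, n + j))"
    unfolding e primitive_def[of "(x, n)"] sum_subtractf[symmetric] w[symmetric] by (simp add: left_diff_distrib)
  also have "\<dots> = (\<Sum>j\<in>?R. if j = 0 then f (x, n) else 0) - (\<Sum>j\<in>?R. of_bool (n = 1) * f (P j x, n + j))"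
    unfolding sum_subtractf[symmetric] by (intro sum.cong refl) (auto simp: left_diff_distrib)
  also have "\<dots> = f (x, n) - (if n = 1 then \<Sum>j\<in>?R. f (P j x, 1 + j) else 0)"
    using N by simp
  finally show ?thesis .
qed

text \<open>Rests on the identity \<open>primitive_weight j (n - j) = of_bool (n = 1 + j) -
  edge_weight j n\<close>. The crossing number is the exact obstruction to cancelling the correction
  term of \<open>primitive_difference\<close> by the face \<open>fst\<close>.\<close>

lemma primitive_sum:
  "(\<Sum>m\<in>{-(N+2)..N+2}. primitive (x, m + 1)) = (\<Sum>j\<in>{-(N+2)..N+2}. f (P j x, 1 + j)) - crossing N f x"
proof -
  let ?R = "{-(N+2)..N+2}" and ?I = "{-N..N}"
  have "(\<Sum>m\<in>?R. primitive (x, m + 1)) = (\<Sum>j\<in>?R. \<Sum>m\<in>?R. primitive_weight j (m + 1) * f (P j x, m + 1 + j))"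
    unfolding primitive_def fst_conv snd_conv by (rule sum.swap)
  also have "\<dots> = (\<Sum>j\<in>?R. \<Sum>n\<in>?I. primitive_weight j (n - j) * f (P j x, n))"
  proof (rule sum.cong[OF refl])
    fix j
    have "(\<Sum>m\<in>?R. primitive_weight j (m + 1) * f (P j x, m + 1 + j))
      = (\<Sum>n\<in>?I. primitive_weight j ((n - (1 + j)) + 1) * f (P j x, (n - (1 + j)) + 1 + j))"
    proof (rule sum_int_shift)
      fix m assume "primitive_weight j (m + 1) * f (P j x, m + 1 + j) \<noteq> 0"
      from primitive_term_neq_0[OF this] show "m \<in> ?R \<and> m + (1 + j) \<in> ?I" by auto
    qed auto
    then show "(\<Sum>m\<in>?R. primitive_weight j (m + 1) * f (P j x, m + 1 + j)) = (\<Sum>n\<in>?I. primitive_weight j (n - j) * f (P j x, n))"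
      by simp
  qed
  finally have 1: "(\<Sum>m\<in>?R. primitive (x, m + 1)) = (\<Sum>j\<in>?R. \<Sum>n\<in>?I. primitive_weight j (n - j) * f (P j x, n))" .
  have "f (P j x, 1 + j) = (\<Sum>n\<in>?I. of_bool (n = 1 + j) * f (P j x, n))" for j
  proof -
    have "(\<Sum>n\<in>?I. of_bool (n = 1 + j) * f (P j x, n)) = (\<Sum>n\<in>?I. if n = 1 + j then f (P j x, 1 + j) else 0)"
      by (intro sum.cong) auto
    also have "\<dots> = f (P j x, 1 + j)" using f_supp[of "P j x" "1 + j"] by (cases "f (P j x, 1 + j) = 0") (auto simp: abs_le_iff)
    finally show ?thesis by simp
  qed
  then have 2: "(\<Sum>j\<in>?R. f (P j x, 1 + j)) = (\<Sum>j\<in>?R. \<Sum>n\<in>?I. of_bool (n = 1 + j) * f (P j x, n))"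
    by (intro sum.cong refl)
  have "crossing N f x = (\<Sum>n\<in>?I. \<Sum>j\<in>?R. edge_weight j n * f (P j x, n))"
    unfolding crossing_def
    by (intro sum.cong refl sum.mono_neutral_left) (auto, (use edge_weight_neq_0 in fastforce)+)
  also have "\<dots> = (\<Sum>j\<in>?R. \<Sum>n\<in>?I. edge_weight j n * f (P j x, n))" by (rule sum.swap)
  finally have 3: "crossing N f x = (\<Sum>j\<in>?R. \<Sum>n\<in>?I. edge_weight j n * f (P j x, n))" .
  show ?thesis
    unfolding 1 2 3 sum_subtractf[symmetric] left_diff_distrib[symmetric]
    by (intro sum.cong refl) (auto simp: primitive_weight_def edge_weight_def)
qed

lemma boundaries1_I:
  assumes "\<And>y. crossing N f y = 0" shows "f \<in> boundaries1 \<phi>"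
proof -
  let ?R = "{-(N+2)..N+2}"
  have N2: "N + 2 \<ge> 0" using N by simp
  have h: "primitive2 ((x, n), (x', m)) \<noteq> 0 \<Longrightarrow> \<bar>n\<bar> \<le> N + 2 \<and> \<bar>m\<bar> \<le> N + 2 \<and> x' = P (- n) x" for x n x' m
    using primitive_neq_0[of "(x, m + 1)"] N by (auto simp: primitive2_def split: if_splits)
  have "boundary2 primitive2 (x, n) = f (x, n)" for x n
  proof -
    have "pushforward snd primitive2 (x, n) = (\<Sum>k\<in>?R. primitive2 ((P k x, k), (x, n)))"
      by (rule pushforward_composable(1)[OF N2]) (rule h)
    also have "\<dots> = (\<Sum>k\<in>?R. if k = 1 then primitive (\<phi> x, n + 1) else 0)"
      by (intro sum.cong refl) (auto simp: primitive2_def P_phi)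
    also have "\<dots> = primitive (\<phi> x, n + 1)" using N by simp
    finally have 1: "pushforward snd primitive2 (x, n) = primitive (\<phi> x, n + 1)" .
    have "pushforward (\<lambda>(g, h). tg_mult g h) primitive2 (x, n) = (\<Sum>k\<in>?R. primitive2 ((x, k), (P (- k) x, n - k)))"
      by (rule pushforward_composable(2)[OF N2]) (rule h)
    also have "\<dots> = (\<Sum>k\<in>?R. if k = 1 then primitive (x, n) else 0)"
      by (intro sum.cong refl) (auto simp: primitive2_def)
    also have "\<dots> = primitive (x, n)" using N by simp
    finally have 2: "pushforward (\<lambda>(g, h). tg_mult g h) primitive2 (x, n) = primitive (x, n)" .
    have "pushforward fst primitive2 (x, n) = (\<Sum>m\<in>?R. primitive2 ((x, n), (P (- n) x, m)))"
      by (rule pushforward_composable(3)[OF N2]) (rule h)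
    also have "\<dots> = (if n = 1 then \<Sum>m\<in>?R. primitive (x, m + 1) else 0)"
      by (auto simp: primitive2_def intro!: sum.cong sum.neutral)
    finally have 3: "pushforward fst primitive2 (x, n) = (if n = 1 then \<Sum>m\<in>?R. primitive (x, m + 1) else 0)" .
    show ?thesis unfolding boundary2_def 1 2 3 using primitive_difference[of x n] primitive_sum[of x] assms by simp
  qed
  then have "f = boundary2 primitive2" by auto
  then show ?thesis using primitive2_compactly_supported by (auto simp: boundaries1_def)
qed

end

lemma indicator_boundary_iff:
  assumes "\<alpha> \<in> F"
  shows "indicator (bis \<alpha>) \<in> boundaries1 \<phi> \<longleftrightarrow> (\<forall>y. perm_index (orb \<alpha> y) = 0)"
proof
  obtain N where N: "N \<ge> 0" "\<And>x. \<bar>disp \<alpha> x\<bar> \<le> N" using disp_bounded[OF assms] by blast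
  {
    assume "indicator (bis \<alpha>) \<in> boundaries1 \<phi>"
    then obtain h where h: "h \<in> compactly_supported (tg_composable \<phi>)" "indicator (bis \<alpha>) = boundary2 h"
      by (auto simp: boundaries1_def)
    obtain N' where N': "N' \<ge> 0" "\<And>x n x' m. h ((x, n), (x', m)) \<noteq> 0 \<Longrightarrow> \<bar>n\<bar> \<le> N' \<and> \<bar>m\<bar> \<le> N' \<and> x' = P (- n) x"
      using composable_bounded[OF h(1)] by metis
    show "\<forall>y. perm_index (orb \<alpha> y) = 0"
    proof
      fix y
      \<comment> \<open>One window has to serve both lemmas: it dominates the displacement of
        \<alpha> and twice the degrees in \<open>h\<close>.\<close>
      have "crossing (max N (2 * N')) (boundary2 h) y = 0"
        by (rule crossing_boundary2[OF N'(1)]) (use N'(2) in auto)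
      moreover have "crossing (max N (2 * N')) (indicator (bis \<alpha>)) y = perm_index (orb \<alpha> y)"
        by (rule crossing_indicator_bis[OF assms]) (use N(2) in \<open>auto simp: le_max_iff_disj\<close>)
      ultimately show "perm_index (orb \<alpha> y) = 0" using h(2) by simp
    qed
  }
  assume 0: "\<forall>y. perm_index (orb \<alpha> y) = 0"
  have "clopen (bis \<alpha>)"
    using full_bisection_bis[OF assms] by (auto simp: full_bisection_def compact_open_bisection_def compact_imp_closed)
  then show "indicator (bis \<alpha>) \<in> boundaries1 \<phi>"
    using N crossing_indicator_bis[OF assms N(2)] 0
    by (intro boundaries1_I[OF N(1)] loc_const_of_clopen) (auto simp: bis_def indicator_def split: if_splits)
qed

lemma carrier_index_kernel_group [simp]: "carrier (index_kernel_group \<phi>) = F0"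
proof -
  have cos: "index_map \<phi> \<alpha> = {(\<lambda>z. b z + indicator (bis \<alpha>) z) | b. b \<in> boundaries1 \<phi>}" if "\<alpha> \<in> F" for \<alpha>
    using that by (auto simp: index_map_def r_coset_def cycle1_group_def fun_group_def bisection_of_eq)
  have zero: "(\<lambda>_. 0) \<in> boundaries1 \<phi>"
    by (rule boundaries1_I[of 0]) (auto simp: crossing_def)
  have "index_map \<phi> \<alpha> = boundaries1 \<phi> \<longleftrightarrow> indicator (bis \<alpha>) \<in> boundaries1 \<phi>" if \<alpha>: "\<alpha> \<in> F" for \<alpha>
  proof
    assume "index_map \<phi> \<alpha> = boundaries1 \<phi>"
    then have "indicator (bis \<alpha>) \<in> {(\<lambda>z. b z + indicator (bis \<alpha>) z) | b. b \<in> boundaries1 \<phi>} \<Longrightarrow> indicator (bis \<alpha>) \<in> boundaries1 \<phi>"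
      using cos[OF \<alpha>] by blast
    moreover have "\<exists>b. indicator (bis \<alpha>) = (\<lambda>z. b z + indicator (bis \<alpha>) z) \<and> b \<in> boundaries1 \<phi>"
      by (rule exI[of _ "\<lambda>_. 0"]) (use zero in simp)
    ultimately show "indicator (bis \<alpha>) \<in> boundaries1 \<phi>" by blast
  next
    assume i: "indicator (bis \<alpha>) \<in> boundaries1 \<phi>"
    show "index_map \<phi> \<alpha> = boundaries1 \<phi>"
    proof (intro equalityI subsetI)
      fix f assume "f \<in> index_map \<phi> \<alpha>"
      then obtain b where "b \<in> boundaries1 \<phi>" "f = (\<lambda>z. b z + indicator (bis \<alpha>) z)" using cos[OF \<alpha>] by auto
      then show "f \<in> boundaries1 \<phi>" using boundaries1_combine[OF _ i, of b 1] by (simp only: mult_1)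
    next
      fix f assume "f \<in> boundaries1 \<phi>"
      then have "(\<lambda>z. f z + (-1) * indicator (bis \<alpha>) z) \<in> boundaries1 \<phi>" (is "?b \<in> _")
        by (rule boundaries1_combine[OF _ i])
      moreover have "f = (\<lambda>z. ?b z + indicator (bis \<alpha>) z)" by (rule ext) simp
      ultimately show "f \<in> index_map \<phi> \<alpha>" unfolding cos[OF \<alpha>] mem_Collect_eq by metis
    qed
  qed
  then show ?thesis
    by (auto simp: index_kernel_group_def kernel_def H1_def F0_def indicator_boundary_iff)
qed

lemma mult_index_kernel_group [simp]: "monoid.mult (index_kernel_group \<phi>) = (\<circ>)"
  and one_index_kernel_group [simp]: "one (index_kernel_group \<phi>) = id"
  by (simp_all add: index_kernel_group_def)

end

section \<open>The signature\<close>

declare add_bit_eq_xor [simp del] mult_bit_eq_and [simp del]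

lemma bit_add_self [simp]: "x + x = (0::bit)" by (simp flip: mult_2)

lemma bit_add_add_self [simp]: "x + (x + y) = (y::bit)" by (simp add: add.assoc[symmetric])

lemma bit_of_bool_neq: "(of_bool (p \<noteq> q) :: bit) = of_bool p + of_bool q"
  by (cases p; cases q) auto

context cantor_system
begin

section \<open>Coboundaries and homology classes modulo 2\<close>

abbreviation cob :: "('x \<Rightarrow> bit) set" where "cob \<equiv> coboundaries \<phi>"

lemma cob_def: "cob = {(\<lambda>x. f (\<phi> x) + f x) | f. loc_const f}"
  by (simp add: coboundaries_def loc_const_continuous_map)

lemma cob_I: "loc_const f \<Longrightarrow> (\<lambda>x. f (\<phi> x) + f x) \<in> cob" by (auto simp: cob_def)

lemma cob_0: "(\<lambda>_. 0) \<in> cob" using cob_I[of "\<lambda>_. 0"] by simp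

lemma cob_add: assumes "f \<in> cob" "g \<in> cob" shows "(\<lambda>x. f x + g x) \<in> cob"
proof -
  obtain f' g' where "loc_const f'" "f = (\<lambda>x. f' (\<phi> x) + f' x)" "loc_const g'" "g = (\<lambda>x. g' (\<phi> x) + g' x)"
    using assms by (auto simp: cob_def)
  then show ?thesis
    using cob_I[of "\<lambda>x. f' x + g' x"] loc_const_comp2[of f' g' "(+)"] by (simp add: ac_simps)
qed

lemma cob_sum: "finite I \<Longrightarrow> (\<And>i. i \<in> I \<Longrightarrow> f i \<in> cob) \<Longrightarrow> (\<lambda>x. \<Sum>i\<in>I. f i x) \<in> cob"
  by (induction I rule: finite_induct) (auto intro: cob_0 cob_add)

lemma cob_loc_const: assumes "f \<in> cob" shows "loc_const f"
proof -
  obtain f' where "loc_const f'" "f = (\<lambda>x. f' (\<phi> x) + f' x)" using assms by (auto simp: cob_def)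
  then show ?thesis
    using loc_const_comp2[OF loc_const_vimage_comp[OF _ continuous_phi], of f' f' "(+)"] by simp
qed

lemma cob_P: assumes "loc_const f" shows "(\<lambda>x. f (P n x) + f x) \<in> cob"
proof (induction n rule: int_induct[where k=0])
  case base then show ?case using cob_0 by simp
next
  case (step1 i)
  have "(\<lambda>x. f (P i (\<phi> x)) + f (P i x)) \<in> cob"
    by (rule cob_I[OF loc_const_vimage_comp[OF assms continuous_P]])
  from cob_add[OF this step1(2)] show ?case by (simp add: P_add add.assoc)
next
  case (step2 i)
  have "(\<lambda>x. f (P (i - 1) (\<phi> x)) + f (P (i - 1) x)) \<in> cob"
    by (rule cob_I[OF loc_const_vimage_comp[OF assms continuous_P]])
  moreover have "P (i - 1) (\<phi> x) = P i x" for x using P_add[of "i - 1" 1 x] by simp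
  ultimately have "(\<lambda>x. f (P i x) + f (P (i - 1) x)) \<in> cob" by simp
  from cob_add[OF this step2(2)] have "(\<lambda>x. f (P i x) + (f (P i x) + (f (P (i - 1) x) + f x))) \<in> cob"
    by (simp add: ac_simps)
  then show ?case by simp
qed

text \<open>The function is cut into pieces \<open>g j\<close>, each living on the image under
  \<beta> of the part where \<beta> acts as \<open>P j\<close>. Their sum is \<open>f\<close>, and
  the sum of the pieces composed with \<open>P j\<close> is \<open>f\<close> composed with \<beta>,
  so \<open>cob_P\<close> applies piece by piece.\<close>

lemma cob_F: assumes "loc_const f" "\<beta> \<in> F" shows "(\<lambda>x. f (\<beta> x) + f x) \<in> cob"
proof -
  obtain N where N: "N \<ge> 0" "\<And>x. \<bar>disp \<beta> x\<bar> \<le> N" using disp_bounded[OF assms(2)] by blast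
  define g where "g j y = of_bool (disp \<beta> (P (- j) y) = j) * f y" for j y
  have g: "loc_const (g j)" for j
    unfolding g_def
    by (rule loc_const_comp2[OF loc_const_vimage_comp[OF loc_const_disp[OF assms(2)] continuous_P] assms(1),
        of "\<lambda>k u. of_bool (k = j) * u"])
  have 1: "(\<Sum>j\<in>{-N..N}. g j (P j x)) = f (\<beta> x)" for x
  proof -
    have "(\<Sum>j\<in>{-N..N}. g j (P j x)) = (\<Sum>j\<in>{-N..N}. if j = disp \<beta> x then f (\<beta> x) else 0)"
      by (intro sum.cong refl) (auto simp: g_def F_disp[OF assms(2), of x])
    also have "\<dots> = f (\<beta> x)" using N(2)[of x] by (auto simp: abs_le_iff)
    finally show ?thesis .
  qed
  have 2: "(\<Sum>j\<in>{-N..N}. g j y) = f y" for y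
  proof -
    have "disp \<beta> (P (- j) y) = j \<longleftrightarrow> j = disp \<beta> (finv \<beta> y)" for j
    proof
      assume "disp \<beta> (P (- j) y) = j"
      then have "\<beta> (P (- j) y) = y" using F_disp[OF assms(2), of "P (- j) y"] by simp
      then have "finv \<beta> y = P (- j) y" using F_finv(2)[OF assms(2)] by metis
      then show "j = disp \<beta> (finv \<beta> y)" using \<open>disp \<beta> (P (- j) y) = j\<close> by simp
    next
      assume j: "j = disp \<beta> (finv \<beta> y)"
      have "y = P j (finv \<beta> y)" using F_disp[OF assms(2), of "finv \<beta> y"] assms(2) j by simp
      then have "P (- j) y = finv \<beta> y" by (metis P_minus(1))
      then show "disp \<beta> (P (- j) y) = j" using j by simp
    qed
    then have "(\<Sum>j\<in>{-N..N}. g j y) = (\<Sum>j\<in>{-N..N}. if j = disp \<beta> (finv \<beta> y) then f y else 0)"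
      by (intro sum.cong refl) (auto simp: g_def)
    also have "\<dots> = f y" using N(2)[of "finv \<beta> y"] by (auto simp: abs_le_iff)
    finally show ?thesis .
  qed
  have "(\<lambda>x. \<Sum>j\<in>{-N..N}. g j (P j x) + g j x) \<in> cob"
    by (intro cob_sum cob_P g) simp
  then show ?thesis by (simp add: sum.distrib 1 2)
qed

lemma carrier_cochain [simp]: "carrier (cochain_group :: ('x \<Rightarrow> bit) monoid) = {f. loc_const f}"
  and mult_cochain [simp]: "monoid.mult (cochain_group :: ('x \<Rightarrow> bit) monoid) = (\<lambda>f g z. f z + g z)"
  and one_cochain [simp]: "one (cochain_group :: ('x \<Rightarrow> bit) monoid) = (\<lambda>_. 0)"
  by (auto simp: cochain_group_def fun_group_def loc_const_continuous_map)

lemma comm_group_cochain: "comm_group (cochain_group :: ('x \<Rightarrow> bit) monoid)"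
  by (rule comm_groupI) (auto simp: ac_simps loc_const_comp2[where h="(+)"] intro!: exI[of "\<lambda>y. loc_const y \<and> _ y"])

lemma inv_cochain: "loc_const (f :: 'x \<Rightarrow> bit) \<Longrightarrow> m_inv cochain_group f = f"
  by (rule group.inv_equality[OF comm_group.axioms(2)[OF comm_group_cochain]]) auto

lemma cob_subgroup: "subgroup cob cochain_group"
  by (rule group.subgroupI[OF comm_group.axioms(2)[OF comm_group_cochain]])
     (auto simp: cob_add cob_loc_const inv_cochain intro: cob_0)

lemma cob_normal: "cob \<lhd> cochain_group"
  using comm_group.subgroup_imp_normal[OF comm_group_cochain cob_subgroup] .

lemma comm_group_H0: "comm_group (H0 \<phi>)"
  unfolding H0_def by (rule comm_group.abelian_FactGroup[OF comm_group_cochain cob_subgroup])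

lemma group_H0: "group (H0 \<phi>)" using comm_group_H0 by (rule comm_group.axioms(2))

abbreviation cls :: "('x \<Rightarrow> bit) \<Rightarrow> ('x \<Rightarrow> bit) set" where "cls \<equiv> H0_class \<phi>"

lemma carrier_H0: "carrier (H0 \<phi>) = cls ` {f. loc_const f}"
  by (simp add: H0_def carrier_FactGroup H0_class_def)

lemma cls_in_H0 [simp]: "loc_const f \<Longrightarrow> cls f \<in> carrier (H0 \<phi>)" by (simp add: carrier_H0)

lemma one_H0: "one (H0 \<phi>) = cls (\<lambda>_. 0)"
  by (auto simp: H0_def H0_class_def r_coset_def)

lemma mult_H0: "loc_const f \<Longrightarrow> loc_const g \<Longrightarrow> monoid.mult (H0 \<phi>) (cls f) (cls g) = cls (\<lambda>x. f x + g x)"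
  using normal.rcos_sum[OF cob_normal, of f g] by (simp add: H0_def H0_class_def)

lemma cls_set: "cls f = {(\<lambda>x. b x + f x) | b. b \<in> cob}"
  by (auto simp: H0_class_def r_coset_def)

lemma cls_self: "f \<in> cls f" unfolding cls_set mem_Collect_eq by (rule exI[of _ "\<lambda>_. 0"]) (simp add: cob_0)

lemma cls_eq_iff: "cls f = cls g \<longleftrightarrow> (\<lambda>x. f x + g x) \<in> cob"
proof
  assume "cls f = cls g"
  then have "f \<in> cls g" using cls_self by auto
  then obtain b where "b \<in> cob" "f = (\<lambda>x. b x + g x)" by (auto simp: cls_set)
  then show "(\<lambda>x. f x + g x) \<in> cob" by (simp add: add.assoc)
next
  have *: "cls f \<subseteq> cls g" if d: "(\<lambda>x. f x + g x) \<in> cob" for f g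
  proof
    fix h assume "h \<in> cls f"
    then obtain b where "b \<in> cob" "h = (\<lambda>x. b x + f x)" by (auto simp: cls_set)
    then have "(\<lambda>x. b x + (f x + g x)) \<in> cob" "h = (\<lambda>x. (b x + (f x + g x)) + g x)"
      using cob_add[OF _ d] by (auto simp: add.assoc)
    then show "h \<in> cls g" unfolding cls_set mem_Collect_eq by metis
  qed
  assume "(\<lambda>x. f x + g x) \<in> cob"
  then show "cls f = cls g" using *[of f g] *[of g f] by (simp add: add.commute)
qed

lemma cls_eq_one_iff: "cls f = one (H0 \<phi>) \<longleftrightarrow> f \<in> cob"
  by (simp add: one_H0 cls_eq_iff)

text \<open>The total number of inversions of the permutation of an orbit is infinite, but the inversions
  between the base point and later points are finitely many.  Their parity is a cochain, whose
  sum over the orbit is the formal parity of the permutation.\<close>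

definition inverted :: "('x \<Rightarrow> 'x) \<Rightarrow> 'x \<Rightarrow> int \<Rightarrow> bit" where
  "inverted \<alpha> x k = of_bool ((0 < k) \<noteq> (orb \<alpha> x 0 < orb \<alpha> x k))"

definition inversions :: "('x \<Rightarrow> 'x) \<Rightarrow> 'x \<Rightarrow> bit" where
  "inversions \<alpha> x = (\<Sum>k | 0 < k \<and> orb \<alpha> x k < orb \<alpha> x 0. 1)"

lemma inverted_bound:
  assumes "\<And>x. \<bar>disp \<alpha> x\<bar> \<le> N" "inverted \<alpha> x k \<noteq> 0" "\<alpha> \<in> F" shows "\<bar>k\<bar> \<le> 2 * N"
  using assms(1)[of x] assms(1)[of "P k x"] assms(2) orb_inj_iff[OF assms(3), of x k 0]
  by (auto simp: inverted_def orb_def split: if_splits)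

lemma inversions_eq_sum:
  assumes "\<alpha> \<in> F" "\<And>x. \<bar>disp \<alpha> x\<bar> \<le> N" "2 * N \<le> M"
  shows "inversions \<alpha> x = (\<Sum>k\<in>{1..M}. inverted \<alpha> x k)"
proof -
  have eq: "inverted \<alpha> x k = of_bool (orb \<alpha> x k < orb \<alpha> x 0)" if "k > 0" for k
    using that orb_inj_iff[OF assms(1), of x k 0] by (auto simp: inverted_def)
  have "inversions \<alpha> x = (\<Sum>k | 0 < k \<and> orb \<alpha> x k < orb \<alpha> x 0. inverted \<alpha> x k)"
    unfolding inversions_def by (rule sum.cong) (auto simp: eq)
  also have "\<dots> = (\<Sum>k\<in>{1..M}. inverted \<alpha> x k)"
  proof (rule sum.mono_neutral_left)
    show "{k. 0 < k \<and> orb \<alpha> x k < orb \<alpha> x 0} \<subseteq> {1..M}"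
    proof
      fix k assume "k \<in> {k. 0 < k \<and> orb \<alpha> x k < orb \<alpha> x 0}"
      then show "k \<in> {1..M}" using eq[of k] inverted_bound[OF assms(2), of x k] assms by auto
    qed
  qed (auto simp: eq)
  finally show ?thesis .
qed

lemma loc_const_orb: "\<alpha> \<in> F \<Longrightarrow> loc_const (\<lambda>x. orb \<alpha> x k)"
  unfolding orb_def
  by (rule loc_const_comp[OF loc_const_vimage_comp[OF loc_const_disp continuous_P]])

lemma loc_const_inverted: "\<alpha> \<in> F \<Longrightarrow> loc_const (\<lambda>x. inverted \<alpha> x k)"
  unfolding inverted_def
  by (rule loc_const_comp2[OF loc_const_orb loc_const_orb, of _ _ "\<lambda>a b. of_bool ((0 < k) \<noteq> (a < b))"])

lemma loc_const_inversions: assumes "\<alpha> \<in> F" shows "loc_const (inversions \<alpha>)"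
proof -
  obtain N where N: "N \<ge> 0" "\<And>x. \<bar>disp \<alpha> x\<bar> \<le> N" using disp_bounded[OF assms] by blast
  have "inversions \<alpha> = (\<lambda>x. \<Sum>k\<in>{1..2*N}. inverted \<alpha> x k)"
    using inversions_eq_sum[OF assms N(2)] by auto
  then show ?thesis using loc_const_sum[of "{1..2*N}" "\<lambda>k x. inverted \<alpha> x k"] loc_const_inverted[OF assms] by simp
qed

lemma inverted_comp:
  assumes "\<alpha> \<in> F" "\<beta> \<in> F"
  shows "inverted \<alpha> (\<beta> x) (orb \<beta> x k - orb \<beta> x 0) = inverted (\<alpha> \<circ> \<beta>) x k + inverted \<beta> x k"
proof -
  have b: "\<beta> x = P (orb \<beta> x 0) x" using P_orb[OF assms(2), of x 0] by simp
  have "inverted \<alpha> (\<beta> x) (orb \<beta> x k - orb \<beta> x 0)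
     = of_bool ((orb \<beta> x 0 < orb \<beta> x k) \<noteq> (orb (\<alpha> \<circ> \<beta>) x 0 < orb (\<alpha> \<circ> \<beta>) x k))"
    unfolding inverted_def b orb_shift orb_comp[OF assms] by simp
  then show ?thesis by (simp add: inverted_def bit_of_bool_neq ac_simps)
qed

text \<open>Being inverted belongs to the unordered pair, so it may be read off from either of the
  two points. This symmetry is what turns the error terms of \<open>inversions_comp\<close> into
  coboundaries.\<close>

lemma inverted_sym:
  assumes "\<alpha> \<in> F" shows "inverted \<alpha> (P k x) (- k) = inverted \<alpha> x k"
  using orb_inj_iff[OF assms, of x k 0] by (auto simp: inverted_def orb_shift)

text \<open>Inversions of the composite and of \<beta> at \<open>x\<close> are compared with those
  of \<alpha> at \<open>\<beta> x\<close>. The pairs involved are the same; the counts differ only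
  in which member of a pair is regarded as the earlier one, and this changes exactly for the pairs
  that \<beta> reverses. Those terms are symmetric in the pair and combine to sums of a function and
  its translate by \<open>P k\<close>, which are coboundaries. Passing from \<open>\<beta> x\<close>
  back to \<open>x\<close> costs one more, by \<open>cob_F\<close>.\<close>

lemma inversions_comp:
  assumes "\<alpha> \<in> F" "\<beta> \<in> F"
  shows "(\<lambda>x. inversions (\<alpha> \<circ> \<beta>) x + (inversions \<alpha> x + inversions \<beta> x)) \<in> cob"
proof -
  obtain A where A: "A \<ge> 0" "\<And>x. \<bar>disp \<alpha> x\<bar> \<le> A" using disp_bounded[OF assms(1)] by blast
  obtain B where B: "B \<ge> 0" "\<And>x. \<bar>disp \<beta> x\<bar> \<le> B" using disp_bounded[OF assms(2)] by blast
  \<comment> \<open>Inversions of \<alpha> occur at relative positions up to \<open>2 * A\<close>,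
    and \<beta> changes relative positions by at most \<open>2 * B\<close>; the same number bounds
    the inversions of the composite.\<close>
  define M where "M = 2 * A + 2 * B"
  define \<kappa> where "\<kappa> x k = orb \<beta> x k - orb \<beta> x 0" for x k
  define G where "G x k = inverted (\<alpha> \<circ> \<beta>) x k + inverted \<beta> x k" for x k
  \<comment> \<open>Supported on the pairs whose order \<beta> reverses: \<open>\<kappa> x k\<close>
    is the position of the image of \<open>P k x\<close> relative to
    \<open>\<beta> x\<close>.\<close>
  define g where "g k x = of_bool ((0 < k) \<noteq> (0 < \<kappa> x k)) * G x k" for k x
  have ab: "\<alpha> \<circ> \<beta> \<in> F" using assms by simp
  have G: "inverted \<alpha> (\<beta> x) (\<kappa> x k) = G x k" for x k
    unfolding G_def \<kappa>_def by (rule inverted_comp[OF assms])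
  have dab: "\<bar>disp (\<alpha> \<circ> \<beta>) x\<bar> \<le> A + B" for x
    using A(2)[of "\<beta> x"] B(2)[of x] by (simp add: disp_comp assms)
  have \<kappa>: "\<bar>\<kappa> x k - k\<bar> \<le> 2 * B" for x k
    using B(2)[of "P k x"] B(2)[of x] by (auto simp: \<kappa>_def orb_def)
  have \<kappa>inj: "\<kappa> x j = \<kappa> x k \<longleftrightarrow> j = k" for x j k by (simp add: \<kappa>_def orb_inj_iff[OF assms(2)])
  have \<kappa>surj: "\<exists>k. \<kappa> x k = m" for x m
  proof -
    obtain k where "orb \<beta> x k = m + orb \<beta> x 0" using orb_bij[OF assms(2)] by (metis bij_pointE)
    then show ?thesis by (intro exI[of _ k]) (simp add: \<kappa>_def)
  qed
  have \<kappa>0: "\<kappa> x 0 = 0" for x by (simp add: \<kappa>_def)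
  have 1: "inversions (\<alpha> \<circ> \<beta>) x + inversions \<beta> x = (\<Sum>k\<in>{-M..M}. of_bool (0 < k) * G x k)" for x
  proof -
    have "inversions (\<alpha> \<circ> \<beta>) x + inversions \<beta> x = (\<Sum>k\<in>{1..M}. G x k)"
      using inversions_eq_sum[OF ab dab, of M x] inversions_eq_sum[OF assms(2) B(2), of M x] A(1) B(1)
      by (simp add: M_def G_def sum.distrib)
    also have "\<dots> = (\<Sum>k\<in>{1..M}. of_bool (0 < k) * G x k)" by (rule sum.cong) auto
    also have "\<dots> = (\<Sum>k\<in>{-M..M}. of_bool (0 < k) * G x k)" by (rule sum.mono_neutral_left) auto
    finally show ?thesis .
  qed
  have 2: "inversions \<alpha> (\<beta> x) = (\<Sum>k\<in>{-M..M}. of_bool (0 < \<kappa> x k) * G x k)" for x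
  proof -
    let ?K = "{k\<in>{-M..M}. \<kappa> x k \<in> {1..2*A}}"
    have "\<kappa> x ` ?K = {1..2*A}"
    proof (intro equalityI subsetI)
      fix m assume m: "m \<in> {1..2*A}"
      obtain k where "\<kappa> x k = m" using \<kappa>surj by blast
      then show "m \<in> \<kappa> x ` ?K" using m \<kappa>[of x k] by (intro image_eqI[of _ _ k]) (auto simp: M_def)
    qed auto
    moreover have "inj_on (\<kappa> x) ?K" by (auto simp: inj_on_def \<kappa>inj)
    ultimately have "(\<Sum>m\<in>{1..2*A}. inverted \<alpha> (\<beta> x) m) = (\<Sum>k\<in>?K. inverted \<alpha> (\<beta> x) (\<kappa> x k))"
      by (metis (mono_tags, lifting) sum.reindex_cong)
    also have "\<dots> = (\<Sum>k\<in>?K. of_bool (0 < \<kappa> x k) * G x k)"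
      by (rule sum.cong) (auto simp: G)
    also have "\<dots> = (\<Sum>k\<in>{-M..M}. of_bool (0 < \<kappa> x k) * G x k)"
    proof (rule sum.mono_neutral_left)
      show "\<forall>k\<in>{-M..M} - ?K. of_bool (0 < \<kappa> x k) * G x k = 0"
      proof
        fix k assume k: "k \<in> {-M..M} - ?K"
        show "of_bool (0 < \<kappa> x k) * G x k = 0"
        proof (cases "0 < \<kappa> x k")
          case True
          then have "\<not> \<bar>\<kappa> x k\<bar> \<le> 2 * A" using k by auto
          then have "G x k = 0" using inverted_bound[OF A(2) _ assms(1), of "\<beta> x" "\<kappa> x k"] G by metis
          then show ?thesis by simp
        qed simp
      qed
    qed auto
    finally show ?thesis using inversions_eq_sum[OF assms(1) A(2), of "2*A" "\<beta> x"] by simp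
  qed
  have sym: "g (- k) (P k x) = g k x" for k x
  proof -
    have k: "\<kappa> (P k x) (- k) = - \<kappa> x k" by (simp add: \<kappa>_def orb_shift)
    have "\<beta> (P k x) = P (\<kappa> x k) (\<beta> x)"
      using P_orb[OF assms(2), of x k] P_orb[OF assms(2), of x 0] by (simp add: \<kappa>_def) (metis P_P diff_add_cancel)
    then have "inverted \<alpha> (\<beta> (P k x)) (\<kappa> (P k x) (- k)) = inverted \<alpha> (\<beta> x) (\<kappa> x k)"
      by (simp add: k inverted_sym[OF assms(1)])
    then have "G (P k x) (- k) = G x k" by (simp add: G)
    then show ?thesis using \<kappa>inj[of x k 0] \<kappa>0[of x] by (auto simp: g_def k)
  qed
  have gl: "loc_const (g k)" for k
  proof -
    have a: "loc_const (\<lambda>x. \<kappa> x k)" unfolding \<kappa>_def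
      by (intro loc_const_comp2[where h="(-)"] loc_const_orb assms)
    have b: "loc_const (\<lambda>x. G x k)" unfolding G_def
      by (intro loc_const_comp2[where h="(+)"] loc_const_inverted assms ab)
    show ?thesis unfolding g_def
      by (rule loc_const_comp2[OF a b, of "\<lambda>m u. of_bool ((0 < k) \<noteq> (0 < m)) * u"])
  qed
  have "inversions (\<alpha> \<circ> \<beta>) x + inversions \<beta> x + inversions \<alpha> (\<beta> x)
      = (\<Sum>k\<in>{1..M}. g (- k) (P k x) + g (- k) x)" for x
  proof -
    have "inversions (\<alpha> \<circ> \<beta>) x + inversions \<beta> x + inversions \<alpha> (\<beta> x) = (\<Sum>k\<in>{-M..M}. g k x)"
      unfolding 1 2 sum.distrib[symmetric] g_def
      by (intro sum.cong refl) (simp only: bit_of_bool_neq distrib_right)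
    also have "\<dots> = (\<Sum>k\<in>{-M..-1} \<union> {1..M}. g k x)"
    proof (rule sum.mono_neutral_right)
      show "\<forall>k\<in>{-M..M} - ({-M..-1} \<union> {1..M}). g k x = 0"
      proof
        fix k assume "k \<in> {-M..M} - ({-M..-1} \<union> {1..M})"
        then have "k = 0" by auto
        then show "g k x = 0" by (simp add: g_def \<kappa>0)
      qed
    qed auto
    also have "\<dots> = (\<Sum>k\<in>{-M..-1}. g k x) + (\<Sum>k\<in>{1..M}. g k x)"
      by (rule sum.union_disjoint) auto
    also have "(\<Sum>k\<in>{-M..-1}. g k x) = (\<Sum>k\<in>{1..M}. g (- k) x)"
      by (rule sum.reindex_bij_witness[where i=uminus and j=uminus]) auto
    finally show ?thesis by (simp add: sum.distrib sym add.commute o_def)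
  qed
  moreover have "(\<lambda>x. \<Sum>k\<in>{1..M}. g (- k) (P k x) + g (- k) x) \<in> cob"
    by (intro cob_sum cob_P gl) simp
  ultimately have "(\<lambda>x. inversions (\<alpha> \<circ> \<beta>) x + inversions \<beta> x + inversions \<alpha> (\<beta> x)) \<in> cob" by simp
  from cob_add[OF this cob_F[OF loc_const_inversions[OF assms(1)] assms(2)]]
  have "(\<lambda>x. inversions (\<alpha> \<circ> \<beta>) x + (inversions \<beta> x + (inversions \<alpha> (\<beta> x) + (inversions \<alpha> (\<beta> x) + inversions \<alpha> x)))) \<in> cob"
    by (simp only: add.assoc)
  then show ?thesis by (simp add: add.commute)
qed

section \<open>The signature homomorphism\<close>

definition sgn_full :: "('x \<Rightarrow> 'x) \<Rightarrow> ('x \<Rightarrow> bit) set" where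
  "sgn_full \<alpha> = cls (inversions \<alpha>)"

lemma sgn_full_in_H0 [simp]: "\<alpha> \<in> F \<Longrightarrow> sgn_full \<alpha> \<in> carrier (H0 \<phi>)"
  by (simp add: sgn_full_def loc_const_inversions)

lemma sgn_full_comp:
  assumes "\<alpha> \<in> F" "\<beta> \<in> F"
  shows "sgn_full (\<alpha> \<circ> \<beta>) = monoid.mult (H0 \<phi>) (sgn_full \<alpha>) (sgn_full \<beta>)"
  unfolding sgn_full_def
  by (simp add: mult_H0 loc_const_inversions assms cls_eq_iff inversions_comp)

lemma sgn_full_hom: "sgn_full \<in> hom (full_group \<phi>) (H0 \<phi>)"
  by (auto simp: hom_def sgn_full_comp)

lemma sgn_full_group_hom: "group_hom (full_group \<phi>) (H0 \<phi>) sgn_full"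
  by (simp add: group_hom_def group_hom_axioms_def group_full_group group_H0 sgn_full_hom)

lemma sgn_full_id: "sgn_full id = one (H0 \<phi>)"
  using group_hom.hom_one[OF sgn_full_group_hom] by simp

lemma sgn_full_finv: "\<alpha> \<in> F \<Longrightarrow> sgn_full (finv \<alpha>) = m_inv (H0 \<phi>) (sgn_full \<alpha>)"
  using group_hom.hom_inv[OF sgn_full_group_hom, of \<alpha>] by simp

lemma sgn_full_conj:
  assumes "\<alpha> \<in> F" "\<gamma> \<in> F" shows "sgn_full (\<gamma> \<circ> \<alpha> \<circ> finv \<gamma>) = sgn_full \<alpha>"
proof -
  interpret H: comm_group "H0 \<phi>" by (rule comm_group_H0)
  show ?thesis using assms
    by (simp add: sgn_full_comp sgn_full_finv H.m_comm[of "sgn_full \<gamma>"] H.m_assoc)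
qed

lemma sgn_full_commutator:
  assumes "\<alpha> \<in> F" "\<beta> \<in> F" shows "sgn_full (\<alpha> \<circ> \<beta> \<circ> finv \<alpha> \<circ> finv \<beta>) = one (H0 \<phi>)"
proof -
  interpret H: comm_group "H0 \<phi>" by (rule comm_group_H0)
  have "\<alpha> \<circ> \<beta> \<circ> finv \<alpha> \<in> F" using assms by (intro F_comp F_inv)
  then show ?thesis using assms
    by (simp only: sgn_full_comp[of "\<alpha> \<circ> \<beta> \<circ> finv \<alpha>" "finv \<beta>"] F_inv sgn_full_conj) (simp add: sgn_full_finv)
qed

lemma sgn_full_D: assumes "\<alpha> \<in> D" shows "sgn_full \<alpha> = one (H0 \<phi>)"
proof -
  have "subgroup (kernel (full_group \<phi>) (H0 \<phi>) sgn_full) (full_group \<phi>)"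
    by (rule group_hom.subgroup_kernel[OF sgn_full_group_hom])
  then have "D \<subseteq> kernel (full_group \<phi>) (H0 \<phi>) sgn_full"
    by (rule D_least) (auto simp: kernel_def sgn_full_commutator)
  then show ?thesis using assms by (auto simp: kernel_def)
qed

end

section \<open>Products of 3-cycles and of involutions\<close>

lemma separate_images:
  fixes f g :: "'a::topological_space \<Rightarrow> 'b::t2_space"
  assumes "continuous_on UNIV f" "continuous_on UNIV g" "f x \<noteq> g x"
  obtains N where "open N" "x \<in> N" "f ` N \<inter> g ` N = {}"
proof -
  obtain U V where UV: "open U" "open V" "f x \<in> U" "g x \<in> V" "U \<inter> V = {}"
    using hausdorff[OF assms(3)] by blast
  show ?thesis
    by (rule that[of "f -` U \<inter> g -` V"])
       (use UV open_vimage[OF UV(1) assms(1)] open_vimage[OF UV(2) assms(2)] in auto)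
qed

lemma disjoint_image_mono: "f ` N \<inter> g ` N = {} \<Longrightarrow> V \<subseteq> N \<Longrightarrow> f ` V \<inter> g ` V = {}"
  by blast

context cantor_system
begin

lemma clopen_Int: "clopen (V :: 'x set) \<Longrightarrow> clopen W \<Longrightarrow> clopen (V \<inter> W)"
  by auto

lemma swap_empty [simp]: "swap \<alpha> {} = id" by (auto simp: swap_def)

lemma swap_union:
  assumes "\<alpha> \<in> F" "(V \<union> W) \<inter> \<alpha> ` (V \<union> W) = {}" "V \<inter> W = {}"
  shows "swap \<alpha> (V \<union> W) = swap \<alpha> V \<circ> swap \<alpha> W"
proof
  fix x
  have im: "\<alpha> ` V \<inter> \<alpha> ` W = {}" using assms(1,3) by (auto simp: F_inj_iff)
  consider "x \<in> V" | "x \<in> W" | v where "v \<in> V" "x = \<alpha> v" | w where "w \<in> W" "x = \<alpha> w"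
    | "x \<notin> V" "x \<notin> W" "x \<notin> \<alpha> ` V" "x \<notin> \<alpha> ` W" by blast
  then show "swap \<alpha> (V \<union> W) x = (swap \<alpha> V \<circ> swap \<alpha> W) x"
  proof cases
    case 1
    moreover have "x \<notin> W" "x \<notin> \<alpha> ` W" using 1 assms by auto
    ultimately show ?thesis by (simp add: swap_in swap_out)
  next
    case 2
    moreover have "\<alpha> x \<notin> V" "\<alpha> x \<notin> \<alpha> ` V" using 2 assms im by auto
    ultimately show ?thesis by (simp add: swap_in swap_out)
  next
    case 3
    moreover have "x \<notin> W" "x \<notin> \<alpha> ` W" "V \<inter> \<alpha> ` V = {}" using 3 assms im by auto
    ultimately show ?thesis using swap_img[OF assms(1,2), of v] swap_img[OF assms(1), of V v]
      by (simp add: swap_out)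
  next
    case 4
    moreover have "w \<notin> V" "w \<notin> \<alpha> ` V" "W \<inter> \<alpha> ` W = {}" using 4 assms im by auto
    ultimately show ?thesis using swap_img[OF assms(1,2), of w] swap_img[OF assms(1), of W w]
      by (simp add: swap_out)
  next
    case 5 then show ?thesis by (simp add: swap_out image_Un)
  qed
qed

lemma swap_finv: assumes "\<alpha> \<in> F" "A \<inter> \<alpha> ` A = {}" shows "swap (finv \<alpha>) (\<alpha> ` A) = swap \<alpha> A"
proof -
  have "finv \<alpha> ` \<alpha> ` A = A" using assms(1) by (simp add: image_image)
  moreover have "finv (finv \<alpha>) x = \<alpha> x" for x
    using F_finv[OF assms(1)] F_finv(2)[OF F_inv[OF assms(1)], of "\<alpha> x"] by simp
  ultimately show ?thesis using assms by (auto simp: swap_def fun_eq_iff)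
qed

lemma swap_conj:
  assumes "\<alpha> \<in> F" "\<gamma> \<in> F"
  shows "\<gamma> \<circ> swap \<alpha> A \<circ> finv \<gamma> = swap (\<gamma> \<circ> \<alpha> \<circ> finv \<gamma>) (\<gamma> ` A)"
proof
  fix x
  have 1: "x \<in> \<gamma> ` B \<longleftrightarrow> finv \<gamma> x \<in> B" for B x using assms(2) by (simp add: image_F)
  have 2: "(\<gamma> \<circ> \<alpha> \<circ> finv \<gamma>) ` \<gamma> ` A = \<gamma> ` \<alpha> ` A" using assms(2) by (simp add: image_image)
  have 3: "finv (\<gamma> \<circ> \<alpha> \<circ> finv \<gamma>) = \<gamma> \<circ> finv \<alpha> \<circ> finv \<gamma>"
    by (rule finv_eqI) (use assms in \<open>auto simp: fun_eq_iff\<close>)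
  show "(\<gamma> \<circ> swap \<alpha> A \<circ> finv \<gamma>) x = swap (\<gamma> \<circ> \<alpha> \<circ> finv \<gamma>) (\<gamma> ` A) x"
    unfolding swap_def 2 3 using assms by (simp add: 1)
qed

lemma swap_cong: "(\<And>x. x \<in> A \<Longrightarrow> \<alpha> x = \<beta> x) \<Longrightarrow> \<alpha> \<in> F \<Longrightarrow> \<beta> \<in> F \<Longrightarrow> swap \<alpha> A = swap \<beta> A"
proof
  fix x assume e: "\<And>x. x \<in> A \<Longrightarrow> \<alpha> x = \<beta> x" and F: "\<alpha> \<in> F" "\<beta> \<in> F"
  have "\<alpha> ` A = \<beta> ` A" using e by auto
  moreover have "finv \<alpha> x = finv \<beta> x" if "x \<in> \<alpha> ` A"
  proof -
    obtain a where "a \<in> A" "x = \<alpha> a" using \<open>x \<in> \<alpha> ` A\<close> by blast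
    then show ?thesis using e[of a] F_finv(2)[OF F(1), of a] F_finv(2)[OF F(2), of a] by simp
  qed
  ultimately show "swap \<alpha> A x = swap \<beta> A x" using e by (simp add: swap_def)
qed

section \<open>3-cycles and their products\<close>

definition cyc_ok :: "('x \<Rightarrow> 'x) \<Rightarrow> ('x \<Rightarrow> 'x) \<Rightarrow> 'x set \<Rightarrow> bool" where
  "cyc_ok \<alpha> \<beta> A \<longleftrightarrow> \<alpha> \<in> F \<and> \<beta> \<in> F \<and> clopen A \<and> A \<inter> \<alpha> ` A = {} \<and> A \<inter> \<beta> ` A = {} \<and> \<alpha> ` A \<inter> \<beta> ` A = {}"

text \<open>The 3-cycle \<open>x \<mapsto> \<beta> x \<mapsto> \<alpha> x \<mapsto> x\<close> for \<open>x \<in> A\<close>.\<close>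

definition cyc :: "('x \<Rightarrow> 'x) \<Rightarrow> ('x \<Rightarrow> 'x) \<Rightarrow> 'x set \<Rightarrow> 'x \<Rightarrow> 'x" where
  "cyc \<alpha> \<beta> A = swap \<alpha> A \<circ> swap \<beta> A"

lemma cyc_okD:
  assumes "cyc_ok \<alpha> \<beta> A"
  shows "\<alpha> \<in> F" "\<beta> \<in> F" "clopen A" "A \<inter> \<alpha> ` A = {}" "A \<inter> \<beta> ` A = {}" "\<alpha> ` A \<inter> \<beta> ` A = {}"
  using assms by (auto simp: cyc_ok_def)

lemma cyc_ok_swap: "cyc_ok \<alpha> \<beta> A \<Longrightarrow> cyc_ok \<beta> \<alpha> A" by (auto simp: cyc_ok_def)

lemma swap_apply_cyc:
  assumes "cyc_ok \<alpha> \<beta> A" "x \<in> A"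
  shows "swap \<alpha> A x = \<alpha> x" "swap \<alpha> A (\<alpha> x) = x" "swap \<alpha> A (\<beta> x) = \<beta> x"
    "swap \<beta> A x = \<beta> x" "swap \<beta> A (\<beta> x) = x" "swap \<beta> A (\<alpha> x) = \<alpha> x"
proof -
  note d = cyc_okD[OF assms(1)]
  have "\<beta> x \<notin> A" "\<beta> x \<notin> \<alpha> ` A" "\<alpha> x \<notin> A" "\<alpha> x \<notin> \<beta> ` A" using d(4-6) assms(2) by blast+
  then show "swap \<alpha> A x = \<alpha> x" "swap \<alpha> A (\<alpha> x) = x" "swap \<alpha> A (\<beta> x) = \<beta> x"
    "swap \<beta> A x = \<beta> x" "swap \<beta> A (\<beta> x) = x" "swap \<beta> A (\<alpha> x) = \<alpha> x"
    using assms(2) d swap_img by (simp_all add: swap_in swap_out)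
qed

lemma cyc_cases:
  assumes "\<And>a. a \<in> A \<Longrightarrow> Q a" "\<And>a. a \<in> A \<Longrightarrow> Q (\<alpha> a)" "\<And>a. a \<in> A \<Longrightarrow> Q (\<beta> a)"
    "x \<notin> A \<Longrightarrow> x \<notin> \<alpha> ` A \<Longrightarrow> x \<notin> \<beta> ` A \<Longrightarrow> Q x"
  shows "Q x"
  using assms by blast

lemma cyc_apply:
  assumes "cyc_ok \<alpha> \<beta> A"
  shows "x \<in> A \<Longrightarrow> cyc \<alpha> \<beta> A x = \<beta> x" "x \<in> A \<Longrightarrow> cyc \<alpha> \<beta> A (\<beta> x) = \<alpha> x" "x \<in> A \<Longrightarrow> cyc \<alpha> \<beta> A (\<alpha> x) = x"
    "x \<notin> A \<Longrightarrow> x \<notin> \<alpha> ` A \<Longrightarrow> x \<notin> \<beta> ` A \<Longrightarrow> cyc \<alpha> \<beta> A x = x"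
  by (simp_all add: cyc_def swap_apply_cyc[OF assms] swap_out)

lemma swap_F_cyc: "cyc_ok \<alpha> \<beta> A \<Longrightarrow> swap \<alpha> A \<in> F" "cyc_ok \<alpha> \<beta> A \<Longrightarrow> swap \<beta> A \<in> F"
  by (auto simp: cyc_ok_def intro: swap_in_F)

lemma cyc_F: "cyc_ok \<alpha> \<beta> A \<Longrightarrow> cyc \<alpha> \<beta> A \<in> F"
  by (simp add: cyc_def swap_F_cyc)

lemma cyc_eqI:
  assumes "cyc_ok \<alpha> \<beta> A" "\<And>x. x \<in> A \<Longrightarrow> f x = \<beta> x" "\<And>x. x \<in> A \<Longrightarrow> f (\<beta> x) = \<alpha> x" "\<And>x. x \<in> A \<Longrightarrow> f (\<alpha> x) = x"
    "\<And>x. x \<notin> A \<Longrightarrow> x \<notin> \<alpha> ` A \<Longrightarrow> x \<notin> \<beta> ` A \<Longrightarrow> f x = x"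
  shows "f = cyc \<alpha> \<beta> A"
proof
  fix x show "f x = cyc \<alpha> \<beta> A x"
    by (rule cyc_cases[where A=A and \<alpha>=\<alpha> and \<beta>=\<beta>]) (simp_all add: assms cyc_apply[OF assms(1)])
qed

text \<open>With \<open>s\<close> and \<open>t\<close> the two involutions,
  \<open>t \<circ> s\<close> has order 3, so the commutator, its square, equals its inverse
  \<open>s \<circ> t\<close>.\<close>

lemma cyc_D: assumes "cyc_ok \<alpha> \<beta> A" shows "cyc \<alpha> \<beta> A \<in> D"
proof -
  let ?s = "swap \<alpha> A" and ?t = "swap \<beta> A"
  have inv: "finv ?s = ?s" "finv ?t = ?t" using assms by (auto simp: cyc_ok_def finv_swap)
  have "?t \<circ> ?s \<circ> finv ?t \<circ> finv ?s = cyc \<alpha> \<beta> A"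
    by (rule cyc_eqI[OF assms]) (simp_all add: inv swap_apply_cyc[OF assms] swap_out)
  then show ?thesis using D_commutator[OF swap_F_cyc(2,1)[OF assms]] by simp
qed

lemma finv_cyc: assumes "cyc_ok \<alpha> \<beta> A" shows "finv (cyc \<alpha> \<beta> A) = cyc \<beta> \<alpha> A"
proof (rule finv_eqI[OF _ cyc_F[OF assms]])
  show "cyc \<alpha> \<beta> A \<circ> cyc \<beta> \<alpha> A = id"
    using assms by (auto simp: cyc_def cyc_ok_def fun_eq_iff swap_swap)
qed

lemma cyc_conj:
  assumes "cyc_ok \<alpha> \<beta> A" "\<gamma> \<in> F"
  shows "\<gamma> \<circ> cyc \<alpha> \<beta> A \<circ> finv \<gamma> = cyc (\<gamma> \<circ> \<alpha> \<circ> finv \<gamma>) (\<gamma> \<circ> \<beta> \<circ> finv \<gamma>) (\<gamma> ` A)"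
    "cyc_ok (\<gamma> \<circ> \<alpha> \<circ> finv \<gamma>) (\<gamma> \<circ> \<beta> \<circ> finv \<gamma>) (\<gamma> ` A)"
proof -
  note d = cyc_okD[OF assms(1)]
  show "\<gamma> \<circ> cyc \<alpha> \<beta> A \<circ> finv \<gamma> = cyc (\<gamma> \<circ> \<alpha> \<circ> finv \<gamma>) (\<gamma> \<circ> \<beta> \<circ> finv \<gamma>) (\<gamma> ` A)"
    unfolding cyc_def swap_conj[OF d(1) assms(2), symmetric] swap_conj[OF d(2) assms(2), symmetric]
    using assms(2) by (auto simp: fun_eq_iff)
  have im: "(\<gamma> \<circ> \<delta> \<circ> finv \<gamma>) ` \<gamma> ` A = \<gamma> ` \<delta> ` A" for \<delta> using assms(2) by (simp add: image_image)
  have dis: "\<gamma> ` S \<inter> \<gamma> ` T = {}" if "S \<inter> T = {}" for S T using that assms(2) by (auto simp: F_inj_iff)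
  show "cyc_ok (\<gamma> \<circ> \<alpha> \<circ> finv \<gamma>) (\<gamma> \<circ> \<beta> \<circ> finv \<gamma>) (\<gamma> ` A)"
    unfolding cyc_ok_def im using d assms(2) clopen_image_F[OF assms(2) d(3)]
    by (intro conjI F_comp F_inv dis) simp_all
qed

text \<open>Closure under inverses is a consequence: \<open>finv_cyc\<close> shows that the inverse
  of a generator is again a generator.\<close>

inductive is_cyc_product :: "('x \<Rightarrow> 'x) \<Rightarrow> bool" where
  "is_cyc_product id"
| "cyc_ok \<alpha> \<beta> A \<Longrightarrow> is_cyc_product g \<Longrightarrow> is_cyc_product (cyc \<alpha> \<beta> A \<circ> g)"

definition cycle_products :: "('x \<Rightarrow> 'x) set" where "cycle_products = Collect is_cyc_product"

lemma cycle_products_id: "id \<in> cycle_products"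
  and cycle_products_step: "cyc_ok \<alpha> \<beta> A \<Longrightarrow> g \<in> cycle_products \<Longrightarrow> cyc \<alpha> \<beta> A \<circ> g \<in> cycle_products"
  unfolding cycle_products_def mem_Collect_eq by (rule is_cyc_product.intros; assumption)+

lemma cycle_products_induct [consumes 1, case_names id step, induct set: cycle_products]:
  assumes "f \<in> cycle_products" "Q id"
    "\<And>\<alpha> \<beta> A g. cyc_ok \<alpha> \<beta> A \<Longrightarrow> g \<in> cycle_products \<Longrightarrow> Q g \<Longrightarrow> Q (cyc \<alpha> \<beta> A \<circ> g)"
  shows "Q f"
  using assms(1) unfolding cycle_products_def mem_Collect_eq
proof (induction rule: is_cyc_product.induct)
  case 1 show ?case by (rule assms(2))
next
  case (2 \<alpha> \<beta> A g)
  then show ?case using assms(3) by (simp only: cycle_products_def mem_Collect_eq)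
qed

lemma cycle_products_cyc: "cyc_ok \<alpha> \<beta> A \<Longrightarrow> cyc \<alpha> \<beta> A \<in> cycle_products"
  using cycle_products_step[OF _ cycle_products_id] by simp

lemma cycle_products_comp: "f \<in> cycle_products \<Longrightarrow> g \<in> cycle_products \<Longrightarrow> f \<circ> g \<in> cycle_products"
  by (induction f rule: cycle_products_induct) (auto simp: o_assoc[symmetric] intro: cycle_products_step)

lemma cycle_products_subset_D: "cycle_products \<subseteq> D"
proof
  fix f assume "f \<in> cycle_products"
  then show "f \<in> D"
  proof induction
    case id show ?case using subgroup.one_closed[OF D_subgroup] unfolding one_full_group .
  next
    case (step \<alpha> \<beta> A g)
    show ?case using subgroup.m_closed[OF D_subgroup cyc_D[OF step(1)] step(3)] unfolding mult_full_group .
  qed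
qed

lemma cycle_products_F: "f \<in> cycle_products \<Longrightarrow> f \<in> F" using cycle_products_subset_D D_subset_F by blast

lemma finv_o: "\<alpha> \<in> F \<Longrightarrow> \<beta> \<in> F \<Longrightarrow> finv (\<alpha> \<circ> \<beta>) = finv \<beta> \<circ> finv \<alpha>"
  by (rule finv_eqI) (auto simp: fun_eq_iff)

lemma finv_finv [simp]: "\<alpha> \<in> F \<Longrightarrow> finv (finv \<alpha>) = \<alpha>"
  by (rule finv_eqI) (auto simp: fun_eq_iff)

lemma finv_id [simp]: "finv (id :: 'x \<Rightarrow> 'x) = id"
  by (rule finv_eqI) auto

lemma cycle_products_finv: "f \<in> cycle_products \<Longrightarrow> finv f \<in> cycle_products"
proof (induction rule: cycle_products_induct)
  case id show ?case unfolding finv_id by (rule cycle_products_id)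
next
  case (step \<alpha> \<beta> A g)
  have "finv (cyc \<alpha> \<beta> A \<circ> g) = finv g \<circ> cyc \<beta> \<alpha> A"
    using step by (simp add: finv_o cyc_F cycle_products_F finv_cyc)
  then show ?case using cycle_products_comp[OF step(3) cycle_products_cyc[OF cyc_ok_swap[OF step(1)]]] by (simp only:)
qed

lemma cycle_products_conj: assumes "f \<in> cycle_products" "\<gamma> \<in> F" shows "\<gamma> \<circ> f \<circ> finv \<gamma> \<in> cycle_products"
  using assms(1)
proof induction
  case id show ?case unfolding comp_id finv_comp(1)[OF assms(2)] by (rule cycle_products_id)
next
  case (step \<alpha> \<beta> A g)
  have "\<gamma> \<circ> (cyc \<alpha> \<beta> A \<circ> g) \<circ> finv \<gamma> = (\<gamma> \<circ> cyc \<alpha> \<beta> A \<circ> finv \<gamma>) \<circ> (\<gamma> \<circ> g \<circ> finv \<gamma>)"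
    using assms(2) by (auto simp: fun_eq_iff)
  moreover have "\<gamma> \<circ> cyc \<alpha> \<beta> A \<circ> finv \<gamma> \<in> cycle_products"
    using cyc_conj[OF step(1) assms(2)] by (simp only: cycle_products_cyc)
  ultimately show ?case using cycle_products_comp[OF _ step(3)] by (simp only:)
qed

section \<open>Congruence modulo 3-cycles\<close>

definition cycle_equiv :: "('x \<Rightarrow> 'x) \<Rightarrow> ('x \<Rightarrow> 'x) \<Rightarrow> bool" where
  "cycle_equiv f g \<longleftrightarrow> f \<in> F \<and> g \<in> F \<and> f \<circ> finv g \<in> cycle_products"

lemma cycle_equiv_refl: "f \<in> F \<Longrightarrow> cycle_equiv f f" by (simp add: cycle_equiv_def finv_comp cycle_products_id)

lemma cycle_equiv_sym: "cycle_equiv f g \<Longrightarrow> cycle_equiv g f"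
  unfolding cycle_equiv_def by (metis cycle_products_finv F_inv finv_finv finv_o)

lemma cycle_equiv_trans: assumes "cycle_equiv f g" "cycle_equiv g h" shows "cycle_equiv f h"
proof -
  have "(f \<circ> finv g) \<circ> (g \<circ> finv h) \<in> cycle_products" using assms by (intro cycle_products_comp[of "f \<circ> finv g"]) (auto simp: cycle_equiv_def)
  moreover have "(f \<circ> finv g) \<circ> (g \<circ> finv h) = f \<circ> finv h" using assms by (auto simp: cycle_equiv_def fun_eq_iff)
  ultimately show ?thesis using assms by (simp add: cycle_equiv_def)
qed

lemma cycle_equiv_comp: assumes "cycle_equiv f f'" "cycle_equiv g g'" shows "cycle_equiv (f \<circ> g) (f' \<circ> g')"
proof -
  have F: "f \<in> F" "f' \<in> F" "g \<in> F" "g' \<in> F" using assms by (auto simp: cycle_equiv_def)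
  have "(f \<circ> (g \<circ> finv g') \<circ> finv f) \<circ> (f \<circ> finv f') \<in> cycle_products"
    using assms F by (intro cycle_products_comp[of "f \<circ> (g \<circ> finv g') \<circ> finv f"] cycle_products_conj) (auto simp: cycle_equiv_def)
  moreover have "(f \<circ> (g \<circ> finv g') \<circ> finv f) \<circ> (f \<circ> finv f') = (f \<circ> g) \<circ> finv (f' \<circ> g')"
    using F by (simp add: finv_o) (auto simp: fun_eq_iff)
  ultimately show ?thesis using F by (simp add: cycle_equiv_def)
qed

lemma swap_disjoint_mono: "A \<inter> \<alpha> ` A = {} \<Longrightarrow> V \<subseteq> A \<Longrightarrow> V \<inter> \<alpha> ` V = {}" by blast

lemma cycle_equiv_cyc: assumes "cyc_ok \<alpha> \<beta> A" shows "cycle_equiv (swap \<alpha> A) (swap \<beta> A)"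
proof -
  have "finv (swap \<beta> A) = swap \<beta> A" using assms by (simp add: cyc_ok_def finv_swap)
  then show ?thesis using cycle_products_cyc[OF assms] swap_F_cyc[OF assms] by (simp add: cycle_equiv_def cyc_def)
qed

text \<open>The maps \<alpha> and \<beta> may agree somewhere on \<open>A\<close>, which rules out a
  direct comparison by one 3-cycle. Locally a third target \<open>P k x\<close> away from
  \<open>x\<close>, \<open>\<alpha> x\<close> and \<open>\<beta> x\<close> is available, as orbits
  are infinite, and each of the two swaps differs from the swap with this target by a
  3-cycle.\<close>

lemma swap_cycle_equiv_swap:
  assumes "\<alpha> \<in> F" "\<beta> \<in> F" "clopen A" "A \<inter> \<alpha> ` A = {}" "A \<inter> \<beta> ` A = {}"
  shows "cycle_equiv (swap \<alpha> A) (swap \<beta> A)"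
  using assms(3)
proof (induction A rule: clopen_induct)
  case empty show ?case unfolding swap_empty by (rule cycle_equiv_refl[OF F_id])
next
  case (local x)
  have "finite {x, \<alpha> x, \<beta> x}" by simp
  moreover have "infinite (range (\<lambda>k. P k x))"
    by (metis P_eq_P_iff finite_imageD infinite_UNIV_int injI)
  ultimately obtain k where k: "P k x \<notin> {x, \<alpha> x, \<beta> x}" by (metis finite_subset image_subsetI)
  obtain N1 where N1: "open N1" "x \<in> N1" "P k ` N1 \<inter> id ` N1 = {}"
    by (rule separate_images[OF continuous_P[of k] continuous_on_id', of x]) (use k in auto)
  obtain N2 where N2: "open N2" "x \<in> N2" "P k ` N2 \<inter> \<alpha> ` N2 = {}"
    by (rule separate_images[OF continuous_P[of k] F_continuous[OF assms(1)], of x]) (use k in auto)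
  obtain N3 where N3: "open N3" "x \<in> N3" "P k ` N3 \<inter> \<beta> ` N3 = {}"
    by (rule separate_images[OF continuous_P[of k] F_continuous[OF assms(2)], of x]) (use k in auto)
  show ?case
  proof (intro exI[of _ "N1 \<inter> N2 \<inter> N3"] conjI allI impI)
    show "open (N1 \<inter> N2 \<inter> N3)" "x \<in> N1 \<inter> N2 \<inter> N3" using N1 N2 N3 by auto
    fix V assume V: "clopen V" "V \<subseteq> N1 \<inter> N2 \<inter> N3" "V \<subseteq> A"
    have d: "V \<inter> P k ` V = {}" "\<alpha> ` V \<inter> P k ` V = {}" "\<beta> ` V \<inter> P k ` V = {}"
      using disjoint_image_mono[OF N1(3), of V] disjoint_image_mono[OF N2(3), of V] disjoint_image_mono[OF N3(3), of V] V(2)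
      by auto
    have "cyc_ok \<alpha> (P k) V" "cyc_ok (P k) \<beta> V"
      using V d assms swap_disjoint_mono[OF assms(4) V(3)] swap_disjoint_mono[OF assms(5) V(3)]
      by (auto simp: cyc_ok_def)
    then show "cycle_equiv (swap \<alpha> V) (swap \<beta> V)" using cycle_equiv_cyc cycle_equiv_trans by blast
  qed
next
  case (union V W)
  have "(V \<union> W) \<inter> \<alpha> ` (V \<union> W) = {}" "(V \<union> W) \<inter> \<beta> ` (V \<union> W) = {}"
    using union(4,5) assms(4,5) by blast+
  then show ?case using union assms by (simp only: swap_union) (intro cycle_equiv_comp)
qed

text \<open>Near a point moved by \<gamma>, the conjugate is a swap over the image of
  \<open>V\<close>; there its moving map may be replaced by the inverse of \<gamma>, and the result
  is the swap of \<gamma> over \<open>V\<close> itself (\<open>swap_finv\<close>). Near a fixed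
  point \<gamma> is the identity, because its displacement vanishes there, and only the moving map
  has changed.\<close>

lemma swap_image_cycle_equiv:
  assumes "\<alpha> \<in> F" "\<gamma> \<in> F" "clopen A" "A \<inter> \<alpha> ` A = {}"
  shows "cycle_equiv (\<gamma> \<circ> swap \<alpha> A \<circ> finv \<gamma>) (swap \<alpha> A)"
  using assms(3)
proof (induction A rule: clopen_induct)
  case empty show ?case unfolding swap_empty comp_id finv_comp(1)[OF assms(2)] by (rule cycle_equiv_refl[OF F_id])
next
  case (local x)
  let ?\<delta> = "\<gamma> \<circ> \<alpha> \<circ> finv \<gamma>"
  have \<delta>: "?\<delta> \<in> F" using assms by (intro F_comp F_inv)
  have dis: "\<gamma> ` V \<inter> ?\<delta> ` \<gamma> ` V = {}" if "V \<subseteq> A" for V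
  proof -
    have "?\<delta> ` \<gamma> ` V = \<gamma> ` \<alpha> ` V" using assms(2) by (simp add: image_image)
    then show ?thesis using swap_disjoint_mono[OF assms(4) that] assms(2) by (auto simp: F_inj_iff)
  qed
  show ?case
  proof (cases "\<gamma> x = x")
    case True
    obtain N where N: "open N" "x \<in> N" "\<And>z. z \<in> N \<Longrightarrow> \<gamma> z = P (disp \<gamma> x) z"
      using F_local[OF assms(2), of x] by blast
    have "disp \<gamma> x = 0" using True by (intro disp_eqI) simp
    then have id: "\<gamma> z = z" if "z \<in> N" for z using N(3)[OF that] by simp
    show ?thesis
    proof (intro exI[of _ N] conjI allI impI)
      fix V assume V: "clopen V" "V \<subseteq> N" "V \<subseteq> A"
      have "\<gamma> ` V = V" using id V(2) by (auto simp: image_iff subset_iff)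
      then have "\<gamma> \<circ> swap \<alpha> V \<circ> finv \<gamma> = swap ?\<delta> V" "V \<inter> ?\<delta> ` V = {}"
        using swap_conj[OF assms(1,2), of V] dis[OF V(3)] by simp_all
      then show "cycle_equiv (\<gamma> \<circ> swap \<alpha> V \<circ> finv \<gamma>) (swap \<alpha> V)"
        using swap_cycle_equiv_swap[OF \<delta> assms(1) V(1)] swap_disjoint_mono[OF assms(4) V(3)] by simp
    qed (use N in auto)
  next
    case False
    obtain N where N: "open N" "x \<in> N" "\<gamma> ` N \<inter> id ` N = {}"
      by (rule separate_images[OF F_continuous[OF assms(2)] continuous_on_id', of x]) (use False in auto)
    show ?thesis
    proof (intro exI[of _ N] conjI allI impI)
      fix V assume V: "clopen V" "V \<subseteq> N" "V \<subseteq> A"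
      have g: "V \<inter> \<gamma> ` V = {}" using disjoint_image_mono[OF N(3) V(2)] by auto
      have "\<gamma> ` V \<inter> finv \<gamma> ` \<gamma> ` V = {}" using g assms(2) by (simp add: image_image Int_commute)
      then have "cycle_equiv (swap ?\<delta> (\<gamma> ` V)) (swap (finv \<gamma>) (\<gamma> ` V))"
        by (intro swap_cycle_equiv_swap \<delta> F_inv assms(2) dis V(3) clopen_image_F V(1))
      then have "cycle_equiv (\<gamma> \<circ> swap \<alpha> V \<circ> finv \<gamma>) (swap \<gamma> V)"
        using swap_conj[OF assms(1,2), of V] swap_finv[OF assms(2) g] by simp
      moreover have "cycle_equiv (swap \<gamma> V) (swap \<alpha> V)"
        by (rule swap_cycle_equiv_swap[OF assms(2,1) V(1) g swap_disjoint_mono[OF assms(4) V(3)]])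
      ultimately show "cycle_equiv (\<gamma> \<circ> swap \<alpha> V \<circ> finv \<gamma>) (swap \<alpha> V)" by (rule cycle_equiv_trans)
    qed (use N in auto)
  qed
next
  case (union V W)
  have "(V \<union> W) \<inter> \<alpha> ` (V \<union> W) = {}" using union(4,5) assms(4) by blast
  then have s: "swap \<alpha> (V \<union> W) = swap \<alpha> V \<circ> swap \<alpha> W" using union assms by (intro swap_union)
  have "\<gamma> \<circ> (swap \<alpha> V \<circ> swap \<alpha> W) \<circ> finv \<gamma> = (\<gamma> \<circ> swap \<alpha> V \<circ> finv \<gamma>) \<circ> (\<gamma> \<circ> swap \<alpha> W \<circ> finv \<gamma>)"
    using assms(2) by (auto simp: fun_eq_iff)
  then show ?case using cycle_equiv_comp[OF union(6,7)] by (simp only: s)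
qed

section \<open>Products of swaps\<close>

inductive is_swap_product :: "('x \<Rightarrow> 'x) \<Rightarrow> bool" where
  "is_swap_product id"
| "\<alpha> \<in> F \<Longrightarrow> clopen A \<Longrightarrow> A \<inter> \<alpha> ` A = {} \<Longrightarrow> is_swap_product g \<Longrightarrow> is_swap_product (swap \<alpha> A \<circ> g)"

definition swap_products :: "('x \<Rightarrow> 'x) set" where "swap_products = Collect is_swap_product"

lemma swap_products_id: "id \<in> swap_products"
  and swap_products_step: "\<alpha> \<in> F \<Longrightarrow> clopen A \<Longrightarrow> A \<inter> \<alpha> ` A = {} \<Longrightarrow> g \<in> swap_products \<Longrightarrow> swap \<alpha> A \<circ> g \<in> swap_products"
  unfolding swap_products_def mem_Collect_eq by (rule is_swap_product.intros; assumption)+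

lemma swap_products_induct [consumes 1, case_names id step, induct set: swap_products]:
  assumes "f \<in> swap_products" "Q id"
    "\<And>\<alpha> A g. \<alpha> \<in> F \<Longrightarrow> clopen A \<Longrightarrow> A \<inter> \<alpha> ` A = {} \<Longrightarrow> g \<in> swap_products \<Longrightarrow> Q g \<Longrightarrow> Q (swap \<alpha> A \<circ> g)"
  shows "Q f"
  using assms(1) unfolding swap_products_def mem_Collect_eq
proof (induction rule: is_swap_product.induct)
  case 1 show ?case by (rule assms(2))
next
  case (2 \<alpha> A g)
  then show ?case using assms(3) by (simp only: swap_products_def mem_Collect_eq)
qed

lemma swap_products_swap: "\<alpha> \<in> F \<Longrightarrow> clopen A \<Longrightarrow> A \<inter> \<alpha> ` A = {} \<Longrightarrow> swap \<alpha> A \<in> swap_products"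
  using swap_products_step[OF _ _ _ swap_products_id] by simp

lemma swap_products_comp: "f \<in> swap_products \<Longrightarrow> g \<in> swap_products \<Longrightarrow> f \<circ> g \<in> swap_products"
  by (induction f rule: swap_products_induct) (auto simp: o_assoc[symmetric] intro: swap_products_step)

lemma swap_products_F0: "f \<in> swap_products \<Longrightarrow> f \<in> F0"
proof (induction rule: swap_products_induct)
  case id show ?case using subgroup.one_closed[OF F0_subgroup] unfolding one_full_group .
next
  case (step \<alpha> A g)
  show ?case by (rule F0_comp[OF swap_F0[OF step(1-3)] step(5)])
qed

lemma swap_products_F: "f \<in> swap_products \<Longrightarrow> f \<in> F" using swap_products_F0 F0_subset_F by blast

lemma swap_products_finv: "f \<in> swap_products \<Longrightarrow> finv f \<in> swap_products"
proof (induction rule: swap_products_induct)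
  case id show ?case unfolding finv_id by (rule swap_products_id)
next
  case (step \<alpha> A g)
  then have "finv (swap \<alpha> A \<circ> g) = finv g \<circ> swap \<alpha> A"
    by (simp add: finv_o swap_in_F swap_products_F finv_swap)
  then show ?case using swap_products_comp[OF step(5) swap_products_swap[OF step(1-3)]] by (simp only:)
qed

end

section \<open>Elements of index zero\<close>

context cantor_system
begin

text \<open>Freeness separates \<open>x\<close> from each of the finitely many points
  \<open>P k x\<close>, one at a time.\<close>

lemma small_clopen:
  assumes "finite K" "0 \<notin> K" "open U" "x \<in> U"
  shows "\<exists>B. clopen B \<and> x \<in> B \<and> B \<subseteq> U \<and> (\<forall>k\<in>K. \<forall>y\<in>B. P k y \<notin> B)"
  using assms(1,2)
proof (induction K)
  case empty then show ?case using clopen_basis[OF assms(3,4)] by blast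
next
  case (insert k K)
  obtain B where B: "clopen B" "x \<in> B" "B \<subseteq> U" "\<forall>k\<in>K. \<forall>y\<in>B. P k y \<notin> B"
    using insert.IH insert.prems by (metis insertCI)
  have "P k x \<noteq> id x" using free[of k x] insert.prems by auto
  obtain N where N: "open N" "x \<in> N" "P k ` N \<inter> id ` N = {}"
    by (rule separate_images[OF continuous_P continuous_on_id' \<open>P k x \<noteq> id x\<close>])
  obtain B' where B': "clopen B'" "x \<in> B'" "B' \<subseteq> N" using clopen_basis[OF N(1,2)] by blast
  show ?case
  proof (intro exI[of _ "B \<inter> B'"] conjI ballI)
    show "open (B \<inter> B')" "closed (B \<inter> B')" "x \<in> B \<inter> B'" "B \<inter> B' \<subseteq> U" using B B' by auto
    fix j y assume jy: "j \<in> insert k K" "y \<in> B \<inter> B'"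
    show "P j y \<notin> B \<inter> B'"
    proof (cases "j = k")
      case True
      have "P k y \<in> P k ` N" using jy(2) B'(3) by blast
      then show ?thesis using True N(3) B'(3) by auto
    next
      case False then show ?thesis using jy B(4) by blast
    qed
  qed
qed

lemma orb_eqI: "s \<in> F \<Longrightarrow> s (P k y) = P m y \<Longrightarrow> orb s y k = m"
  using P_orb[of s y k] by simp

lemma orb_ident [simp]: "orb (\<lambda>x. x) y k = k" by (simp add: orb_def disp_eqI)

text \<open>Pairwise disjointness of the levels of a tower, phrased through return times: a common
  point of the levels \<open>i\<close> and \<open>j\<close> is the same as a return of
  \<open>V\<close> to itself after \<open>i - j\<close> steps.\<close>

definition levels_disjoint :: "int set \<Rightarrow> 'x set \<Rightarrow> bool" where
  "levels_disjoint I V \<longleftrightarrow> (\<forall>y\<in>V. \<forall>i\<in>I. \<forall>j\<in>I. P (i - j) y \<in> V \<longrightarrow> i = j)"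

text \<open>Applies the permutation \<open>b\<close> of \<open>I\<close> to the levels \<open>P k V\<close>, \<open>k \<in> I\<close>, of a tower.\<close>

definition shuffle :: "int set \<Rightarrow> 'x set \<Rightarrow> (int \<Rightarrow> int) \<Rightarrow> 'x \<Rightarrow> 'x" where
  "shuffle I V b x = (if \<exists>k\<in>I. P (- k) x \<in> V then
     (let k = (THE k. k \<in> I \<and> P (- k) x \<in> V) in P (b k - k) x) else x)"

lemma shuffle_level:
  assumes "levels_disjoint I V" "y \<in> V" "k \<in> I" shows "shuffle I V b (P k y) = P (b k) y"
proof -
  have "(THE j. j \<in> I \<and> P (- j) (P k y) \<in> V) = k"
    using assms by (intro the_equality) (auto simp: levels_disjoint_def P_P)
  then show ?thesis using assms by (auto simp: shuffle_def P_P)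
qed

lemma shuffle_out: "(\<And>k. k \<in> I \<Longrightarrow> P (- k) x \<notin> V) \<Longrightarrow> shuffle I V b x = x"
  by (auto simp: shuffle_def)

lemma level_cases:
  obtains (level) y k where "y \<in> V" "k \<in> I" "x = P k y" | (out) "\<And>k. k \<in> I \<Longrightarrow> P (- k) x \<notin> V"
  by (metis P_minus(2))

lemma shuffle_comp:
  assumes "levels_disjoint I V" "c permutes I"
  shows "shuffle I V b \<circ> shuffle I V c = shuffle I V (b \<circ> c)"
proof
  fix x show "(shuffle I V b \<circ> shuffle I V c) x = shuffle I V (b \<circ> c) x"
  proof (cases x rule: level_cases[of V I])
    case (level y k)
    moreover have "c k \<in> I" using assms(2) level(2) by (simp add: permutes_in_image)
    ultimately show ?thesis using assms by (simp add: shuffle_level)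
  next
    case out then show ?thesis by (simp add: shuffle_out)
  qed
qed

lemma shuffle_id: assumes "levels_disjoint I V" shows "shuffle I V id = id"
proof
  fix x show "shuffle I V id x = id x"
    by (cases x rule: level_cases[of V I]) (simp_all add: shuffle_level[OF assms] shuffle_out)
qed

lemma shuffle_transpose:
  assumes "levels_disjoint I V" "i \<in> I" "j \<in> I" "i \<noteq> j"
  shows "P i ` V \<inter> P (j - i) ` P i ` V = {}"
    "shuffle I V (Transposition.transpose i j) = swap (P (j - i)) (P i ` V)"
proof -
  have im: "P (j - i) ` P i ` V = P j ` V" by (simp add: image_image P_P)
  have dis: "P k ` V \<inter> P l ` V = {}" if kl: "k \<in> I" "l \<in> I" "k \<noteq> l" for k l
  proof -
    have False if "y \<in> V" "z \<in> V" "P k y = P l z" for y z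
    proof -
      have "z = P (k - l) y" using that(3) by (metis P_P P_minus(1) add.commute uminus_add_conv_diff)
      then show False using assms(1) kl that(1,2) by (auto simp: levels_disjoint_def)
    qed
    then show ?thesis by blast
  qed
  show d: "P i ` V \<inter> P (j - i) ` P i ` V = {}" unfolding im by (rule dis[OF assms(2-4)])
  show "shuffle I V (Transposition.transpose i j) = swap (P (j - i)) (P i ` V)"
  proof
    fix x show "shuffle I V (Transposition.transpose i j) x = swap (P (j - i)) (P i ` V) x"
    proof (cases x rule: level_cases[of V I])
      case (level y k)
      consider "k = i" | "k = j" | "k \<noteq> i" "k \<noteq> j" by blast
      then show ?thesis
      proof cases
        case 1 then show ?thesis using level by (simp add: shuffle_level[OF assms(1)] swap_in P_P)
      next
        case 2
        have "swap (P (j - i)) (P i ` V) (P (j - i) (P i y)) = P i y"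
          using level by (intro swap_img d) auto
        then show ?thesis using 2 level by (simp add: shuffle_level[OF assms(1)] P_P)
      next
        case 3
        have "x \<notin> P i ` V" "x \<notin> P j ` V" using dis[of k i] dis[of k j] level assms(2,3) 3 by blast+
        then show ?thesis using 3 level by (simp add: shuffle_level[OF assms(1)] swap_out im)
      qed
    next
      case out
      have "x \<notin> P i ` V" "x \<notin> P j ` V" using out[OF assms(2)] out[OF assms(3)] by auto
      then show ?thesis using out by (simp add: shuffle_out swap_out im)
    qed
  qed
qed

text \<open>A permutation of the finite set \<open>I\<close> is a product of transpositions, and a
  transposition of two levels is a swap.\<close>

lemma shuffle_swap_products:
  assumes "levels_disjoint I V" "finite I" "clopen V" "b permutes I"
  shows "shuffle I V b \<in> swap_products"
  using assms(4,2)
proof (induction rule: permutes_induct)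
  case id show ?case unfolding shuffle_id[OF assms(1)] by (rule swap_products_id)
next
  case (swap i j p)
  have "shuffle I V (Transposition.transpose i j \<circ> p) = swap (P (j - i)) (P i ` V) \<circ> shuffle I V p"
    using shuffle_comp[OF assms(1) swap(4), of "Transposition.transpose i j"]
      shuffle_transpose(2)[OF assms(1) swap(1-3)] by simp
  moreover have "swap (P (j - i)) (P i ` V) \<in> swap_products"
    by (intro swap_products_swap P_in_F clopen_image_P assms(3) shuffle_transpose(1)[OF assms(1) swap(1-3)])
  ultimately show ?case using swap_products_comp[OF _ swap(5)] by (simp only:)
qed

lemma involution_permutes:
  assumes "\<And>k. b (b k) = k" "\<And>k. k \<notin> I \<Longrightarrow> b k = k" shows "b permutes I"
  unfolding permutes_def using assms by metis

text \<open>As \<open>\<alpha>\<close> has index zero, equally many points near \<open>B\<close> cross the cut at \<open>B\<close> in either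
  direction, so they can be exchanged by a finite permutation of levels.\<close>

lemma cut_respecting_correction:
  assumes \<alpha>: "\<alpha> \<in> F0" and N: "N > 0" "\<And>x. \<bar>disp \<alpha> x\<bar> \<le> N" and B: "clopen B"
    and far: "\<And>y k. y \<in> B \<Longrightarrow> k \<noteq> 0 \<Longrightarrow> \<bar>k\<bar> < 2 * N \<Longrightarrow> P k y \<notin> B"
  shows "\<exists>s\<in>swap_products. \<forall>y\<in>B. \<forall>k. 0 \<le> k \<longleftrightarrow> 0 \<le> orb (\<alpha> \<circ> s) y k"
proof -
  let ?I = "{-N..<N}"
  have \<alpha>F: "\<alpha> \<in> F" using \<alpha> F0_subset_F by blast
  have orb\<alpha>: "\<bar>orb \<alpha> y k - k\<bar> \<le> N" for y k using N(2) by (simp add: orb_def)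
  \<comment> \<open>The invariants of the gluing: \<open>?ii\<close> says that the correction acts
    only on the levels over \<open>V\<close>, \<open>?iii\<close> that the cuts at \<open>V\<close>
    are repaired, and \<open>?i\<close> that positions beyond the window keep to their side of every
    cut at \<open>B\<close>. The last one refers to all of \<open>B\<close>, so that it survives
    composition of corrections over different pieces.\<close>
  let ?i = "\<lambda>s. \<forall>y\<in>B. \<forall>k. (N \<le> k \<longrightarrow> N \<le> orb s y k) \<and> (k < - N \<longrightarrow> orb s y k < - N)"
  let ?ii = "\<lambda>s V. \<forall>x. (\<forall>k\<in>?I. P (- k) x \<notin> V) \<longrightarrow> s x = x"
  let ?iii = "\<lambda>s V. \<forall>y\<in>V. \<forall>k\<in>?I. orb s y k \<in> ?I \<and> (0 \<le> k \<longleftrightarrow> 0 \<le> orb \<alpha> y (orb s y k))"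
  let ?Q = "\<lambda>V. \<exists>s\<in>swap_products. ?i s \<and> ?ii s V \<and> ?iii s V"
  have "?Q A" if A: "clopen A" "A \<subseteq> B" for A
    using A(1)
  proof (induction A rule: clopen_induct)
    case empty show ?case by (intro bexI[OF _ swap_products_id]) auto
  next
    case (local y0)
    obtain W where W: "open W" "y0 \<in> W" "\<forall>k\<in>?I. \<forall>z\<in>W. disp \<alpha> (P k z) = disp \<alpha> (P k y0)"
      using loc_const_finite_family[of ?I "\<lambda>k z. disp \<alpha> (P k z)" y0]
        loc_const_vimage_comp[OF loc_const_disp[OF \<alpha>F] continuous_P] by auto
    let ?Pos = "{k. k < 0 \<and> 0 \<le> orb \<alpha> y0 k}" and ?Neg = "{k. 0 \<le> k \<and> orb \<alpha> y0 k < 0}"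
    have sub: "?Pos \<subseteq> ?I" "?Neg \<subseteq> ?I"
    proof -
      have "k \<in> ?I" if "k < 0 \<and> 0 \<le> orb \<alpha> y0 k \<or> 0 \<le> k \<and> orb \<alpha> y0 k < 0" for k
        using orb\<alpha>[of y0 k] that by auto
      then show "?Pos \<subseteq> ?I" "?Neg \<subseteq> ?I" by blast+
    qed
    have "perm_index (orb \<alpha> y0) = 0" using \<alpha> by (simp add: F0_def)
    then have "card ?Pos = card ?Neg" by (rule perm_index_eq_0[OF orb_bounded[OF \<alpha>F]])
    then obtain f where f: "bij_betw f ?Pos ?Neg"
      using finite_same_card_bij finite_subset[OF sub(1)] finite_subset[OF sub(2)] by blast
    \<comment> \<open>The involution exchanging the positions that cross the cut upwards with those
      that cross it downwards, along \<open>f\<close>. Followed by \<alpha>, it keeps each of them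
      on the side where it started.\<close>
    define b where "b k = (if k \<in> ?Pos then f k else if k \<in> ?Neg then inv_into ?Pos f k else k)" for k
    have bPos: "b k \<in> ?Neg" "inv_into ?Pos f (b k) = k" if "k \<in> ?Pos" for k
    proof -
      have "b k = f k" using that unfolding b_def by (simp only: if_True)
      then show "b k \<in> ?Neg" "inv_into ?Pos f (b k) = k"
        using bij_betw_apply[OF f that] bij_betw_inv_into_left[OF f that] by (simp_all only:)
    qed
    have bNeg: "b k \<in> ?Pos" "f (b k) = k" if "k \<in> ?Neg" for k
    proof -
      have "k \<notin> ?Pos" using that by simp
      then have "b k = inv_into ?Pos f k" using that unfolding b_def by (simp only: if_False if_True)
      then show "b k \<in> ?Pos" "f (b k) = k"
        using bij_betw_apply[OF bij_betw_inv_into[OF f] that] bij_betw_inv_into_right[OF f that] by (simp_all only:)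
    qed
    have bElse: "b k = k" if "k \<notin> ?Pos" "k \<notin> ?Neg" for k using that unfolding b_def by (simp only: if_False)
    have "b (b k) = k" for k
    proof -
      consider "k \<in> ?Pos" | "k \<in> ?Neg" | "k \<notin> ?Pos" "k \<notin> ?Neg" by blast
      then show ?thesis
      proof cases
        case 1
        then have "b k \<in> ?Neg" "b k \<notin> ?Pos" using bPos(1)[OF 1] by auto
        then have "b (b k) = inv_into ?Pos f (b k)" unfolding b_def[of "b k"] by (simp only: if_False if_True)
        then show ?thesis using bPos(2)[OF 1] by (simp only:)
      next
        case 2
        then have "b (b k) = f (b k)" using bNeg(1)[OF 2] unfolding b_def[of "b k"] by (simp only: if_True)
        then show ?thesis using bNeg(2)[OF 2] by (simp only:)
      next
        case 3 show ?thesis by (simp only: bElse[OF 3])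
      qed
    qed
    then have perm: "b permutes ?I"
      by (rule involution_permutes) (use bElse sub in blast)
    have bI: "b k \<in> ?I" if "k \<in> ?I" for k using permutes_in_image[OF perm, of k] that by blast
    have key: "0 \<le> k \<longleftrightarrow> 0 \<le> orb \<alpha> y0 (b k)" for k
    proof -
      consider "k \<in> ?Pos" | "k \<in> ?Neg" | "k \<notin> ?Pos" "k \<notin> ?Neg" by blast
      then show ?thesis
      proof cases
        case 1 then show ?thesis using bPos(1)[OF 1] by auto
      next
        case 2 then show ?thesis using bNeg(1)[OF 2] by auto
      next
        case 3 then show ?thesis using bElse[OF 3] by auto
      qed
    qed
    show ?case
    proof (intro exI[of _ W] conjI allI impI W(1,2))
      fix V assume V: "clopen V" "V \<subseteq> W" and VA: "V \<subseteq> A"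
      note V = V order_trans[OF VA A(2)]
      let ?s = "shuffle ?I V b"
      have lev: "levels_disjoint ?I V"
        unfolding levels_disjoint_def
      proof (intro ballI impI)
        fix y i j assume "y \<in> V" "i \<in> ?I" "j \<in> ?I" "P (i - j) y \<in> V"
        then show "i = j" using far[of y "i - j"] V(3) by force
      qed
      have swap_products: "?s \<in> swap_products" by (rule shuffle_swap_products[OF lev _ V(1) perm]) simp
      then have sF: "?s \<in> F" by (rule swap_products_F)
      have 1: "?i ?s"
      proof (intro ballI allI)
        fix y k assume y: "y \<in> B"
        show "(N \<le> k \<longrightarrow> N \<le> orb ?s y k) \<and> (k < - N \<longrightarrow> orb ?s y k < - N)"
        proof (cases "P k y" rule: level_cases[of V ?I])
          case (level v i)
          have v: "v = P (k - i) y" using level(3) by (metis P_P P_minus(1) add.commute uminus_add_conv_diff)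
          have "?s (P k y) = P (b i) v" unfolding level(3) by (rule shuffle_level[OF lev level(1,2)])
          then have "orb ?s y k = b i + (k - i)" using v by (intro orb_eqI[OF sF]) (simp add: P_P)
          moreover have "b i \<in> ?I" by (rule bI[OF level(2)])
          \<comment> \<open>Visits to \<open>B\<close> are at least \<open>2 * N\<close> apart,
            which is the length of the window, so a window over another point of \<open>B\<close>
            lies wholly on one side.\<close>
          moreover have "k - i = 0 \<or> \<bar>k - i\<bar> \<ge> 2 * N" using far[OF y, of "k - i"] level(1) V(3) v by force
          ultimately show ?thesis using level(2) by auto
        next
          case out
          then have "orb ?s y k = k" by (intro orb_eqI[OF sF] shuffle_out)
          then show ?thesis by simp
        qed
      qed
      have 2: "?ii ?s V" by (auto intro: shuffle_out)
      have 3: "?iii ?s V"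
      proof (intro ballI)
        fix y k assume yk: "y \<in> V" "k \<in> ?I"
        have o: "orb ?s y k = b k" by (intro orb_eqI[OF sF] shuffle_level[OF lev] yk)
        have "orb \<alpha> y (b k) = orb \<alpha> y0 (b k)"
          using W(3) bI[OF yk(2)] yk(1) V(2) by (auto simp: orb_def)
        then show "orb ?s y k \<in> ?I \<and> (0 \<le> k \<longleftrightarrow> 0 \<le> orb \<alpha> y (orb ?s y k))"
          using o key[of k] bI[OF yk(2)] by simp
      qed
      show "?Q V" using swap_products 1 2 3 by blast
    qed
  next
    case (union V W)
    have VW: "V \<subseteq> B" "W \<subseteq> B" using union(4,5) A(2) by blast+
    obtain s1 where s1: "s1 \<in> swap_products" "?i s1" "?ii s1 V" "?iii s1 V" using union(6) by blast
    obtain s2 where s2: "s2 \<in> swap_products" "?i s2" "?ii s2 W" "?iii s2 W" using union(7) by blast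
    have F: "s1 \<in> F" "s2 \<in> F" using s1 s2 swap_products_F by auto
    have oc: "orb (s1 \<circ> s2) y k = orb s1 y (orb s2 y k)" for y k by (simp add: orb_comp F)
    \<comment> \<open>For the same reason the windows over disjoint parts of \<open>B\<close> do not
      meet.\<close>
    have out: "P (- i) (P k y) \<notin> T" if "y \<in> S" "k \<in> ?I" "i \<in> ?I" "S \<subseteq> B" "T \<subseteq> B" "S \<inter> T = {}" for y k i S T
    proof
      assume a: "P (- i) (P k y) \<in> T"
      then have "P (k - i) y \<in> B" using that(5) by (auto simp: P_P)
      then have "k = i" using far[of y "k - i"] that by force
      then show False using a that by auto
    qed
    have fix1: "orb s1 y k = k" if "y \<in> W" "k \<in> ?I" for y k
      using s1(3) out[OF that _ VW(2,1)] union(3) by (intro orb_eqI[OF F(1)]) blast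
    have fix2: "orb s2 y k = k" if "y \<in> V" "k \<in> ?I" for y k
      using s2(3) out[OF that _ VW union(3)] by (intro orb_eqI[OF F(2)]) blast
    show ?case
    proof (intro bexI[of _ "s1 \<circ> s2"] conjI)
      show "?i (s1 \<circ> s2)" unfolding oc using s1(2) s2(2) by blast
      show "?ii (s1 \<circ> s2) (V \<union> W)" using s1(3) s2(3) by simp
      show "?iii (s1 \<circ> s2) (V \<union> W)"
      proof (intro ballI)
        fix y k assume y: "y \<in> V \<union> W" and k: "k \<in> ?I"
        from y show "orb (s1 \<circ> s2) y k \<in> ?I \<and> (0 \<le> k \<longleftrightarrow> 0 \<le> orb \<alpha> y (orb (s1 \<circ> s2) y k))"
        proof
          assume "y \<in> V"
          then show ?thesis unfolding oc fix2[OF \<open>y \<in> V\<close> k] using s1(4) k by blast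
        next
          assume yW: "y \<in> W"
          have "orb s2 y k \<in> ?I" using s2(4) yW k by blast
          then show ?thesis unfolding oc fix1[OF yW \<open>orb s2 y k \<in> ?I\<close>] using s2(4) k yW by blast
        qed
      qed
      show "s1 \<circ> s2 \<in> swap_products" by (rule swap_products_comp[OF s1(1) s2(1)])
    qed
  qed
  from this[OF B order_refl] obtain s where s: "s \<in> swap_products" "?i s" "?iii s B" by blast
  have sF: "s \<in> F" using s(1) by (rule swap_products_F)
  have "0 \<le> k \<longleftrightarrow> 0 \<le> orb (\<alpha> \<circ> s) y k" if y: "y \<in> B" for y k
  proof -
    consider "k \<in> ?I" | "N \<le> k" | "k < - N" by force
    then show ?thesis
    proof cases
      case 1 then show ?thesis using s(3) y by (simp add: orb_comp \<alpha>F sF)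
    next
      case 2
      then have "N \<le> orb s y k" using s(2) y by blast
      then show ?thesis using 2 orb\<alpha>[of y "orb s y k"] N(1) by (simp add: orb_comp \<alpha>F sF)
    next
      case 3
      then have "orb s y k < - N" using s(2) y by blast
      then show ?thesis using 3 orb\<alpha>[of y "orb s y k"] N(1) by (simp add: orb_comp \<alpha>F sF)
    qed
  qed
  then show ?thesis using s(1) by blast
qed

text \<open>An element that respects the cuts at \<open>B\<close> permutes the levels between consecutive visits to \<open>B\<close>.\<close>

lemma tower_preserving_swap_products:
  assumes \<beta>: "\<beta> \<in> F" and B: "clopen B" "B \<noteq> {}"
    and cut: "\<And>y k. y \<in> B \<Longrightarrow> 0 \<le> k \<longleftrightarrow> 0 \<le> orb \<beta> y k"
  shows "\<beta> \<in> swap_products"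
proof -
  obtain K where K: "K \<ge> 0" "\<And>x. \<exists>k. 0 \<le> k \<and> k \<le> K \<and> P k x \<in> B" using recurrence[of B] B by blast
  \<comment> \<open>Height of \<open>x\<close> above the last visit to \<open>B\<close>, a point of
    \<open>B\<close> having height zero; \<open>base x\<close> is the bottom of its column.\<close>
  define e where "e x = (LEAST n::nat. P (- int n) x \<in> B)" for x
  define base where "base x = P (- int (e x)) x" for x
  have ex: "\<exists>n::nat. int n \<le> K \<and> P (- int n) x \<in> B" for x
  proof -
    obtain k where k: "0 \<le> k" "k \<le> K" "P k (P (- K) x) \<in> B" using K(2)[of "P (- K) x"] by blast
    then have "P (- int (nat (K - k))) x \<in> B" by (simp add: P_P)
    then show ?thesis using k by (intro exI[of _ "nat (K - k)"]) auto
  qed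
  have base_B: "base x \<in> B" for x
    unfolding base_def e_def by (rule LeastI_ex) (use ex in blast)
  have e_le: "int (e x) \<le> K" for x
  proof -
    obtain n where n: "int n \<le> K" "P (- int n) x \<in> B" using ex by blast
    have "e x \<le> n" unfolding e_def by (rule Least_le) (rule n(2))
    then show ?thesis using n(1) by simp
  qed
  have less_e: "P (- int m) x \<notin> B" if "m < e x" for m x using not_less_Least that unfolding e_def by blast
  have P_base: "P (int (e x)) (base x) = x" for x by (simp add: base_def)
  have base_eqI: "int (e x) = k \<and> base x = y"
    if "y \<in> B" "0 \<le> k" "x = P k y" "\<And>i. 0 < i \<Longrightarrow> i \<le> k \<Longrightarrow> P i y \<notin> B" for x y k
  proof -
    have "e x = nat k" unfolding e_def
    proof (rule Least_equality)
      show "P (- int (nat k)) x \<in> B" using that by simp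
      fix n assume n: "P (- int n) x \<in> B"
      show "nat k \<le> n"
      proof (rule ccontr)
        assume "\<not> nat k \<le> n"
        then have "P (k - int n) y \<notin> B" using that(2) by (intro that(4)) auto
        then show False using n that(3) by (simp add: P_P)
      qed
    qed
    then show ?thesis using that by (simp add: base_def)
  qed
  have between: "P i (base x) \<notin> B" if "0 < i" "i \<le> int (e x)" for i x
    using less_e[of "nat (int (e x) - i)" x] that by (simp add: base_def P_P)
  \<comment> \<open>A visit to \<open>B\<close> strictly above the base and not above
    \<open>\<beta> x\<close> would be a cut with \<open>x\<close> below it and
    \<open>\<beta> x\<close> on or above it.\<close>
  have base_\<beta>: "base (\<beta> x) = base x" for x
  proof -
    let ?y = "base x" and ?k = "int (e x)"
    have bx: "\<beta> x = P (orb \<beta> ?y ?k) ?y" using P_orb[OF \<beta>, of ?y ?k] P_base[of x] by simp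
    have "P i ?y \<notin> B" if i: "0 < i" "i \<le> orb \<beta> ?y ?k" for i
    proof
      assume iB: "P i ?y \<in> B"
      have "0 \<le> orb \<beta> (P i ?y) (?k - i)" using i by (simp add: orb_shift)
      then have "i \<le> ?k" using cut[OF iB, of "?k - i"] by simp
      then show False using between[OF i(1), of x] iB by blast
    qed
    moreover have "0 \<le> orb \<beta> ?y ?k" using cut[OF base_B, of ?k] by simp
    ultimately show ?thesis using base_eqI[OF base_B _ bx] by blast
  qed
  have base_\<beta>': "base (finv \<beta> x) = base x" for x using base_\<beta>[of "finv \<beta> x"] \<beta> by simp
  have loc_base: "loc_const (\<lambda>x. base x \<in> V)" if V: "clopen V" for V
  proof (rule loc_constI)
    fix x
    obtain W where W: "open W" "x \<in> W" "\<forall>n\<in>{0..e x}. \<forall>z\<in>W. (P (- int n) z \<in> B) = (P (- int n) x \<in> B)"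
      using loc_const_finite_family[of "{0..e x}" "\<lambda>n z. P (- int n) z \<in> B" x]
        loc_const_vimage_comp[OF loc_const_indicator[OF B(1)] continuous_P] by auto
    obtain W' where W': "open W'" "x \<in> W'" "\<And>z. z \<in> W' \<Longrightarrow> (P (- int (e x)) z \<in> V) = (P (- int (e x)) x \<in> V)"
      using loc_constE[OF loc_const_vimage_comp[OF loc_const_indicator[OF V] continuous_P[of "- int (e x)"]], of x] by metis
    have ez: "e z = e x" if z: "z \<in> W" for z
      unfolding e_def[of z]
    proof (rule Least_equality)
      show "P (- int (e x)) z \<in> B" using W(3) z base_B[of x] by (simp add: base_def)
      fix n assume "P (- int n) z \<in> B"
      then show "e x \<le> n" using W(3) z less_e[of n x] by (metis atLeastAtMost_iff le0 le_cases not_less)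
    qed
    show "\<exists>U. open U \<and> x \<in> U \<and> (\<forall>z\<in>U. (base z \<in> V) = (base x \<in> V))"
    proof (intro exI[of _ "W \<inter> W'"] conjI ballI)
      show "open (W \<inter> W')" "x \<in> W \<inter> W'" using W(1,2) W'(1,2) by auto
      fix z assume "z \<in> W \<inter> W'"
      then show "(base z \<in> V) = (base x \<in> V)" using ez[of z] W'(3)[of z] by (simp add: base_def)
    qed
  qed
  \<comment> \<open>The restriction of \<beta> to the columns based in \<open>V\<close>. Since
    \<beta> preserves columns, restrictions over disjoint bases compose to the restriction over the
    union.\<close>
  define \<gamma> where "\<gamma> V x = (if base x \<in> V then \<beta> x else x)" for V x
  have "\<gamma> B \<in> swap_products" using B(1)
  proof (induction B rule: clopen_induct)
    case empty
    have "\<gamma> {} = id" by (auto simp: \<gamma>_def)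
    then show ?case using swap_products_id by (simp only:)
  next
    case (local y0)
    let ?J = "{0..K}"
    obtain W1 where W1: "open W1" "y0 \<in> W1" "\<forall>k\<in>?J. \<forall>z\<in>W1. (P k z \<in> B) = (P k y0 \<in> B)"
      using loc_const_finite_family[of ?J "\<lambda>k z. P k z \<in> B" y0]
        loc_const_vimage_comp[OF loc_const_indicator[OF B(1)] continuous_P] by auto
    obtain W2 where W2: "open W2" "y0 \<in> W2" "\<forall>k\<in>?J. \<forall>z\<in>W2. disp \<beta> (P k z) = disp \<beta> (P k y0)"
      using loc_const_finite_family[of ?J "\<lambda>k z. disp \<beta> (P k z)" y0]
        loc_const_vimage_comp[OF loc_const_disp[OF \<beta>] continuous_P] by auto
    \<comment> \<open>The levels of the column over \<open>y0\<close>, the same for all base points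
      near \<open>y0\<close>.\<close>
    define I where "I = {k\<in>?J. \<forall>i. 0 < i \<longrightarrow> i \<le> k \<longrightarrow> P i y0 \<notin> B}"
    have finI: "finite I" by (rule finite_subset[of _ ?J]) (auto simp: I_def)
    have I_iff: "k \<in> I \<longleftrightarrow> k \<ge> 0 \<and> int (e (P k y)) = k \<and> base (P k y) = y" if "y \<in> W1" "y \<in> B" for y k
    proof
      assume k: "k \<in> I"
      have "P i y \<notin> B" if "0 < i" "i \<le> k" for i
      proof -
        have "i \<in> ?J" using that k by (auto simp: I_def)
        then show ?thesis using W1(3) \<open>y \<in> W1\<close> k that by (auto simp: I_def)
      qed
      then show "k \<ge> 0 \<and> int (e (P k y)) = k \<and> base (P k y) = y"
        using base_eqI[OF that(2) _ refl, of k] k by (auto simp: I_def)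
    next
      assume k: "k \<ge> 0 \<and> int (e (P k y)) = k \<and> base (P k y) = y"
      then have kJ: "k \<in> ?J" using e_le[of "P k y"] by auto
      have "P i y0 \<notin> B" if "0 < i" "i \<le> k" for i
      proof -
        have "P i y \<notin> B" using between[OF that(1), of "P k y"] that k by auto
        moreover have "i \<in> ?J" using that kJ by auto
        ultimately show ?thesis using W1(3) \<open>y \<in> W1\<close> by blast
      qed
      then show "k \<in> I" using kJ by (auto simp: I_def)
    qed
    define b where "b k = (if k \<in> I then orb \<beta> y0 k else k)" for k
    have bI: "b k \<in> I" if k: "k \<in> I" for k
    proof -
      have "base (P k y0) = y0" using I_iff[OF W1(2) local] k by blast
      then have "base (P (b k) y0) = y0" using base_\<beta>[of "P k y0"] P_orb[OF \<beta>, of y0 k] k by (simp add: b_def)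
      moreover have "b k \<ge> 0" using cut[OF local, of k] k by (auto simp: b_def I_def)
      moreover have "int (e (P (b k) y0)) = b k"
        using P_base[of "P (b k) y0"] calculation(1) by simp
      ultimately show ?thesis using I_iff[OF W1(2) local] by blast
    qed
    have perm: "b permutes I"
    proof (rule bij_imp_permutes)
      have inj: "inj_on b I" by (auto simp: inj_on_def b_def orb_inj_iff[OF \<beta>])
      then show "bij_betw b I I" using bI finI by (simp add: bij_betw_def endo_inj_surj image_subsetI)
    qed (simp add: b_def)
    show ?case
    proof (intro exI[of _ "W1 \<inter> W2"] conjI allI impI)
      show "open (W1 \<inter> W2)" "y0 \<in> W1 \<inter> W2" using W1 W2 by auto
      fix V assume V: "clopen V" "V \<subseteq> W1 \<inter> W2" "V \<subseteq> B"
      have lev: "levels_disjoint I V"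
        unfolding levels_disjoint_def
      proof (intro ballI impI)
        fix y i j assume a: "y \<in> V" "i \<in> I" "j \<in> I" "P (i - j) y \<in> V"
        have "base (P j (P (i - j) y)) = P (i - j) y" using I_iff[of "P (i - j) y" j] a V by blast
        moreover have "base (P i y) = y" using I_iff[of y i] a V by blast
        ultimately have "P (i - j) y = y" by (simp add: P_P)
        then show "i = j" using free[of "i - j" y] by simp
      qed
      have "\<gamma> V x = shuffle I V b x" for x
      proof (cases "base x \<in> V")
        case True
        have k: "int (e x) \<in> I" using I_iff[of "base x" "int (e x)"] True V P_base[of x] by auto
        have "shuffle I V b (P (int (e x)) (base x)) = P (b (int (e x))) (base x)"
          by (rule shuffle_level[OF lev True k])
        moreover have "b (int (e x)) = orb \<beta> (base x) (int (e x))"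
        proof -
          have "base x \<in> W2" using True V by blast
          then have "disp \<beta> (P (int (e x)) (base x)) = disp \<beta> (P (int (e x)) y0)" using W2(3) e_le[of x] by auto
          then show ?thesis using k by (simp add: b_def orb_def)
        qed
        ultimately show ?thesis using True P_orb[OF \<beta>, of "base x" "int (e x)"] P_base[of x] by (simp add: \<gamma>_def)
      next
        case False
        have "P (- k) x \<notin> V" if k: "k \<in> I" for k
        proof
          assume a: "P (- k) x \<in> V"
          then have "base (P k (P (- k) x)) = P (- k) x" using I_iff[of "P (- k) x" k] k V by blast
          then show False using a False by simp
        qed
        then show ?thesis using False by (simp add: \<gamma>_def shuffle_out)
      qed
      then have "\<gamma> V = shuffle I V b" by (rule ext)
      then show "\<gamma> V \<in> swap_products" using shuffle_swap_products[OF lev finI V(1) perm] by (simp only:)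
    qed
  next
    case (union V W)
    have "\<gamma> (V \<union> W) = \<gamma> V \<circ> \<gamma> W"
      using union(3) by (auto simp: \<gamma>_def base_\<beta> fun_eq_iff)
    then show ?case using swap_products_comp[OF union(6,7)] by (simp only:)
  qed
  moreover have "\<gamma> B = \<beta>" using base_B by (auto simp: \<gamma>_def)
  ultimately show ?thesis by simp
qed

theorem F0_eq_swap_products: "F0 = swap_products"
proof
  show "swap_products \<subseteq> F0" using swap_products_F0 by blast
  show "F0 \<subseteq> swap_products"
  proof
    fix \<alpha> assume \<alpha>: "\<alpha> \<in> F0"
    then have \<alpha>F: "\<alpha> \<in> F" using F0_subset_F by blast
    obtain N0 where N0: "N0 \<ge> 0" "\<And>x. \<bar>disp \<alpha> x\<bar> \<le> N0" using disp_bounded[OF \<alpha>F] by blast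
    \<comment> \<open>One more than the bound, because the correction lemma requires a positive
      \<open>N\<close>.\<close>
    define N where "N = N0 + 1"
    have N: "N > 0" "\<bar>disp \<alpha> x\<bar> \<le> N" for x using N0(1) N0(2)[of x] by (simp_all add: N_def)
    obtain x0 :: 'x where True by blast
    obtain B where B: "clopen B" "x0 \<in> B" "\<forall>k\<in>{-2*N..2*N} - {0}. \<forall>y\<in>B. P k y \<notin> B"
      using small_clopen[of "{-2*N..2*N} - {0}" UNIV x0] by auto
    have far: "P k y \<notin> B" if "y \<in> B" "k \<noteq> 0" "\<bar>k\<bar> < 2 * N" for y k
      using B(3) that by (auto simp: abs_less_iff)
    have "\<exists>s\<in>swap_products. \<forall>y\<in>B. \<forall>k. 0 \<le> k \<longleftrightarrow> 0 \<le> orb (\<alpha> \<circ> s) y k"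
      by (rule cut_respecting_correction[OF \<alpha> N B(1)]) (rule far)
    then obtain s where s: "s \<in> swap_products" "\<forall>y\<in>B. \<forall>k. 0 \<le> k \<longleftrightarrow> 0 \<le> orb (\<alpha> \<circ> s) y k"
      by blast
    have sF: "s \<in> F" using s(1) by (rule swap_products_F)
    have "\<alpha> \<circ> s \<in> swap_products"
    proof (rule tower_preserving_swap_products[OF _ B(1)])
      show "\<alpha> \<circ> s \<in> F" using \<alpha>F sF by simp
      show "B \<noteq> {}" using B(2) by blast
      show "\<And>y k. y \<in> B \<Longrightarrow> 0 \<le> k \<longleftrightarrow> 0 \<le> orb (\<alpha> \<circ> s) y k" using s(2) by blast
    qed
    then have "(\<alpha> \<circ> s) \<circ> finv s \<in> swap_products" using swap_products_comp swap_products_finv[OF s(1)] by blast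
    moreover have "(\<alpha> \<circ> s) \<circ> finv s = \<alpha>" using sF by (auto simp: fun_eq_iff)
    ultimately show "\<alpha> \<in> swap_products" by simp
  qed
qed

end

section \<open>The kernel of the signature\<close>

lemma bit_add_eq_1: "a + b = (1::bit) \<longleftrightarrow> (a = 1) \<noteq> (b = 1)"
  by (cases "a = 0"; cases "b = 0") simp_all

lemma indicator_bit_union: "V \<inter> W = {} \<Longrightarrow> (indicator (V \<union> W) x :: bit) = indicator V x + indicator W x"
  by (auto simp: indicator_def)

lemma indicator_bit_symdiff: "(indicator ((V - W) \<union> (W - V)) x :: bit) = indicator V x + indicator W x"
  by (auto simp: indicator_def)

context cantor_system
begin

lemma cycle_equiv_sgn: assumes "cycle_equiv f g" shows "sgn_full f = sgn_full g"
proof -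
  interpret H: comm_group "H0 \<phi>" by (rule comm_group_H0)
  have F: "f \<in> F" "g \<in> F" "f \<circ> finv g \<in> D" using assms cycle_products_subset_D by (auto simp: cycle_equiv_def)
  have "(f \<circ> finv g) \<circ> g = f" using F by (auto simp: fun_eq_iff)
  then have "sgn_full f = monoid.mult (H0 \<phi>) (sgn_full (f \<circ> finv g)) (sgn_full g)"
    using sgn_full_comp[of "f \<circ> finv g" g] F by (metis F_comp F_inv)
  also have "\<dots> = sgn_full g" unfolding sgn_full_D[OF F(3)] using F by simp
  finally show ?thesis .
qed

text \<open>On each orbit this involution only exchanges neighbours. A point of \<open>A\<close> is
  inverted with its successor and with no other later point, and a point outside \<open>A\<close>
  has no later inverted partner, so the cochain is the indicator itself and not merely cohomologous
  to it.\<close>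

lemma sgn_swap_phi:
  assumes "clopen A" "A \<inter> \<phi> ` A = {}"
  shows "sgn_full (swap \<phi> A) = cls (indicator A)"
proof -
  let ?s = "swap \<phi> A"
  have d1: "disp ?s z = 1" if "z \<in> A" for z using that by (intro disp_eqI) (simp add: swap_in)
  have d2: "disp ?s z = - 1" if "z \<in> \<phi> ` A" for z
  proof -
    obtain a where a: "a \<in> A" "z = \<phi> a" using \<open>z \<in> \<phi> ` A\<close> by blast
    then have "?s z = a" using swap_img[OF phi_in_F assms(2)] by simp
    moreover have "a = P (- 1) z" using a P_minus(1)[of 1 a] by simp
    ultimately show ?thesis by (intro disp_eqI) simp
  qed
  have d3: "disp ?s z = 0" if "z \<notin> A" "z \<notin> \<phi> ` A" for z using that by (intro disp_eqI) (simp add: swap_out)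
  have d: "disp ?s z = 1 \<and> z \<in> A \<or> disp ?s z = - 1 \<and> z \<in> \<phi> ` A \<or> disp ?s z = 0 \<and> z \<notin> A" for z
    using d1[of z] d2[of z] d3[of z] by blast
  have "inversions ?s x = indicator A x" for x
  proof (cases "x \<in> A")
    case True
    have "{k. 0 < k \<and> orb ?s x k < orb ?s x 0} = {1}"
    proof (intro equalityI subsetI)
      fix k assume "k \<in> {k. 0 < k \<and> orb ?s x k < orb ?s x 0}"
      then show "k \<in> {1}" using d[of "P k x"] d1[OF True] by (auto simp: orb_def)
    next
      fix k :: int assume "k \<in> {1}"
      then show "k \<in> {k. 0 < k \<and> orb ?s x k < orb ?s x 0}"
        using d2[of "\<phi> x"] d1[OF True] True by (auto simp: orb_def)
    qed
    then show ?thesis using True by (simp add: inversions_def)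
  next
    case False
    have "{k. 0 < k \<and> orb ?s x k < orb ?s x 0} = {}"
    proof -
      have False if "0 < k" "orb ?s x k < orb ?s x 0" for k
        using d[of x] d[of "P k x"] False that by (auto simp: orb_def)
      then show ?thesis by blast
    qed
    then have "inversions ?s x = 0" unfolding inversions_def by (simp only: sum.empty)
    then show ?thesis using False by simp
  qed
  then have "inversions ?s = indicator A" by (rule ext)
  then show ?thesis by (simp add: sgn_full_def)
qed

text \<open>Locally \<alpha> either coincides with \<phi> or has an image disjoint from that of
  \<phi>. In the second case the swap may be exchanged for the one with \<phi> modulo a 3-cycle,
  which does not affect the signature, so no inversions have to be counted for general
  \<alpha>.\<close>

lemma sgn_swap:
  assumes "\<alpha> \<in> F" "clopen A" "A \<inter> \<alpha> ` A = {}"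
  shows "sgn_full (swap \<alpha> A) = cls (indicator A)"
  using assms(2)
proof (induction A rule: clopen_induct)
  case empty
  have "indicator {} = (\<lambda>_::'x. 0 :: bit)" by auto
  then show ?case unfolding swap_empty sgn_full_id one_H0 by (simp only:)
next
  case (local x)
  have "\<alpha> x \<in> \<alpha> ` A" using local by (rule imageI)
  then have x: "\<alpha> x \<noteq> id x" using local assms(3) by (metis IntI empty_iff id_apply)
  obtain N1 where N1: "open N1" "x \<in> N1" "\<alpha> ` N1 \<inter> id ` N1 = {}"
    by (rule separate_images[OF F_continuous[OF assms(1)] continuous_on_id' x])
  have "\<phi> x \<noteq> id x" using free[of 1 x] by fastforce
  obtain N2 where N2: "open N2" "x \<in> N2" "\<phi> ` N2 \<inter> id ` N2 = {}"
    by (rule separate_images[OF continuous_phi continuous_on_id' \<open>\<phi> x \<noteq> id x\<close>])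
  have phi_dis: "V \<inter> \<phi> ` V = {}" if "V \<subseteq> N2" for V using disjoint_image_mono[OF N2(3) that] by auto
  show ?case
  proof (cases "disp \<alpha> x = 1")
    case True
    obtain N where N: "open N" "x \<in> N" "\<And>z. z \<in> N \<Longrightarrow> \<alpha> z = \<phi> z"
      using F_local[OF assms(1), of x] True by auto
    show ?thesis
    proof (intro exI[of _ "N \<inter> N2"] conjI allI impI)
      show "open (N \<inter> N2)" "x \<in> N \<inter> N2" using N N2 by auto
      fix V assume V: "clopen V" "V \<subseteq> N \<inter> N2" "V \<subseteq> A"
      have "swap \<alpha> V = swap \<phi> V" using N(3) V(2) assms(1) by (intro swap_cong) auto
      then show "sgn_full (swap \<alpha> V) = cls (indicator V)" using sgn_swap_phi[OF V(1)] phi_dis V(2) by auto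
    qed
  next
    case False
    have "\<alpha> x \<noteq> \<phi> x" using False disp_eqI[of \<alpha> x 1] by auto
    then obtain N3 where N3: "open N3" "x \<in> N3" "\<alpha> ` N3 \<inter> \<phi> ` N3 = {}"
      using separate_images[OF F_continuous[OF assms(1)] continuous_phi] by metis
    show ?thesis
    proof (intro exI[of _ "N2 \<inter> N3"] conjI allI impI)
      show "open (N2 \<inter> N3)" "x \<in> N2 \<inter> N3" using N2 N3 by auto
      fix V assume V: "clopen V" "V \<subseteq> N2 \<inter> N3" "V \<subseteq> A"
      have p: "V \<inter> \<phi> ` V = {}" using phi_dis V(2) by auto
      have "cyc_ok \<alpha> \<phi> V"
        using V assms(1) swap_disjoint_mono[OF assms(3) V(3)] p disjoint_image_mono[OF N3(3), of V]
        by (auto simp: cyc_ok_def)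
      then have "sgn_full (swap \<alpha> V) = sgn_full (swap \<phi> V)" by (intro cycle_equiv_sgn cycle_equiv_cyc)
      then show "sgn_full (swap \<alpha> V) = cls (indicator V)" using sgn_swap_phi[OF V(1) p] by simp
    qed
  qed
next
  case (union V W)
  have "(V \<union> W) \<inter> \<alpha> ` (V \<union> W) = {}" using union(4,5) assms(3) by blast
  then have s: "swap \<alpha> (V \<union> W) = swap \<alpha> V \<circ> swap \<alpha> W" using union assms by (intro swap_union)
  have "swap \<alpha> V \<in> F" "swap \<alpha> W \<in> F"
    by (intro swap_in_F assms(1) union(1,2) swap_disjoint_mono[OF assms(3)] union(4,5))+
  then have "sgn_full (swap \<alpha> (V \<union> W)) = cls (\<lambda>x. indicator V x + indicator W x)"
    unfolding s using union by (simp add: sgn_full_comp mult_H0 loc_const_of_clopen)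
  moreover have "(\<lambda>x. indicator V x + indicator W x) = (indicator (V \<union> W) :: 'x \<Rightarrow> bit)"
    using indicator_bit_union[OF union(3)] by auto
  ultimately show ?case by simp
qed

section \<open>Reduction to a fixed base set\<close>

context
  fixes B :: "'x set"
  assumes B: "clopen B" "B \<noteq> {}" "B \<inter> \<phi> ` B = {}"
begin

lemma swap_base:
  assumes "C \<subseteq> B" "b \<in> B"
  shows "swap \<phi> C b = (if b \<in> C then \<phi> b else b)" "swap \<phi> C (\<phi> b) = (if b \<in> C then b else \<phi> b)"
proof -
  have "b \<notin> \<phi> ` C" "\<phi> b \<notin> C" using assms B(3) by blast+
  moreover have "\<phi> b \<in> \<phi> ` C \<longleftrightarrow> b \<in> C" by (rule inj_image_mem_iff[OF bij_is_inj[OF bij_phi]])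
  ultimately show "swap \<phi> C b = (if b \<in> C then \<phi> b else b)" "swap \<phi> C (\<phi> b) = (if b \<in> C then b else \<phi> b)"
    by (auto simp: swap_def)
qed

text \<open>Over a fixed base each pair consisting of \<open>b\<close> and \<open>\<phi> b\<close>
  is flipped independently, so composition counts flips modulo 2; symmetric difference is the set
  version of adding indicators.\<close>

lemma swap_symdiff:
  assumes "C \<subseteq> B" "C' \<subseteq> B"
  shows "swap \<phi> C \<circ> swap \<phi> C' = swap \<phi> ((C - C') \<union> (C' - C))"
proof
  fix x
  have d: "(C - C') \<union> (C' - C) \<subseteq> B" using assms by blast
  consider "x \<in> B" | b where "b \<in> B" "x = \<phi> b" | "x \<notin> B" "x \<notin> \<phi> ` B" by blast
  then show "(swap \<phi> C \<circ> swap \<phi> C') x = swap \<phi> ((C - C') \<union> (C' - C)) x"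
  proof cases
    case 1 then show ?thesis using assms d by (auto simp: swap_base)
  next
    case 2 then show ?thesis using assms d by (auto simp: swap_base)
  next
    case 3
    then have "swap \<phi> E x = x" if "E \<subseteq> B" for E using that by (intro swap_out) auto
    then show ?thesis using assms d by simp
  qed
qed

text \<open>A small piece is carried into \<open>B\<close> by a power of \<phi>, as every orbit
  visits \<open>B\<close>. Conjugation does not change the swap modulo 3-cycles, and over
  \<open>B\<close> the moving map may be replaced by \<phi>.\<close>

lemma swap_to_base:
  assumes "\<alpha> \<in> F" "clopen A" "A \<inter> \<alpha> ` A = {}"
  shows "\<exists>C. clopen C \<and> C \<subseteq> B \<and> cycle_equiv (swap \<alpha> A) (swap \<phi> C)"
  using assms(2)
proof (induction A rule: clopen_induct)
  case empty
  show ?case by (rule exI[of _ "{}"], unfold swap_empty) (simp only: cycle_equiv_refl F_id open_empty closed_empty empty_subsetI simp_thms)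
next
  case (local x)
  obtain n where n: "P n x \<in> B" using recurrence_ex[of B x] B by blast
  show ?case
  proof (rule exI[of _ "P n -` B"], intro conjI allI impI)
    show "open (P n -` B)" "x \<in> P n -` B" using B(1) open_vimage continuous_P n by auto
    fix V assume V: "clopen V" "V \<subseteq> P n -` B" "V \<subseteq> A"
    let ?C = "P n ` V" and ?\<delta> = "P n \<circ> \<alpha> \<circ> finv (P n)"
    have C: "clopen ?C" "?C \<subseteq> B" using clopen_image_P[OF V(1)] V(2) by auto
    have dis: "V \<inter> \<alpha> ` V = {}" by (rule swap_disjoint_mono[OF assms(3) V(3)])
    have "?\<delta> ` ?C = P n ` \<alpha> ` V" by (simp add: image_image)
    then have "?C \<inter> ?\<delta> ` ?C = {}" using dis by auto
    then have "cycle_equiv (swap ?\<delta> ?C) (swap \<phi> ?C)"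
      using swap_disjoint_mono[OF B(3) C(2)] assms(1) by (intro swap_cycle_equiv_swap C(1)) auto
    moreover have "cycle_equiv (swap ?\<delta> ?C) (swap \<alpha> V)"
      using swap_image_cycle_equiv[OF assms(1) P_in_F V(1) dis, of n] swap_conj[OF assms(1) P_in_F, of n V] by simp
    ultimately have "cycle_equiv (swap \<alpha> V) (swap \<phi> ?C)" using cycle_equiv_sym cycle_equiv_trans by blast
    then show "\<exists>C. clopen C \<and> C \<subseteq> B \<and> cycle_equiv (swap \<alpha> V) (swap \<phi> C)" using C by blast
  qed
next
  case (union V W)
  obtain C where C: "clopen C" "C \<subseteq> B" "cycle_equiv (swap \<alpha> V) (swap \<phi> C)" using union(6) by blast
  obtain C' where C': "clopen C'" "C' \<subseteq> B" "cycle_equiv (swap \<alpha> W) (swap \<phi> C')" using union(7) by blast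
  have "(V \<union> W) \<inter> \<alpha> ` (V \<union> W) = {}" using union(4,5) assms(3) by blast
  then have s: "swap \<alpha> (V \<union> W) = swap \<alpha> V \<circ> swap \<alpha> W" using union assms by (intro swap_union)
  have "cycle_equiv (swap \<alpha> (V \<union> W)) (swap \<phi> ((C - C') \<union> (C' - C)))"
    unfolding s swap_symdiff[OF C(2) C'(2), symmetric] by (rule cycle_equiv_comp[OF C(3) C'(3)])
  moreover have "clopen ((C - C') \<union> (C' - C))" using C(1) C'(1) by (auto simp: open_Diff closed_Diff)
  ultimately show ?case using C C' by (intro exI[of _ "(C - C') \<union> (C' - C)"]) auto
qed

lemma swap_products_to_base:
  assumes "s \<in> swap_products" shows "\<exists>C. clopen C \<and> C \<subseteq> B \<and> cycle_equiv s (swap \<phi> C)"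
  using assms
proof induction
  case id
  show ?case by (rule exI[of _ "{}"], unfold swap_empty) (simp only: cycle_equiv_refl F_id open_empty closed_empty empty_subsetI simp_thms)
next
  case (step \<alpha> A g)
  obtain C where C: "clopen C" "C \<subseteq> B" "cycle_equiv (swap \<alpha> A) (swap \<phi> C)" using swap_to_base[OF step(1-3)] by blast
  obtain C' where C': "clopen C'" "C' \<subseteq> B" "cycle_equiv g (swap \<phi> C')" using step(5) by blast
  have "cycle_equiv (swap \<alpha> A \<circ> g) (swap \<phi> ((C - C') \<union> (C' - C)))"
    unfolding swap_symdiff[OF C(2) C'(2), symmetric] by (rule cycle_equiv_comp[OF C(3) C'(3)])
  moreover have "clopen ((C - C') \<union> (C' - C))" using C(1) C'(1) by (auto simp: open_Diff closed_Diff)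
  moreover have "(C - C') \<union> (C' - C) \<subseteq> B" using C(2) C'(2) by blast
  ultimately show ?case by metis
qed

text \<open>The additive counterpart of \<open>swap_to_base\<close>: translation by a power of
  \<phi> does not change the class of an indicator.\<close>

lemma class_at_base:
  assumes "clopen A" shows "\<exists>C. clopen C \<and> C \<subseteq> B \<and> cls (indicator A) = cls (indicator C)"
  using assms
proof (induction A rule: clopen_induct)
  case empty
  show ?case by (intro exI[of _ "{}"]) simp
next
  case (local x)
  obtain n where n: "P n x \<in> B" using recurrence_ex[of B x] B by blast
  show ?case
  proof (rule exI[of _ "P n -` B"], intro conjI allI impI)
    show "open (P n -` B)" "x \<in> P n -` B" using B(1) open_vimage continuous_P n by auto
    fix V assume V: "clopen V" "V \<subseteq> P n -` B" "V \<subseteq> A"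
    have C: "clopen (P n ` V)" "P n ` V \<subseteq> B" using clopen_image_P[OF V(1)] V(2) by auto
    have "indicator V = (\<lambda>x. indicator (P n ` V) (P n x) :: bit)" by (auto simp: indicator_def fun_eq_iff)
    then have "cls (indicator V) = cls (indicator (P n ` V))"
      unfolding cls_eq_iff using cob_P[OF loc_const_of_clopen[OF C(1)], of n] by simp
    then show "\<exists>C. clopen C \<and> C \<subseteq> B \<and> cls (indicator V) = cls (indicator C)" using C by blast
  qed
next
  case (union V W)
  obtain C where C: "clopen C" "C \<subseteq> B" "cls (indicator V) = cls (indicator C)" using union(6) by blast
  obtain C' where C': "clopen C'" "C' \<subseteq> B" "cls (indicator W) = cls (indicator C')" using union(7) by blast
  let ?E = "(C - C') \<union> (C' - C)"
  have ind: "indicator (V \<union> W) = (\<lambda>x. indicator V x + indicator W x :: bit)"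
    "indicator ?E = (\<lambda>x. indicator C x + indicator C' x :: bit)"
    using indicator_bit_union[OF union(3)] indicator_bit_symdiff[of C C'] by auto
  have "cls (indicator (V \<union> W)) = cls (indicator ?E)"
    unfolding ind using mult_H0[of "indicator V" "indicator W"] mult_H0[of "indicator C" "indicator C'"]
      C C' union(1,2) by (simp add: loc_const_of_clopen)
  moreover have "clopen ?E" using C(1) C'(1) by (auto simp: open_Diff closed_Diff)
  ultimately show ?case using C C' by (intro exI[of _ ?E]) auto
qed

text \<open>\<open>R\<close> is the first return map to \<open>B\<close>, extended by the identity
  so that it belongs to \<open>F\<close>. The last property says that a function unchanged by steps
  outside \<open>B\<close> is constant on the whole excursion from \<open>\<phi> x\<close> to
  \<open>R x\<close>.\<close>

lemma first_return:
  obtains R where "R \<in> F" "\<And>x. R x \<in> B \<longleftrightarrow> x \<in> B"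
    "\<And>f x. (\<And>z. z \<notin> B \<Longrightarrow> f (\<phi> z) = (f z :: bit)) \<Longrightarrow> x \<in> B \<Longrightarrow> f (R x) = f (\<phi> x)"
proof -
  obtain K where K: "K \<ge> 0" "\<And>x. \<exists>k. 0 \<le> k \<and> k \<le> K \<and> P k x \<in> B" using recurrence[of B] B by blast
  \<comment> \<open>The return time is positive, so the starting point in \<open>B\<close> does not
    count as a return.\<close>
  define h where "h x = (LEAST n. 0 < n \<and> P (int n) x \<in> B)" for x
  have "\<exists>n. 0 < n \<and> P (int n) x \<in> B" for x
  proof -
    obtain k where k: "0 \<le> k" "P k (P 1 x) \<in> B" using K(2)[of "P 1 x"] by blast
    then have "P (int (Suc (nat k))) x \<in> B" by (simp add: P_phi add.commute)
    then show ?thesis by blast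
  qed
  from LeastI_ex[OF this] have h: "0 < h x" "P (int (h x)) x \<in> B" for x unfolding h_def by auto
  have less_h: "P (int m) x \<notin> B" if "0 < m" "m < h x" for m x
    using not_less_Least[of m "\<lambda>n. 0 < n \<and> P (int n) x \<in> B"] that unfolding h_def by blast
  have h_eqI: "h x = n" if "0 < n" "P (int n) x \<in> B" "\<And>m. 0 < m \<Longrightarrow> m < n \<Longrightarrow> P (int m) x \<notin> B" for x n
    unfolding h_def by (rule Least_equality) (use that in \<open>auto simp: not_less[symmetric]\<close>)
  have loc_h: "loc_const h"
  proof (rule loc_constI)
    fix x
    obtain W where W: "open W" "x \<in> W" "\<forall>n\<in>{0..h x}. \<forall>z\<in>W. (P (int n) z \<in> B) = (P (int n) x \<in> B)"
      using loc_const_finite_family[of "{0..h x}" "\<lambda>n z. P (int n) z \<in> B" x]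
        loc_const_vimage_comp[OF loc_const_indicator[OF B(1)] continuous_P] by auto
    have "h z = h x" if z: "z \<in> W" for z
    proof (rule h_eqI)
      show "0 < h x" by (rule h)
      show "P (int (h x)) z \<in> B" using W(3) z h(2)[of x] by auto
      fix m assume "0 < m" "m < h x"
      then show "P (int m) z \<notin> B" using W(3) z less_h[of m x] by auto
    qed
    then show "\<exists>V. open V \<and> x \<in> V \<and> (\<forall>z\<in>V. h z = h x)" using W by blast
  qed
  define R where "R x = (if x \<in> B then P (int (h x)) x else x)" for x
  have RB: "R x \<in> B \<longleftrightarrow> x \<in> B" for x by (simp add: R_def h)
  have inj_aux: "\<not> h x < h y" if "x \<in> B" "y \<in> B" "P (int (h x)) x = P (int (h y)) y" for x y
  proof
    assume l: "h x < h y"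
    have "x = P (- int (h x)) (P (int (h y)) y)" using that(3) P_minus(1)[of "int (h x)" x] by simp
    then have "x = P (int (h y - h x)) y" using l by (simp add: P_P of_nat_diff)
    moreover have "P (int (h y - h x)) y \<notin> B" using l h(1)[of x] by (intro less_h) auto
    ultimately show False using that by simp
  qed
  have "bij R"
  proof (rule bijI)
    show "inj R"
    proof (rule injI)
      fix x y assume e: "R x = R y"
      show "x = y"
      proof (cases "x \<in> B")
        case True
        then have y: "y \<in> B" using e RB by metis
        have e': "P (int (h x)) x = P (int (h y)) y" using e True y by (simp add: R_def)
        then have "h x = h y" using inj_aux[OF True y e'] inj_aux[OF y True e'[symmetric]] by simp
        then show ?thesis using e' by simp
      next
        case False
        then have "y \<notin> B" using e RB by metis
        then show ?thesis using e False by (simp add: R_def)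
      qed
    qed
    show "surj R"
    proof -
      have "\<exists>x. R x = b" for b
      proof (cases "b \<in> B")
        case True
        let ?Q = "\<lambda>n. 0 < n \<and> P (- int n) b \<in> B"
        \<comment> \<open>Starting \<open>K + 1\<close> steps before \<open>b\<close> guarantees a
          visit strictly earlier than \<open>b\<close>.\<close>
        obtain k where k: "0 \<le> k" "k \<le> K" "P k (P (- K - 1) b) \<in> B" using K(2)[of "P (- K - 1) b"] by blast
        then have "P (- int (nat (K + 1 - k))) b \<in> B" by (simp add: P_P algebra_simps)
        then have "?Q (nat (K + 1 - k))" using k by auto
        then have g: "?Q (LEAST n. ?Q n)" by (rule LeastI)
        let ?g = "LEAST n. ?Q n"
        let ?x = "P (- int ?g) b"
        have "h ?x = ?g"
        proof (rule h_eqI)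
          show "0 < ?g" using g by blast
          show "P (int ?g) ?x \<in> B" using True by simp
          fix m assume m: "0 < m" "m < ?g"
          then have "\<not> ?Q (?g - m)" by (intro not_less_Least) simp
          then show "P (int m) ?x \<notin> B" using m by (simp add: P_P of_nat_diff algebra_simps)
        qed
        then show ?thesis using g by (intro exI[of _ ?x]) (simp add: R_def)
      next
        case False then show ?thesis by (intro exI[of _ b]) (simp add: R_def)
      qed
      then show ?thesis by (metis surjI)
    qed
  qed
  moreover have "R x = P (if x \<in> B then int (h x) else 0) x" for x by (simp add: R_def)
  moreover have "loc_const (\<lambda>x. if x \<in> B then int (h x) else 0)"
    by (rule loc_const_comp2[OF loc_const_indicator[OF B(1)] loc_h, of "\<lambda>p n. if p then int n else 0"])
  ultimately have "R \<in> F" by (rule F_I)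
  moreover have "f (R x) = f (\<phi> x)" if f: "\<And>z. z \<notin> B \<Longrightarrow> f (\<phi> z) = (f z :: bit)" and x: "x \<in> B" for f x
  proof -
    have "Suc m \<le> h x \<Longrightarrow> f (P (int (Suc m)) x) = f (\<phi> x)" for m
    proof (induction m)
      case 0 then show ?case by simp
    next
      case (Suc m)
      have "f (\<phi> (P (int (Suc m)) x)) = f (P (int (Suc m)) x)" using Suc.prems by (intro f less_h) auto
      then show ?case using Suc P_Suc[of "int (Suc m)" x] by (simp add: add.commute)
    qed
    from this[of "h x - 1"] show ?thesis using h(1)[of x] x by (simp add: R_def)
  qed
  ultimately show ?thesis using RB that by blast
qed

text \<open>If \<open>indicator C\<close> is the coboundary of \<open>f\<close>, then \<open>C\<close> is the symmetric difference of
  \<open>{x \<in> B. f x = 1}\<close> and its preimage under the first return map, and the involutions over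
  these two sets agree modulo 3-cycles.\<close>

lemma swap_coboundary_cycle_products:
  assumes "clopen C" "C \<subseteq> B" "indicator C \<in> cob" shows "swap \<phi> C \<in> cycle_products"
proof -
  obtain f where f: "loc_const f" "(indicator C :: 'x \<Rightarrow> bit) = (\<lambda>x. f (\<phi> x) + f x)"
    using assms(3) by (auto simp: cob_def)
  have fC: "(indicator C x :: bit) = f (\<phi> x) + f x" for x using fun_cong[OF f(2)] .
  have f0: "f (\<phi> z) = f z" if "z \<notin> B" for z
  proof -
    have "z \<notin> C" using that assms(2) by blast
    then have "f (\<phi> z) + f z = 0" using fC[of z] by simp
    then have "f (\<phi> z) + f z + f z = f z" by simp
    then show ?thesis by (simp add: add.assoc)
  qed
  obtain R where R: "R \<in> F" "\<And>x. R x \<in> B \<longleftrightarrow> x \<in> B"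
    "\<And>f x. (\<And>z. z \<notin> B \<Longrightarrow> f (\<phi> z) = (f z :: bit)) \<Longrightarrow> x \<in> B \<Longrightarrow> f (R x) = f (\<phi> x)"
    using first_return by metis
  have fR: "f (R x) = f (\<phi> x)" if "x \<in> B" for x using R(3)[of f x] f0 that by blast
  let ?E = "{x\<in>B. f x = 1}" and ?E' = "{x\<in>B. f (R x) = 1}"
  have cl: "clopen {x. f x = 1}" using loc_const_clopen[OF f(1), of "\<lambda>b. b = 1"] by simp
  have "{x. f (R x) = 1} = R -` {x. f x = 1}" by auto
  then have cl': "clopen {x. f (R x) = 1}"
    using open_vimage[OF conjunct1[OF cl] F_continuous[OF R(1)]] closed_vimage[OF conjunct2[OF cl] F_continuous[OF R(1)]]
    by (simp only: simp_thms)
  have E: "clopen ?E" "clopen ?E'" "?E \<subseteq> B" "?E' \<subseteq> B"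
    using clopen_Int[OF B(1) cl] clopen_Int[OF B(1) cl'] by (auto simp: Int_def)
  have "C = (?E' - ?E) \<union> (?E - ?E')"
  proof -
    have "x \<in> C \<longleftrightarrow> x \<in> (?E' - ?E) \<union> (?E - ?E')" for x
    proof (cases "x \<in> B")
      case True
      have "x \<in> C \<longleftrightarrow> (indicator C x :: bit) = 1" by (auto simp: indicator_def)
      then have "x \<in> C \<longleftrightarrow> f (R x) + f x = 1" using fC[of x] fR[OF True] by simp
      also have "\<dots> \<longleftrightarrow> (f (R x) = 1) \<noteq> (f x = 1)"
        by (rule bit_add_eq_1)
      finally show ?thesis using True by blast
    next
      case False then show ?thesis using assms(2) by auto
    qed
    then show ?thesis by blast
  qed
  then have s: "swap \<phi> C = swap \<phi> ?E' \<circ> swap \<phi> ?E" using swap_symdiff[OF E(4,3)] by simp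
  have dE': "?E' \<inter> \<phi> ` ?E' = {}" by (rule swap_disjoint_mono[OF B(3) E(4)])
  have "R ` ?E' = ?E"
  proof
    show "R ` ?E' \<subseteq> ?E" using R(2) by auto
    show "?E \<subseteq> R ` ?E'"
    proof
      fix y assume y: "y \<in> ?E"
      have "R (finv R y) = y" using R(1) by simp
      then have "finv R y \<in> ?E'" using y R(2)[of "finv R y"] by simp
      then have "R (finv R y) \<in> R ` ?E'" by (rule imageI)
      then show "y \<in> R ` ?E'" using \<open>R (finv R y) = y\<close> by simp
    qed
  qed
  let ?\<delta> = "R \<circ> \<phi> \<circ> finv R"
  have "cycle_equiv (swap ?\<delta> ?E) (swap \<phi> ?E')"
    using swap_image_cycle_equiv[OF phi_in_F R(1) E(2) dE'] swap_conj[OF phi_in_F R(1), of ?E'] \<open>R ` ?E' = ?E\<close> by simp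
  moreover have "?E \<inter> ?\<delta> ` ?E = {}"
  proof -
    have "?\<delta> ` R ` ?E' = R ` \<phi> ` ?E'" using R(1) by (simp add: image_image)
    then have "R ` ?E' \<inter> ?\<delta> ` R ` ?E' = {}" using dE' R(1) by (auto simp: F_inj_iff)
    then show ?thesis unfolding \<open>R ` ?E' = ?E\<close> .
  qed
  then have "cycle_equiv (swap ?\<delta> ?E) (swap \<phi> ?E)"
    using R(1) swap_disjoint_mono[OF B(3) E(3)] by (intro swap_cycle_equiv_swap E(1)) auto
  ultimately have e: "cycle_equiv (swap \<phi> ?E') (swap \<phi> ?E)" using cycle_equiv_sym cycle_equiv_trans by blast
  have dE: "?E \<inter> \<phi> ` ?E = {}" by (rule swap_disjoint_mono[OF B(3) E(3)])
  have "finv (swap \<phi> ?E) = swap \<phi> ?E" using E(1) dE by (intro finv_swap) auto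
  then show ?thesis using e s by (simp only: cycle_equiv_def)
qed

end

lemma base_exists: obtains B where "clopen B" "B \<noteq> {}" "B \<inter> \<phi> ` B = {}"
proof -
  obtain x0 :: 'x where True by blast
  obtain B where "clopen B" "x0 \<in> B" "\<forall>k\<in>{1}. \<forall>y\<in>B. P k y \<notin> B"
    using small_clopen[of "{1}" UNIV x0] by auto
  then show ?thesis by (intro that[of B]) auto
qed

text \<open>Modulo 3-cycles \<alpha> is a swap of \<phi> over some \<open>C\<close> inside a base.
  Its signature is the class of the indicator of \<open>C\<close>, so trivial signature supplies the
  coboundary hypothesis of \<open>swap_coboundary_cycle_products\<close>.\<close>

lemma sgn_kernel_cycle_products: assumes "\<alpha> \<in> F0" "sgn_full \<alpha> = one (H0 \<phi>)" shows "\<alpha> \<in> cycle_products"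
proof -
  obtain B where B: "clopen B" "B \<noteq> {}" "B \<inter> \<phi> ` B = {}" by (rule base_exists)
  have "\<alpha> \<in> swap_products" using assms(1) F0_eq_swap_products by simp
  then obtain C where C: "clopen C" "C \<subseteq> B" "cycle_equiv \<alpha> (swap \<phi> C)" using swap_products_to_base[OF B] by blast
  have "sgn_full \<alpha> = cls (indicator C)"
    using cycle_equiv_sgn[OF C(3)] sgn_swap_phi[OF C(1) swap_disjoint_mono[OF B(3) C(2)]] by simp
  then have "indicator C \<in> cob" using assms(2) cls_eq_one_iff by metis
  then have s: "swap \<phi> C \<in> cycle_products" by (rule swap_coboundary_cycle_products[OF B C(1,2)])
  have "(\<alpha> \<circ> finv (swap \<phi> C)) \<circ> swap \<phi> C \<in> cycle_products" using C(3) by (intro cycle_products_comp[OF _ s]) (simp add: cycle_equiv_def)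
  moreover have "(\<alpha> \<circ> finv (swap \<phi> C)) \<circ> swap \<phi> C = \<alpha>" using C(3) by (auto simp: cycle_equiv_def fun_eq_iff)
  ultimately show ?thesis by simp
qed

theorem D_eq_cycle_products: "D = cycle_products"
  using cycle_products_subset_D sgn_kernel_cycle_products sgn_full_D D_subset_F0 by blast

theorem D_eq_kernel: "D = {\<alpha> \<in> F0. sgn_full \<alpha> = one (H0 \<phi>)}"
  using cycle_products_subset_D sgn_kernel_cycle_products sgn_full_D D_subset_F0 by blast

lemma class_representative:
  assumes "loc_const (f :: 'x \<Rightarrow> bit)"
  obtains C where "clopen C" "C \<inter> \<phi> ` C = {}" "cls f = cls (indicator C)"
proof -
  obtain B where B: "clopen B" "B \<noteq> {}" "B \<inter> \<phi> ` B = {}" by (rule base_exists)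
  have A: "clopen {x. f x = 1}" using loc_const_clopen[OF assms, of "\<lambda>b. b = 1"] by simp
  have "f = indicator {x. f x = 1}" by (auto simp: indicator_def fun_eq_iff)
  then obtain C where "clopen C" "C \<subseteq> B" "cls f = cls (indicator C)" using class_at_base[OF B A] by metis
  then show ?thesis using that swap_disjoint_mono[OF B(3)] by blast
qed

lemma sgn_full_surj:
  assumes "c \<in> carrier (H0 \<phi>)"
  obtains C where "clopen C" "C \<inter> \<phi> ` C = {}" "sgn_full (swap \<phi> C) = c"
proof -
  obtain f where f: "loc_const f" "c = cls f" using assms by (auto simp: carrier_H0)
  obtain C where "clopen C" "C \<inter> \<phi> ` C = {}" "cls f = cls (indicator C)" using class_representative[OF f(1)] .
  then show ?thesis using that sgn_swap_phi f(2) by metis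
qed

section \<open>Existence and uniqueness of the signature\<close>

lemma tau_F0:
  assumes "compact_open_bisection \<phi> U" "tg_range ` U \<inter> tg_source \<phi> ` U = {}"
  shows "tau \<phi> U \<in> F0" "sgn_full (tau \<phi> U) = H0_class \<phi> (indicator (tg_range ` U))"
proof -
  note t = tau_swap[OF assms]
  have d: "tg_range ` U \<inter> tau \<phi> U ` tg_range ` U = {}" using t(3) assms(2) by simp
  show "tau \<phi> U \<in> F0" using swap_F0[OF t(1,2) d] t(4) by simp
  show "sgn_full (tau \<phi> U) = H0_class \<phi> (indicator (tg_range ` U))" using sgn_swap[OF t(1,2) d] t(4) by simp
qed

lemma is_signature_sgn_full: "is_signature \<phi> (restrict sgn_full F0)"
  unfolding is_signature_def
proof (intro conjI allI impI)
  have hom: "restrict sgn_full F0 \<in> hom (index_kernel_group \<phi>) (H0 \<phi>)"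
  proof (rule homI)
    fix x assume "x \<in> carrier (index_kernel_group \<phi>)"
    then have x: "x \<in> F0" "x \<in> F" using F0_subset_F by auto
    show "restrict sgn_full F0 x \<in> carrier (H0 \<phi>)" using x by simp
    fix y assume "y \<in> carrier (index_kernel_group \<phi>)"
    then have y: "y \<in> F0" "y \<in> F" using F0_subset_F by auto
    show "restrict sgn_full F0 (x \<otimes>\<^bsub>index_kernel_group \<phi>\<^esub> y)
        = restrict sgn_full F0 x \<otimes>\<^bsub>H0 \<phi>\<^esub> restrict sgn_full F0 y"
      unfolding mult_index_kernel_group restrict_apply'[OF x(1)] restrict_apply'[OF y(1)]
        restrict_apply'[OF F0_comp[OF x(1) y(1)]] by (rule sgn_full_comp[OF x(2) y(2)])
  qed
  moreover have "restrict sgn_full F0 ` F0 = carrier (H0 \<phi>)"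
  proof (intro equalityI subsetI)
    fix c assume "c \<in> carrier (H0 \<phi>)"
    then obtain C where "clopen C" "C \<inter> \<phi> ` C = {}" "sgn_full (swap \<phi> C) = c" by (rule sgn_full_surj)
    then show "c \<in> restrict sgn_full F0 ` F0" using swap_F0[OF phi_in_F, of C]
      by (intro image_eqI[of _ _ "swap \<phi> C"]) auto
  qed (use hom in \<open>auto simp: hom_def Pi_def\<close>)
  ultimately show "restrict sgn_full F0 \<in> epi (index_kernel_group \<phi>) (H0 \<phi>)" by (simp add: epi_def)
  show "kernel (index_kernel_group \<phi>) (H0 \<phi>) (restrict sgn_full F0) = carrier (commutator_full_group \<phi>)"
    by (auto simp: kernel_def D_eq_kernel)
  show "restrict sgn_full F0 \<in> extensional (carrier (index_kernel_group \<phi>))" by simp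
  fix U assume "compact_open_bisection \<phi> U \<and> tg_range ` U \<inter> tg_source \<phi> ` U = {}"
  then show "restrict sgn_full F0 (tau \<phi> U) = H0_class \<phi> (indicator (tg_range ` U))"
    using tau_F0 by simp
qed

text \<open>The value at \<open>g\<close> is the class of a set \<open>C\<close>, which by the
  prescribed values is also the value at the involution \<open>tau\<close> over \<open>C\<close>.
  Hence \<open>g \<circ> ?t\<close> lies in the prescribed kernel \<open>D\<close>, where
  \<open>sgn_full\<close> is trivial too, and this determines \<open>sgn_full g\<close>.\<close>

lemma signature_unique:
  assumes "is_signature \<phi> s" shows "s = restrict sgn_full F0"
proof
  fix g
  have s: "s \<in> hom (index_kernel_group \<phi>) (H0 \<phi>)" "s ` F0 = carrier (H0 \<phi>)"
    "{x \<in> F0. s x = one (H0 \<phi>)} = D" "s \<in> extensional F0"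
    "\<And>U. compact_open_bisection \<phi> U \<Longrightarrow> tg_range ` U \<inter> tg_source \<phi> ` U = {} \<Longrightarrow>
        s (tau \<phi> U) = H0_class \<phi> (indicator (tg_range ` U))"
    using assms by (auto simp: is_signature_def epi_def kernel_def)
  interpret H: comm_group "H0 \<phi>" by (rule comm_group_H0)
  show "s g = restrict sgn_full F0 g"
  proof (cases "g \<in> F0")
    case True
    then have "s g \<in> carrier (H0 \<phi>)" using s(2) by blast
    then obtain f where f: "loc_const f" "s g = cls f" by (auto simp: carrier_H0)
    obtain C where C: "clopen C" "C \<inter> \<phi> ` C = {}" "cls f = cls (indicator C)" using class_representative[OF f(1)] .
    let ?U = "C \<times> {- 1 :: int}"
    note U = tau_shift[OF C(1,2)]
    have dis: "tg_range ` ?U \<inter> tg_source \<phi> ` ?U = {}" using U(2,3) C(2) by simp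
    let ?t = "tau \<phi> ?U"
    have t: "?t \<in> F0" "sgn_full ?t = cls (indicator C)" "s ?t = cls (indicator C)"
      using tau_F0[OF U(1) dis] s(5)[OF U(1) dis] U(2) by simp_all
    have st: "s ?t = s g" using t(3) C(3) f(2) by simp
    have tt: "?t \<circ> ?t = id"
      using tau_swap[OF U(1) dis] swap_swap[of ?t C] U(2) C(2) U(3) by (auto simp: fun_eq_iff)
    have hom: "s (a \<circ> b) = monoid.mult (H0 \<phi>) (s a) (s b)" if "a \<in> F0" "b \<in> F0" for a b
      using s(1) that by (simp add: hom_def)
    have sid: "s id = one (H0 \<phi>)" using s(3) subgroup.one_closed[OF D_subgroup] by auto
    have "s (g \<circ> ?t) = monoid.mult (H0 \<phi>) (s ?t) (s ?t)" using hom[OF True t(1)] st by simp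
    also have "\<dots> = one (H0 \<phi>)" using hom[OF t(1) t(1)] tt sid by simp
    finally have "g \<circ> ?t \<in> D" using s(3) True t(1) F0_comp by blast
    then have "sgn_full (g \<circ> ?t) = one (H0 \<phi>)" by (rule sgn_full_D)
    moreover have F: "g \<in> F" "?t \<in> F" using True t(1) F0_subset_F by auto
    ultimately have "monoid.mult (H0 \<phi>) (sgn_full g) (sgn_full ?t) = monoid.mult (H0 \<phi>) (sgn_full ?t) (sgn_full ?t)"
      using sgn_full_comp[OF F] sgn_full_comp[OF F(2) F(2)] tt sgn_full_id by simp
    then have "sgn_full g = sgn_full ?t" using F by simp
    then show ?thesis using True t(2) C(3) f(2) by simp
  next
    case False then show ?thesis using extensional_arb[OF s(4) False] unfolding restrict_apply by (simp only: if_False)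
  qed
qed

lemma sgn_map_eq: "\<alpha> \<in> F0 \<Longrightarrow> sgn_map \<phi> \<alpha> = sgn_full \<alpha>"
  using the_equality[of "is_signature \<phi>", OF is_signature_sgn_full signature_unique] by (simp add: sgn_map_def)

end

section \<open>Two-to-one covers\<close>

lemma bit_add_eq_0: "a + b = (0::bit) \<longleftrightarrow> a = b"
  by (cases "a = 0"; cases "b = 0") simp_all

locale double_cover = G: cantor_system \<phi> + H: cantor_system \<psi>
  for \<phi> :: "'x::t2_space \<Rightarrow> 'x" and \<psi> :: "'y::t2_space \<Rightarrow> 'y" +
  fixes \<pi> :: "'x \<Rightarrow> 'y"
  assumes cover: "equivariant_double_cover \<phi> \<psi> \<pi>"
begin

lemma pi_phi: "\<pi> (\<phi> x) = \<psi> (\<pi> x)"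
  and card_fibre: "card (\<pi> -` {y}) = 2"
  and covering: "covering_space UNIV \<pi> UNIV"
  using cover by (auto simp: equivariant_double_cover_def)

lemma continuous_pi: "continuous_on UNIV \<pi>"
  using covering by (simp add: covering_space_def)

lemma surj_pi: "\<exists>x. \<pi> x = y"
proof -
  have "\<pi> -` {y} \<noteq> {}" using card_fibre[of y] by force
  then show ?thesis by blast
qed

lemma pi_P: "\<pi> (G.P n x) = H.P n (\<pi> x)"
proof (induction n rule: int_induct[where k=0])
  case base then show ?case by simp
next
  case (step1 i) then show ?case by (simp add: G.P_Suc H.P_Suc pi_phi)
next
  case (step2 i)
  have "\<psi> (\<pi> (G.P (i - 1) x)) = \<psi> (H.P (i - 1) (\<pi> x))"
    using step2 G.P_Suc[of "i - 1" x] H.P_Suc[of "i - 1" "\<pi> x"] by (simp add: pi_phi)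
  then show ?case using H.F_inj_iff[OF H.phi_in_F] by simp
qed

text \<open>Over a clopen part \<open>V\<close> of an evenly covered set, one sheet gives a section;
  it is closed because it is the compact image of \<open>V\<close> under the local inverse. Over
  disjoint base sets sections can be united without any matching condition.\<close>

lemma clopen_section: "\<exists>S. clopen S \<and> inj_on \<pi> S \<and> \<pi> ` S = UNIV"
proof -
  have "\<exists>S. clopen S \<and> inj_on \<pi> S \<and> \<pi> ` S = A" if "clopen A" for A
    using that
  proof (induction A rule: H.clopen_induct)
    case empty show ?case by (intro exI[of _ "{}"]) simp
  next
    case (local y)
    obtain T v where T: "y \<in> T" "open T" "\<Union>v = \<pi> -` T" "\<And>u. u \<in> v \<Longrightarrow> open u"
      "\<And>u. u \<in> v \<Longrightarrow> \<exists>q. homeomorphism u T \<pi> q"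
      using covering unfolding covering_space_def by (auto dest!: spec[of _ y])
    obtain x where "\<pi> x = y" using surj_pi by blast
    then have "x \<in> \<Union>v" using T(1,3) by simp
    then obtain u where u: "u \<in> v" "x \<in> u" by blast
    obtain q where q: "homeomorphism u T \<pi> q" using T(5)[OF u(1)] by blast
    show ?case
    proof (rule exI[of _ T], intro conjI allI impI T(1,2))
      fix V :: "'y set" assume V: "clopen V" "V \<subseteq> T"
      have S: "u \<inter> \<pi> -` V = q ` V"
      proof (intro equalityI subsetI)
        fix x assume "x \<in> u \<inter> \<pi> -` V"
        then have "x = q (\<pi> x)" "\<pi> x \<in> V" using q by (auto simp: homeomorphism_def)
        then show "x \<in> q ` V" by (rule image_eqI)
      next
        fix x assume "x \<in> q ` V"
        then show "x \<in> u \<inter> \<pi> -` V" using q V(2) by (auto simp: homeomorphism_def)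
      qed
      have "compact (q ` V)"
        by (rule compact_continuous_image[OF continuous_on_subset[OF homeomorphism_cont2[OF q] V(2)] H.clopen_compact])
           (use V in simp)
      then have cl: "closed (u \<inter> \<pi> -` V)" unfolding S by (rule compact_imp_closed)
      have op: "open (u \<inter> \<pi> -` V)"
        using T(4)[OF u(1)] V(1) open_vimage[OF _ continuous_pi] by blast
      have "inj_on \<pi> u" using q by (auto simp: homeomorphism_def inj_on_def) (metis)
      then have "inj_on \<pi> (u \<inter> \<pi> -` V)" by (rule inj_on_subset) blast
      moreover have "\<pi> ` (u \<inter> \<pi> -` V) = V" using q V(2) unfolding homeomorphism_def by blast
      ultimately show "\<exists>S. clopen S \<and> inj_on \<pi> S \<and> \<pi> ` S = V" using cl op by blast
    qed
  next
    case (union V W)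
    obtain S1 S2 where S: "clopen S1" "inj_on \<pi> S1" "\<pi> ` S1 = V" "clopen S2" "inj_on \<pi> S2" "\<pi> ` S2 = W"
      using union(6,7) by blast
    have "inj_on \<pi> (S1 \<union> S2)" unfolding inj_on_Un
      using S(2,3,5,6) union(3) by (simp only: simp_thms) blast
    then show ?case using S by (intro exI[of _ "S1 \<union> S2"]) (auto simp: image_Un)
  qed
  then show ?thesis by simp
qed

lemma fibre_two:
  assumes "inj_on \<pi> S" "\<pi> ` S = UNIV"
  shows "\<exists>s x. s \<in> S \<and> x \<notin> S \<and> \<pi> -` {y} = {s, x}"
proof -
  obtain a b where ab: "\<pi> -` {y} = {a, b}" "a \<noteq> b" using card_fibre[of y] by (auto simp: card_2_iff)
  obtain s where s: "s \<in> S" "\<pi> s = y" using assms(2) by (metis UNIV_I imageE)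
  have "a \<in> \<pi> -` {y}" "b \<in> \<pi> -` {y}" unfolding ab(1) by simp_all
  then have "\<pi> a = y" "\<pi> b = y" by simp_all
  moreover have "s \<in> {a, b}" using s(2) unfolding ab(1)[symmetric] by simp
  ultimately obtain x where x: "\<pi> -` {y} = {s, x}" "x \<noteq> s" "\<pi> x = y" using ab by blast
  have "x \<notin> S" using inj_onD[OF assms(1), of x s] s x by blast
  then show ?thesis using s(1) x(1) by blast
qed

text \<open>The clopen section \<open>S\<close> becomes sheet 0, and \<open>c\<close> records
  whether \<phi> carries the point of \<open>S\<close> over \<open>y\<close> out of
  \<open>S\<close>. As \<phi> maps fibres bijectively to fibres, the other point of the fibre
  behaves in the opposite way, which gives the cocycle formula on both sheets.\<close>

theorem trivialization_exists: "\<exists>T c. clopen_trivialization \<phi> \<psi> \<pi> T c"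
proof -
  obtain S where S: "clopen S" "inj_on \<pi> S" "\<pi> ` S = UNIV" using clopen_section by blast
  note two = fibre_two[OF S(2,3)]
  define t :: "'x \<Rightarrow> bit" where "t x = (if x \<in> S then 0 else 1)" for x
  define T where "T x = (\<pi> x, t x)" for x
  define c :: "'y \<Rightarrow> bit" where "c y = (if y \<in> \<pi> ` (S \<inter> \<phi> -` S) then 0 else 1)" for y
  have t_eq: "t x = t x' \<longleftrightarrow> (x \<in> S \<longleftrightarrow> x' \<in> S)" for x x' by (simp add: t_def)
  have t_inj: "x = x'" if "\<pi> x = \<pi> x'" "x \<in> S \<longleftrightarrow> x' \<in> S" for x x'
  proof -
    obtain s z where "s \<in> S" "z \<notin> S" "\<pi> -` {\<pi> x} = {s, z}" using two by meson
    moreover have "x \<in> \<pi> -` {\<pi> x}" "x' \<in> \<pi> -` {\<pi> x}" using that by auto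
    ultimately show ?thesis using that(2) by auto
  qed
  have "homeomorphic_map euclidean (prod_topology euclidean (discrete_topology UNIV)) T"
  proof (rule continuous_imp_homeomorphic_map)
    have "loc_const t" unfolding t_def
      by (rule loc_const_comp[OF loc_const_indicator[OF S(1)], of "\<lambda>p. if p then 0 else 1"])
    then show "continuous_map euclidean (prod_topology euclidean (discrete_topology UNIV)) T"
      unfolding T_def by (intro continuous_map_pairedI) (simp_all add: loc_const_continuous_map continuous_pi)
    show "compact_space (euclidean :: 'x topology)" using G.compact_space by (simp add: compact_space_def)
    have "Hausdorff_space (euclidean :: 'y topology)"
      unfolding Hausdorff_space_def disjnt_def using hausdorff by (auto simp: Int_commute)
    then show "Hausdorff_space (prod_topology (euclidean :: 'y topology) (discrete_topology (UNIV :: bit set)))"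
      by (simp add: Hausdorff_space_prod_topology)
    show "inj_on T (topspace euclidean)" using t_inj t_eq by (auto simp: inj_on_def T_def)
    have "\<exists>x. T x = (y, a)" for y a
    proof -
      obtain s z where sz: "s \<in> S" "z \<notin> S" "\<pi> -` {y} = {s, z}" using two by meson
      then have "\<pi> s = y" "\<pi> z = y" by blast+
      then have "T s = (y, 0)" "T z = (y, 1)" using sz by (simp_all add: T_def t_def)
      then show ?thesis by (cases "a = 0") auto
    qed
    then show "T ` topspace euclidean = topspace (prod_topology euclidean (discrete_topology UNIV))"
      by (auto simp: image_iff) (metis)
  qed
  moreover have "loc_const c"
  proof -
    have phi_S: "clopen (\<phi> -` S)" using S(1) open_vimage closed_vimage G.continuous_phi by metis
    have closed_img: "closed (\<pi> ` A)" if "closed A" for A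
      by (rule compact_imp_closed[OF compact_continuous_image[OF continuous_on_subset[OF continuous_pi] G.clopen_compact[OF that]]]) simp
    have "closed (\<pi> ` (S \<inter> \<phi> -` S))" "closed (\<pi> ` (S - \<phi> -` S))"
      using S(1) phi_S by (auto intro!: closed_img closed_Diff)
    \<comment> \<open>Since \<pi> maps \<open>S\<close> bijectively onto the base, complements
      within \<open>S\<close> become complements; two complementary closed images are
      clopen.\<close>
    moreover have "- \<pi> ` (S \<inter> \<phi> -` S) = \<pi> ` (S - \<phi> -` S)"
    proof -
      have "y \<notin> \<pi> ` (S \<inter> \<phi> -` S) \<longleftrightarrow> y \<in> \<pi> ` (S - \<phi> -` S)" for y
      proof -
        obtain s where s: "s \<in> S" "y = \<pi> s" using S(3) by (metis UNIV_I imageE)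
        have "\<pi> s \<in> \<pi> ` A \<longleftrightarrow> s \<in> A" if "A \<subseteq> S" for A
          using inj_on_image_mem_iff[OF S(2) s(1) that] .
        from this[of "S \<inter> \<phi> -` S"] this[of "S - \<phi> -` S"] show ?thesis
          unfolding s(2) using s(1) by (simp only: Int_lower1 Diff_subset Int_iff Diff_iff) simp
      qed
      then show ?thesis by (intro equalityI subsetI) (simp_all only: Compl_iff simp_thms)
    qed
    ultimately have "clopen (\<pi> ` (S \<inter> \<phi> -` S))" by (metis open_closed)
    then show ?thesis unfolding c_def
      by (rule loc_const_comp[OF loc_const_indicator, of _ "\<lambda>p. if p then 0 else 1"])
  qed
  moreover have "t (\<phi> x) = t x + c (\<pi> x)" for x
  proof -
    obtain s z where sz: "s \<in> S" "z \<notin> S" "\<pi> -` {\<pi> x} = {s, z}" using two by meson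
    have p: "\<pi> s = \<pi> x" "\<pi> z = \<pi> x" using sz by blast+
    have x: "x = s \<or> x = z" using sz by blast
    have cs: "c (\<pi> x) = 0 \<longleftrightarrow> \<phi> s \<in> S"
    proof -
      have "\<pi> x \<in> \<pi> ` (S \<inter> \<phi> -` S) \<longleftrightarrow> \<phi> s \<in> S"
      proof
        assume "\<pi> x \<in> \<pi> ` (S \<inter> \<phi> -` S)"
        then obtain s' where "s' \<in> S" "\<phi> s' \<in> S" "\<pi> s' = \<pi> s" using p by auto
        then show "\<phi> s \<in> S" using sz(1) S(2) by (metis inj_onD)
      next
        assume "\<phi> s \<in> S"
        then have "\<pi> s \<in> \<pi> ` (S \<inter> \<phi> -` S)" using sz(1) by blast
        then show "\<pi> x \<in> \<pi> ` (S \<inter> \<phi> -` S)" using p by simp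
      qed
      then show ?thesis by (simp add: c_def)
    qed
    have "\<phi> s \<noteq> \<phi> z" using sz(1,2) G.F_inj_iff[OF G.phi_in_F] by metis
    moreover have "\<pi> (\<phi> s) = \<pi> (\<phi> z)" using p by (simp add: pi_phi)
    ultimately have "\<phi> s \<in> S \<longleftrightarrow> \<phi> z \<notin> S" using t_inj by blast
    then show ?thesis using x cs sz(1,2) by (cases "c (\<pi> x) = 0") (auto simp: t_def)
  qed
  ultimately have "clopen_trivialization \<phi> \<psi> \<pi> T c"
    unfolding clopen_trivialization_def loc_const_continuous_map
    by (auto simp: T_def pi_phi)
  then show ?thesis by blast
qed

end

locale trivialized_cover = double_cover \<phi> \<psi> \<pi>
  for \<phi> :: "'x::t2_space \<Rightarrow> 'x" and \<psi> :: "'y::t2_space \<Rightarrow> 'y" and \<pi> :: "'x \<Rightarrow> 'y" +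
  fixes T :: "'x \<Rightarrow> 'y \<times> bit" and c :: "'y \<Rightarrow> bit"
  assumes triv: "clopen_trivialization \<phi> \<psi> \<pi> T c"
begin

section \<open>The deck transformation and the zero section\<close>

definition sheet :: "'x \<Rightarrow> bit" where "sheet x = snd (T x)"

definition deck :: "'x \<Rightarrow> 'x" where "deck x = (THE z. T z = (\<pi> x, sheet x + 1))"

definition sec :: "'y \<Rightarrow> 'x" where "sec y = (THE z. T z = (y, 0))"

lemma T_eq: "T x = (\<pi> x, sheet x)"
  using triv by (auto simp: clopen_trivialization_def sheet_def prod_eq_iff)

lemma T_homeo: "homeomorphic_map euclidean (prod_topology euclidean (discrete_topology UNIV)) T"
  and loc_const_c: "loc_const c"
  and sheet_phi: "sheet (\<phi> x) = sheet x + c (\<pi> x)"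
  using triv by (auto simp: clopen_trivialization_def loc_const_continuous_map sheet_def)
    (metis T_eq sheet_def snd_conv)

lemma T_inj: "T x = T y \<longleftrightarrow> x = y"
  using T_homeo by (auto simp: homeomorphic_eq_everything_map inj_on_def)

lemma T_surj: "\<exists>x. T x = z"
  using T_homeo by (simp add: homeomorphic_eq_everything_map) (metis surjD)

lemma sheet_inj: "\<pi> x = \<pi> z \<Longrightarrow> sheet x = sheet z \<Longrightarrow> x = z"
  using T_inj[of x z] by (simp add: T_eq)

lemma T_deck: "T (deck x) = (\<pi> x, sheet x + 1)"
  unfolding deck_def by (rule theI') (metis T_inj T_surj)

lemma T_sec: "T (sec y) = (y, 0)"
  unfolding sec_def by (rule theI') (metis T_inj T_surj)

lemma pi_deck [simp]: "\<pi> (deck x) = \<pi> x" and sheet_deck [simp]: "sheet (deck x) = sheet x + 1"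
  using T_deck[of x] by (auto simp: T_eq)

lemma pi_sec [simp]: "\<pi> (sec y) = y" and sheet_sec [simp]: "sheet (sec y) = 0"
  using T_sec[of y] by (auto simp: T_eq)

lemma deck_deck [simp]: "deck (deck x) = x"
  by (rule sheet_inj) (simp_all add: add.assoc)

lemma bit_neq_add_1: "a \<noteq> a + (1::bit)" "a + 1 \<noteq> (a::bit)"
  by (metis add_cancel_left_right zero_neq_one)+

lemma deck_neq [simp]: "deck x \<noteq> x" "x \<noteq> deck x"
  using sheet_deck[of x] bit_neq_add_1 by metis+

lemma pi_eq_iff: "\<pi> x = \<pi> z \<longleftrightarrow> z = x \<or> z = deck x"
proof
  assume e: "\<pi> x = \<pi> z"
  have "sheet z = sheet x \<or> sheet z = sheet x + 1"
    by (cases "sheet x = 0"; cases "sheet z = 0") simp_all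
  then show "z = x \<or> z = deck x" using e sheet_inj by (metis pi_deck sheet_deck)
qed auto

lemma sec_cases: "sec (\<pi> x) = x \<or> sec (\<pi> x) = deck x"
  using pi_eq_iff[of x "sec (\<pi> x)"] by simp

lemma deck_phi: "deck (\<phi> x) = \<phi> (deck x)"
  by (rule sheet_inj) (simp_all add: pi_phi sheet_phi ac_simps)

lemma deck_P: "deck (G.P n x) = G.P n (deck x)"
proof (rule sheet_inj)
  show "\<pi> (deck (G.P n x)) = \<pi> (G.P n (deck x))" by (simp add: pi_P)
  have "sheet (G.P n (deck x)) = sheet (G.P n x) + 1"
  proof (induction n rule: int_induct[where k=0])
    case base then show ?case by simp
  next
    case (step1 i)
    show ?case by (simp only: G.P_Suc sheet_phi pi_P pi_deck step1(2)) (simp only: ac_simps)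
  next
    case (step2 i)
    have "sheet (\<phi> (G.P (i - 1) (deck x))) = sheet (\<phi> (G.P (i - 1) x)) + 1"
      using step2(2) G.P_Suc[of "i - 1"] by simp
    then show ?case by (simp add: sheet_phi pi_P)
  qed
  then show "sheet (deck (G.P n x)) = sheet (G.P n (deck x))" by simp
qed

text \<open>A return of the orbit to the fibre would be a period of \<open>\<pi> x\<close>
  downstairs. The two points of a fibre therefore lie on different orbits, and an element of the
  full group can move one while fixing the other.\<close>

lemma deck_not_orbit: "deck x \<noteq> G.P n x"
proof
  assume e: "deck x = G.P n x"
  then have "H.P n (\<pi> x) = \<pi> x" using pi_P[of n x] pi_deck[of x] by simp
  then have "n = 0" by (rule H.free)
  then show False using e by simp
qed

lemma loc_const_sheet: "loc_const sheet"
proof -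
  have "continuous_map euclidean (discrete_topology UNIV) (snd \<circ> T)"
    by (rule continuous_map_compose[OF homeomorphic_imp_continuous_map[OF T_homeo] continuous_map_snd])
  then show ?thesis by (simp add: loc_const_continuous_map sheet_def[abs_def] o_def)
qed

lemma T_inverse:
  obtains S where "continuous_map (prod_topology euclidean (discrete_topology UNIV)) euclidean S" "\<And>x. S (T x) = x"
proof -
  obtain S where "homeomorphic_maps euclidean (prod_topology euclidean (discrete_topology UNIV)) T S"
    using T_homeo homeomorphic_map_maps by blast
  then show ?thesis using that[of S] by (auto simp: homeomorphic_maps_def)
qed

lemma continuous_deck: "continuous_on UNIV deck"
proof -
  obtain S where S: "continuous_map (prod_topology euclidean (discrete_topology UNIV)) euclidean S" "\<And>x. S (T x) = x"
    using T_inverse by blast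
  have "loc_const (\<lambda>x. sheet x + 1)" by (rule loc_const_comp[OF loc_const_sheet])
  then have "continuous_map euclidean (prod_topology euclidean (discrete_topology UNIV)) (\<lambda>x. (\<pi> x, sheet x + 1))"
    by (intro continuous_map_pairedI) (simp_all add: continuous_pi loc_const_continuous_map)
  then have "continuous_map euclidean euclidean (S \<circ> (\<lambda>x. (\<pi> x, sheet x + 1)))" by (rule continuous_map_compose[OF _ S(1)])
  moreover have "S \<circ> (\<lambda>x. (\<pi> x, sheet x + 1)) = deck" using S(2)[of "deck _"] by (simp add: fun_eq_iff T_deck)
  ultimately show ?thesis by simp
qed

lemma continuous_sec: "continuous_on UNIV sec"
proof -
  obtain S where S: "continuous_map (prod_topology euclidean (discrete_topology UNIV)) euclidean S" "\<And>x. S (T x) = x"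
    using T_inverse by blast
  have "continuous_map euclidean (prod_topology euclidean (discrete_topology UNIV)) (\<lambda>y::'y. (y, 0::bit))"
    by (intro continuous_map_pairedI) simp_all
  then have "continuous_map euclidean euclidean (S \<circ> (\<lambda>y. (y, 0)))" by (rule continuous_map_compose[OF _ S(1)])
  moreover have "S \<circ> (\<lambda>y. (y, 0)) = sec" using S(2)[of "sec _"] by (simp add: fun_eq_iff T_sec)
  ultimately show ?thesis by simp
qed

lemma clopen_vimage_pi: "clopen V \<Longrightarrow> clopen (\<pi> -` V)"
  using open_vimage[OF _ continuous_pi] closed_vimage[OF _ continuous_pi] by blast

lemma loc_const_pi: "loc_const f \<Longrightarrow> loc_const (f \<circ> \<pi>)"
  using loc_const_vimage_comp[OF _ continuous_pi] by (simp add: o_def)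

lemma descend:
  assumes "loc_const f" "\<And>x. f (deck x) = f x"
  shows "loc_const (f \<circ> sec)" "(f \<circ> sec) (\<pi> x) = f x"
  using loc_const_vimage_comp[OF assms(1) continuous_sec] sec_cases[of x] assms(2)
  by (auto simp: o_def)

text \<open>The concrete form of \<open>pi_star\<close>: the same displacements, read through \<pi>
  (\<open>pi_star_eq\<close>).\<close>

definition lift :: "('y \<Rightarrow> 'y) \<Rightarrow> 'x \<Rightarrow> 'x" where
  "lift \<alpha> x = G.P (H.disp \<alpha> (\<pi> x)) x"

lemma pi_lift: "\<alpha> \<in> H.F \<Longrightarrow> \<pi> (lift \<alpha> x) = \<alpha> (\<pi> x)"
  using H.F_disp[of \<alpha> "\<pi> x"] by (simp add: lift_def pi_P)

lemma lift_comp: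
  assumes "\<alpha> \<in> H.F" "\<beta> \<in> H.F" shows "lift (\<alpha> \<circ> \<beta>) = lift \<alpha> \<circ> lift \<beta>"
proof
  fix x
  have "lift \<alpha> (lift \<beta> x) = G.P (H.disp \<alpha> (\<beta> (\<pi> x))) (G.P (H.disp \<beta> (\<pi> x)) x)"
    using pi_lift[OF assms(2), of x] by (simp add: lift_def)
  then show "lift (\<alpha> \<circ> \<beta>) x = (lift \<alpha> \<circ> lift \<beta>) x"
    using H.disp_comp[OF assms, of "\<pi> x"] by (simp add: lift_def[of "\<alpha> \<circ> \<beta>"] G.P_P add.commute)
qed

lemma lift_id [simp]: "lift id = id" by (auto simp: lift_def)

lemma disp_lift [simp]: "G.disp (lift \<alpha>) x = H.disp \<alpha> (\<pi> x)"
  by (rule G.disp_eqI) (simp add: lift_def)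

lemma lift_F: assumes "\<alpha> \<in> H.F" shows "lift \<alpha> \<in> G.F"
proof (rule G.F_I)
  show "bij (lift \<alpha>)"
    by (rule o_bij[of "lift (finv \<alpha>)"]) (simp_all add: lift_comp[symmetric] assms H.F_inv H.finv_comp)
  show "lift \<alpha> x = G.P ((H.disp \<alpha> \<circ> \<pi>) x) x" for x by (simp add: lift_def)
  show "loc_const (H.disp \<alpha> \<circ> \<pi>)" by (rule loc_const_pi[OF H.loc_const_disp[OF assms]])
qed

lemma lift_finv: assumes "\<alpha> \<in> H.F" shows "lift (finv \<alpha>) = finv (lift \<alpha>)"
  by (rule G.finv_eqI[symmetric]) (simp_all add: lift_comp[symmetric] assms H.F_inv H.finv_comp lift_F)

lemma lift_inj: assumes "\<alpha> \<in> H.F" "\<beta> \<in> H.F" "lift \<alpha> = lift \<beta>" shows "\<alpha> = \<beta>"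
proof
  fix y show "\<alpha> y = \<beta> y" using pi_lift[OF assms(1), of "sec y"] pi_lift[OF assms(2), of "sec y"] assms(3) by simp
qed

lemma lift_deck: "lift \<alpha> (deck x) = deck (lift \<alpha> x)"
  by (simp add: lift_def deck_P)

text \<open>As the deck transformation commutes with the powers of \<phi>, commuting with it forces
  the displacement of \<beta> to be equal on both points of a fibre. It then descends to a
  displacement on the base, which defines the element to be lifted.\<close>

lemma deck_commuting_is_lift:
  assumes "\<beta> \<in> G.F" "\<And>x. \<beta> (deck x) = deck (\<beta> x)"
  obtains \<alpha> where "\<alpha> \<in> H.F" "\<beta> = lift \<alpha>"
proof -
  have inv: "G.disp \<beta> (deck x) = G.disp \<beta> x" for x
    using assms(2)[of x] G.F_disp[OF assms(1), of x] by (intro G.disp_eqI) (simp add: deck_P)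
  let ?e = "G.disp \<beta> \<circ> sec"
  have e: "loc_const ?e" "?e (\<pi> x) = G.disp \<beta> x" for x
    using descend[OF G.loc_const_disp[OF assms(1)]] inv by auto
  define \<alpha> where "\<alpha> y = H.P (?e y) y" for y
  have pa: "\<pi> (\<beta> x) = \<alpha> (\<pi> x)" for x
    using G.F_disp[OF assms(1), of x] e(2)[of x] by (simp add: \<alpha>_def pi_P)
  have "bij \<alpha>"
  proof (rule bijI)
    show "inj \<alpha>"
    proof (rule injI)
      fix y z assume "\<alpha> y = \<alpha> z"
      then have "\<pi> (\<beta> (sec y)) = \<pi> (\<beta> (sec z))" by (simp add: pa)
      then have "\<beta> (sec z) = \<beta> (sec y) \<or> \<beta> (sec z) = \<beta> (deck (sec y))"
        using pi_eq_iff assms(2) by metis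
      then have "sec z = sec y \<or> sec z = deck (sec y)" using G.F_inj_iff[OF assms(1)] by metis
      then show "y = z" by (metis pi_deck pi_sec)
    qed
    show "surj \<alpha>"
    proof (rule surjI[of _ "\<lambda>y. \<pi> (finv \<beta> (sec y))"])
      fix y show "\<alpha> (\<pi> (finv \<beta> (sec y))) = y" using pa[of "finv \<beta> (sec y)"] assms(1) by simp
    qed
  qed
  then have "\<alpha> \<in> H.F" using \<alpha>_def e(1) by (rule H.F_I)
  moreover have "\<beta> = lift \<alpha>"
  proof
    fix x
    have "H.disp \<alpha> (\<pi> x) = G.disp \<beta> x" by (rule H.disp_eqI) (simp add: \<alpha>_def e(2)[unfolded o_apply])
    then show "\<beta> x = lift \<alpha> x" using G.F_disp[OF assms(1), of x] by (simp add: lift_def)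
  qed
  ultimately show ?thesis by (rule that)
qed

lemma pi_star_eq: assumes "\<alpha> \<in> H.F" shows "pi_star \<phi> \<psi> \<pi> \<alpha> = lift \<alpha>"
proof -
  have "(\<lambda>(x, n). (\<pi> x, n)) -` H.bis \<alpha> = G.bis (lift \<alpha>)"
  proof (intro equalityI subsetI)
    fix g assume "g \<in> (\<lambda>(x, n). (\<pi> x, n)) -` H.bis \<alpha>"
    then obtain x n y where g: "g = (x, n)" "\<pi> x = \<alpha> y" "n = H.disp \<alpha> y" by (cases g) (auto simp: H.bis_def)
    let ?z = "G.P (- n) x"
    have "\<pi> ?z = y" using g H.F_disp[OF assms, of y] by (simp add: pi_P)
    then have "g = (lift \<alpha> ?z, G.disp (lift \<alpha>) ?z)" using g by (simp add: lift_def)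
    then show "g \<in> G.bis (lift \<alpha>)" unfolding G.bis_def by (rule range_eqI)
  next
    fix g assume "g \<in> G.bis (lift \<alpha>)"
    then obtain z where "g = (lift \<alpha> z, G.disp (lift \<alpha>) z)" by (auto simp: G.bis_def)
    then show "g \<in> (\<lambda>(x, n). (\<pi> x, n)) -` H.bis \<alpha>" by (simp add: H.bis_def pi_lift[OF assms])
  qed
  then show ?thesis
    unfolding pi_star_def H.bisection_of_eq[OF assms] using G.theta_bis[OF lift_F[OF assms]] by simp
qed

lemma orb_lift [simp]: "G.orb (lift \<alpha>) x = H.orb \<alpha> (\<pi> x)"
  by (auto simp: G.orb_def H.orb_def pi_P)

lemma lift_F0_iff: assumes "\<alpha> \<in> H.F" shows "lift \<alpha> \<in> G.F0 \<longleftrightarrow> \<alpha> \<in> H.F0"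
proof -
  have "(\<forall>x. perm_index (H.orb \<alpha> (\<pi> x)) = 0) \<longleftrightarrow> (\<forall>y. perm_index (H.orb \<alpha> y) = 0)" by (metis pi_sec)
  then show ?thesis using assms lift_F by (simp add: G.F0_def H.F0_def)
qed

lemma sgn_lift: "G.sgn_full (lift \<alpha>) = G.cls (H.inversions \<alpha> \<circ> \<pi>)"
proof -
  have "G.inversions (lift \<alpha>) = H.inversions \<alpha> \<circ> \<pi>" by (auto simp: G.inversions_def H.inversions_def)
  then show ?thesis by (simp add: G.sgn_full_def)
qed

section \<open>The pullback on cochains and its kernel\<close>

lemma pullback_cob: assumes "b \<in> H.cob" shows "b \<circ> \<pi> \<in> G.cob"
proof -
  obtain g where g: "loc_const g" "b = (\<lambda>y. g (\<psi> y) + g y)" using assms by (auto simp: H.cob_def)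
  then show ?thesis using G.cob_I[OF loc_const_pi[OF g(1)]] by (simp add: o_def pi_phi)
qed

lemma pullback_cls: "H0_pullback \<phi> \<pi> (H.cls f) = G.cls (f \<circ> \<pi>)"
proof -
  have "G.cls (f' \<circ> \<pi>) = G.cls (f \<circ> \<pi>)" if f': "f' \<in> H.cls f" for f'
  proof -
    obtain b where "b \<in> H.cob" "f' = (\<lambda>y. b y + f y)" using f' by (auto simp: H.cls_set)
    then show ?thesis using pullback_cob[of b] by (simp add: G.cls_eq_iff o_def add.assoc)
  qed
  then show ?thesis unfolding H0_pullback_def using H.cls_self[of f] by blast
qed

lemma sheet_coboundary: "c \<circ> \<pi> \<in> G.cob"
proof -
  have "(\<lambda>x. sheet (\<phi> x) + sheet x) = c \<circ> \<pi>" by (auto simp: sheet_phi ac_simps)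
  then show ?thesis using G.cob_I[OF loc_const_sheet] by simp
qed

lemma invariant_const:
  assumes "loc_const u" "\<And>x. u (\<phi> x) = u x" shows "u x = u z"
proof -
  have "u (G.P n x) = u x" for n x
  proof (induction n rule: int_induct[where k=0])
    case (step2 i) then show ?case using assms(2)[of "G.P (i - 1) x"] G.P_Suc[of "i - 1" x] by simp
  qed (simp_all add: G.P_Suc assms(2))
  moreover have "closed {y. u y = u z}" using loc_const_clopen[OF assms(1), of "\<lambda>v. v = u z"] by simp
  ultimately have "{y. u y = u z} = UNIV" by (intro G.minimal_closed) auto
  then show ?thesis by blast
qed

text \<open>If \<open>c\<close> were the coboundary of \<open>h\<close>, then \<open>sheet\<close>
  plus \<open>h \<circ> \<pi>\<close> would be \<phi>-invariant and so constant by minimality,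
  whereas the deck transformation changes it by 1.\<close>

lemma c_not_coboundary: "c \<notin> H.cob"
proof
  assume "c \<in> H.cob"
  then obtain h where h: "loc_const h" "c = (\<lambda>y. h (\<psi> y) + h y)" by (auto simp: H.cob_def)
  let ?u = "\<lambda>x. sheet x + (h \<circ> \<pi>) x"
  have "loc_const ?u" by (rule loc_const_comp2[OF loc_const_sheet loc_const_pi[OF h(1)]])
  moreover have "?u (\<phi> x) = ?u x" for x by (simp add: sheet_phi h(2) pi_phi ac_simps)
  ultimately have "?u (deck x) = ?u x" for x by (rule invariant_const)
  then have "sheet (deck x) = sheet x" for x by simp
  then show False using bit_neq_add_1 by (metis sheet_deck)
qed

text \<open>Let the pullback of \<open>f\<close> be the coboundary of \<open>g\<close>. The sum of
  \<open>g\<close> and \<open>g \<circ> deck\<close> is invariant, hence constant. If it is 0,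
  \<open>g\<close> descends and shows that \<open>f\<close> is a coboundary; if it is 1, then
  \<open>g\<close> plus \<open>sheet\<close> is the function that descends, and the coboundary
  downstairs is \<open>f\<close> plus \<open>c\<close>.\<close>

lemma pullback_kernel:
  assumes "loc_const f"
  shows "f \<circ> \<pi> \<in> G.cob \<longleftrightarrow> f \<in> H.cob \<or> (\<lambda>y. f y + c y) \<in> H.cob"
proof
  assume "f \<circ> \<pi> \<in> G.cob"
  then obtain g where g: "loc_const g" "f \<circ> \<pi> = (\<lambda>x. g (\<phi> x) + g x)" by (auto simp: G.cob_def)
  have fg: "f (\<pi> x) = g (\<phi> x) + g x" for x using fun_cong[OF g(2), of x] by simp
  have g_phi: "g (\<phi> x) = f (\<pi> x) + g x" for x by (simp add: fg add.assoc)
  let ?k = "\<lambda>x. g (deck x) + g x"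
  have kl: "loc_const ?k" by (rule loc_const_comp2[OF loc_const_vimage_comp[OF g(1) continuous_deck] g(1)])
  have k_phi: "?k (\<phi> x) = ?k x" for x
    using g_phi[of x] g_phi[of "deck x"] by (simp add: deck_phi ac_simps)
  have k_const: "?k x = ?k z" for x z by (rule invariant_const[OF kl k_phi])
  show "f \<in> H.cob \<or> (\<lambda>y. f y + c y) \<in> H.cob"
  \<comment> \<open>An arbitrary point serves as test point, as \<open>?k\<close> is
    constant.\<close>
  proof (cases "?k (sec undefined) = 0")
    case True
    then have "g (deck x) + g x = 0" for x using k_const by metis
    then have inv: "g (deck x) = g x" for x by (metis add.assoc add.right_neutral bit_add_self)
    note d = descend[OF g(1) inv]
    have "f y = (g \<circ> sec) (\<psi> y) + (g \<circ> sec) y" for y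
      using fg[of "sec y"] d(2)[of "\<phi> (sec y)"] d(2)[of "sec y"] by (simp add: pi_phi)
    then have "f = (\<lambda>y. (g \<circ> sec) (\<psi> y) + (g \<circ> sec) y)" by (rule ext)
    then show ?thesis using H.cob_I[OF d(1)] by simp
  next
    case False
    then have "?k (sec undefined) = 1" by simp
    then have k1: "g (deck x) + g x = 1" for x using k_const by metis
    let ?g = "\<lambda>x. g x + sheet x"
    have inv: "?g (deck x) = ?g x" for x
    proof -
      have "g (deck x) = g x + 1" using k1[of x] by (metis add.assoc add.commute bit_add_self add.right_neutral)
      then show ?thesis by (simp add: ac_simps)
    qed
    have gl: "loc_const ?g" by (rule loc_const_comp2[OF g(1) loc_const_sheet])
    note d = descend[OF gl inv]
    have "f y + c y = (?g \<circ> sec) (\<psi> y) + (?g \<circ> sec) y" for y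
      using fg[of "sec y"] d(2)[of "\<phi> (sec y)"] d(2)[of "sec y"] sheet_phi[of "sec y"] by (simp add: pi_phi ac_simps)
    then have "(\<lambda>y. f y + c y) = (\<lambda>y. (?g \<circ> sec) (\<psi> y) + (?g \<circ> sec) y)" by (rule ext)
    then show ?thesis using H.cob_I[OF d(1)] by simp
  qed
next
  assume "f \<in> H.cob \<or> (\<lambda>y. f y + c y) \<in> H.cob"
  then show "f \<circ> \<pi> \<in> G.cob"
  proof
    assume "(\<lambda>y. f y + c y) \<in> H.cob"
    from G.cob_add[OF pullback_cob[OF this] sheet_coboundary] show ?thesis by (simp add: o_def add.assoc)
  qed (rule pullback_cob)
qed

section \<open>The transfer and the cokernel of the pullback\<close>

definition transfer :: "('x \<Rightarrow> bit) \<Rightarrow> 'y \<Rightarrow> bit" where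
  "transfer g y = g (sec y) + g (deck (sec y))"

lemma transfer_pi: "transfer g (\<pi> x) = g x + g (deck x)"
  using sec_cases[of x] by (auto simp: transfer_def add.commute)

lemma loc_const_transfer: assumes "loc_const g" shows "loc_const (transfer g)"
  unfolding transfer_def
  by (rule loc_const_comp2[OF loc_const_vimage_comp[OF assms continuous_sec]
      loc_const_vimage_comp[OF loc_const_vimage_comp[OF assms continuous_deck] continuous_sec]])

lemma transfer_add: "transfer (\<lambda>x. f x + g x) = (\<lambda>y. transfer f y + transfer g y)"
  by (auto simp: transfer_def ac_simps)

lemma transfer_coboundary: "transfer (\<lambda>x. g (\<phi> x) + g x) = (\<lambda>y. transfer g (\<psi> y) + transfer g y)"
proof
  fix y
  have "transfer g (\<psi> y) = g (\<phi> (sec y)) + g (\<phi> (deck (sec y)))"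
    using transfer_pi[of g "\<phi> (sec y)"] by (simp add: pi_phi deck_phi)
  then show "transfer (\<lambda>x. g (\<phi> x) + g x) y = transfer g (\<psi> y) + transfer g y"
    by (simp add: transfer_def ac_simps)
qed

lemma transfer_surj: assumes "loc_const f" obtains g where "loc_const g" "transfer g = f"
proof (rule that)
  let ?g = "\<lambda>x. if sheet x = 0 then (f \<circ> \<pi>) x else 0"
  show "loc_const ?g"
    by (rule loc_const_comp2[OF loc_const_sheet loc_const_pi[OF assms], of "\<lambda>a b. if a = 0 then b else 0"])
  show "transfer ?g = f" by (auto simp: transfer_def)
qed

lemma transfer_cob: "g \<in> G.cob \<Longrightarrow> transfer g \<in> H.cob"
  using H.cob_I[OF loc_const_transfer] by (auto simp: G.cob_def transfer_coboundary)

text \<open>Exactness at the upper group. If the fibre sums of \<open>g\<close> form the coboundary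
  of \<open>h\<close>, a function \<open>h'\<close> with fibre sums \<open>h\<close> is used to
  correct \<open>g\<close> within its class to fibre sums zero. Over bits this means equal values on
  both points of each fibre, so the corrected function is pulled back from the base.\<close>

lemma transfer_cob_iff:
  assumes "loc_const g"
  shows "transfer g \<in> H.cob \<longleftrightarrow> (\<exists>f. loc_const f \<and> G.cls g = G.cls (f \<circ> \<pi>))"
proof
  assume "transfer g \<in> H.cob"
  then obtain h where h: "loc_const h" "transfer g = (\<lambda>y. h (\<psi> y) + h y)" by (auto simp: H.cob_def)
  obtain h' where h': "loc_const h'" "transfer h' = h" using transfer_surj[OF h(1)] .
  let ?d = "\<lambda>x. h' (\<phi> x) + h' x"
  let ?g = "\<lambda>x. g x + ?d x"
  have "transfer ?d = transfer g" using h h' by (simp add: transfer_coboundary)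
  then have t0: "transfer ?g y = 0" for y using transfer_add[of g ?d] by simp
  have inv: "?g (deck x) = ?g x" for x
    using t0[of "\<pi> x"] unfolding transfer_pi bit_add_eq_0 by (rule sym)
  have d: "?d \<in> G.cob" by (rule G.cob_I[OF h'(1)])
  have gl: "loc_const ?g" by (rule loc_const_comp2[OF assms G.cob_loc_const[OF d]])
  note e = descend[OF gl inv]
  have "(?g \<circ> sec) \<circ> \<pi> = ?g" using e(2) by (auto simp: fun_eq_iff)
  moreover have "G.cls g = G.cls ?g" unfolding G.cls_eq_iff using d by simp
  ultimately show "\<exists>f. loc_const f \<and> G.cls g = G.cls (f \<circ> \<pi>)" using e(1) by metis
next
  assume "\<exists>f. loc_const f \<and> G.cls g = G.cls (f \<circ> \<pi>)"
  then obtain f where f: "loc_const f" "(\<lambda>x. g x + (f \<circ> \<pi>) x) \<in> G.cob" by (auto simp: G.cls_eq_iff)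
  have "transfer (f \<circ> \<pi>) = (\<lambda>_. 0)" by (auto simp: transfer_def)
  then have "transfer (\<lambda>x. g x + (f \<circ> \<pi>) x) = transfer g" using transfer_add[of g "f \<circ> \<pi>"] by simp
  then show "transfer g \<in> H.cob" using transfer_cob[OF f(2)] by simp
qed

text \<open>The representative is chosen arbitrarily; \<open>transfer_class_cls\<close> shows that
  the choice is immaterial.\<close>

definition transfer_class :: "('x \<Rightarrow> bit) set \<Rightarrow> ('y \<Rightarrow> bit) set" where
  "transfer_class K = H.cls (transfer (SOME g. g \<in> K))"

lemma transfer_class_cls: "transfer_class (G.cls g) = H.cls (transfer g)"
proof -
  have "(SOME g'. g' \<in> G.cls g) \<in> G.cls g" using someI[of "\<lambda>g'. g' \<in> G.cls g", OF G.cls_self] .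
  then obtain b where b: "b \<in> G.cob" "(SOME g'. g' \<in> G.cls g) = (\<lambda>x. b x + g x)" by (auto simp: G.cls_set)
  have "transfer (\<lambda>x. b x + g x) = (\<lambda>y. transfer b y + transfer g y)" by (rule transfer_add)
  then show ?thesis unfolding transfer_class_def b(2) H.cls_eq_iff using transfer_cob[OF b(1)] by (simp add: add.assoc)
qed

lemma transfer_class_hom: "group_hom (H0 \<phi>) (H0 \<psi>) transfer_class"
proof -
  have "transfer_class \<in> hom (H0 \<phi>) (H0 \<psi>)"
    by (rule homI) (auto simp: G.carrier_H0 transfer_class_cls loc_const_transfer G.mult_H0 H.mult_H0 transfer_add)
  then show ?thesis by (simp add: group_hom_def group_hom_axioms_def G.group_H0 H.group_H0)
qed

lemma pullback_image: "H0_pullback \<phi> \<pi> ` carrier (H0 \<psi>) = kernel (H0 \<phi>) (H0 \<psi>) transfer_class"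
proof (intro equalityI subsetI)
  fix K assume "K \<in> H0_pullback \<phi> \<pi> ` carrier (H0 \<psi>)"
  then obtain f where f: "loc_const f" "K = G.cls (f \<circ> \<pi>)" by (auto simp: H.carrier_H0 pullback_cls)
  then have "transfer (f \<circ> \<pi>) \<in> H.cob" using transfer_cob_iff[OF loc_const_pi[OF f(1)]] by blast
  then show "K \<in> kernel (H0 \<phi>) (H0 \<psi>) transfer_class"
    using f by (simp add: kernel_def transfer_class_cls H.cls_eq_one_iff loc_const_pi)
next
  fix K assume "K \<in> kernel (H0 \<phi>) (H0 \<psi>) transfer_class"
  then obtain g where g: "loc_const g" "K = G.cls g" "transfer g \<in> H.cob"
    by (auto simp: kernel_def G.carrier_H0 transfer_class_cls H.cls_eq_one_iff)
  then obtain f where "loc_const f" "K = G.cls (f \<circ> \<pi>)" using transfer_cob_iff[OF g(1)] by metis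
  then have "K = H0_pullback \<phi> \<pi> (H.cls f)" "H.cls f \<in> carrier (H0 \<psi>)" by (simp_all add: pullback_cls)
  then show "K \<in> H0_pullback \<phi> \<pi> ` carrier (H0 \<psi>)" by (rule image_eqI)
qed

lemma transfer_class_surj: "transfer_class ` carrier (H0 \<phi>) = carrier (H0 \<psi>)"
proof (intro equalityI subsetI)
  fix K assume "K \<in> carrier (H0 \<psi>)"
  then obtain f where f: "loc_const f" "K = H.cls f" by (auto simp: H.carrier_H0)
  obtain g where "loc_const g" "transfer g = f" using transfer_surj[OF f(1)] .
  then show "K \<in> transfer_class ` carrier (H0 \<phi>)" using f
    by (intro image_eqI[of _ _ "G.cls g"]) (auto simp: transfer_class_cls)
qed (auto simp: G.carrier_H0 transfer_class_cls loc_const_transfer)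

lemma coker_pullback: "H0 \<phi> Mod (H0_pullback \<phi> \<pi> ` carrier (H0 \<psi>)) \<cong> H0 \<psi>"
  unfolding pullback_image by (rule group_hom.FactGroup_iso[OF transfer_class_hom transfer_class_surj])

end

section \<open>Subgroups containing the lifted 3-cycles\<close>

context cantor_system
begin

text \<open>Describes a 3-cycle by orbit positions relative to the points of \<open>V\<close>, which
  may differ from all three levels. Unlike \<open>cyc\<close> it does not refer to auxiliary maps,
  and it determines \<open>f\<close> completely (\<open>tricyc_unique\<close>).\<close>

definition tricyc :: "('x \<Rightarrow> 'x) \<Rightarrow> int \<Rightarrow> int \<Rightarrow> int \<Rightarrow> 'x set \<Rightarrow> bool" where
  "tricyc f i j k V \<longleftrightarrow>
     (\<forall>v\<in>V. f (P i v) = P j v \<and> f (P j v) = P k v \<and> f (P k v) = P i v) \<and>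
     (\<forall>x. (\<forall>v\<in>V. x \<noteq> P i v \<and> x \<noteq> P j v \<and> x \<noteq> P k v) \<longrightarrow> f x = x)"

lemma tricyc_rotate: "tricyc f i j k V \<Longrightarrow> tricyc f j k i V"
  unfolding tricyc_def by blast

lemma tricyc_unique: assumes "tricyc f i j k V" "tricyc g i j k V" shows "f = g"
proof
  fix x
  show "f x = g x"
  proof (cases "\<forall>v\<in>V. x \<noteq> P i v \<and> x \<noteq> P j v \<and> x \<noteq> P k v")
    case True then show ?thesis using assms by (simp add: tricyc_def)
  next
    case False
    then obtain v where "v \<in> V" "x = P i v \<or> x = P j v \<or> x = P k v" by blast
    then show ?thesis using assms by (auto simp: tricyc_def)
  qed
qed

lemma tricyc_conj:
  assumes "tricyc f i j k V" "\<eta> \<in> F"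
    "\<And>v. v \<in> V \<Longrightarrow> \<eta> (P i v) = P i' v" "\<And>v. v \<in> V \<Longrightarrow> \<eta> (P j v) = P j' v" "\<And>v. v \<in> V \<Longrightarrow> \<eta> (P k v) = P k' v"
  shows "tricyc (\<eta> \<circ> f \<circ> finv \<eta>) i' j' k' V"
proof -
  have inv: "finv \<eta> (P i' v) = P i v" "finv \<eta> (P j' v) = P j v" "finv \<eta> (P k' v) = P k v" if "v \<in> V" for v
    using assms(3-5)[OF that] F_finv(2)[OF assms(2)] by metis+
  have "(\<eta> \<circ> f \<circ> finv \<eta>) x = x" if x: "\<forall>v\<in>V. x \<noteq> P i' v \<and> x \<noteq> P j' v \<and> x \<noteq> P k' v" for x
  proof -
    have "\<forall>v\<in>V. finv \<eta> x \<noteq> P i v \<and> finv \<eta> x \<noteq> P j v \<and> finv \<eta> x \<noteq> P k v"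
      using x assms(3-5) F_finv(1)[OF assms(2), of x] by metis
    then have "f (finv \<eta> x) = finv \<eta> x" using assms(1) by (simp add: tricyc_def)
    then show ?thesis using assms(2) by simp
  qed
  then show ?thesis using assms(1,3-5) inv by (simp add: tricyc_def)
qed

lemma tricyc_shift: "tricyc f i j k (P (- n) ` V) \<longleftrightarrow> tricyc f (i - n) (j - n) (k - n) V"
  by (simp add: tricyc_def P_P)

lemma cyc_tricyc:
  assumes "cyc_ok \<alpha> \<beta> V" "\<And>v. v \<in> V \<Longrightarrow> \<alpha> v = P k v" "\<And>v. v \<in> V \<Longrightarrow> \<beta> v = P j v"
  shows "tricyc (cyc \<alpha> \<beta> V) 0 j k V"
proof -
  show ?thesis unfolding tricyc_def
  proof (intro conjI ballI allI impI)
    fix v assume v: "v \<in> V"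
    show "cyc \<alpha> \<beta> V (P 0 v) = P j v" "cyc \<alpha> \<beta> V (P j v) = P k v" "cyc \<alpha> \<beta> V (P k v) = P 0 v"
      using cyc_apply(1-3)[OF assms(1) v] assms(2,3)[OF v] by simp_all
  next
    fix x assume x: "\<forall>v\<in>V. x \<noteq> P 0 v \<and> x \<noteq> P j v \<and> x \<noteq> P k v"
    show "cyc \<alpha> \<beta> V x = x"
    proof (rule cyc_apply(4)[OF assms(1)])
      show "x \<notin> V" "x \<notin> \<alpha> ` V" "x \<notin> \<beta> ` V" using x assms(2,3) by auto
    qed
  qed
qed

lemma local_cyc_ok:
  assumes "i \<noteq> 0" "j \<noteq> 0" "i \<noteq> j" "open U" "z \<in> U"
  obtains V where "clopen V" "z \<in> V" "V \<subseteq> U" "cyc_ok (P j) (P i) V"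
proof -
  obtain V where V: "clopen V" "z \<in> V" "V \<subseteq> U" "\<forall>k\<in>{i, j, j - i}. \<forall>y\<in>V. P k y \<notin> V"
    using small_clopen[of "{i, j, j - i}" U z] assms by auto
  have "V \<inter> P j ` V = {}" "V \<inter> P i ` V = {}" using V(4) by auto
  moreover have "P j ` V \<inter> P i ` V = {}"
  proof -
    have False if "y \<in> V" "y' \<in> V" "P j y = P i y'" for y y'
    proof -
      have "P (j - i) y = y'" using that(3) by (metis P_P P_minus(1) add.commute uminus_add_conv_diff)
      then show False using V(4) that by blast
    qed
    then show ?thesis by blast
  qed
  ultimately show ?thesis using that V by (simp add: cyc_ok_def)
qed

lemma cyc_ok_mono: "cyc_ok \<alpha> \<beta> V \<Longrightarrow> clopen W \<Longrightarrow> W \<subseteq> V \<Longrightarrow> cyc_ok \<alpha> \<beta> W"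
  unfolding cyc_ok_def by blast

text \<open>Provides an element of the commutator subgroup with a prescribed effect on finitely many
  points. The third position \<open>P j z\<close> of the 3-cycle is chosen off \<open>S\<close>, and
  the set carrying it is shrunk until all three levels avoid \<open>S\<close>.\<close>

lemma local_cyc:
  assumes "i \<noteq> 0" "finite S" "z \<notin> S" "P i z \<notin> S"
  obtains \<delta> where "\<delta> \<in> D" "\<delta> z = P i z" "\<And>s. s \<in> S \<Longrightarrow> \<delta> s = s"
proof -
  have "finite ((\<lambda>k. P k z) -` S)" by (rule finite_vimageI[OF assms(2)]) (simp add: inj_def)
  then have "finite ((\<lambda>k. P k z) -` S \<union> {0, i})" by simp
  then obtain j where j: "j \<notin> (\<lambda>k. P k z) -` S \<union> {0, i}" using ex_new_if_finite[OF infinite_UNIV_int] by blast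
  let ?U = "- (S \<union> P (- i) ` S \<union> P (- j) ` S)"
  have "open ?U" using assms(2) by (intro open_Compl finite_imp_closed) simp
  moreover have "z \<in> ?U" using assms(3,4) j by auto
  ultimately obtain V where V: "clopen V" "z \<in> V" "V \<subseteq> ?U" "cyc_ok (P j) (P i) V"
    using local_cyc_ok[of i j ?U z] assms(1) j by auto
  have "cyc (P j) (P i) V s = s" if "s \<in> S" for s
  proof (rule cyc_apply(4)[OF V(4)])
    show "s \<notin> V" using V(3) that by blast
    show "s \<notin> P j ` V"
    proof
      assume "s \<in> P j ` V"
      then obtain v where "v \<in> V" "s = P j v" by blast
      then have "v \<in> P (- j) ` S" using that by (metis P_minus(1) image_eqI)
      then show False using V(3) \<open>v \<in> V\<close> by blast
    qed
    show "s \<notin> P i ` V"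
    proof
      assume "s \<in> P i ` V"
      then obtain v where "v \<in> V" "s = P i v" by blast
      then have "v \<in> P (- i) ` S" using that by (metis P_minus(1) image_eqI)
      then show False using V(3) \<open>v \<in> V\<close> by blast
    qed
  qed
  then show ?thesis using that cyc_D[OF V(4)] cyc_apply(1)[OF V(4,2)] by blast
qed

text \<open>The supports of \<zeta> and \<delta> meet only in \<open>A\<close>, and both maps push
  \<open>A\<close> off itself. As for two permutations with one common moved point, the commutator
  is then a 3-cycle, here from \<open>a\<close> to \<open>\<zeta> a\<close> to
  \<open>\<delta> a\<close>.\<close>

lemma commutator_apply:
  assumes "\<zeta> \<in> F" "\<delta> \<in> F" "\<And>z. z \<notin> A \<Longrightarrow> \<zeta> z = z \<or> \<delta> z = z" "\<And>z. z \<in> A \<Longrightarrow> \<zeta> z \<notin> A \<and> \<delta> z \<notin> A"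
  defines "f \<equiv> \<zeta> \<circ> \<delta> \<circ> finv \<zeta> \<circ> finv \<delta>"
  shows "a \<in> A \<Longrightarrow> f a = \<zeta> a" "a \<in> A \<Longrightarrow> f (\<zeta> a) = \<delta> a" "a \<in> A \<Longrightarrow> f (\<delta> a) = a"
    "z \<notin> A \<Longrightarrow> z \<notin> \<zeta> ` A \<Longrightarrow> z \<notin> \<delta> ` A \<Longrightarrow> f z = z"
proof -
  note fz = F_finv[OF assms(1)] and fd = F_finv[OF assms(2)]
  have iz: "finv \<zeta> z = z" if "\<zeta> z = z" for z using fz(2)[of z] that by simp
  have id: "finv \<delta> z = z" if "\<delta> z = z" for z using fd(2)[of z] that by simp
  have nz: "finv \<zeta> a \<notin> A" "finv \<delta> a \<notin> A" if "a \<in> A" for a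
    using assms(4)[of "finv \<zeta> a"] assms(4)[of "finv \<delta> a"] that fz(1) fd(1) by auto
  {
    assume a: "a \<in> A"
    have ne: "\<zeta> a \<noteq> a" "\<delta> a \<noteq> a" "\<zeta> (\<zeta> a) \<noteq> \<zeta> a" "\<delta> (\<delta> a) \<noteq> \<delta> a"
      using assms(4)[OF a] a F_inj_iff[OF assms(1)] F_inj_iff[OF assms(2)] by metis+
    let ?u = "finv \<delta> a"
    have "\<delta> ?u \<noteq> ?u" using nz(2)[OF a] a fd(1)[of a] by metis
    then have "\<zeta> ?u = ?u" using assms(3)[OF nz(2)[OF a]] by blast
    then show "f a = \<zeta> a" using iz fd by (simp add: f_def)
    have "\<delta> (\<zeta> a) = \<zeta> a" using assms(3)[of "\<zeta> a"] assms(4)[OF a] ne(3) by blast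
    moreover have "\<zeta> (\<delta> a) = \<delta> a" using assms(3)[of "\<delta> a"] assms(4)[OF a] ne(4) by blast
    ultimately show "f (\<zeta> a) = \<delta> a" using id fz by (simp add: f_def)
    let ?b = "finv \<zeta> a"
    have "\<zeta> ?b \<noteq> ?b" using nz(1)[OF a] a fz(1)[of a] by metis
    then have "\<delta> ?b = ?b" using assms(3)[OF nz(1)[OF a]] by blast
    then show "f (\<delta> a) = a" using fz fd by (simp add: f_def)
  }
  assume z: "z \<notin> A" "z \<notin> \<zeta> ` A" "z \<notin> \<delta> ` A"
  show "f z = z"
  proof (cases "\<delta> z = z")
    case True
    let ?v = "finv \<zeta> z"
    have v: "?v \<notin> A" using z(2) fz(1)[of z] by (metis image_eqI)
    show ?thesis
    proof (cases "\<zeta> ?v = ?v")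
      case True
      then have "?v = z" using fz(1)[of z] by simp
      then show ?thesis using id[OF \<open>\<delta> z = z\<close>] \<open>\<delta> z = z\<close> fz(1)[of z] by (simp add: f_def)
    next
      case False
      then have "\<delta> ?v = ?v" using assms(3)[OF v] by blast
      then show ?thesis using id[OF \<open>\<delta> z = z\<close>] fz(1)[of z] by (simp add: f_def)
    qed
  next
    case False
    then have zz: "\<zeta> z = z" using assms(3)[OF z(1)] by blast
    let ?u = "finv \<delta> z"
    have "?u \<notin> A" using z(3) fd(1)[of z] by (metis image_eqI)
    moreover have "\<delta> ?u \<noteq> ?u" using False fd(1)[of z] by metis
    ultimately have "\<zeta> ?u = ?u" using assms(3) by blast
    then show ?thesis using iz fd(1)[of z] zz by (simp add: f_def)
  qed
qed

end

lemma disjoint_from_union3: "x \<in> A \<union> B \<union> C \<Longrightarrow> Z \<inter> A = {} \<Longrightarrow> Z \<inter> B = {} \<Longrightarrow> Z \<inter> C = {} \<Longrightarrow> x \<notin> Z"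
  by blast

context trivialized_cover
begin

lemma lift_tricyc:
  assumes "\<alpha> \<in> H.F" "H.tricyc \<alpha> i j k V"
  shows "G.tricyc (lift \<alpha>) i j k (\<pi> -` V)"
proof -
  have 1: "lift \<alpha> (G.P m v) = G.P n v" if "\<alpha> (H.P m (\<pi> v)) = H.P n (\<pi> v)" for m n v
  proof -
    have "H.disp \<alpha> (\<pi> (G.P m v)) = n - m" using that by (intro H.disp_eqI) (simp add: pi_P H.P_P)
    then show ?thesis by (simp add: lift_def G.P_P)
  qed
  have "lift \<alpha> x = x" if x: "\<forall>v\<in>\<pi> -` V. x \<noteq> G.P i v \<and> x \<noteq> G.P j v \<and> x \<noteq> G.P k v" for x
  proof -
    have "\<forall>v\<in>V. \<pi> x \<noteq> H.P m v" if "\<forall>v\<in>\<pi> -` V. x \<noteq> G.P m v" for m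
    proof (intro ballI notI)
      fix v assume "v \<in> V" "\<pi> x = H.P m v"
      then have "G.P (- m) x \<in> \<pi> -` V" by (simp add: pi_P)
      then show False using that by force
    qed
    then have "\<alpha> (\<pi> x) = \<pi> x" using assms(2) x by (simp add: H.tricyc_def)
    then have "H.disp \<alpha> (\<pi> x) = 0" by (intro H.disp_eqI) simp
    then show ?thesis by (simp add: lift_def)
  qed
  moreover have "lift \<alpha> (G.P i v) = G.P j v" "lift \<alpha> (G.P j v) = G.P k v" "lift \<alpha> (G.P k v) = G.P i v"
    if "\<pi> v \<in> V" for v
    using assms(2) that by (intro 1; simp add: H.tricyc_def)+
  ultimately show ?thesis by (simp add: G.tricyc_def)
qed

lemma lift_D_subset: assumes "\<alpha> \<in> H.D" shows "lift \<alpha> \<in> G.D"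
proof -
  have F: "\<alpha> \<in> H.F0" "\<alpha> \<in> H.F" using assms H.D_subset_F0 H.F0_subset_F by blast+
  have "H.inversions \<alpha> \<in> H.cob" using H.sgn_full_D[OF assms] by (simp add: H.sgn_full_def H.cls_eq_one_iff)
  then have "G.sgn_full (lift \<alpha>) = one (H0 \<phi>)" by (simp add: sgn_lift G.cls_eq_one_iff pullback_cob)
  then show ?thesis using F lift_F0_iff by (simp add: G.D_eq_kernel)
qed

lemma separate_family:
  fixes f g :: "'i \<Rightarrow> 'a::topological_space \<Rightarrow> 'b::t2_space"
  assumes "finite I" "\<And>i. i \<in> I \<Longrightarrow> continuous_on UNIV (f i) \<and> continuous_on UNIV (g i) \<and> f i x \<noteq> g i x"
  shows "\<exists>N. open N \<and> x \<in> N \<and> (\<forall>i\<in>I. f i ` N \<inter> g i ` N = {})"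
  using assms
proof (induction I)
  case empty show ?case by (intro exI[of _ UNIV]) auto
next
  case (insert i I)
  obtain N where N: "open N" "x \<in> N" "\<forall>i\<in>I. f i ` N \<inter> g i ` N = {}" using insert.IH insert.prems by (metis insertCI)
  have "continuous_on UNIV (f i)" "continuous_on UNIV (g i)" "f i x \<noteq> g i x" using insert.prems by auto
  then obtain N' where N': "open N'" "x \<in> N'" "f i ` N' \<inter> g i ` N' = {}" by (rule separate_images)
  show ?case
  proof (intro exI[of _ "N \<inter> N'"] conjI ballI)
    show "open (N \<inter> N')" "x \<in> N \<inter> N'" using N N' by auto
    fix l assume "l \<in> insert i I"
    then show "f l ` (N \<inter> N') \<inter> g l ` (N \<inter> N') = {}" using N(3) N'(3) by blast
  qed
qed

definition germ :: "('x \<Rightarrow> 'x) set \<Rightarrow> 'x \<Rightarrow> int \<Rightarrow> int \<Rightarrow> int \<Rightarrow> bool" where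
  "germ L z i j k \<longleftrightarrow> (\<exists>N. open N \<and> z \<in> N \<and> (\<forall>V. clopen V \<longrightarrow> V \<subseteq> N \<longrightarrow> (\<exists>f\<in>L. G.tricyc f i j k V)))"

context
  fixes L :: "('x \<Rightarrow> 'x) set"
  assumes L_subset: "L \<subseteq> G.D"
    and L_comp: "\<And>f g. f \<in> L \<Longrightarrow> g \<in> L \<Longrightarrow> f \<circ> g \<in> L"
    and L_finv: "\<And>f. f \<in> L \<Longrightarrow> finv f \<in> L"
    and L_lift: "\<And>\<delta>. \<delta> \<in> H.D \<Longrightarrow> lift \<delta> \<in> L"
begin

lemma germ_rotate: "germ L z i j k \<Longrightarrow> germ L z j k i"
  unfolding germ_def using G.tricyc_rotate by metis

lemma germ_shift: assumes "germ L z i j k" shows "germ L (G.P n z) (i - n) (j - n) (k - n)"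
proof -
  obtain N where N: "open N" "z \<in> N" "\<And>V. clopen V \<Longrightarrow> V \<subseteq> N \<Longrightarrow> \<exists>f\<in>L. G.tricyc f i j k V"
    using assms unfolding germ_def by metis
  show ?thesis unfolding germ_def
  proof (rule exI[of _ "G.P n ` N"], intro conjI allI impI)
    show "open (G.P n ` N)" "G.P n z \<in> G.P n ` N" using N G.open_image_P by auto
    fix V assume V: "clopen V" "V \<subseteq> G.P n ` N"
    have "clopen (G.P (- n) ` V)" "G.P (- n) ` V \<subseteq> N" using G.clopen_image_P[OF V(1)] V(2) by auto
    then show "\<exists>f\<in>L. G.tricyc f (i - n) (j - n) (k - n) V" using N(3) G.tricyc_shift by metis
  qed
qed

text \<open>Conjugation by the lift of a local 3-cycle downstairs that moves position
  \<open>i\<close> to \<open>i'\<close> and fixes the positions \<open>j\<close> and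
  \<open>k\<close>. The effect on positions at \<open>z\<close> persists in a neighbourhood.\<close>

lemma germ_replace:
  assumes "germ L z i j k" "i' \<noteq> i" "i' \<noteq> j" "i' \<noteq> k" "i \<noteq> j" "i \<noteq> k"
  shows "germ L z i' j k"
proof -
  obtain N where N: "open N" "z \<in> N" "\<And>V. clopen V \<Longrightarrow> V \<subseteq> N \<Longrightarrow> \<exists>f\<in>L. G.tricyc f i j k V"
    using assms(1) unfolding germ_def by metis
  obtain \<delta> where \<delta>: "\<delta> \<in> H.D" "\<delta> (H.P i (\<pi> z)) = H.P (i' - i) (H.P i (\<pi> z))"
    "\<And>s. s \<in> {H.P j (\<pi> z), H.P k (\<pi> z)} \<Longrightarrow> \<delta> s = s"
    using H.local_cyc[of "i' - i" "{H.P j (\<pi> z), H.P k (\<pi> z)}" "H.P i (\<pi> z)"] assms(2-6) by (auto simp: H.P_P)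
  have \<delta>F: "\<delta> \<in> H.F" using \<delta>(1) H.D_subset_F by blast
  have ld: "loc_const (\<lambda>x. G.disp (lift \<delta>) (G.P m x))" for m
    by (rule loc_const_vimage_comp[OF G.loc_const_disp[OF lift_F[OF \<delta>F]] G.continuous_P])
  obtain N' where N': "open N'" "z \<in> N'"
    "\<forall>m\<in>{i, j, k}. \<forall>x\<in>N'. G.disp (lift \<delta>) (G.P m x) = G.disp (lift \<delta>) (G.P m z)"
    using loc_const_finite_family[of "{i, j, k}" "\<lambda>m x. G.disp (lift \<delta>) (G.P m x)" z] ld by auto
  have dz: "G.disp (lift \<delta>) (G.P i z) = i' - i" "G.disp (lift \<delta>) (G.P j z) = 0" "G.disp (lift \<delta>) (G.P k z) = 0"
    using \<delta>(2,3) by (simp_all add: pi_P H.disp_eqI)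
  have dx: "lift \<delta> (G.P i x) = G.P i' x" "lift \<delta> (G.P j x) = G.P j x" "lift \<delta> (G.P k x) = G.P k x" if "x \<in> N'" for x
    using N'(3) dz that G.F_disp[OF lift_F[OF \<delta>F]] by (simp_all add: G.P_P)
  show ?thesis unfolding germ_def
  proof (rule exI[of _ "N \<inter> N'"], intro conjI allI impI)
    show "open (N \<inter> N')" "z \<in> N \<inter> N'" using N N' by auto
    fix V assume V: "clopen V" "V \<subseteq> N \<inter> N'"
    then obtain f where f: "f \<in> L" "G.tricyc f i j k V" using N(3)[of V] by blast
    have "G.tricyc (lift \<delta> \<circ> f \<circ> finv (lift \<delta>)) i' j k V"
      by (rule G.tricyc_conj[OF f(2) lift_F[OF \<delta>F]]) (use V(2) dx in auto)
    moreover have "lift \<delta> \<circ> f \<circ> finv (lift \<delta>) \<in> L" by (intro L_comp L_finv L_lift \<delta>(1) f(1))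
    ultimately show "\<exists>f\<in>L. G.tricyc f i' j k V" by blast
  qed
qed

text \<open>Replacing positions one at a time could produce collisions between old and new ones. The
  detour through \<open>a\<close>, \<open>a + 1\<close>, \<open>a + 2\<close>, larger than all six
  given positions, avoids them.\<close>

lemma germ_any:
  assumes "germ L z i j k" "i \<noteq> j" "i \<noteq> k" "j \<noteq> k" "i' \<noteq> j'" "i' \<noteq> k'" "j' \<noteq> k'"
  shows "germ L z i' j' k'"
proof -
  define b where "b = Max {i, j, k, i', j', k'}"
  define a where "a = b + 1"
  have "m \<le> b" if "m \<in> {i, j, k, i', j', k'}" for m
    unfolding b_def by (rule Max_ge[OF _ that]) simp
  then have a: "m < a" if "m \<in> {i, j, k, i', j', k'}" for m
    using that unfolding a_def by (simp only: zless_add1_eq le_less)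
  note A = a[of i] a[of j] a[of k] a[of i'] a[of j'] a[of k']
  have "germ L z a j k" by (rule germ_replace[OF assms(1)]) (use A assms in auto)
  from germ_rotate[OF this] have "germ L z (a + 1) k a" by (rule germ_replace) (use A assms in auto)
  from germ_rotate[OF this] have "germ L z (a + 2) a (a + 1)" by (rule germ_replace) (use A assms in auto)
  from germ_rotate[OF this] have "germ L z i' (a + 1) (a + 2)" by (rule germ_replace) (use A assms in auto)
  from germ_rotate[OF this] have "germ L z j' (a + 2) i'" by (rule germ_replace) (use A assms in auto)
  from germ_rotate[OF this] have "germ L z k' i' j'" by (rule germ_replace) (use A assms in auto)
  from germ_rotate[OF this] show ?thesis .
qed

text \<open>The property is open by definition, and by \<open>germ_shift\<close> and
  \<open>germ_any\<close> the set of points with the standard positions 0, 1, 2 is invariant under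
  \<phi>. Its complement is a closed invariant set missing \<open>z\<close>, hence empty by
  minimality.\<close>

lemma germ_everywhere:
  assumes "germ L z i j k" "i \<noteq> j" "i \<noteq> k" "j \<noteq> k" "i' \<noteq> j'" "i' \<noteq> k'" "j' \<noteq> k'"
  shows "germ L z' i' j' k'"
proof -
  let ?Z = "{w. \<not> germ L w 0 1 2}"
  have "open {w. germ L w 0 1 2}"
  proof (subst open_subopen, intro ballI)
    fix w assume "w \<in> {w. germ L w 0 1 2}"
    then obtain N where N: "open N" "w \<in> N" "\<forall>V. clopen V \<longrightarrow> V \<subseteq> N \<longrightarrow> (\<exists>f\<in>L. G.tricyc f 0 1 2 V)"
      unfolding germ_def by blast
    have "N \<subseteq> {w. germ L w 0 1 2}" unfolding germ_def using N by blast
    then show "\<exists>N. open N \<and> w \<in> N \<and> N \<subseteq> {w. germ L w 0 1 2}" using N(1,2) by blast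
  qed
  moreover have "?Z = - {w. germ L w 0 1 2}" by auto
  ultimately have "closed ?Z" by (simp add: closed_def)
  moreover have "G.P n w \<in> ?Z" if "w \<in> ?Z" for w n
  proof (rule ccontr)
    assume "G.P n w \<notin> ?Z"
    then have "germ L (G.P (- n) (G.P n w)) (0 - - n) (1 - - n) (2 - - n)" by (intro germ_shift) simp
    then have "germ L w n (1 + n) (2 + n)" by simp
    then have "germ L w 0 1 2" by (rule germ_any) auto
    then show False using that by simp
  qed
  moreover have "germ L z 0 1 2" by (rule germ_any[OF assms(1-4)]) auto
  ultimately have "?Z = {}" using G.minimal_closed[of ?Z] by blast
  then have "germ L z' 0 1 2" by blast
  then show ?thesis by (rule germ_any) (use assms in auto)
qed

text \<open>Near each point an arbitrary 3-cycle is given by three fixed positions and so coincides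
  with an element supplied by the germ there. Gluing puts all 3-cycles into \<open>L\<close>, and
  these generate \<open>G.D\<close>.\<close>

lemma germ_imp_full:
  assumes "germ L z i j k" "i \<noteq> j" "i \<noteq> k" "j \<noteq> k" "id \<in> L"
  shows "L = G.D"
proof
  have cyc_L: "G.cyc \<alpha> \<beta> A \<in> L" if ok: "G.cyc_ok \<alpha> \<beta> A" for \<alpha> \<beta> A
  proof -
    note d = G.cyc_okD[OF ok]
    show ?thesis using d(3)
    proof (induction A rule: G.clopen_induct)
      case empty
      have "G.cyc \<alpha> \<beta> {} = id" by (simp add: G.cyc_def)
      then show ?case using assms(5) by (simp only:)
    next
      case (local x)
      obtain N1 where N1: "open N1" "x \<in> N1" "\<forall>z\<in>N1. \<alpha> z = G.P (G.disp \<alpha> x) z" using G.F_local[OF d(1)] by blast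
      obtain N2 where N2: "open N2" "x \<in> N2" "\<forall>z\<in>N2. \<beta> z = G.P (G.disp \<beta> x) z" using G.F_local[OF d(2)] by blast
      let ?m = "G.disp \<alpha> x" and ?n = "G.disp \<beta> x"
      have ax: "\<alpha> x = G.P ?m x" "\<beta> x = G.P ?n x" using N1 N2 by auto
      have im: "\<alpha> x \<in> \<alpha> ` A" "\<beta> x \<in> \<beta> ` A" using local by (auto intro: imageI)
      have "\<alpha> x \<noteq> x" "\<beta> x \<noteq> x" "\<alpha> x \<noteq> \<beta> x" using im local d(4-6) by (metis disjoint_iff)+
      then have mn: "0 \<noteq> ?n" "0 \<noteq> ?m" "?n \<noteq> ?m" using ax by auto
      have "germ L x 0 ?n ?m" by (rule germ_everywhere[OF assms(1-4) mn])
      then obtain N where N: "open N" "x \<in> N" "\<forall>V. clopen V \<longrightarrow> V \<subseteq> N \<longrightarrow> (\<exists>f\<in>L. G.tricyc f 0 ?n ?m V)"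
        unfolding germ_def by blast
      show ?case
      proof (rule exI[of _ "N \<inter> N1 \<inter> N2"], intro conjI allI impI)
        show "open (N \<inter> N1 \<inter> N2)" "x \<in> N \<inter> N1 \<inter> N2" using N N1 N2 by auto
        fix V assume V: "clopen V" "V \<subseteq> N \<inter> N1 \<inter> N2" "V \<subseteq> A"
        have "V \<subseteq> N" using V(2) by blast
        then obtain f where f: "f \<in> L" "G.tricyc f 0 ?n ?m V" using N(3) V(1) by blast
        have "G.tricyc (G.cyc \<alpha> \<beta> V) 0 ?n ?m V"
          by (rule G.cyc_tricyc[OF G.cyc_ok_mono[OF ok V(1,3)]]) (use V(2) N1(3) N2(3) in blast)+
        then have "G.cyc \<alpha> \<beta> V = f" using f(2) by (rule G.tricyc_unique)
        then show "G.cyc \<alpha> \<beta> V \<in> L" using f(1) by simp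
      qed
    next
      case (union V W)
      have VW: "V \<union> W \<subseteq> A" using union(4,5) by blast
      have okU: "G.cyc_ok \<alpha> \<beta> (V \<union> W)" using G.cyc_ok_mono[OF ok _ VW] union(1,2) by (simp add: closed_Un open_Un)
      have okV: "G.cyc_ok \<alpha> \<beta> V" and okW: "G.cyc_ok \<alpha> \<beta> W" using G.cyc_ok_mono[OF ok] union(1,2,4,5) by blast+
      have im: "\<alpha> ` V \<inter> \<alpha> ` W = {}" "\<beta> ` V \<inter> \<beta> ` W = {}"
        using union(3) d(1,2) by (auto simp: G.F_inj_iff)
      note dU = G.cyc_okD(4-6)[OF okU]
      have dis: "V \<inter> \<alpha> ` W = {}" "V \<inter> \<beta> ` W = {}" "W \<inter> \<alpha> ` V = {}" "W \<inter> \<beta> ` V = {}"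
        "\<alpha> ` V \<inter> \<beta> ` W = {}" "\<alpha> ` W \<inter> \<beta> ` V = {}"
        using dU unfolding image_Un by blast+
      have fixV: "G.cyc \<alpha> \<beta> V x = x" if "x \<in> W \<union> \<alpha> ` W \<union> \<beta> ` W" for x
      proof (rule G.cyc_apply(4)[OF okV])
        show "x \<notin> V" by (rule disjoint_from_union3[OF that union(3) dis(1,2)])
        show "x \<notin> \<alpha> ` V" by (rule disjoint_from_union3[OF that _ im(1) dis(5)]) (use dis(3) in blast)
        show "x \<notin> \<beta> ` V" by (rule disjoint_from_union3[OF that _ _ im(2)]) (use dis(4,6) in blast)+
      qed
      have fixW: "G.cyc \<alpha> \<beta> W x = x" if "x \<in> V \<union> \<alpha> ` V \<union> \<beta> ` V" for x
      proof (rule G.cyc_apply(4)[OF okW])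
        show "x \<notin> W" by (rule disjoint_from_union3[OF that _ dis(3,4)]) (use union(3) in blast)
        show "x \<notin> \<alpha> ` W" by (rule disjoint_from_union3[OF that _ _ dis(6)]) (use dis(1) im(1) in blast)+
        show "x \<notin> \<beta> ` W" by (rule disjoint_from_union3[OF that]) (use dis(2,5) im(2) in blast)+
      qed
      have "G.cyc \<alpha> \<beta> V \<circ> G.cyc \<alpha> \<beta> W = G.cyc \<alpha> \<beta> (V \<union> W)"
      proof (rule G.cyc_eqI[OF okU])
        fix x
        show "(G.cyc \<alpha> \<beta> V \<circ> G.cyc \<alpha> \<beta> W) x = \<beta> x" if "x \<in> V \<union> W"
          using that fixV fixW G.cyc_apply(1)[OF okV] G.cyc_apply(1)[OF okW] by auto
        show "(G.cyc \<alpha> \<beta> V \<circ> G.cyc \<alpha> \<beta> W) (\<beta> x) = \<alpha> x" if "x \<in> V \<union> W"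
          using that fixV fixW G.cyc_apply(2)[OF okV] G.cyc_apply(2)[OF okW] by auto
        show "(G.cyc \<alpha> \<beta> V \<circ> G.cyc \<alpha> \<beta> W) (\<alpha> x) = x" if "x \<in> V \<union> W"
          using that fixV fixW G.cyc_apply(3)[OF okV] G.cyc_apply(3)[OF okW] by auto
        show "(G.cyc \<alpha> \<beta> V \<circ> G.cyc \<alpha> \<beta> W) x = x"
          if "x \<notin> V \<union> W" "x \<notin> \<alpha> ` (V \<union> W)" "x \<notin> \<beta> ` (V \<union> W)"
          using that by (simp add: image_Un G.cyc_apply(4)[OF okV] G.cyc_apply(4)[OF okW])
      qed
      then show ?case using L_comp[OF union(6,7)] by simp
    qed
  qed
  have "f \<in> L" if "f \<in> G.cycle_products" for f
    using that
  proof induction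
    case id show ?case by (rule assms(5))
  next
    case (step \<alpha> \<beta> A g) show ?case by (rule L_comp[OF cyc_L[OF step(1)] step(3)])
  qed
  then show "G.D \<subseteq> L" using G.D_eq_cycle_products by blast
qed (rule L_subset)

end

end

lemma (in cantor_system) tricyc_moved:
  assumes "tricyc f i j k A" "f z \<noteq> z" shows "\<exists>v\<in>A. z = P i v \<or> z = P j v \<or> z = P k v"
  using assms unfolding tricyc_def by blast

context trivialized_cover
begin

section \<open>A single-sheet 3-cycle from a non-commuting element\<close>

lemma finite_fibre: "finite (\<pi> -` {y})"
  using card_fibre[of y] by (intro card_ge_0_finite) simp

lemma clopen_image_pi: assumes "clopen A" shows "clopen (\<pi> ` A)"
proof -
  have "\<pi> ` A = sec -` (A \<union> deck -` A)"
  proof (intro equalityI subsetI)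
    fix y assume "y \<in> \<pi> ` A"
    then obtain x where "x \<in> A" "y = \<pi> x" by blast
    then show "y \<in> sec -` (A \<union> deck -` A)" using sec_cases[of x] by auto
  next
    fix y assume "y \<in> sec -` (A \<union> deck -` A)"
    then have "sec y \<in> A \<or> deck (sec y) \<in> A" by simp
    then show "y \<in> \<pi> ` A" by (metis image_eqI pi_deck pi_sec)
  qed
  moreover have "open (sec -` (A \<union> deck -` A))" "closed (sec -` (A \<union> deck -` A))"
    using assms by (auto intro!: open_vimage closed_vimage open_Un closed_Un continuous_sec continuous_deck)
  ultimately show ?thesis by simp
qed

text \<open>By freeness at most one of the steps 1, 2, 3 leads to \<open>z\<close>; two others
  remain.\<close>

lemma two_steps_avoiding:
  obtains i j :: int where "i \<noteq> 0" "j \<noteq> 0" "i \<noteq> j" "H.P i y \<noteq> z" "H.P j y \<noteq> z"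
proof (cases "H.P 1 y = z")
  case True
  then have "H.P 2 y \<noteq> z" "H.P 3 y \<noteq> z" using H.P_eq_P_iff[of 1 y 2] H.P_eq_P_iff[of 1 y 3] by auto
  then show ?thesis using that[of 2 3] by simp
next
  case False
  show ?thesis
  proof (cases "H.P 2 y = z")
    case True
    then have "H.P 3 y \<noteq> z" using H.P_eq_P_iff[of 2 y 3] by auto
    then show ?thesis using that[of 1 3] False by simp
  next
    case False
    then show ?thesis using that[of 1 2] \<open>H.P 1 y \<noteq> z\<close> by simp
  qed
qed

text \<open>As \<open>\<alpha> (deck x) \<noteq> deck (\<alpha> x)\<close>, the support of the \<open>\<alpha>\<close>-conjugate of a small lifted
  3-cycle at \<open>\<pi> x\<close> meets that of a suitable lifted 3-cycle at \<open>\<pi> (\<alpha> x)\<close> in a single sheet, so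
  their commutator is a 3-cycle living on one sheet.\<close>

lemma starting_germ:
  fixes L :: "('x \<Rightarrow> 'x) set"
  assumes L_subset: "L \<subseteq> G.D"
    and L_comp: "\<And>f g. f \<in> L \<Longrightarrow> g \<in> L \<Longrightarrow> f \<circ> g \<in> L"
    and L_finv: "\<And>f. f \<in> L \<Longrightarrow> finv f \<in> L"
    and L_lift: "\<And>\<delta>. \<delta> \<in> H.D \<Longrightarrow> lift \<delta> \<in> L"
    and \<alpha>: "\<alpha> \<in> L" "\<alpha> (deck x) \<noteq> deck (\<alpha> x)"
  shows "\<exists>m k. germ L (\<alpha> x) 0 m k \<and> 0 \<noteq> m \<and> 0 \<noteq> k \<and> m \<noteq> k"
proof -
  have \<alpha>F: "\<alpha> \<in> G.F" using \<alpha>(1) L_subset G.D_subset_F by blast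
  note fa = G.F_finv[OF \<alpha>F]
  let ?y = "\<pi> x" and ?x0 = "\<alpha> x"
  \<comment> \<open>The point that \<alpha> maps to \<open>deck ?x0\<close>. As \<alpha> does not
    commute with \<open>deck\<close> at \<open>x\<close>, it lies outside the fibre of
    \<open>x\<close>, and the steps \<open>i\<close>, \<open>j\<close> are chosen so that the
    3-cycle at \<open>?y\<close> misses its fibre as well.\<close>
  let ?w = "finv \<alpha> (deck ?x0)"
  have "?w \<noteq> x" "?w \<noteq> deck x" using \<alpha>(2) fa(1)[of "deck ?x0"] deck_neq(1)[of ?x0] by metis+
  then have wy: "\<pi> ?w \<noteq> ?y" using pi_eq_iff[of x ?w] by metis
  obtain i j where ij: "i \<noteq> 0" "j \<noteq> 0" "i \<noteq> j" "H.P i ?y \<noteq> \<pi> ?w" "H.P j ?y \<noteq> \<pi> ?w"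
    by (rule two_steps_avoiding)
  define E where "E = (\<lambda>s. H.P s ?y) ` {0, i, j}"
  \<comment> \<open>Support, as seen from the single point \<open>x\<close>, of the
    \<alpha>-conjugate of the lifted 3-cycle at \<open>?y\<close>; it contains \<open>?x0\<close>
    but not \<open>deck ?x0\<close>.\<close>
  define S where "S = \<alpha> ` (\<pi> -` E)"
  have wE: "\<pi> ?w \<notin> E" using wy ij(4,5) by (auto simp: E_def)
  have S_iff: "z \<in> S \<longleftrightarrow> \<pi> (finv \<alpha> z) \<in> E" for z
    by (simp add: S_def G.image_F[OF \<alpha>F])
  have "finite (\<pi> -` E)"
    by (subst vimage_eq_UN) (simp add: E_def finite_fibre)
  then have finS: "finite S" by (simp add: S_def)
  have finK: "finite ((\<lambda>k. G.P k z) -` S)" for z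
    by (rule finite_vimageI[OF finS]) (simp add: inj_def)
  \<comment> \<open>Steps to be avoided: those leading from \<open>?x0\<close> or from its deck
    image into \<open>S\<close>, and the trivial step.\<close>
  define K where "K = (\<lambda>k. G.P k ?x0) -` S \<union> (\<lambda>k. G.P k (deck ?x0)) -` S \<union> {0}"
  have "finite K" by (simp add: K_def finK)
  then obtain k where k: "k \<notin> K" using ex_new_if_finite[OF infinite_UNIV_int] by blast
  have "finite (insert k K)" using \<open>finite K\<close> by simp
  then obtain l where l: "l \<notin> insert k K" using ex_new_if_finite[OF infinite_UNIV_int] by blast
  \<comment> \<open>The lifted 3-cycle at the fibre of \<open>?x0\<close> moves six points; these
    maps produce from \<open>?x0\<close> the five others, none of which lies in
    \<open>S\<close>.\<close>
  define Hs where "Hs = {deck, G.P k, G.P l, G.P k \<circ> deck, G.P l \<circ> deck}"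
  have Hs_cont: "continuous_on UNIV h" if "h \<in> Hs" for h
    using that continuous_on_compose2[OF G.continuous_P continuous_deck]
    by (auto simp: Hs_def continuous_deck G.continuous_P o_def)
  have Hs_S: "\<pi> (finv \<alpha> (h ?x0)) \<notin> E" if "h \<in> Hs" for h
    using that k l wE unfolding S_iff[symmetric] Hs_def K_def
    by (auto simp: S_iff)
  obtain N1 where N1: "open N1" "x \<in> N1"
    "\<forall>p\<in>Hs \<times> {0, i, j}. (\<lambda>z. \<pi> (finv \<alpha> (fst p (\<alpha> z)))) ` N1 \<inter> (\<lambda>z. H.P (snd p) (\<pi> z)) ` N1 = {}"
  proof -
    have "\<exists>N. open N \<and> x \<in> N \<and> (\<forall>p\<in>Hs \<times> {0, i, j}. (\<lambda>z. \<pi> (finv \<alpha> (fst p (\<alpha> z)))) ` N \<inter> (\<lambda>z. H.P (snd p) (\<pi> z)) ` N = {})"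
    proof (rule separate_family)
      fix p assume p: "p \<in> Hs \<times> {0, i, j}"
      have "continuous_on UNIV (\<lambda>z. fst p (\<alpha> z))"
        by (rule continuous_on_compose2[OF Hs_cont G.F_continuous[OF \<alpha>F]]) (use p in auto)
      then have "continuous_on UNIV (\<lambda>z. finv \<alpha> (fst p (\<alpha> z)))"
        by (rule continuous_on_compose2[OF G.F_continuous[OF G.F_inv[OF \<alpha>F]]]) simp
      then have "continuous_on UNIV (\<lambda>z. \<pi> (finv \<alpha> (fst p (\<alpha> z))))"
        by (rule continuous_on_compose2[OF continuous_pi]) simp
      moreover have "continuous_on UNIV (\<lambda>z. H.P (snd p) (\<pi> z))"
        by (rule continuous_on_compose2[OF H.continuous_P continuous_pi]) simp
      moreover have "\<pi> (finv \<alpha> (fst p (\<alpha> x))) \<noteq> H.P (snd p) (\<pi> x)"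
      proof -
        have "H.P (snd p) (\<pi> x) \<in> E" using p by (auto simp: E_def)
        moreover have "\<pi> (finv \<alpha> (fst p (\<alpha> x))) \<notin> E" using p by (intro Hs_S) auto
        ultimately show ?thesis by metis
      qed
      ultimately show "continuous_on UNIV (\<lambda>z. \<pi> (finv \<alpha> (fst p (\<alpha> z)))) \<and>
          continuous_on UNIV (\<lambda>z. H.P (snd p) (\<pi> z)) \<and> \<pi> (finv \<alpha> (fst p (\<alpha> x))) \<noteq> H.P (snd p) (\<pi> x)"
        by blast
    qed (simp add: Hs_def)
    then show ?thesis using that by blast
  qed
  have k0: "k \<noteq> 0" "l \<noteq> 0" "k \<noteq> l" using k l by (auto simp: K_def)
  obtain W0 where W0: "clopen W0" "?y \<in> W0" "H.cyc_ok (H.P j) (H.P i) W0"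
    using H.local_cyc_ok[OF ij(1-3) open_UNIV UNIV_I] by metis
  obtain W1 where W1: "clopen W1" "\<pi> ?x0 \<in> W1" "H.cyc_ok (H.P l) (H.P k) W1"
    using H.local_cyc_ok[OF k0 open_UNIV UNIV_I] by metis
  have "loc_const (\<lambda>z. G.disp \<alpha> (G.P s z))" for s
    by (rule loc_const_vimage_comp[OF G.loc_const_disp[OF \<alpha>F] G.continuous_P])
  then obtain N2 where N2: "open N2" "x \<in> N2"
    "\<forall>s\<in>{0, i}. \<forall>z\<in>N2. G.disp \<alpha> (G.P s z) = G.disp \<alpha> (G.P s x)"
    using loc_const_finite_family[of "{0, i}" "\<lambda>s z. G.disp \<alpha> (G.P s z)" x] by auto
  obtain N3 where N3: "open N3" "x \<in> N3" "\<And>z. z \<in> N3 \<Longrightarrow> sheet z = sheet x"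
    using loc_constE[OF loc_const_sheet, of x] by metis
  \<comment> \<open>Position of \<open>\<alpha> (G.P i z)\<close> relative to
    \<open>\<alpha> z\<close> for \<open>z\<close> near \<open>x\<close>.\<close>
  define m where "m = G.disp \<alpha> (G.P i x) + i - G.disp \<alpha> x"
  have \<alpha>m: "\<alpha> (G.P i z) = G.P m (\<alpha> z)" if "z \<in> N2" for z
    using N2(3) that G.F_disp[OF \<alpha>F, of z] G.F_disp[OF \<alpha>F, of "G.P i z"] by (simp add: m_def G.P_P)
  have mk: "0 \<noteq> m" "m \<noteq> k"
  proof -
    have "G.P i x \<noteq> x" using ij(1) G.free[of i x] by blast
    then have "\<alpha> (G.P i x) \<noteq> \<alpha> x" by (simp add: G.F_inj_iff[OF \<alpha>F])
    then show "0 \<noteq> m" using \<alpha>m[OF N2(2)] by auto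
    have "G.P m ?x0 \<in> S" unfolding \<alpha>m[OF N2(2), symmetric] S_iff using fa by (simp add: E_def pi_P)
    then show "m \<noteq> k" using k by (auto simp: K_def)
  qed
  let ?N = "N1 \<inter> N2 \<inter> N3 \<inter> \<pi> -` W0 \<inter> \<alpha> -` \<pi> -` W1"
  have "open (\<pi> -` W0)" "open (\<alpha> -` \<pi> -` W1)"
    using W0(1) W1(1) clopen_vimage_pi open_vimage[OF _ G.F_continuous[OF \<alpha>F]] by auto
  then have N: "open ?N" "x \<in> ?N" using N1 N2 N3 W0 W1 by auto
  have "\<exists>f\<in>L. G.tricyc f 0 m k A" if A: "clopen A" "A \<subseteq> \<alpha> ` ?N" for A
  proof -
    define A' where "A' = finv \<alpha> ` A"
    have A': "clopen A'" unfolding A'_def by (rule G.clopen_image_F[OF G.F_inv[OF \<alpha>F] A(1)])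
    have A'N: "A' \<subseteq> ?N"
    proof
      fix z assume "z \<in> A'"
      then obtain a where "a \<in> A" "z = finv \<alpha> a" unfolding A'_def by blast
      then obtain n where "n \<in> ?N" "a = \<alpha> n" using A(2) by blast
      then have "z = n" using \<open>z = finv \<alpha> a\<close> fa(2) by simp
      then show "z \<in> ?N" using \<open>n \<in> ?N\<close> by simp
    qed
    have cycle_products': "a \<in> A \<longleftrightarrow> finv \<alpha> a \<in> A'" for a
    proof
      assume "finv \<alpha> a \<in> A'"
      then obtain a' where "a' \<in> A" "finv \<alpha> a = finv \<alpha> a'" unfolding A'_def by blast
      then show "a \<in> A" using fa(1) by metis
    qed (simp add: A'_def)
    have A'A: "\<alpha> z \<in> A \<longleftrightarrow> z \<in> A'" for z using cycle_products'[of "\<alpha> z"] fa by simp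
    let ?V = "\<pi> ` A'" and ?W = "\<pi> ` A"
    have V: "clopen ?V" "?V \<subseteq> W0" using clopen_image_pi[OF A'] A'N by auto
    have W: "clopen ?W" "?W \<subseteq> W1"
    proof -
      show "clopen ?W" by (rule clopen_image_pi[OF A(1)])
      show "?W \<subseteq> W1" using A(2) by auto
    qed
    have okV: "H.cyc_ok (H.P j) (H.P i) ?V" by (rule H.cyc_ok_mono[OF W0(3) V])
    have okW: "H.cyc_ok (H.P l) (H.P k) ?W" by (rule H.cyc_ok_mono[OF W1(3) W])
    define \<gamma> where "\<gamma> = lift (H.cyc (H.P j) (H.P i) ?V)"
    define \<delta> where "\<delta> = lift (H.cyc (H.P l) (H.P k) ?W)"
    have \<gamma>: "\<gamma> \<in> L" "G.tricyc \<gamma> 0 i j (\<pi> -` ?V)"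
      unfolding \<gamma>_def by (intro L_lift H.cyc_D okV, intro lift_tricyc H.cyc_F okV H.cyc_tricyc refl)
    have \<delta>: "\<delta> \<in> L" "G.tricyc \<delta> 0 k l (\<pi> -` ?W)"
      unfolding \<delta>_def by (intro L_lift H.cyc_D okW, intro lift_tricyc H.cyc_F okW H.cyc_tricyc refl)
    define \<zeta> where "\<zeta> = \<alpha> \<circ> \<gamma> \<circ> finv \<alpha>"
    have \<zeta>L: "\<zeta> \<in> L" unfolding \<zeta>_def by (intro L_comp L_finv \<gamma>(1) \<alpha>(1))
    have F: "\<zeta> \<in> G.F" "\<delta> \<in> G.F" using \<zeta>L \<delta>(1) L_subset G.D_subset_F by blast+
    have \<zeta>a: "\<zeta> a = G.P m a" if "a \<in> A" for a
    proof -
      let ?z = "finv \<alpha> a"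
      have z: "?z \<in> A'" using cycle_products' that by blast
      then have "\<gamma> ?z = G.P i ?z" using \<gamma>(2) by (simp add: G.tricyc_def)
      then show ?thesis using \<alpha>m[of ?z] z A'N fa(1)[of a] by (auto simp: \<zeta>_def)
    qed
    have \<delta>a: "\<delta> a = G.P k a" "\<delta> (G.P k a) = G.P l a" if "a \<in> A" for a
      using \<delta>(2) that by (simp_all add: G.tricyc_def)
    have h2: "\<zeta> a \<notin> A \<and> \<delta> a \<notin> A" if a: "a \<in> A" for a
    proof
      show "\<zeta> a \<notin> A"
      proof
        let ?z = "finv \<alpha> a"
        assume "\<zeta> a \<in> A"
        have z: "?z \<in> A'" using cycle_products' a by blast
        then have "\<gamma> ?z = G.P i ?z" using \<gamma>(2) by (simp add: G.tricyc_def)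
        then have "G.P i ?z \<in> A'" using \<open>\<zeta> a \<in> A\<close> A'A by (simp add: \<zeta>_def)
        then have "H.P i (\<pi> ?z) \<in> ?V" by (metis image_eqI pi_P)
        moreover have "H.P i (\<pi> ?z) \<in> H.P i ` ?V" using z by blast
        ultimately show False using H.cyc_okD(5)[OF okV] by blast
      qed
      show "\<delta> a \<notin> A"
      proof
        assume "\<delta> a \<in> A"
        then have "H.P k (\<pi> a) \<in> ?W" using \<delta>a(1)[OF a] by (metis image_eqI pi_P)
        moreover have "H.P k (\<pi> a) \<in> H.P k ` ?W" using a by blast
        ultimately show False using H.cyc_okD(5)[OF okW] by blast
      qed
    qed
    \<comment> \<open>A point outside \<open>A\<close> moved by both maps is \<open>h a\<close> for
      some \<open>h\<close> in \<open>Hs\<close> and some \<open>a\<close> in \<open>A\<close>,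
      while its \<alpha>-preimage lies over one of the three levels of \<open>?V\<close>; the choice
      of \<open>N1\<close> excludes this.\<close>
    have h1: "\<zeta> z = z \<or> \<delta> z = z" if z: "z \<notin> A" for z
    proof (rule ccontr)
      assume "\<not> (\<zeta> z = z \<or> \<delta> z = z)"
      then have mv: "\<zeta> z \<noteq> z" "\<delta> z \<noteq> z" by auto
      obtain v where v: "\<pi> v \<in> ?W" "z = G.P 0 v \<or> z = G.P k v \<or> z = G.P l v"
        using G.tricyc_moved[OF \<delta>(2) mv(2)] by auto
      obtain a where a: "a \<in> A" "\<pi> a = \<pi> v" using v(1) by (metis imageE)
      have "v = a \<or> v = deck a" using pi_eq_iff[of a v] a(2) by simp
      moreover have "z \<noteq> a" using z a(1) by blast
      ultimately have "z = deck a \<or> z = G.P k a \<or> z = G.P l a \<or> z = (G.P k \<circ> deck) a \<or> z = (G.P l \<circ> deck) a"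
        using v(2) by auto
      then have "\<exists>h\<in>Hs. z = h a" unfolding Hs_def by blast
      then obtain h where h: "h \<in> Hs" "z = h a" by blast
      let ?u = "finv \<alpha> z"
      have "\<gamma> ?u \<noteq> ?u"
      proof
        assume "\<gamma> ?u = ?u"
        then have "\<zeta> z = z" using fa(1) by (simp add: \<zeta>_def)
        then show False using mv(1) by simp
      qed
      then obtain v' where v': "\<pi> v' \<in> ?V" "?u = G.P 0 v' \<or> ?u = G.P i v' \<or> ?u = G.P j v'"
        using G.tricyc_moved[OF \<gamma>(2) \<open>\<gamma> ?u \<noteq> ?u\<close>] by auto
      obtain x' where x': "x' \<in> A'" "\<pi> x' = \<pi> v'" using v'(1) by (metis imageE)
      obtain s where s: "s \<in> {0, i, j}" "\<pi> ?u = H.P s (\<pi> x')"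
        using v'(2) x'(2) by (metis insertCI pi_P)
      let ?x'' = "finv \<alpha> a"
      have x'': "?x'' \<in> A'" using cycle_products' a(1) by blast
      have "\<pi> (finv \<alpha> (h (\<alpha> ?x''))) = H.P s (\<pi> x')" using s(2) h(2) fa(1)[of a] by simp
      moreover have "x' \<in> N1" "?x'' \<in> N1" using x'(1) x'' A'N by auto
      moreover have "(\<lambda>z. \<pi> (finv \<alpha> (h (\<alpha> z)))) ` N1 \<inter> (\<lambda>z. H.P s (\<pi> z)) ` N1 = {}"
        using N1(3)[rule_format, of "(h, s)"] h(1) s(1) by simp
      ultimately show False by (metis (no_types, lifting) disjoint_iff image_eqI)
    qed
    let ?f = "\<zeta> \<circ> \<delta> \<circ> finv \<zeta> \<circ> finv \<delta>"
    have ca: "?f a = \<zeta> a" "?f (\<zeta> a) = \<delta> a" "?f (\<delta> a) = a" if "a \<in> A" for a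
      using G.commutator_apply(1,2,3)[OF F, of A a] h1 h2 that by metis+
    have ca4: "?f z = z" if "z \<notin> A" "z \<notin> \<zeta> ` A" "z \<notin> \<delta> ` A" for z
      using G.commutator_apply(4)[OF F, of A z] h1 h2 that by metis
    have "?f \<in> L" by (intro L_comp L_finv \<zeta>L \<delta>(1))
    moreover have "G.tricyc ?f 0 m k A"
      unfolding G.tricyc_def
    proof (intro conjI ballI allI impI)
      fix a assume a: "a \<in> A"
      show "?f (G.P 0 a) = G.P m a" using ca(1)[OF a] \<zeta>a[OF a] by simp
      show "?f (G.P m a) = G.P k a" using ca(2)[OF a] \<zeta>a[OF a] \<delta>a(1)[OF a] by simp
      show "?f (G.P k a) = G.P 0 a" using ca(3)[OF a] \<delta>a(1)[OF a] by simp
    next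
      fix z assume z: "\<forall>a\<in>A. z \<noteq> G.P 0 a \<and> z \<noteq> G.P m a \<and> z \<noteq> G.P k a"
      show "?f z = z"
      proof (rule ca4)
        show "z \<notin> A" using z by auto
        show "z \<notin> \<zeta> ` A" "z \<notin> \<delta> ` A" using z \<zeta>a \<delta>a(1) by auto
      qed
    qed
    ultimately show ?thesis by blast
  qed
  moreover have "open (\<alpha> ` ?N)" by (rule G.open_image_F[OF \<alpha>F N(1)])
  moreover have "?x0 \<in> \<alpha> ` ?N" using N(2) by (rule imageI)
  ultimately have "germ L ?x0 0 m k" unfolding germ_def by blast
  then show ?thesis using mk k0 by blast
qed

end

section \<open>The centralizer of the deck transformation\<close>

lemma group_two_iso:
  assumes "group G" "carrier G = {one G, a}" "a \<noteq> one G"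
  shows "G \<cong> integer_mod_group 2"
proof -
  interpret group G by fact
  have a: "a \<in> carrier G" using assms(2) by simp
  have "a \<otimes>\<^bsub>G\<^esub> a \<noteq> a" using l_cancel_one[OF a a] assms(3) by blast
  then have aa: "a \<otimes>\<^bsub>G\<^esub> a = one G" using m_closed[OF a a] assms(2) by blast
  let ?h = "\<lambda>z. if z = one G then 0 else 1 :: int"
  have "?h \<in> hom G (integer_mod_group 2)"
  proof (rule homI)
    fix x y assume "x \<in> carrier G" "y \<in> carrier G"
    then have "x = one G \<or> x = a" "y = one G \<or> y = a" using assms(2) by auto
    then show "?h (x \<otimes>\<^bsub>G\<^esub> y) = ?h x \<otimes>\<^bsub>integer_mod_group 2\<^esub> ?h y" using aa a assms(3) by auto
  qed (auto simp: carrier_integer_mod_group)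
  moreover have "bij_betw ?h (carrier G) (carrier (integer_mod_group 2))"
    unfolding bij_betw_def
  proof
    have h: "?h (one G) = 0" "?h a = 1" using assms(3) by simp_all
    then show "inj_on ?h (carrier G)" unfolding assms(2) inj_on_def by (metis insertE singletonD zero_neq_one)
    have "?h ` carrier G = {0, 1}" unfolding assms(2) image_insert image_empty h ..
    also have "{0, 1 :: int} = carrier (integer_mod_group 2)" by (auto simp: carrier_integer_mod_group)
    finally show "?h ` carrier G = carrier (integer_mod_group 2)" .
  qed
  ultimately show ?thesis by (auto simp: is_iso_def iso_def)
qed

context cantor_system
begin

section \<open>Subgroups and normalizers in the commutator subgroup\<close>

lemma mult_commutator_full_group [simp]: "monoid.mult (commutator_full_group \<phi>) = (\<circ>)"
  and one_commutator_full_group [simp]: "one (commutator_full_group \<phi>) = id"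
  by (simp_all add: commutator_full_group_def)

lemma group_commutator_full_group: "group (commutator_full_group \<phi>)"
  using group.subgroup_imp_group[OF group_full_group D_subgroup]
  by (simp add: commutator_full_group_def D_def)

lemma D_comp: "f \<in> D \<Longrightarrow> g \<in> D \<Longrightarrow> f \<circ> g \<in> D"
  and D_finv: "f \<in> D \<Longrightarrow> finv f \<in> D"
  and D_id: "id \<in> D"
  using subgroup.m_closed[OF D_subgroup] subgroup.m_inv_closed[OF D_subgroup, of f]
    subgroup.one_closed[OF D_subgroup] D_subset_F by auto

lemma inv_commutator_full_group [simp]:
  assumes "f \<in> D" shows "m_inv (commutator_full_group \<phi>) f = finv f"
proof -
  have "f \<in> F" using assms D_subset_F by blast
  then show ?thesis
    by (intro group.inv_equality[OF group_commutator_full_group]) (simp_all add: finv_comp D_finv assms)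
qed

lemma subgroup_commutator_full_group_iff:
  "subgroup S (commutator_full_group \<phi>) \<longleftrightarrow>
     S \<subseteq> D \<and> id \<in> S \<and> (\<forall>f\<in>S. \<forall>g\<in>S. f \<circ> g \<in> S) \<and> (\<forall>f\<in>S. finv f \<in> S)"
proof
  assume S: "subgroup S (commutator_full_group \<phi>)"
  have "S \<subseteq> D" using subgroup.subset[OF S] by simp
  moreover have "finv f \<in> S" if "f \<in> S" for f
    using subgroup.m_inv_closed[OF S that] \<open>S \<subseteq> D\<close> that by (simp add: subset_iff)
  ultimately show "S \<subseteq> D \<and> id \<in> S \<and> (\<forall>f\<in>S. \<forall>g\<in>S. f \<circ> g \<in> S) \<and> (\<forall>f\<in>S. finv f \<in> S)"
    using subgroup.m_closed[OF S] subgroup.one_closed[OF S] by simp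
next
  assume "S \<subseteq> D \<and> id \<in> S \<and> (\<forall>f\<in>S. \<forall>g\<in>S. f \<circ> g \<in> S) \<and> (\<forall>f\<in>S. finv f \<in> S)"
  then show "subgroup S (commutator_full_group \<phi>)"
    by (intro group.subgroupI[OF group_commutator_full_group]) (auto dest: subsetD)
qed

lemma normalizer_commutator_full_group:
  assumes "S \<subseteq> D"
  shows "normalizer (commutator_full_group \<phi>) S = {\<gamma> \<in> D. (\<lambda>f. \<gamma> \<circ> f \<circ> finv \<gamma>) ` S = S}"
proof -
  have "\<gamma> <#\<^bsub>commutator_full_group \<phi>\<^esub> S #>\<^bsub>commutator_full_group \<phi>\<^esub> (inv\<^bsub>commutator_full_group \<phi>\<^esub> \<gamma>)
      = (\<lambda>f. \<gamma> \<circ> f \<circ> finv \<gamma>) ` S" if "\<gamma> \<in> D" for \<gamma>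
    using that by (auto simp: l_coset_def r_coset_def)
  then show ?thesis using assms by (auto simp: normalizer_def stabilizer_def)
qed

end

context trivialized_cover
begin

definition deck_commuting :: "('x \<Rightarrow> 'x) set" where
  "deck_commuting = {\<beta> \<in> G.D. \<forall>x. \<beta> (deck x) = deck (\<beta> x)}"

lemma subgroup_deck_commuting: "subgroup deck_commuting (commutator_full_group \<phi>)"
  unfolding G.subgroup_commutator_full_group_iff
proof (intro conjI ballI)
  fix f assume "f \<in> deck_commuting"
  then have f: "f \<in> G.D" "f \<in> G.F" "f (deck x) = deck (f x)" for x
    using G.D_subset_F by (auto simp: deck_commuting_def)
  have "finv f (deck x) = deck (finv f x)" for x
    using f(3)[of "finv f x"] G.F_finv[OF f(2)] by metis
  then show "finv f \<in> deck_commuting" using f(1) by (simp add: deck_commuting_def G.D_finv)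
qed (auto simp: deck_commuting_def G.D_id G.D_comp)

text \<open>The signature of a lift is the pullback of the signature downstairs, so it is trivial
  exactly when the latter lies in the kernel of the pullback, the group generated by the class of
  \<open>c\<close>.\<close>

lemma lift_D_iff:
  assumes "\<alpha> \<in> H.F"
  shows "lift \<alpha> \<in> G.D \<longleftrightarrow> \<alpha> \<in> H.F0 \<and> H.sgn_full \<alpha> \<in> {one (H0 \<psi>), H.cls c}"
proof -
  have "G.sgn_full (lift \<alpha>) = one (H0 \<phi>) \<longleftrightarrow> H.sgn_full \<alpha> \<in> {one (H0 \<psi>), H.cls c}"
    using pullback_kernel[OF H.loc_const_inversions[OF assms]]
    by (simp add: sgn_lift G.cls_eq_one_iff H.sgn_full_def H.cls_eq_one_iff H.cls_eq_iff)
  then show ?thesis using lift_F0_iff[OF assms] by (simp add: G.D_eq_kernel)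
qed

lemma deck_commuting_eq:
  "lift ` {\<alpha> \<in> H.F0. H.sgn_full \<alpha> \<in> {one (H0 \<psi>), H.cls c}} = deck_commuting"
proof (intro equalityI subsetI)
  fix \<beta> assume "\<beta> \<in> lift ` {\<alpha> \<in> H.F0. H.sgn_full \<alpha> \<in> {one (H0 \<psi>), H.cls c}}"
  then obtain \<alpha> where a: "\<beta> = lift \<alpha>" "\<alpha> \<in> H.F0" "H.sgn_full \<alpha> \<in> {one (H0 \<psi>), H.cls c}" by blast
  then have "\<beta> \<in> G.D" using lift_D_iff[of \<alpha>] H.F0_subset_F by blast
  then show "\<beta> \<in> deck_commuting" using a(1) by (simp add: deck_commuting_def lift_deck)
next
  fix \<beta> assume "\<beta> \<in> deck_commuting"
  then have b: "\<beta> \<in> G.D" "\<beta> \<in> G.F" "\<beta> (deck x) = deck (\<beta> x)" for x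
    using G.D_subset_F by (auto simp: deck_commuting_def)
  obtain \<alpha> where a: "\<alpha> \<in> H.F" "\<beta> = lift \<alpha>" by (rule deck_commuting_is_lift[OF b(2,3)])
  then show "\<beta> \<in> lift ` {\<alpha> \<in> H.F0. H.sgn_full \<alpha> \<in> {one (H0 \<psi>), H.cls c}}"
    using b(1) lift_D_iff[OF a(1)] by blast
qed

lemma lift_D_deck_commuting: "lift ` H.D \<subseteq> deck_commuting"
  by (auto simp: deck_commuting_def lift_D_subset lift_deck)

lemma subgroup_lift_D: "subgroup (lift ` H.D) (commutator_full_group \<phi>)"
  unfolding G.subgroup_commutator_full_group_iff
proof (intro conjI ballI)
  show "lift ` H.D \<subseteq> G.D" using lift_D_subset by blast
  show "id \<in> lift ` H.D" using H.D_id lift_id by (metis image_eqI)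
  fix f assume "f \<in> lift ` H.D"
  then obtain \<alpha> where a: "f = lift \<alpha>" "\<alpha> \<in> H.D" by blast
  then have aF: "\<alpha> \<in> H.F" using H.D_subset_F by blast
  show "finv f \<in> lift ` H.D" using a H.D_finv[OF a(2)] lift_finv[OF aF] by (metis image_eqI)
  fix g assume "g \<in> lift ` H.D"
  then obtain \<beta> where b: "g = lift \<beta>" "\<beta> \<in> H.D" by blast
  then have bF: "\<beta> \<in> H.F" using H.D_subset_F by blast
  show "f \<circ> g \<in> lift ` H.D" using a b H.D_comp[OF a(2) b(2)] lift_comp[OF aF bF] by (metis image_eqI)
qed

lemma subgroup_dichotomy:
  assumes "subgroup L (commutator_full_group \<phi>)" "lift ` H.D \<subseteq> L"
  shows "L \<subseteq> deck_commuting \<or> L = G.D"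
proof (cases "L \<subseteq> deck_commuting")
  case False
  have L: "L \<subseteq> G.D" "id \<in> L" "\<And>f g. f \<in> L \<Longrightarrow> g \<in> L \<Longrightarrow> f \<circ> g \<in> L" "\<And>f. f \<in> L \<Longrightarrow> finv f \<in> L"
    "\<And>\<delta>. \<delta> \<in> H.D \<Longrightarrow> lift \<delta> \<in> L"
    using assms by (auto simp: G.subgroup_commutator_full_group_iff)
  obtain \<alpha> x where "\<alpha> \<in> L" "\<alpha> (deck x) \<noteq> deck (\<alpha> x)"
    using False L(1) by (auto simp: deck_commuting_def)
  then have "\<exists>m k. germ L (\<alpha> x) 0 m k \<and> 0 \<noteq> m \<and> 0 \<noteq> k \<and> m \<noteq> k"
    using starting_germ[of L \<alpha> x] L by blast
  then obtain m k where g: "germ L (\<alpha> x) 0 m k" "0 \<noteq> m" "0 \<noteq> k" "m \<noteq> k" by blast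
  have "L = G.D" using germ_imp_full[of L "\<alpha> x" 0 m k] L g by blast
  then show ?thesis ..
qed simp

text \<open>A local 3-cycle can move \<open>x\<close> and fix \<open>deck x\<close>, because the two
  points lie on different orbits.\<close>

lemma deck_commuting_proper: "deck_commuting \<noteq> G.D"
proof
  assume eq: "deck_commuting = G.D"
  fix x
  obtain \<delta> where d: "\<delta> \<in> G.D" "\<delta> x = G.P 1 x" "\<delta> (deck x) = deck x"
    using G.local_cyc[of 1 "{deck x}" x] deck_not_orbit[of x 0] deck_not_orbit[of x 1] by auto
  then have "\<delta> (deck x) = deck (\<delta> x)" unfolding eq[symmetric] by (simp add: deck_commuting_def)
  then have "deck x = deck (G.P 1 x)" using d(2,3) by metis
  then have "x = G.P 1 x" by (metis deck_deck)
  then show False using G.free[of 1 x] by simp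
qed

section \<open>The subgroup generated by the class of \<open>c\<close>\<close>

lemma cls_c_in_H0: "H.cls c \<in> carrier (H0 \<psi>)" by (simp add: loc_const_c)

lemma cls_c_neq: "H.cls c \<noteq> one (H0 \<psi>)" by (simp add: H.cls_eq_one_iff c_not_coboundary)

lemma cls_c_sq: "monoid.mult (H0 \<psi>) (H.cls c) (H.cls c) = one (H0 \<psi>)"
  by (simp add: H.mult_H0 loc_const_c H.one_H0)

lemma subgroup_cls_c: "subgroup {one (H0 \<psi>), H.cls c} (H0 \<psi>)"
proof -
  interpret H0: group "H0 \<psi>" by (rule H.group_H0)
  have "inv\<^bsub>H0 \<psi>\<^esub> (H.cls c) = H.cls c" by (rule H0.inv_equality[OF cls_c_sq]) (simp_all add: loc_const_c)
  then show ?thesis using cls_c_sq cls_c_in_H0 by (intro H0.subgroupI) auto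
qed

lemma generate_cls_c: "generate (H0 \<psi>) {H.cls c} = {one (H0 \<psi>), H.cls c}"
proof
  show "generate (H0 \<psi>) {H.cls c} \<subseteq> {one (H0 \<psi>), H.cls c}"
    by (rule group.generate_subgroup_incl[OF H.group_H0 _ subgroup_cls_c]) simp
  show "{one (H0 \<psi>), H.cls c} \<subseteq> generate (H0 \<psi>) {H.cls c}"
    by (simp add: generate.one generate.incl)
qed

lemma cls_c_iso: "subgroup_of (H0 \<psi>) {one (H0 \<psi>), H.cls c} \<cong> integer_mod_group 2"
  by (rule group_two_iso[OF group.subgroup_imp_group[OF H.group_H0 subgroup_cls_c], of "H.cls c"])
    (simp_all add: cls_c_neq)

lemma kernel_pullback: "kernel (H0 \<psi>) (H0 \<phi>) (H0_pullback \<phi> \<pi>) = {one (H0 \<psi>), H.cls c}"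
proof (intro equalityI subsetI)
  fix K assume "K \<in> kernel (H0 \<psi>) (H0 \<phi>) (H0_pullback \<phi> \<pi>)"
  then obtain f where f: "loc_const f" "K = H.cls f" "G.cls (f \<circ> \<pi>) = one (H0 \<phi>)"
    by (auto simp: kernel_def H.carrier_H0 pullback_cls)
  then have "f \<in> H.cob \<or> (\<lambda>y. f y + c y) \<in> H.cob"
    using pullback_kernel[OF f(1)] by (simp add: G.cls_eq_one_iff)
  then show "K \<in> {one (H0 \<psi>), H.cls c}" using f(2) by (simp add: H.cls_eq_one_iff H.cls_eq_iff)
next
  fix K assume K: "K \<in> {one (H0 \<psi>), H.cls c}"
  have "H0_pullback \<phi> \<pi> (one (H0 \<psi>)) = one (H0 \<phi>)" by (simp add: H.one_H0 pullback_cls G.one_H0 o_def)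
  moreover have "H0_pullback \<phi> \<pi> (H.cls c) = one (H0 \<phi>)"
    unfolding pullback_cls G.cls_eq_one_iff by (rule sheet_coboundary)
  moreover have "one (H0 \<psi>) \<in> carrier (H0 \<psi>)" by (rule subgroup.one_closed[OF group.subgroup_self[OF H.group_H0]])
  ultimately show "K \<in> kernel (H0 \<psi>) (H0 \<phi>) (H0_pullback \<phi> \<pi>)"
    using K cls_c_in_H0 unfolding kernel_def by blast
qed

text \<open>For \<gamma> in the normalizer, the conjugate \<open>?s\<close> of \<open>deck\<close>
  by \<gamma> commutes with all lifts of elements of \<open>H.D\<close>. If \<open>?s x\<close> were
  outside the fibre of \<open>x\<close>, a local 3-cycle downstairs could fix \<open>\<pi> x\<close>
  and move \<open>\<pi> (?s x)\<close>, contradicting this. So \<open>?s\<close> preserves fibres,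
  and having no fixed point it equals \<open>deck\<close>.\<close>

lemma normalizer_lift_D: "normalizer (commutator_full_group \<phi>) (lift ` H.D) = deck_commuting"
proof -
  have LD: "lift ` H.D \<subseteq> G.D" using lift_D_subset by blast
  have conj: "(\<lambda>f. \<gamma> \<circ> f \<circ> finv \<gamma>) ` lift ` H.D \<subseteq> lift ` H.D" if \<gamma>: "\<gamma> \<in> deck_commuting" for \<gamma>
  proof
    fix f assume "f \<in> (\<lambda>f. \<gamma> \<circ> f \<circ> finv \<gamma>) ` lift ` H.D"
    then obtain \<delta> where d: "\<delta> \<in> H.D" "f = \<gamma> \<circ> lift \<delta> \<circ> finv \<gamma>" by blast
    obtain \<alpha> where a: "\<alpha> \<in> H.F" "\<gamma> = lift \<alpha>"
      using \<gamma> unfolding deck_commuting_eq[symmetric] using H.F0_subset_F by blast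
    have dF: "\<delta> \<in> H.F" using d(1) H.D_subset_F by blast
    have "f = lift (\<alpha> \<circ> \<delta> \<circ> finv \<alpha>)"
      unfolding d(2) a(2) by (simp only: lift_comp lift_finv a(1) dF H.F_comp H.F_inv)
    moreover have "\<alpha> \<circ> \<delta> \<circ> finv \<alpha> \<in> H.D" using H.cycle_products_conj[OF _ a(1)] d(1) H.D_eq_cycle_products by blast
    ultimately show "f \<in> lift ` H.D" by blast
  qed
  have "\<gamma> \<in> deck_commuting" if \<gamma>: "\<gamma> \<in> G.D" "(\<lambda>f. \<gamma> \<circ> f \<circ> finv \<gamma>) ` lift ` H.D = lift ` H.D" for \<gamma>
  proof -
    have F: "\<gamma> \<in> G.F" using \<gamma>(1) G.D_subset_F by blast
    note fg = G.F_finv[OF F]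
    let ?s = "\<lambda>x. \<gamma> (deck (finv \<gamma> x))"
    have comm: "?s (lift \<delta> x) = lift \<delta> (?s x)" if \<delta>: "\<delta> \<in> H.D" for \<delta> x
    proof -
      have "lift \<delta> \<in> (\<lambda>f. \<gamma> \<circ> f \<circ> finv \<gamma>) ` lift ` H.D" unfolding \<gamma>(2) using \<delta> by (rule imageI)
      then obtain \<delta>' where "lift \<delta> = \<gamma> \<circ> lift \<delta>' \<circ> finv \<gamma>" by blast
      then have "lift \<delta> z = \<gamma> (lift \<delta>' (finv \<gamma> z))" for z by simp
      then show ?thesis by (simp only: fg lift_deck)
    qed
    have neq: "?s x \<noteq> x" for x
    proof
      assume "?s x = x"
      then have "deck (finv \<gamma> x) = finv \<gamma> x" using fg(2)[of "deck (finv \<gamma> x)"] by simp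
      then show False using deck_neq(1)[of "finv \<gamma> x"] by simp
    qed
    have "\<pi> (?s x) = \<pi> x" for x
    proof (rule ccontr)
      assume ne: "\<pi> (?s x) \<noteq> \<pi> x"
      obtain i :: int where i: "i \<noteq> 0" "H.P i (\<pi> (?s x)) \<noteq> \<pi> x" by (rule two_steps_avoiding)
      obtain \<delta> where d: "\<delta> \<in> H.D" "\<delta> (\<pi> (?s x)) = H.P i (\<pi> (?s x))" "\<delta> (\<pi> x) = \<pi> x"
        using H.local_cyc[of i "{\<pi> x}" "\<pi> (?s x)"] i ne by auto
      have dF: "\<delta> \<in> H.F" using d(1) H.D_subset_F by blast
      have "H.disp \<delta> (\<pi> x) = 0" by (rule H.disp_eqI) (simp add: d(3))
      then have "lift \<delta> x = x" by (simp add: lift_def)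
      then have "?s x = lift \<delta> (?s x)" using comm[OF d(1), of x] by simp
      then have "\<pi> (?s x) = H.P i (\<pi> (?s x))" using pi_lift[OF dF, of "?s x"] d(2) by simp
      then show False using H.free[of i "\<pi> (?s x)"] i(1) by simp
    qed
    then have "?s x = deck x" for x using neq[of x] pi_eq_iff[of x "?s x"] by metis
    then have "\<gamma> (deck x) = deck (\<gamma> x)" for x using fg(2) by metis
    then show ?thesis using \<gamma>(1) by (simp add: deck_commuting_def)
  qed
  moreover have "(\<lambda>f. \<gamma> \<circ> f \<circ> finv \<gamma>) ` lift ` H.D = lift ` H.D" "\<gamma> \<in> G.D" if \<gamma>: "\<gamma> \<in> deck_commuting" for \<gamma>
  proof -
    show D: "\<gamma> \<in> G.D" using \<gamma> by (simp add: deck_commuting_def)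
    then have F: "\<gamma> \<in> G.F" using G.D_subset_F by blast
    have inv: "finv \<gamma> \<in> deck_commuting"
      using \<gamma> subgroup_deck_commuting by (simp add: G.subgroup_commutator_full_group_iff)
    have "lift ` H.D \<subseteq> (\<lambda>f. \<gamma> \<circ> f \<circ> finv \<gamma>) ` lift ` H.D"
    proof
      fix f assume f: "f \<in> lift ` H.D"
      then have "finv \<gamma> \<circ> f \<circ> finv (finv \<gamma>) \<in> lift ` H.D" using conj[OF inv] by blast
      moreover have "f = \<gamma> \<circ> (finv \<gamma> \<circ> f \<circ> finv (finv \<gamma>)) \<circ> finv \<gamma>"
        using G.F_finv[OF F] by (auto simp: G.finv_finv[OF F])
      ultimately show "f \<in> (\<lambda>f. \<gamma> \<circ> f \<circ> finv \<gamma>) ` lift ` H.D" by blast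
    qed
    then show "(\<lambda>f. \<gamma> \<circ> f \<circ> finv \<gamma>) ` lift ` H.D = lift ` H.D" using conj[OF \<gamma>] by blast
  qed
  ultimately show ?thesis unfolding G.normalizer_commutator_full_group[OF LD] by blast
qed

section \<open>Maximality and splitting\<close>

lemma maximal_deck_commuting: "maximal_subgroup deck_commuting (commutator_full_group \<phi>)"
  unfolding maximal_subgroup_def
proof (intro conjI allI impI)
  fix L assume L: "subgroup L (commutator_full_group \<phi>) \<and> deck_commuting \<subseteq> L"
  then show "L = deck_commuting \<or> L = carrier (commutator_full_group \<phi>)"
    using subgroup_dichotomy[of L] lift_D_deck_commuting by auto
qed (simp_all add: subgroup_deck_commuting deck_commuting_proper)

lemma maximal_unique:
  assumes "maximal_subgroup L (commutator_full_group \<phi>)" "lift ` H.D \<subseteq> L"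
  shows "L = deck_commuting"
proof -
  have "L \<subseteq> deck_commuting"
    using subgroup_dichotomy[of L] assms by (auto simp: maximal_subgroup_def)
  then show ?thesis
    using assms(1) subgroup_deck_commuting deck_commuting_proper by (auto simp: maximal_subgroup_def)
qed

lemma lift_D_mem_iff:
  assumes "\<alpha> \<in> H.F0" shows "lift \<alpha> \<in> lift ` H.D \<longleftrightarrow> H.sgn_full \<alpha> = one (H0 \<psi>)"
proof
  assume "lift \<alpha> \<in> lift ` H.D"
  then obtain \<delta> where "\<delta> \<in> H.D" "lift \<alpha> = lift \<delta>" by blast
  then have "\<alpha> \<in> H.D" using lift_inj[of \<alpha> \<delta>] assms H.F0_subset_F H.D_subset_F by blast
  then show "H.sgn_full \<alpha> = one (H0 \<psi>)" by (rule H.sgn_full_D)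
qed (use assms in \<open>simp add: H.D_eq_kernel\<close>)

text \<open>The lift of this involution shows that the lifts of \<open>H.D\<close> do not exhaust
  \<open>deck_commuting\<close>, and it generates the complement that splits the extension.\<close>

lemma involution_over_c:
  obtains \<tau> where "\<tau> \<in> H.F0" "H.sgn_full \<tau> = H.cls c" "\<tau> \<circ> \<tau> = id"
proof -
  obtain C where C: "clopen C" "C \<inter> \<psi> ` C = {}" "H.sgn_full (H.swap \<psi> C) = H.cls c"
    by (rule H.sgn_full_surj[OF cls_c_in_H0])
  show ?thesis
  proof (rule that[of "H.swap \<psi> C"])
    show "H.swap \<psi> C \<in> H.F0" by (rule H.swap_F0[OF H.phi_in_F C(1,2)])
    show "H.swap \<psi> C \<circ> H.swap \<psi> C = id" using H.swap_swap[OF H.phi_in_F C(2)] by auto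
  qed (rule C(3))
qed

lemma lift_D_not_maximal: "\<not> maximal_subgroup (lift ` H.D) (commutator_full_group \<phi>)"
proof
  assume "maximal_subgroup (lift ` H.D) (commutator_full_group \<phi>)"
  then have eq: "lift ` H.D = deck_commuting" by (rule maximal_unique) simp
  obtain \<tau> where t: "\<tau> \<in> H.F0" "H.sgn_full \<tau> = H.cls c" by (rule involution_over_c)
  then have "lift \<tau> \<in> lift ` H.D" unfolding eq deck_commuting_eq[symmetric] by blast
  then show False using lift_D_mem_iff[OF t(1)] t(2) cls_c_neq by simp
qed

text \<open>The preimage under the signature of the image of the pullback lies strictly between.\<close>

lemma lift_F_not_maximal: "\<not> maximal_subgroup (lift ` H.F) (full_group \<phi>)"
proof
  assume max: "maximal_subgroup (lift ` H.F) (full_group \<phi>)"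
  \<comment> \<open>The image of the pullback is the kernel of \<open>transfer_class\<close>, so
    this is its preimage under the signature.\<close>
  let ?K = "{\<beta> \<in> G.F. transfer_class (G.sgn_full \<beta>) = one (H0 \<psi>)}"
  interpret t: group_hom "H0 \<phi>" "H0 \<psi>" transfer_class by (rule transfer_class_hom)
  have "subgroup ?K (full_group \<phi>)"
    by (rule G.subgroup_full_groupI)
      (auto simp: G.F_comp G.F_inv G.sgn_full_comp G.sgn_full_finv G.sgn_full_in_H0 G.sgn_full_id)
  moreover have "lift ` H.F \<subseteq> ?K"
  proof
    fix \<beta> assume "\<beta> \<in> lift ` H.F"
    then obtain \<alpha> where a: "\<alpha> \<in> H.F" "\<beta> = lift \<alpha>" by blast
    have "G.sgn_full \<beta> = H0_pullback \<phi> \<pi> (H.cls (H.inversions \<alpha>))" by (simp add: a(2) sgn_lift pullback_cls)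
    then have "G.sgn_full \<beta> \<in> kernel (H0 \<phi>) (H0 \<psi>) transfer_class"
      unfolding pullback_image[symmetric] using H.loc_const_inversions[OF a(1)] by simp
    then show "\<beta> \<in> ?K" using lift_F[OF a(1)] a(2) by (simp add: kernel_def)
  qed
  ultimately have "?K = lift ` H.F \<or> ?K = G.F" using max unfolding maximal_subgroup_def by simp
  then show False
  proof
    assume eq: "?K = lift ` H.F"
    have "G.D \<subseteq> ?K" using G.D_subset_F G.sgn_full_D by auto
    then have "G.D \<subseteq> deck_commuting" unfolding eq using lift_deck by (auto simp: deck_commuting_def)
    then show False using deck_commuting_proper by (auto simp: deck_commuting_def)
  next
    assume eq: "?K = G.F"
    obtain K where K: "K \<in> carrier (H0 \<phi>)" "transfer_class K = H.cls c"
      using transfer_class_surj cls_c_in_H0 by (metis imageE)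
    obtain C where C: "clopen C" "C \<inter> \<phi> ` C = {}" "G.sgn_full (G.swap \<phi> C) = K"
      by (rule G.sgn_full_surj[OF K(1)])
    have "G.swap \<phi> C \<in> G.F" by (rule G.swap_in_F[OF G.phi_in_F C(1,2)])
    then have "transfer_class K = one (H0 \<psi>)" using eq C(3) by blast
    then show False using K(2) cls_c_neq by simp
  qed
qed

lemma deck_commuting_split:
  "\<exists>q. split_short_exact (subgroup_of (commutator_full_group \<phi>) (lift ` H.D)) id
     (subgroup_of (commutator_full_group \<phi>) deck_commuting) q (integer_mod_group 2)"
proof -
  let ?A = "subgroup_of (commutator_full_group \<phi>) (lift ` H.D)"
  let ?B = "subgroup_of (commutator_full_group \<phi>) deck_commuting"
  \<comment> \<open>The signature downstairs takes only the values one and \<open>H.cls c\<close> on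
    these elements; \<open>q\<close> is that signature, read as an integer modulo 2.\<close>
  define q where "q = (\<lambda>\<beta>. if \<beta> \<in> lift ` H.D then 0 else 1 :: int)"
  obtain \<tau> where t: "\<tau> \<in> H.F0" "H.sgn_full \<tau> = H.cls c" "\<tau> \<circ> \<tau> = id" by (rule involution_over_c)
  have tF: "\<tau> \<in> H.F" using t(1) H.F0_subset_F by blast
  have tM: "lift \<tau> \<in> deck_commuting" unfolding deck_commuting_eq[symmetric] using t by blast
  have qt: "q (lift \<tau>) = 1" using lift_D_mem_iff[OF t(1)] t(2) cls_c_neq by (simp add: q_def)
  have idLD: "id \<in> lift ` H.D" using subgroup_lift_D by (simp add: G.subgroup_commutator_full_group_iff)
  then have qid: "q id = 0" by (simp add: q_def)
  have idM: "id \<in> deck_commuting" using idLD lift_D_deck_commuting by blast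
  have C2: "carrier (integer_mod_group 2) = {0, 1}" by (auto simp: carrier_integer_mod_group)
  have q_lift: "q (lift \<alpha>) = (if H.sgn_full \<alpha> = one (H0 \<psi>) then 0 else 1)" if "\<alpha> \<in> H.F0" for \<alpha>
    using lift_D_mem_iff[OF that] by (simp add: q_def)
  interpret H0: group "H0 \<psi>" by (rule H.group_H0)
  have "q \<in> hom ?B (integer_mod_group 2)"
  proof (rule homI)
    fix f g assume "f \<in> carrier ?B" "g \<in> carrier ?B"
    then obtain \<alpha> \<beta> where a: "\<alpha> \<in> H.F0" "f = lift \<alpha>" "H.sgn_full \<alpha> \<in> {one (H0 \<psi>), H.cls c}"
      and b: "\<beta> \<in> H.F0" "g = lift \<beta>" "H.sgn_full \<beta> \<in> {one (H0 \<psi>), H.cls c}"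
      by (auto simp: deck_commuting_eq[symmetric])
    have F: "\<alpha> \<in> H.F" "\<beta> \<in> H.F" using a(1) b(1) H.F0_subset_F by blast+
    have "f \<circ> g = lift (\<alpha> \<circ> \<beta>)" by (simp add: a b lift_comp F)
    then have "q (f \<circ> g) = (if monoid.mult (H0 \<psi>) (H.sgn_full \<alpha>) (H.sgn_full \<beta>) = one (H0 \<psi>) then 0 else 1)"
      using q_lift[OF H.F0_comp[OF a(1) b(1)]] H.sgn_full_comp[OF F] by simp
    then show "q (f \<otimes>\<^bsub>?B\<^esub> g) = q f \<otimes>\<^bsub>integer_mod_group 2\<^esub> q g"
      using a(3) b(3) cls_c_neq cls_c_sq q_lift[OF a(1)] q_lift[OF b(1)] cls_c_in_H0 a(2) b(2) by auto
  qed (simp add: q_def C2)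
  moreover have "q ` deck_commuting = {0, 1}"
  proof
    show "q ` deck_commuting \<subseteq> {0, 1}" by (auto simp: q_def)
    have "q id \<in> q ` deck_commuting" "q (lift \<tau>) \<in> q ` deck_commuting" using tM idM by blast+
    then show "{0, 1} \<subseteq> q ` deck_commuting" using qid qt by simp
  qed
  ultimately have "q \<in> epi ?B (integer_mod_group 2)" by (simp add: epi_def C2)
  moreover have "id \<in> mon ?A ?B" using lift_D_deck_commuting by (auto simp: mon_def hom_def)
  moreover have "kernel ?B (integer_mod_group 2) q = id ` carrier ?A"
    using lift_D_deck_commuting by (auto simp: kernel_def q_def split: if_splits)
  moreover have "group ?A" "group ?B"
    using group.subgroup_imp_group[OF G.group_commutator_full_group] subgroup_lift_D subgroup_deck_commuting
    by blast+
  ultimately have "short_exact ?A id ?B q (integer_mod_group 2)" by (simp add: short_exact_def)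
  moreover have "\<exists>s \<in> hom (integer_mod_group 2) ?B. \<forall>z \<in> carrier (integer_mod_group 2). q (s z) = z"
  proof (intro bexI ballI)
    let ?s = "\<lambda>z :: int. if z = 0 then id else lift \<tau>"
    have "lift \<tau> \<circ> lift \<tau> = id" using lift_comp[OF tF tF] t(3) by simp
    then show "?s \<in> hom (integer_mod_group 2) ?B" by (intro homI) (auto simp: C2 tM idM)
    show "q (?s z) = z" if "z \<in> carrier (integer_mod_group 2)" for z
      using that qid qt by (auto simp: C2)
  qed
  ultimately show ?thesis unfolding split_short_exact_def by blast
qed

end

theorem proposition4p3:
  fixes \<phi> :: "'x::t2_space \<Rightarrow> 'x" and \<psi> :: "'y::t2_space \<Rightarrow> 'y" and \<pi> :: "'x \<Rightarrow> 'y"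
  assumes "cantor_minimal \<phi>" and "cantor_minimal \<psi>"
    and "equivariant_double_cover \<phi> \<psi> \<pi>"
  shows "(\<exists>T c. clopen_trivialization \<phi> \<psi> \<pi> T c) \<and>
    (\<forall>T c. clopen_trivialization \<phi> \<psi> \<pi> T c \<longrightarrow>
      (let FG = full_group \<phi>; DG = commutator_full_group \<phi>;
           FH = full_group \<psi>; DH = commutator_full_group \<psi>;
           P = pi_star \<phi> \<psi> \<pi>;
           Pull = H0_pullback \<phi> \<pi>;
           C = generate (H0 \<psi>) {H0_class \<psi> c};
           M = P ` {g \<in> carrier (index_kernel_group \<psi>). sgn_map \<psi> g \<in> C}
       in
         kernel (H0 \<psi>) (H0 \<phi>) Pull = C \<and>
         subgroup_of (H0 \<psi>) C \<cong> integer_mod_group 2 \<and>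
         H0 \<phi> Mod (Pull ` carrier (H0 \<psi>)) \<cong> H0 \<psi> \<and>
         carrier (H0 \<psi>) \<noteq> {\<one>\<^bsub>H0 \<psi>\<^esub>} \<and>
         \<not> maximal_subgroup (P ` carrier FH) FG \<and>
         \<not> maximal_subgroup (P ` carrier DH) DG \<and>
         M = normalizer DG (P ` carrier DH) \<and>
         maximal_subgroup M DG \<and> P ` carrier DH \<subseteq> M \<and>
         (\<forall>L. maximal_subgroup L DG \<and> P ` carrier DH \<subseteq> L \<longrightarrow> L = M) \<and>
         (\<exists>q. split_short_exact (subgroup_of DG (P ` carrier DH)) id
                (subgroup_of DG M) q (integer_mod_group 2))))"
proof -
  interpret double_cover \<phi> \<psi> \<pi>
    using assms by (simp add: double_cover_def double_cover_axioms_def cantor_system_def)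
  show ?thesis
  proof (intro conjI allI impI)
    show "\<exists>T c. clopen_trivialization \<phi> \<psi> \<pi> T c" by (rule trivialization_exists)
    fix T c assume "clopen_trivialization \<phi> \<psi> \<pi> T c"
    then interpret trivialized_cover \<phi> \<psi> \<pi> T c by unfold_locales
    have P: "pi_star \<phi> \<psi> \<pi> ` S = lift ` S" if "S \<subseteq> H.F" for S
      using that by (intro image_cong refl pi_star_eq) blast
    have PM: "pi_star \<phi> \<psi> \<pi> ` {g \<in> H.F0. sgn_map \<psi> g \<in> {one (H0 \<psi>), H.cls c}} = deck_commuting"
    proof -
      have "{g \<in> H.F0. sgn_map \<psi> g \<in> {one (H0 \<psi>), H.cls c}} = {g \<in> H.F0. H.sgn_full g \<in> {one (H0 \<psi>), H.cls c}}"
        by (intro Collect_cong conj_cong refl) (simp only: H.sgn_map_eq)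
      moreover have "{g \<in> H.F0. H.sgn_full g \<in> {one (H0 \<psi>), H.cls c}} \<subseteq> H.F" using H.F0_subset_F by blast
      ultimately show ?thesis using deck_commuting_eq by (simp only: P)
    qed
    have nontriv: "carrier (H0 \<psi>) \<noteq> {one (H0 \<psi>)}" using cls_c_in_H0 cls_c_neq by blast
    have unique: "\<forall>L. maximal_subgroup L (commutator_full_group \<phi>) \<and> lift ` H.D \<subseteq> L \<longrightarrow> L = deck_commuting"
      using maximal_unique by blast
    show "let FG = full_group \<phi>; DG = commutator_full_group \<phi>;
           FH = full_group \<psi>; DH = commutator_full_group \<psi>;
           P = pi_star \<phi> \<psi> \<pi>;
           Pull = H0_pullback \<phi> \<pi>;
           C = generate (H0 \<psi>) {H0_class \<psi> c};
           M = P ` {g \<in> carrier (index_kernel_group \<psi>). sgn_map \<psi> g \<in> C}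
       in
         kernel (H0 \<psi>) (H0 \<phi>) Pull = C \<and>
         subgroup_of (H0 \<psi>) C \<cong> integer_mod_group 2 \<and>
         H0 \<phi> Mod (Pull ` carrier (H0 \<psi>)) \<cong> H0 \<psi> \<and>
         carrier (H0 \<psi>) \<noteq> {\<one>\<^bsub>H0 \<psi>\<^esub>} \<and>
         \<not> maximal_subgroup (P ` carrier FH) FG \<and>
         \<not> maximal_subgroup (P ` carrier DH) DG \<and>
         M = normalizer DG (P ` carrier DH) \<and>
         maximal_subgroup M DG \<and> P ` carrier DH \<subseteq> M \<and>
         (\<forall>L. maximal_subgroup L DG \<and> P ` carrier DH \<subseteq> L \<longrightarrow> L = M) \<and>
         (\<exists>q. split_short_exact (subgroup_of DG (P ` carrier DH)) id
                (subgroup_of DG M) q (integer_mod_group 2))"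
      unfolding Let_def generate_cls_c H.carrier_index_kernel_group H.carrier_full_group
        H.carrier_commutator_full_group PM P[OF H.D_subset_F] P[OF subset_refl]
      by (intro conjI kernel_pullback cls_c_iso coker_pullback nontriv lift_F_not_maximal
        lift_D_not_maximal normalizer_lift_D[symmetric] maximal_deck_commuting
        lift_D_deck_commuting unique deck_commuting_split)
  qed
qed

end
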